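(* Fix an o-minimal expansion of the real field $(\mathbb{R},+,\cdot)$. Let $0\le d\le n$, $n\ge1$, and let $X\subset\mathbb{C}^n$ be a closed pure $d$-dimensional complex analytic set. Suppose that $C_\infty(X)$ is definable and $\dim_{\mathbb{R}}C_\infty(X)\le 2d$. Then $X$ is algebraic.
   Context: A closed pure $d$-dimensional complex analytic set $X\subset\mathbb{C}^n$ is a nonempty closed complex analytic subset having dimension $d$ at each of its points. $X$ is algebraic if it is the common zero set of a family of polynomials in $\mathbb{C}[z_1,\dots,z_n]$. For $A\subset\mathbb{C}^n$, the total tangent cone at infinity is $$C_\infty(A)=\{v\in\mathbb{C}^n:\exists\, x_j\in A,\ t_j>0,\ \|x_j\|\to\infty,\ t_j\to\infty,\ x_j/t_j\to v\}$$ (empty if $A$ is bounded). $\mathbb{C}^n$ is identified with $\mathbb{R}^{2n}$, definable means definable (with parameters) in the fixed o-minimal structure, and $\dim_{\mathbb{R}}$ is the o-minimal dimension of a definable set (with $\dim_{\mathbb{R}}\varnothing=-\infty$). *)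

theory Defs
  imports "HOL-Analysis.Analysis" "HOL-Library.Poly_Mapping"
begin

section \<open>O-minimal expansions of the real field\<close>

text \<open>
  Throughout, \<open>\<real>\<^sup>m\<close> is \<^term>\<open>topspace (Euclidean_space m)\<close>, i.e. the functions
  \<^typ>\<open>nat \<Rightarrow> real\<close> vanishing at all indices \<open>\<ge> m\<close>; its topology is induced by the
  product topology. With this encoding \<open>x(m := 0)\<close> is the projection
  of \<open>x \<in> \<real>\<^bsup>m+1\<^esup>\<close> to its first \<open>m\<close> coordinates, and
  \<open>\<lambda>i. x (Suc i)\<close> the projection to its last \<open>m\<close> coordinates.
\<close>

abbreviation Rn :: "nat \<Rightarrow> (nat \<Rightarrow> real) set" where
  "Rn m \<equiv> topspace (Euclidean_space m)"

text \<open>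
  \<open>D m\<close> is the collection of subsets of \<open>\<real>\<^sup>m\<close> that are definable with parameters.
  Parameters are accounted for by the definability of all singletons; the order need not be
  mentioned since it is definable from the field operations.
\<close>

locale ominimal_expansion =
  fixes D :: "nat \<Rightarrow> (nat \<Rightarrow> real) set set"
  assumes definable_subset: "A \<in> D m \<Longrightarrow> A \<subseteq> Rn m"
    and definable_empty: "{} \<in> D m"
    and definable_Un: "A \<in> D m \<Longrightarrow> B \<in> D m \<Longrightarrow> A \<union> B \<in> D m"
    and definable_compl: "A \<in> D m \<Longrightarrow> Rn m - A \<in> D m"
    and definable_cylinder_right: "A \<in> D m \<Longrightarrow> {x \<in> Rn (Suc m). x(m := 0) \<in> A} \<in> D (Suc m)"
    and definable_cylinder_left: "A \<in> D m \<Longrightarrow> {x \<in> Rn (Suc m). (\<lambda>i. x (Suc i)) \<in> A} \<in> D (Suc m)"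
    and definable_diagonal: "i < m \<Longrightarrow> j < m \<Longrightarrow> {x \<in> Rn m. x i = x j} \<in> D m"
    and definable_projection: "A \<in> D (Suc m) \<Longrightarrow> (\<lambda>x. x(m := 0)) ` A \<in> D m"
    and definable_singleton: "{x \<in> Rn 1. x 0 = r} \<in> D 1"
    and definable_plus: "{x \<in> Rn 3. x 2 = x 0 + x 1} \<in> D 3"
    and definable_times: "{x \<in> Rn 3. x 2 = x 0 * x 1} \<in> D 3"
    and ominimal: "A \<in> D 1 \<Longrightarrow>
      \<exists>\<I>. finite \<I> \<and> (\<forall>I\<in>\<I>. is_interval I) \<and> (\<lambda>x. x 0) ` A = \<Union>\<I>"

definition definable_continuous ::
  "(nat \<Rightarrow> (nat \<Rightarrow> real) set set) \<Rightarrow> nat \<Rightarrow> (nat \<Rightarrow> real) set \<Rightarrow> ((nat \<Rightarrow> real) \<Rightarrow> real) \<Rightarrow> bool"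
  where "definable_continuous D m C f \<longleftrightarrow>
    {x \<in> Rn (Suc m). x(m := 0) \<in> C \<and> x m = f (x(m := 0))} \<in> D (Suc m) \<and> continuous_on C f"

definition cell_bound ::
  "(nat \<Rightarrow> (nat \<Rightarrow> real) set set) \<Rightarrow> nat \<Rightarrow> (nat \<Rightarrow> real) set \<Rightarrow> ((nat \<Rightarrow> real) \<Rightarrow> ereal) \<Rightarrow> bool"
  where "cell_bound D m C F \<longleftrightarrow>
    F = (\<lambda>_. - \<infinity>) \<or> F = (\<lambda>_. \<infinity>) \<or>
    (\<exists>f. definable_continuous D m C f \<and> F = (\<lambda>x. ereal (f x)))"

text \<open>
  \<open>cell D m k C\<close>: \<open>C \<subseteq> \<real>\<^sup>m\<close> is an \<open>(i\<^sub>1, \<dots>, i\<^sub>m)\<close>-cell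
  with \<open>k = i\<^sub>1 + \<dots> + i\<^sub>m\<close>.
\<close>

inductive cell ::
  "(nat \<Rightarrow> (nat \<Rightarrow> real) set set) \<Rightarrow> nat \<Rightarrow> nat \<Rightarrow> (nat \<Rightarrow> real) set \<Rightarrow> bool"
  for D where
  cell_point: "cell D 0 0 (Rn 0)"
| cell_graph: "cell D m k C \<Longrightarrow> definable_continuous D m C f \<Longrightarrow>
    cell D (Suc m) k {x \<in> Rn (Suc m). x(m := 0) \<in> C \<and> x m = f (x(m := 0))}"
| cell_band: "cell D m k C \<Longrightarrow> cell_bound D m C F \<Longrightarrow> cell_bound D m C G \<Longrightarrow>
    (\<And>x. x \<in> C \<Longrightarrow> F x < G x) \<Longrightarrow>
    cell D (Suc m) (Suc k)
      {x \<in> Rn (Suc m). x(m := 0) \<in> C \<and>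
         F (x(m := 0)) < ereal (x m) \<and> ereal (x m) < G (x(m := 0))}"

text \<open>The supremum is taken in \<^typ>\<open>ereal\<close>, so the empty set has dimension \<open>-\<infinity>\<close>.\<close>

definition odim :: "(nat \<Rightarrow> (nat \<Rightarrow> real) set set) \<Rightarrow> nat \<Rightarrow> (nat \<Rightarrow> real) set \<Rightarrow> ereal"
  where "odim D m A = (SUP k \<in> {k. \<exists>C. cell D m k C \<and> C \<subseteq> A}. ereal (real k))"

text \<open>
  The identification of \<open>\<complex>\<^sup>n\<close> with \<open>\<real>\<^bsup>2n\<^esup>\<close>, for a fixed enumeration of the
  index type. Its choice is immaterial, since definability and dimension are invariant under
  permutations of the coordinates.
\<close>

definition realify :: "complex ^ 'n \<Rightarrow> nat \<Rightarrow> real"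
  where "realify z j =
    (if j < 2 * CARD('n) then
       (let w = z $ from_nat_into UNIV (j div 2) in if even j then Re w else Im w)
     else 0)"

definition definable_Cn :: "(nat \<Rightarrow> (nat \<Rightarrow> real) set set) \<Rightarrow> (complex ^ 'n) set \<Rightarrow> bool"
  where "definable_Cn D A \<longleftrightarrow> realify ` A \<in> D (2 * CARD('n))"

definition real_dim_Cn :: "(nat \<Rightarrow> (nat \<Rightarrow> real) set set) \<Rightarrow> (complex ^ 'n) set \<Rightarrow> ereal"
  where "real_dim_Cn D A = odim D (2 * CARD('n)) (realify ` A)"

lemma bij_betw_realify: "bij_betw (realify :: complex ^ 'n \<Rightarrow> _) UNIV (Rn (2 * CARD('n)))"
proof -
  let ?e = "from_nat_into (UNIV :: 'n set)"
  have e: "bij_betw ?e {..<CARD('n)} UNIV"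
    by (rule bij_betw_from_nat_into_finite) simp
  have "inj (realify :: complex ^ 'n \<Rightarrow> _)"
  proof (rule injI)
    fix z w :: "complex ^ 'n"
    assume eq: "realify z = realify w"
    show "z = w"
    proof (rule vec_eq_iff[THEN iffD2], rule allI)
      fix i :: 'n
      obtain k where k: "k < CARD('n)" "?e k = i"
        using e by (metis UNIV_I bij_betw_def imageE lessThan_iff)
      have "realify z (2 * k) = realify w (2 * k)" "realify z (2 * k + 1) = realify w (2 * k + 1)"
        using eq by simp_all
      with k show "z $ i = w $ i"
        by (simp add: realify_def complex_eq_iff)
    qed
  qed
  moreover have "range (realify :: complex ^ 'n \<Rightarrow> _) = Rn (2 * CARD('n))"
  proof
    show "range (realify :: complex ^ 'n \<Rightarrow> _) \<subseteq> Rn (2 * CARD('n))"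
      by (auto simp: topspace_Euclidean_space realify_def)
    show "Rn (2 * CARD('n)) \<subseteq> range (realify :: complex ^ 'n \<Rightarrow> _)"
    proof
      fix x assume x: "x \<in> Rn (2 * CARD('n))"
      let ?k = "inv_into {..<CARD('n)} ?e"
      let ?z = "(\<chi> i. Complex (x (2 * ?k i)) (x (2 * ?k i + 1))) :: complex ^ 'n"
      have "realify ?z j = x j" for j
      proof (cases "j < 2 * CARD('n)")
        case True
        then have "?k (?e (j div 2)) = j div 2"
          using e by (intro inv_into_f_f) (auto simp: bij_betw_def)
        moreover have "x (2 * (j div 2)) = x j" if "even j"
          using that by simp
        moreover have "x (2 * (j div 2) + 1) = x j" if "odd j"
          using that by (metis odd_two_times_div_two_succ)
        ultimately show ?thesis
          using True by (simp only: realify_def Let_def vec_lambda_beta complex.sel if_True split: if_split) blast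
      next
        case False
        with x show ?thesis
          by (simp add: realify_def topspace_Euclidean_space)
      qed
      then have "x = realify ?z"
        by (simp add: fun_eq_iff)
      then show "x \<in> range (realify :: complex ^ 'n \<Rightarrow> _)"
        by (rule range_eqI)
    qed
  qed
  ultimately show ?thesis
    by (simp add: bij_betw_def)
qed

section \<open>Complex analytic sets\<close>

definition holomorphic_Cn :: "(complex ^ 'n \<Rightarrow> complex) \<Rightarrow> (complex ^ 'n) set \<Rightarrow> bool"
  where "holomorphic_Cn f U \<longleftrightarrow>
    (\<forall>z\<in>U. \<exists>L. (f has_derivative L) (at z) \<and> (\<forall>c v. L (c *s v) = c * L v))"

definition closed_analytic_set :: "(complex ^ 'n) set \<Rightarrow> bool"
  where "closed_analytic_set X \<longleftrightarrow> closed X \<and>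
    (\<forall>a\<in>X. \<exists>U F. open U \<and> a \<in> U \<and> finite F \<and> (\<forall>f\<in>F. holomorphic_Cn f U) \<and>
       X \<inter> U = {z \<in> U. \<forall>f\<in>F. f z = 0})"

text \<open>
  \<open>regular_point X k a\<close>: near \<open>a \<in> X\<close>, the set \<open>X\<close> is a complex submanifold of dimension
  \<open>k\<close>, i.e. a biholomorphic map \<open>\<phi>\<close> with inverse \<open>\<psi>\<close> straightens it to a
  \<open>k\<close>-dimensional coordinate subspace.
\<close>

definition regular_point :: "(complex ^ 'n) set \<Rightarrow> nat \<Rightarrow> complex ^ 'n \<Rightarrow> bool"
  where "regular_point X k a \<longleftrightarrow> a \<in> X \<and>
    (\<exists>U V \<phi> \<psi> (I :: 'n set).
       open U \<and> a \<in> U \<and> open V \<and> homeomorphism U V \<phi> \<psi> \<and>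
       (\<forall>i. holomorphic_Cn (\<lambda>z. \<phi> z $ i) U) \<and>
       (\<forall>i. holomorphic_Cn (\<lambda>w. \<psi> w $ i) V) \<and>
       card I = k \<and> \<phi> ` (X \<inter> U) = {w \<in> V. \<forall>i. i \<notin> I \<longrightarrow> w $ i = 0})"

text \<open>
  The dimension of \<open>X\<close> at \<open>a\<close> is the limit superior, for regular points \<open>z \<rightarrow> a\<close>
  (\<open>z = a\<close> allowed), of the dimension of the manifold germ of \<open>X\<close> at \<open>z\<close>. As
  only the values \<open>0, \<dots>, n\<close> occur, this is the largest value attained arbitrarily close to
  \<open>a\<close>. For analytic \<open>X\<close> and \<open>a \<in> X\<close> the set below is nonempty because
  regular points are dense.
\<close>

definition analytic_dim_at :: "(complex ^ 'n) set \<Rightarrow> complex ^ 'n \<Rightarrow> nat"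
  where "analytic_dim_at X a = Max {k. a \<in> closure {z. regular_point X k z}}"

definition closed_pure_dim_analytic :: "nat \<Rightarrow> (complex ^ 'n) set \<Rightarrow> bool"
  where "closed_pure_dim_analytic d X \<longleftrightarrow>
    X \<noteq> {} \<and> closed_analytic_set X \<and> (\<forall>a\<in>X. analytic_dim_at X a = d)"

section \<open>Algebraic sets and the tangent cone at infinity\<close>

text \<open>
  A polynomial over \<open>\<complex>\<close> in variables indexed by \<open>'n\<close> is a finitely supported map from exponent
  vectors to coefficients.
\<close>

definition poly_eval :: "(('n::finite \<Rightarrow>\<^sub>0 nat) \<Rightarrow>\<^sub>0 complex) \<Rightarrow> complex ^ 'n \<Rightarrow> complex"
  where "poly_eval p z =
    (\<Sum>\<alpha>\<in>Poly_Mapping.keys p. Poly_Mapping.lookup p \<alpha> *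
       (\<Prod>i\<in>UNIV. z $ i ^ Poly_Mapping.lookup \<alpha> i))"

definition algebraic_set :: "(complex ^ 'n) set \<Rightarrow> bool"
  where "algebraic_set X \<longleftrightarrow> (\<exists>P. X = {z. \<forall>p\<in>P. poly_eval p z = 0})"

definition tangent_cone_at_infinity :: "(complex ^ 'n) set \<Rightarrow> (complex ^ 'n) set"
  where "tangent_cone_at_infinity A =
    {v. \<exists>(x :: nat \<Rightarrow> complex ^ 'n) (t :: nat \<Rightarrow> real).
       (\<forall>j. x j \<in> A \<and> t j > 0) \<and>
       filterlim (\<lambda>j. norm (x j)) at_top sequentially \<and>
       filterlim t at_top sequentially \<and>
       (\<lambda>j. x j /\<^sub>R t j) \<longlonglongrightarrow> v}"

end

theory Submission
  imports Defs "HOL-Complex_Analysis.Complex_Analysis"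
begin

text \<open>
  Among all linear coordinates of \<open>\<complex>\<^sup>n\<close>, choose a coordinate subspace \<open>L\<close> of the largest
  possible dimension that meets the tangent cone \<open>C\<close> only in \<open>0\<close>. If its codimension exceeds \<open>d\<close>,
  then by maximality \<open>L\<close> and each vector \<open>e + w\<close>, with \<open>w\<close> in a \<open>d\<close>-dimensional coordinate space,
  span a subspace meeting \<open>C\<close> at every prescribed distance from \<open>L\<close>. A definable selection gives an
  injective definable map from a box of dimension \<open>2d + 1\<close> into \<open>C\<close>, and the image of such a map
  contains a cell of dimension \<open>2d + 1\<close>, a contradiction. Hence \<open>L\<close> has codimension \<open>d\<close> and, by
  compactness of the unit sphere, the \<open>L\<close>-coordinates of the points of \<open>X\<close> are bounded linearly by
  the other \<open>d\<close> coordinates.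

  For a point \<open>b \<notin> X\<close>, a linear form on \<open>L\<close> separates \<open>b\<close> from the finitely many points of \<open>X\<close> over
  the projection of \<open>b\<close>. The image of \<open>X\<close> under the projection to \<open>d\<close> coordinates and this form is a
  hypersurface; the elementary symmetric functions of its sheets are entire of polynomial growth,
  hence polynomials, so that \<open>X\<close> satisfies a polynomial equation that \<open>b\<close> does not.
\<close>

text \<open>The tangent cone is invariant under positive real dilations only. Of a transversal
  vector just the modulus of one coordinate can therefore be prescribed, not its phase; with
  \<open>d\<close> complex slopes this makes \<open>2 * d + 1\<close> real parameters, exactly one
  more than the dimension bound admits. Dimension is the supremum over cells contained in the set,
  so the contradiction needs an actual cell inside the image of the parameter box. A Baire argument
  over rational data reduces this to finite unions of intervals in one real variable, and an
  induction on the ambient dimension exhibits the image of a small box as a graph or a band over a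
  lower cell. On the analytic side all projections stay inside \<open>complex ^ 'n\<close>:
  forgetting a coordinate means passing to the cylinder over the image. The main use of purity is
  that a holomorphic sheet either lies in the projected hypersurface or misses it. This fails in the
  presence of lower dimensional pieces, and purity excludes them through the density of points near
  which the hypersurface contains a graph.\<close>

no_notation fps_nth (infixl "$" 75)

section \<open>Holomorphic functions of several variables\<close>

lemma has_derivative_vec:
  fixes g :: "'a::real_normed_vector \<Rightarrow> 'b::euclidean_space ^ 'n"
  assumes "\<And>i. ((\<lambda>x. g x $ i) has_derivative (\<lambda>v. L v $ i)) (at a within S)"
  shows "(g has_derivative L) (at a within S)"
proof (subst has_derivative_componentwise_within, rule ballI)
  fix b :: "'b ^ 'n" assume "b \<in> Basis"
  then obtain i u where "b = axis i u" by (auto simp: Basis_vec_def)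
  then show "((\<lambda>x. g x \<bullet> b) has_derivative (\<lambda>x. L x \<bullet> b)) (at a within S)"
    using has_derivative_inner_left[OF assms[of i], of u] by (simp add: inner_axis)
qed

lemma holomorphic_CnE:
  assumes "holomorphic_Cn f U" "z \<in> U"
  obtains L where "(f has_derivative L) (at z)" "\<And>c v. L (c *s v) = c * L v"
  using assms unfolding holomorphic_Cn_def by blast

lemma holomorphic_Cn_subset: "holomorphic_Cn f U \<Longrightarrow> V \<subseteq> U \<Longrightarrow> holomorphic_Cn f V"
  unfolding holomorphic_Cn_def by blast

lemma holomorphic_Cn_const [simp]: "holomorphic_Cn (\<lambda>_. c) U"
  unfolding holomorphic_Cn_def by (auto intro!: exI[of _ "\<lambda>_. 0"])

lemma holomorphic_Cn_coord [simp]: "holomorphic_Cn (\<lambda>z. z $ i) U"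
  unfolding holomorphic_Cn_def
  by (auto intro!: exI[of _ "\<lambda>z. z $ i"] bounded_linear_imp_has_derivative bounded_linear_vec_nth)

lemma holomorphic_Cn_add:
  assumes "holomorphic_Cn f U" "holomorphic_Cn g U"
  shows "holomorphic_Cn (\<lambda>z. f z + g z) U"
  unfolding holomorphic_Cn_def
proof
  fix z assume z: "z \<in> U"
  obtain L where L: "(f has_derivative L) (at z)" "\<And>c v. L (c *s v) = c * L v"
    using holomorphic_CnE[OF assms(1) z] by blast
  obtain M where M: "(g has_derivative M) (at z)" "\<And>c v. M (c *s v) = c * M v"
    using holomorphic_CnE[OF assms(2) z] by blast
  show "\<exists>L. ((\<lambda>z. f z + g z) has_derivative L) (at z) \<and> (\<forall>c v. L (c *s v) = c * L v)"
    by (rule exI, rule conjI, rule has_derivative_add[OF L(1) M(1)])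
      (simp add: L(2) M(2) algebra_simps)
qed

lemma holomorphic_Cn_mult:
  assumes "holomorphic_Cn f U" "holomorphic_Cn g U"
  shows "holomorphic_Cn (\<lambda>z. f z * g z) U"
  unfolding holomorphic_Cn_def
proof
  fix z assume z: "z \<in> U"
  obtain L where L: "(f has_derivative L) (at z)" "\<And>c v. L (c *s v) = c * L v"
    using holomorphic_CnE[OF assms(1) z] by blast
  obtain M where M: "(g has_derivative M) (at z)" "\<And>c v. M (c *s v) = c * M v"
    using holomorphic_CnE[OF assms(2) z] by blast
  show "\<exists>L. ((\<lambda>z. f z * g z) has_derivative L) (at z) \<and> (\<forall>c v. L (c *s v) = c * L v)"
    by (rule exI, rule conjI, rule has_derivative_mult[OF L(1) M(1)])
      (simp add: L(2) M(2) algebra_simps)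
qed

lemma holomorphic_Cn_sum:
  assumes "\<And>i. i \<in> I \<Longrightarrow> holomorphic_Cn (f i) U"
  shows "holomorphic_Cn (\<lambda>z. \<Sum>i\<in>I. f i z) U"
  using assms by (induction I rule: infinite_finite_induct) (auto intro: holomorphic_Cn_add)

lemma holomorphic_Cn_prod:
  assumes "\<And>i. i \<in> I \<Longrightarrow> holomorphic_Cn (f i) U"
  shows "holomorphic_Cn (\<lambda>z. \<Prod>i\<in>I. f i z) U"
  using assms by (induction I rule: infinite_finite_induct) (auto intro: holomorphic_Cn_mult)

lemma holomorphic_Cn_power:
  assumes "holomorphic_Cn f U"
  shows "holomorphic_Cn (\<lambda>z. f z ^ k) U"
  by (induction k) (auto intro: holomorphic_Cn_mult assms)

lemma holomorphic_Cn_uminus: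
  assumes "holomorphic_Cn f U" shows "holomorphic_Cn (\<lambda>z. - f z) U"
  using holomorphic_Cn_mult[OF holomorphic_Cn_const[of "-1"] assms] by simp

lemma holomorphic_Cn_diff:
  assumes "holomorphic_Cn f U" "holomorphic_Cn g U"
  shows "holomorphic_Cn (\<lambda>z. f z - g z) U"
  using holomorphic_Cn_add[OF assms(1) holomorphic_Cn_uminus[OF assms(2)]] by simp

lemma holomorphic_Cn_inverse:
  assumes "holomorphic_Cn f U" "\<And>z. z \<in> U \<Longrightarrow> f z \<noteq> 0"
  shows "holomorphic_Cn (\<lambda>z. inverse (f z)) U"
  unfolding holomorphic_Cn_def
proof
  fix z assume z: "z \<in> U"
  obtain L where L: "(f has_derivative L) (at z)" "\<And>c v. L (c *s v) = c * L v"
    using holomorphic_CnE[OF assms(1) z] by blast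
  show "\<exists>L. ((\<lambda>z. inverse (f z)) has_derivative L) (at z) \<and> (\<forall>c v. L (c *s v) = c * L v)"
    by (rule exI, rule conjI, rule Deriv.has_derivative_inverse[OF assms(2)[OF z] L(1)])
      (simp add: L(2) algebra_simps)
qed

lemma holomorphic_Cn_divide:
  assumes "holomorphic_Cn f U" "holomorphic_Cn g U" "\<And>z. z \<in> U \<Longrightarrow> g z \<noteq> 0"
  shows "holomorphic_Cn (\<lambda>z. f z / g z) U"
  using holomorphic_Cn_mult[OF assms(1) holomorphic_Cn_inverse[OF assms(2,3)]]
  by (simp add: divide_inverse)

lemma holomorphic_Cn_isCont: "holomorphic_Cn f U \<Longrightarrow> z \<in> U \<Longrightarrow> isCont f z"
  by (meson holomorphic_CnE has_derivative_continuous)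

lemma holomorphic_Cn_continuous_on: "holomorphic_Cn f U \<Longrightarrow> continuous_on U f"
  by (simp add: continuous_at_imp_continuous_on holomorphic_Cn_isCont)

lemma holomorphic_Cn_compose:
  assumes f: "holomorphic_Cn f V" and g: "\<And>i. holomorphic_Cn (\<lambda>z. g z $ i) U" and "g ` U \<subseteq> V"
  shows "holomorphic_Cn (\<lambda>z. f (g z)) U"
  unfolding holomorphic_Cn_def
proof
  fix z assume z: "z \<in> U"
  then have "g z \<in> V" using assms(3) by blast
  then obtain L where L: "(f has_derivative L) (at (g z))" "\<And>c v. L (c *s v) = c * L v"
    using holomorphic_CnE[OF f] by blast
  have "\<forall>i. \<exists>M. ((\<lambda>z. g z $ i) has_derivative M) (at z) \<and> (\<forall>c v. M (c *s v) = c * M v)"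
    using g z unfolding holomorphic_Cn_def by blast
  then obtain M where M: "\<And>i. ((\<lambda>z. g z $ i) has_derivative M i) (at z)"
    "\<And>i c v. M i (c *s v) = c * M i v" by metis
  have "(g has_derivative (\<lambda>v. \<chi> i. M i v)) (at z)"
    by (rule has_derivative_vec) (simp add: M)
  from has_derivative_compose[OF this L(1)]
  have 1: "((\<lambda>x. f (g x)) has_derivative (\<lambda>x. L (\<chi> i. M i x))) (at z)" .
  have "(\<chi> i. M i (c *s v)) = c *s (\<chi> i. M i v)" for c v
    by (simp add: vec_eq_iff M)
  with 1 show "\<exists>L. ((\<lambda>z. f (g z)) has_derivative L) (at z) \<and> (\<forall>c v. L (c *s v) = c * L v)"
    by (intro exI[of _ "\<lambda>x. L (\<chi> i. M i x)"]) (simp add: L)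
qed

text \<open>Chain rule along a complex curve: complex linearity of \<open>L\<close> turns the real
  derivative into multiplication by the number \<open>L D\<close>.\<close>

lemma holomorphic_Cn_curve_derivative:
  fixes f :: "complex ^ 'n \<Rightarrow> complex"
  assumes L: "(f has_derivative L) (at (\<gamma> t))" "\<And>c v. L (c *s v) = c * L v"
    and \<gamma>: "\<And>i. ((\<lambda>t. \<gamma> t $ i) has_field_derivative D $ i) (at t)"
  shows "((\<lambda>t. f (\<gamma> t)) has_field_derivative L D) (at t)"
proof -
  have "(\<gamma> has_derivative (\<lambda>h. h *s D)) (at t)"
  proof (rule has_derivative_vec)
    fix i show "((\<lambda>x. \<gamma> x $ i) has_derivative (\<lambda>v. (v *s D) $ i)) (at t)"
      using \<gamma>[of i] by (simp add: has_field_derivative_def mult.commute[of _ "D $ i"])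
  qed
  from has_derivative_compose[OF this L(1)] show ?thesis
    by (simp add: has_field_derivative_def L(2) mult_commute_abs)
qed

lemma holomorphic_Cn_curve:
  assumes f: "holomorphic_Cn f U" and \<gamma>: "\<And>i. (\<lambda>t. \<gamma> t $ i) holomorphic_on S"
    and "open S" "\<And>t. t \<in> S \<Longrightarrow> \<gamma> t \<in> U"
  shows "(\<lambda>t. f (\<gamma> t)) holomorphic_on S"
proof (subst holomorphic_on_open[OF \<open>open S\<close>], rule ballI)
  fix t assume t: "t \<in> S"
  obtain L where L: "(f has_derivative L) (at (\<gamma> t))" "\<And>c v. L (c *s v) = c * L v"
    using holomorphic_CnE[OF f assms(4)[OF t]] by blast
  have "((\<lambda>t. \<gamma> t $ i) has_field_derivative (\<chi> i. deriv (\<lambda>t. \<gamma> t $ i) t) $ i) (at t)" for i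
    using holomorphic_derivI[OF \<gamma>[of i] \<open>open S\<close> t] by simp
  from holomorphic_Cn_curve_derivative[OF L this]
  show "\<exists>f'. ((\<lambda>t. f (\<gamma> t)) has_field_derivative f') (at t)" by blast
qed

section \<open>Partial derivatives and Cauchy integral representations\<close>

lemma axis_zero [simp]: "axis i 0 = 0"
  by (simp add: vec_eq_iff axis_def)

lemma norm_axis_vec [simp]: "norm (axis i (c :: 'a::real_inner)) = norm c"
  by (simp add: norm_eq_sqrt_inner inner_axis)

text \<open>Defined by a one-variable \<open>deriv\<close> along the axis, so that Cauchy's theory
  in one variable applies directly.\<close>

definition pd :: "'n \<Rightarrow> (complex ^ 'n \<Rightarrow> complex) \<Rightarrow> complex ^ 'n \<Rightarrow> complex" where
  "pd i f z = deriv (\<lambda>t. f (z + axis i t)) 0"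

lemma pd_eq_derivative:
  fixes f :: "complex ^ 'n \<Rightarrow> complex"
  assumes L: "(f has_derivative L) (at z)" "\<And>c v. L (c *s v) = c * L v"
  shows "pd i f z = L (axis i 1)"
proof -
  have "((\<lambda>t. f (z + axis i t)) has_field_derivative L (axis i 1)) (at 0)"
  proof (rule holomorphic_Cn_curve_derivative[OF _ L(2)])
    show "(f has_derivative L) (at (z + axis i 0))" using L(1) by simp
    fix j show "((\<lambda>t. (z + axis i t) $ j) has_field_derivative axis i 1 $ j) (at 0)"
      by (cases "j = i") (auto simp: axis_def intro!: derivative_eq_intros)
  qed
  then show ?thesis by (simp add: pd_def DERIV_imp_deriv)
qed

lemma holomorphic_Cn_has_derivative:
  assumes "holomorphic_Cn f U" "z \<in> U"
  shows "(f has_derivative (\<lambda>v. \<Sum>i\<in>UNIV. v $ i * pd i f z)) (at z)"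
proof -
  obtain L where L: "(f has_derivative L) (at z)" "\<And>c v. L (c *s v) = c * L v"
    using holomorphic_CnE[OF assms] by blast
  have "linear L" using L(1) has_derivative_linear by blast
  have "L v = (\<Sum>i\<in>UNIV. v $ i * pd i f z)" for v
  proof -
    have "L v = L (\<Sum>i\<in>UNIV. v $ i *s axis i 1)" by (simp add: basis_expansion)
    also have "\<dots> = (\<Sum>i\<in>UNIV. L (v $ i *s axis i 1))" by (rule linear_sum[OF \<open>linear L\<close>])
    finally show ?thesis by (simp add: L(2) pd_eq_derivative[OF L])
  qed
  then have "L = (\<lambda>v. \<Sum>i\<in>UNIV. v $ i * pd i f z)" by blast
  with L(1) show ?thesis by simp
qed

lemma contour_integral_circlepath_eq:
  "contour_integral (circlepath c r) h =
     integral {0..1} (\<lambda>s. h (circlepath c r s) * (2 * pi * \<i> * r * exp (2 * of_real pi * \<i> * s)))"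
  unfolding contour_integral_integral by (simp add: vector_derivative_circlepath)

text \<open>Cauchy's formula for the first derivative at the centre of the circle. Parametrised by
  the angle, \<open>dt\<close> contributes \<open>2 * pi * \<i> * t\<close>, which cancels the
  prefactor and one of the two powers of \<open>t\<close>. Only values of \<open>f\<close> enter,
  and this is what makes derivatives controllable under parameters.\<close>

lemma pd_integral:
  assumes f: "holomorphic_Cn f U" and U: "ball z R \<subseteq> U" and r: "0 < r" "r < R"
  shows "pd i f z = integral {0..1} (\<lambda>s::real. f (z + axis i (circlepath 0 r s)) / circlepath 0 r s)"
proof -
  have hol: "(\<lambda>t::complex. f (z + axis i t)) holomorphic_on ball 0 R"
  proof (rule holomorphic_Cn_curve[OF f])
    fix j show "(\<lambda>t. (z + axis i t) $ j) holomorphic_on ball 0 R"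
      by (cases "j = i") (auto simp: axis_def intro!: holomorphic_intros)
  next
    fix t :: complex assume "t \<in> ball 0 R"
    then have "z + axis i t \<in> ball z R" by (simp add: dist_norm)
    then show "z + axis i t \<in> U" using U by blast
  qed auto
  have "((\<lambda>t. f (z + axis i t)) has_field_derivative
     (1 / (2 * of_real pi * \<i>) * contour_integral (circlepath 0 r) (\<lambda>u. f (z + axis i u) / (u-0)^2))) (at 0)"
  proof (rule Cauchy_derivative_integral_circlepath(2))
    show "continuous_on (cball 0 r) (\<lambda>t. f (z + axis i t))"
      by (rule holomorphic_on_imp_continuous_on, rule holomorphic_on_subset[OF hol]) (use r in auto)
    show "(\<lambda>t. f (z + axis i t)) holomorphic_on ball 0 r"
      by (rule holomorphic_on_subset[OF hol]) (use r in auto)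
  qed (use r in auto)
  then have "pd i f z = 1 / (2 * of_real pi * \<i>) * contour_integral (circlepath 0 r) (\<lambda>u. f (z + axis i u) / (u-0)^2)"
    by (simp add: pd_def DERIV_imp_deriv)
  also have "\<dots> = integral {0..1} (\<lambda>s::real. 1 / (2 * of_real pi * \<i>) *
      (f (z + axis i (circlepath 0 r s)) / (circlepath 0 r s)^2 * (2 * pi * \<i> * r * exp (2 * of_real pi * \<i> * s))))"
    by (simp only: contour_integral_circlepath_eq integral_mult_right diff_zero)
  also have "\<dots> = integral {0..1} (\<lambda>s::real. f (z + axis i (circlepath 0 r s)) / circlepath 0 r s)"
    by (rule integral_cong) (use r in \<open>simp add: circlepath field_simps power2_eq_square\<close>)
  finally show ?thesis .
qed

text \<open>Leibniz's rule asks for joint continuity of the derivative, whereas joint continuity is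
  given for \<open>G\<close> only. Cauchy's formula expresses the derivative through values of
  \<open>G\<close> and thereby supplies it.\<close>

lemma holomorphic_Cn_integral:
  fixes G :: "complex ^ 'n \<Rightarrow> real \<Rightarrow> complex"
  assumes "open U" and hol: "\<And>\<theta>. \<theta> \<in> {a..b} \<Longrightarrow> holomorphic_Cn (\<lambda>z. G z \<theta>) U"
    and cont: "continuous_on (U \<times> {a..b}) (\<lambda>(z,\<theta>). G z \<theta>)"
  shows "holomorphic_Cn (\<lambda>z. integral {a..b} (G z)) U"
  unfolding holomorphic_Cn_def
proof
  fix z0 assume "z0 \<in> U"
  then obtain R where R: "R > 0" "cball z0 R \<subseteq> U" using \<open>open U\<close> open_contains_cball by blast
  \<comment> \<open>With a third of the radius, every \<open>z\<close> in \<open>B\<close> keeps a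
    ball of radius \<open>2 * r\<close> inside \<open>U\<close>, and in it the circle of radius
    \<open>r\<close> about \<open>z\<close>.\<close>
  define r where "r = R / 3"
  have r: "r > 0" using R r_def by simp
  define B where "B = ball z0 r"
  have sub: "ball z (2*r) \<subseteq> U" if "z \<in> B" for z
  proof
    fix w assume "w \<in> ball z (2*r)"
    then have "dist z0 w \<le> R" using that dist_triangle[of z0 w z] by (auto simp: B_def r_def)
    then show "w \<in> U" using R by auto
  qed
  define P where "P i z \<theta> = integral {0..1} (\<lambda>s::real. G (z + axis i (circlepath 0 r s)) \<theta> / circlepath 0 r s)"
    for i z \<theta>
  have P: "pd i (\<lambda>z. G z \<theta>) z = P i z \<theta>" if "z \<in> B" "\<theta> \<in> {a..b}" for i z \<theta>
    unfolding P_def using pd_integral[OF hol[OF that(2)] sub[OF that(1)], of r i] r by simp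
  have contP: "continuous_on (B \<times> {a..b}) (\<lambda>(z,\<theta>). P i z \<theta>)" for i
  proof -
    have "continuous_on ((B \<times> {a..b}) \<times> cbox 0 1)
        (\<lambda>(x, s::real). G (fst x + axis i (circlepath 0 r s)) (snd x) / circlepath 0 r s)"
      unfolding split_beta
    proof (rule continuous_on_divide)
      show "continuous_on ((B \<times> {a..b}) \<times> cbox 0 1)
         (\<lambda>p. G (fst (fst p) + axis i (circlepath 0 r (snd p))) (snd (fst p)))"
      proof (rule continuous_on_compose2[OF cont, of _ "\<lambda>p. (fst (fst p) + axis i (circlepath 0 r (snd p)), snd (fst p))", simplified])
        show "continuous_on ((B \<times> {a..b}) \<times> cbox 0 1) (\<lambda>p. (fst (fst p) + axis i (circlepath 0 r (snd p)), snd (fst p)))"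
        proof -
          have "axis i (circlepath 0 r s) = circlepath 0 r s *s axis i 1" for s by (simp add: vec_eq_iff axis_def)
          then show ?thesis unfolding circlepath
            by (auto intro!: continuous_intros simp: axis_def vector_scalar_mult_def)
        qed
        show "(\<lambda>p. (fst (fst p) + axis i (circlepath 0 r (snd p)), snd (fst p))) ` ((B \<times> {a..b}) \<times> cbox 0 1) \<subseteq> U \<times> {a..b}"
        proof -
          have "z + axis i (circlepath 0 r s) \<in> U" if "z \<in> B" for z s
            using sub[OF that] r by (force simp: dist_norm circlepath norm_mult)
          then show ?thesis by auto
        qed
      qed
      show "continuous_on ((B \<times> {a..b}) \<times> cbox 0 1) (\<lambda>x. circlepath 0 r (snd x))"
        unfolding circlepath by (auto intro!: continuous_intros)
      show "\<forall>x\<in>(B \<times> {a..b}) \<times> cbox 0 1. circlepath 0 r (snd x) \<noteq> 0"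
        using r by (simp add: circlepath)
    qed
    from integral_continuous_on_param[OF this] show ?thesis
      by (simp add: P_def split_beta)
  qed
  define fx where "fx z \<theta> = Blinfun (\<lambda>v :: complex ^ 'n. \<Sum>i\<in>UNIV. v $ i * P i z \<theta>)" for z \<theta>
  have bl: "bounded_linear (\<lambda>v :: complex ^ 'n. \<Sum>i\<in>UNIV. v $ i * P i z \<theta>)" for z \<theta>
    by (intro bounded_linear_sum bounded_linear_mult_const bounded_linear_vec_nth)
  have fx: "blinfun_apply (fx z \<theta>) = (\<lambda>v. \<Sum>i\<in>UNIV. v $ i * P i z \<theta>)" for z \<theta>
    unfolding fx_def using bl by (simp add: bounded_linear_Blinfun_apply)
  have contfx: "continuous_on (B \<times> cbox a b) (\<lambda>(z, \<theta>). fx z \<theta>)"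
    by (rule continuous_on_blinfun_componentwise)
      (use contP in \<open>auto simp: fx split_beta intro!: continuous_intros\<close>)
  have *: "((\<lambda>z. integral (cbox a b) (G z)) has_derivative integral (cbox a b) (fx z0)) (at z0 within B)"
  proof (rule leibniz_rule)
    show "((\<lambda>z. G z \<theta>) has_derivative blinfun_apply (fx z \<theta>)) (at z within B)"
      if "z \<in> B" "\<theta> \<in> cbox a b" for z \<theta>
    proof -
      have "z \<in> U" using sub[OF that(1)] r centre_in_ball[of z "2*r"] by auto
      then show ?thesis
        using holomorphic_Cn_has_derivative[OF hol, of \<theta> z] that P
        by (auto simp: fx intro: has_derivative_at_withinI)
    qed
    show "G z integrable_on cbox a b" if "z \<in> B" for z
    proof -
      have "continuous_on {a..b} (G z)"
        using sub[OF that] r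
        by (intro continuous_on_compose2[OF cont, of _ "\<lambda>\<theta>. (z,\<theta>)", simplified]) (auto intro!: continuous_intros)
      then show ?thesis by (simp add: integrable_continuous_interval)
    qed
    show "continuous_on (B \<times> cbox a b) (\<lambda>(z, \<theta>). fx z \<theta>)" by (fact contfx)
  qed (auto simp: B_def r)
  have int: "fx z0 integrable_on cbox a b"
  proof -
    have "continuous_on (cbox a b) (fx z0)"
      by (rule continuous_on_compose2[OF contfx, of _ "\<lambda>\<theta>. (z0,\<theta>)", simplified])
        (auto intro!: continuous_intros simp: B_def r)
    then show ?thesis by (rule integrable_continuous)
  qed
  have "((\<lambda>z. integral {a..b} (G z)) has_derivative integral (cbox a b) (fx z0)) (at z0)"
    using * at_within_open[of z0 B] r by (simp add: B_def)
  moreover have "blinfun_apply (integral (cbox a b) (fx z0)) (c *s v) =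
      c * blinfun_apply (integral (cbox a b) (fx z0)) v" for c v
    unfolding blinfun_apply_integral[OF int] fx by (simp add: mult.assoc flip: sum_distrib_left)
  ultimately show "\<exists>L. ((\<lambda>z. integral {a..b} (G z)) has_derivative L) (at z0) \<and> (\<forall>c v. L (c *s v) = c * L v)"
    by blast
qed

lemma holomorphic_Cn_contour_integral:
  fixes G :: "complex ^ 'n \<Rightarrow> complex \<Rightarrow> complex"
  assumes "open U" "r > 0" and hol: "\<And>t. t \<in> sphere c r \<Longrightarrow> holomorphic_Cn (\<lambda>z. G z t) U"
    and cont: "continuous_on (U \<times> sphere c r) (\<lambda>(z,t). G z t)"
  shows "holomorphic_Cn (\<lambda>z. contour_integral (circlepath c r) (G z)) U"
  unfolding contour_integral_circlepath_eq
proof (rule holomorphic_Cn_integral[OF \<open>open U\<close>])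
  have sph: "circlepath c r s \<in> sphere c r" for s :: real
    using \<open>r > 0\<close> by (simp add: circlepath dist_norm norm_mult)
  show "holomorphic_Cn (\<lambda>z. G z (circlepath c r s) * (2 * pi * \<i> * r * exp (2 * of_real pi * \<i> * s))) U"
    for s :: real
    by (intro holomorphic_Cn_mult hol sph holomorphic_Cn_const)
  show "continuous_on (U \<times> {0..1}) (\<lambda>(z, s::real). G z (circlepath c r s) * (2 * pi * \<i> * r * exp (2 * of_real pi * \<i> * s)))"
    unfolding split_beta
  proof (rule continuous_on_mult)
    show "continuous_on (U \<times> {0..1}) (\<lambda>p. G (fst p) (circlepath c r (snd p)))"
      by (rule continuous_on_compose2[OF cont, of _ "\<lambda>p. (fst p, circlepath c r (snd p))", simplified])
        (use \<open>r > 0\<close> in \<open>auto intro!: continuous_intros simp: circlepath dist_norm norm_mult\<close>)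
  qed (auto intro!: continuous_intros)
qed

text \<open>The integrand in \<open>pd_integral\<close> is holomorphic in the base point, hence so
  is the integral; holomorphy thus passes to derivatives of all orders.\<close>

lemma holomorphic_Cn_pd:
  assumes f: "holomorphic_Cn f U" and "open U"
  shows "holomorphic_Cn (pd i f) U"
  unfolding holomorphic_Cn_def
proof
  fix z0 assume "z0 \<in> U"
  then obtain R where R: "R > 0" "cball z0 R \<subseteq> U" using \<open>open U\<close> open_contains_cball by blast
  define r where "r = R / 3"
  have r: "r > 0" using R r_def by simp
  define B where "B = ball z0 r"
  have sub: "ball z (2*r) \<subseteq> U" if "z \<in> B" for z
  proof
    fix w assume "w \<in> ball z (2*r)"
    then have "dist z0 w \<le> R" using that dist_triangle[of z0 w z] by (auto simp: B_def r_def)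
    then show "w \<in> U" using R by auto
  qed
  have sub': "z + axis i (circlepath 0 r s) \<in> U" if "z \<in> B" for z s
    using sub[OF that] r by (force simp: dist_norm circlepath norm_mult)
  define F where "F z = integral {0..1} (\<lambda>s::real. f (z + axis i (circlepath 0 r s)) / circlepath 0 r s)" for z
  have eq: "pd i f z = F z" if "z \<in> B" for z
    unfolding F_def using pd_integral[OF f sub[OF that], of r i] r by simp
  have "holomorphic_Cn F B"
    unfolding F_def
  proof (rule holomorphic_Cn_integral)
    show "open B" by (simp add: B_def)
    show "holomorphic_Cn (\<lambda>z. f (z + axis i (circlepath 0 r s)) / circlepath 0 r s) B" for s
      using r sub'
      by (intro holomorphic_Cn_divide holomorphic_Cn_compose[OF f, of "\<lambda>z. z + axis i (circlepath 0 r s)"])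
        (auto simp: circlepath intro!: holomorphic_Cn_add)
    show "continuous_on (B \<times> {0..1}) (\<lambda>(z, s). f (z + axis i (circlepath 0 r s)) / circlepath 0 r s)"
      unfolding split_beta
    proof (rule continuous_on_divide)
      have "continuous_on (B \<times> {0..1}) (\<lambda>p. fst p + axis i (circlepath 0 r (snd p)))"
      proof -
        have "axis i (circlepath 0 r s) = circlepath 0 r s *s axis i 1" for s by (simp add: vec_eq_iff axis_def)
        then show ?thesis unfolding circlepath
          by (auto intro!: continuous_intros simp: axis_def vector_scalar_mult_def)
      qed
      then show "continuous_on (B \<times> {0..1}) (\<lambda>p. f (fst p + axis i (circlepath 0 r (snd p))))"
        by (rule continuous_on_compose2[OF holomorphic_Cn_continuous_on[OF f]]) (use sub' in auto)
    qed (use r in \<open>auto simp: circlepath intro!: continuous_intros\<close>)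
  qed
  then obtain L where L: "(F has_derivative L) (at z0)" "\<And>c v. L (c *s v) = c * L v"
    using r by (auto simp: B_def elim!: holomorphic_CnE)
  have "(pd i f has_derivative L) (at z0)"
    by (rule has_derivative_transform_within_open[OF L(1), of B]) (use r eq in \<open>auto simp: B_def\<close>)
  with L show "\<exists>L. (pd i f has_derivative L) (at z0) \<and> (\<forall>c v. L (c *s v) = c * L v)" by blast
qed

section \<open>Restriction to complex lines and the identity theorem\<close>

lemma holomorphic_Cn_line:
  assumes "holomorphic_Cn f U" "open U"
  shows "(\<lambda>t. f (a + t *s v)) holomorphic_on {t. a + t *s v \<in> U}" "open {t. a + t *s v \<in> U}"
proof -
  have "continuous_on UNIV (\<lambda>t. a + t *s v)"
    unfolding vector_scalar_mult_def by (intro continuous_intros)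
  with \<open>open U\<close> have "open ((\<lambda>t. a + t *s v) -` U)"
    by (metis continuous_open_vimage continuous_on_eq_continuous_at open_UNIV UNIV_I)
  then show "open {t. a + t *s v \<in> U}" by (simp add: vimage_def)
  then show "(\<lambda>t. f (a + t *s v)) holomorphic_on {t. a + t *s v \<in> U}"
    by (intro holomorphic_Cn_curve[OF assms(1)]) (auto intro!: holomorphic_intros)
qed

text \<open>The complex line through a point of \<open>V\<close> and \<open>w\<close> meets the
  convex set \<open>U\<close> in a convex, hence connected, set of parameters, where the
  one-variable identity theorem applies.\<close>

lemma holomorphic_Cn_eq_0_on_convex:
  assumes f: "holomorphic_Cn f U" and "open U" "convex U" and V: "open V" "V \<subseteq> U" "V \<noteq> {}"
    and 0: "\<And>z. z \<in> V \<Longrightarrow> f z = 0" and w: "w \<in> U"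
  shows "f w = 0"
proof -
  obtain a where a: "a \<in> V" using V by blast
  let ?S = "{t. a + t *s (w - a) \<in> U}"
  have "convex ?S"
  proof (rule convexI)
    fix x y :: complex and u v :: real
    assume *: "x \<in> ?S" "y \<in> ?S" "0 \<le> u" "0 \<le> v" "u + v = 1"
    have "a + (u *\<^sub>R x + v *\<^sub>R y) *s (w - a) = u *\<^sub>R (a + x *s (w - a)) + v *\<^sub>R (a + y *s (w - a))"
    proof -
      have "u *\<^sub>R a + v *\<^sub>R a = a" using *(5) by (simp flip: scaleR_add_left)
      then show ?thesis
        by (simp add: vec_eq_iff scaleR_conv_of_real[where 'a = complex] algebra_simps)
    qed
    also have "\<dots> \<in> U" using \<open>convex U\<close> * by (simp add: convexD)
    finally show "u *\<^sub>R x + v *\<^sub>R y \<in> ?S" by simp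
  qed
  note hol = holomorphic_Cn_line[OF f \<open>open U\<close>, of a "w - a"]
  have T: "open {t. a + t *s (w - a) \<in> V}" using holomorphic_Cn_line(2)[OF holomorphic_Cn_const V(1)] .
  have 0: "0 \<in> {t. a + t *s (w - a) \<in> V}" using a by (simp add: vector_scalar_mult_def vec_eq_iff zero_vec_def[symmetric])
  have "(\<lambda>t. f (a + t *s (w - a))) 1 = (\<lambda>_. 0) (1::complex)"
  proof (rule analytic_continuation_open[where s="{t. a + t *s (w - a) \<in> V}" and s'="?S" and f="\<lambda>t. f (a + t *s (w - a))" and g="\<lambda>_. 0"])
    show "{t. a + t *s (w - a) \<in> V} \<noteq> {}" using 0 by blast
    show "connected ?S" by (rule convex_connected[OF \<open>convex ?S\<close>])
  qed (use hol T V assms(7) w in auto)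
  then show ?thesis by simp
qed


text \<open>Encodes the projection along axis \<open>i\<close> without changing the space: the fibre
  of \<open>X\<close> over \<open>z\<close> is \<open>{t. vupd z i t \<in> X}\<close>, and the base
  is \<open>complex ^ 'n\<close> itself, with coordinate \<open>i\<close> carried along.\<close>

definition vupd :: "complex ^ 'n \<Rightarrow> 'n \<Rightarrow> complex \<Rightarrow> complex ^ 'n" where
  "vupd z i t = (\<chi> j. if j = i then t else z $ j)"

lemma vupd_nth [simp]: "vupd z i t $ j = (if j = i then t else z $ j)"
  by (simp add: vupd_def)

lemma vupd_vupd [simp]: "vupd (vupd z i s) i t = vupd z i t"
  by (simp add: vec_eq_iff)

lemma vupd_same [simp]: "vupd z i (z $ i) = z"
  by (simp add: vec_eq_iff)

lemma vupd_inj [simp]: "vupd z i s = vupd z i t \<longleftrightarrow> s = t"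
  by (auto simp: vec_eq_iff split: if_splits)

lemma continuous_on_vupd [continuous_intros]:
  assumes "continuous_on S f" "continuous_on S g"
  shows "continuous_on S (\<lambda>x. vupd (f x) i (g x))"
proof -
  have "continuous_on S (\<lambda>x. if j = i then g x else f x $ j)" for j
    by (cases "j = i") (auto intro!: continuous_intros assms)
  then show ?thesis unfolding vupd_def by (intro continuous_on_vec_lambda)
qed

lemma holomorphic_Cn_vupd:
  assumes f: "holomorphic_Cn f V" and g: "\<And>i. holomorphic_Cn (\<lambda>z. g z $ i) U"
    and h: "holomorphic_Cn h U" and "\<And>z. z \<in> U \<Longrightarrow> vupd (g z) i (h z) \<in> V"
  shows "holomorphic_Cn (\<lambda>z. f (vupd (g z) i (h z))) U"
proof (rule holomorphic_Cn_compose[OF f, of "\<lambda>z. vupd (g z) i (h z)"])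
  fix j show "holomorphic_Cn (\<lambda>z. vupd (g z) i (h z) $ j) U"
    by (cases "j = i") (auto simp: g h)
qed (use assms in auto)

lemma holomorphic_on_vupd:
  assumes f: "holomorphic_Cn f V" "open S" "\<And>t. t \<in> S \<Longrightarrow> vupd z i t \<in> V"
  shows "(\<lambda>t. f (vupd z i t)) holomorphic_on S"
proof (rule holomorphic_Cn_curve[OF f(1) _ f(2,3)])
  fix j show "(\<lambda>t. vupd z i t $ j) holomorphic_on S"
    by (cases "j = i") (auto intro!: holomorphic_intros)
qed

lemma deriv_vupd: "deriv (\<lambda>t. f (vupd z i t)) s = pd i f (vupd z i s)"
proof -
  have "vupd z i s + axis i t = vupd z i (s + t)" for t
    by (simp add: vec_eq_iff axis_def)
  then show ?thesis
    by (subst deriv_shift_0) (simp add: pd_def o_def)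
qed

section \<open>Biholomorphic charts and the inverse function theorem\<close>

definition biholomorphic ::
  "(complex ^ 'n) set \<Rightarrow> (complex ^ 'n) set \<Rightarrow> (complex ^ 'n \<Rightarrow> complex ^ 'n) \<Rightarrow> (complex ^ 'n \<Rightarrow> complex ^ 'n) \<Rightarrow> bool"
  where "biholomorphic U V \<phi> \<psi> \<longleftrightarrow> open U \<and> open V \<and> homeomorphism U V \<phi> \<psi> \<and>
    (\<forall>i. holomorphic_Cn (\<lambda>z. \<phi> z $ i) U) \<and> (\<forall>i. holomorphic_Cn (\<lambda>w. \<psi> w $ i) V)"

lemma homeomorphism_restrict_open:
  assumes h: "homeomorphism U V \<phi> \<psi>" and "open U" "open V" "open V1" "V1 \<subseteq> V"
  shows "homeomorphism (\<psi> ` V1) V1 \<phi> \<psi>" "open (\<psi> ` V1)"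
proof -
  have 1: "\<psi> w \<in> U" "\<phi> (\<psi> w) = w" if "w \<in> V" for w
    using h that by (auto simp: homeomorphism_def)
  have 2: "\<psi> (\<phi> z) = z" if "z \<in> U" for z
    using h that by (auto simp: homeomorphism_def)
  have eq: "\<psi> ` V1 = \<phi> -` V1 \<inter> U"
  proof
    show "\<psi> ` V1 \<subseteq> \<phi> -` V1 \<inter> U" using 1 \<open>V1 \<subseteq> V\<close> by auto
    show "\<phi> -` V1 \<inter> U \<subseteq> \<psi> ` V1" using 2 by (auto intro!: image_eqI[of _ \<psi>])
  qed
  show "homeomorphism (\<psi> ` V1) V1 \<phi> \<psi>"
  proof (rule homeomorphismI)
    show "continuous_on (\<psi> ` V1) \<phi>"
      using h eq by (auto simp: homeomorphism_def intro: continuous_on_subset)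
    show "continuous_on V1 \<psi>"
      using h \<open>V1 \<subseteq> V\<close> by (auto simp: homeomorphism_def intro: continuous_on_subset)
  qed (use 1 2 eq \<open>V1 \<subseteq> V\<close> in auto)
  show "open (\<psi> ` V1)"
    unfolding eq using h \<open>open U\<close> \<open>open V1\<close> continuous_on_open_vimage[of U \<phi>]
    by (auto simp: homeomorphism_def)
qed

lemma biholomorphic_restrict:
  assumes "biholomorphic U V \<phi> \<psi>" "open V1" "V1 \<subseteq> V"
  shows "biholomorphic (\<psi> ` V1) V1 \<phi> \<psi>"
proof -
  have "\<psi> ` V1 \<subseteq> U" using assms by (auto simp: biholomorphic_def homeomorphism_def)
  then show ?thesis
    using assms homeomorphism_restrict_open[of U V \<phi> \<psi> V1] holomorphic_Cn_subset
    unfolding biholomorphic_def by blast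
qed

lemma biholomorphic_compose:
  assumes 1: "biholomorphic U V \<phi> \<psi>" and 2: "biholomorphic V W \<sigma> \<tau>"
  shows "biholomorphic U W (\<sigma> \<circ> \<phi>) (\<psi> \<circ> \<tau>)"
proof -
  have "\<phi> ` U \<subseteq> V" "\<tau> ` W \<subseteq> V" using assms by (auto simp: biholomorphic_def homeomorphism_def)
  moreover have "homeomorphism U W (\<sigma> \<circ> \<phi>) (\<psi> \<circ> \<tau>)"
    using homeomorphism_compose[of U V \<phi> \<psi> W \<sigma> \<tau>] assms by (auto simp: biholomorphic_def)
  ultimately show ?thesis
    using assms holomorphic_Cn_compose[of "\<lambda>z. \<sigma> z $ i" V \<phi> U for i]
      holomorphic_Cn_compose[of "\<lambda>z. \<psi> z $ i" V \<tau> W for i]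
    unfolding biholomorphic_def by auto
qed

text \<open>The real inverse function theorem gives a differentiable inverse; its derivative is the
  inverse of a complex linear bijection and therefore complex linear again.\<close>

lemma holomorphic_inverse_function:
  fixes \<phi> :: "complex ^ 'n \<Rightarrow> complex ^ 'n"
  assumes "open U" "a \<in> U" and hol: "\<And>i. holomorphic_Cn (\<lambda>z. \<phi> z $ i) U"
    and inj: "\<And>v. (\<And>i. (\<Sum>j\<in>UNIV. v $ j * pd j (\<lambda>z. \<phi> z $ i) a) = 0) \<Longrightarrow> v = 0"
  obtains U' V \<psi> where "biholomorphic U' V \<phi> \<psi>" "U' \<subseteq> U" "a \<in> U'"
proof -
  define f' where "f' z = Blinfun (\<lambda>v :: complex ^ 'n. \<chi> i. \<Sum>j\<in>UNIV. v $ j * pd j (\<lambda>z. \<phi> z $ i) z)" for z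
  have bl: "bounded_linear (\<lambda>v :: complex ^ 'n. \<chi> i. \<Sum>j\<in>UNIV. v $ j * pd j (\<lambda>z. \<phi> z $ i) z)" for z
    by (intro linear_conv_bounded_linear[THEN iffD1] linearI)
      (simp_all add: vec_eq_iff algebra_simps sum.distrib scaleR_sum_right)
  have f': "blinfun_apply (f' z) = (\<lambda>v. \<chi> i. \<Sum>j\<in>UNIV. v $ j * pd j (\<lambda>z. \<phi> z $ i) z)" for z
    unfolding f'_def using bl by (simp add: bounded_linear_Blinfun_apply)
  have lin: "blinfun_apply (f' z) (c *s v) = c *s blinfun_apply (f' z) v" for z c v
    by (simp add: f' vec_eq_iff sum_distrib_left mult.assoc)
  have der: "(\<phi> has_derivative blinfun_apply (f' z)) (at z)" if "z \<in> U" for z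
    unfolding f' by (rule has_derivative_vec) (simp add: holomorphic_Cn_has_derivative[OF hol that])
  have cont: "continuous_on U f'"
    by (rule continuous_on_blinfun_componentwise)
      (auto simp: f' intro!: continuous_intros holomorphic_Cn_continuous_on holomorphic_Cn_sum
          holomorphic_Cn_mult holomorphic_Cn_pd hol \<open>open U\<close>)
  have "linear (blinfun_apply (f' a))" by (rule bounded_linear.linear[OF blinfun.bounded_linear_right])
  moreover have "inj (blinfun_apply (f' a))"
  proof (subst linear_injective_0[OF calculation], intro allI impI)
    fix v assume "blinfun_apply (f' a) v = 0"
    then show "v = 0" by (intro inj) (simp add: f' vec_eq_iff)
  qed
  ultimately obtain g where g: "linear g" "g \<circ> blinfun_apply (f' a) = id"
    using linear_injective_left_inverse by blast
  have "Blinfun g o\<^sub>L f' a = id_blinfun"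
    by (rule blinfun_eqI)
      (use g in \<open>simp add: bounded_linear_Blinfun_apply linear_conv_bounded_linear[symmetric] o_def fun_eq_iff\<close>)
  from inverse_function_theorem[OF \<open>open U\<close> der cont \<open>a \<in> U\<close> this]
  obtain U' V \<psi> g' where *: "open U'" "U' \<subseteq> U" "a \<in> U'" "open V" "\<phi> a \<in> V" "homeomorphism U' V \<phi> \<psi>"
    "\<And>y. y \<in> V \<Longrightarrow> (\<psi> has_derivative g' y) (at y)"
    "\<And>y. y \<in> V \<Longrightarrow> g' y = inv (blinfun_apply (f' (\<psi> y)))"
    "\<And>y. y \<in> V \<Longrightarrow> bij (blinfun_apply (f' (\<psi> y)))" by metis
  have "holomorphic_Cn (\<lambda>w. \<psi> w $ i) V" for i
    unfolding holomorphic_Cn_def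
  proof
    fix y assume y: "y \<in> V"
    have "((\<lambda>w. \<psi> w $ i) has_derivative (\<lambda>v. g' y v $ i)) (at y)"
      by (rule bounded_linear.has_derivative[OF bounded_linear_vec_nth *(7)[OF y]])
    moreover have "g' y (c *s v) = c *s g' y v" for c v
      using *(9)[OF y] lin unfolding *(8)[OF y]
      by (metis bij_inv_eq_iff)
    ultimately show "\<exists>L. ((\<lambda>w. \<psi> w $ i) has_derivative L) (at y) \<and> (\<forall>c v. L (c *s v) = c * L v)"
      by (intro exI[of _ "\<lambda>v. g' y v $ i"]) simp
  qed
  then have "biholomorphic U' V \<phi> \<psi>"
    unfolding biholomorphic_def using * hol holomorphic_Cn_subset by blast
  then show ?thesis using * that by blast
qed

lemma pd_coord: "pd j (\<lambda>z. z $ i) a = (if i = j then 1 else 0)"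
  by (cases "i = j") (auto simp: pd_def axis_def)

text \<open>In chart coordinates the Jacobian of \<open>\<lambda>w. vupd w j (D w)\<close> is the
  identity except for row \<open>j\<close>, so its determinant is \<open>pd j D w\<close>. This is
  the exchange step behind both maximality arguments on regular points.\<close>

lemma biholomorphic_replace_coordinate:
  fixes \<phi> :: "complex ^ 'n \<Rightarrow> complex ^ 'n"
  assumes bi: "biholomorphic U V \<phi> \<psi>" and D: "holomorphic_Cn D V" and w: "w \<in> V" "pd j D w \<noteq> 0"
  obtains U' V' \<psi>' where "U' \<subseteq> U" "\<psi> w \<in> U'" "biholomorphic U' V' (\<lambda>z. vupd (\<phi> z) j (D (\<phi> z))) \<psi>'"
proof -
  have "open V" using bi by (simp add: biholomorphic_def)
  obtain V1 W \<tau> where V1: "biholomorphic V1 W (\<lambda>w. vupd w j (D w)) \<tau>" "V1 \<subseteq> V" "w \<in> V1"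
  proof (rule holomorphic_inverse_function[OF \<open>open V\<close> w(1)])
    fix i show "holomorphic_Cn (\<lambda>w. vupd w j (D w) $ i) V"
      by (cases "i = j") (auto simp: D)
  next
    fix v :: "complex ^ 'n"
    assume *: "\<And>i. (\<Sum>k\<in>UNIV. v $ k * pd k (\<lambda>w. vupd w j (D w) $ i) w) = 0"
    have 1: "v $ i = 0" if "i \<noteq> j" for i
    proof -
      have "(\<Sum>k\<in>UNIV. v $ k * pd k (\<lambda>w. vupd w j (D w) $ i) w) = (\<Sum>k\<in>UNIV. if k = i then v $ k else 0)"
        using that by (intro sum.cong) (auto simp: pd_coord)
      then show ?thesis using *[of i] by simp
    qed
    have "(\<Sum>k\<in>UNIV. v $ k * pd k D w) = (\<Sum>k\<in>UNIV. if k = j then v $ j * pd j D w else 0)"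
      by (intro sum.cong) (auto simp: 1)
    then have "v $ j * pd j D w = 0" using *[of j] by simp
    with w(2) have "v $ j = 0" by simp
    with 1 have "v $ i = 0" for i by (cases "i = j") auto
    then show "v = 0" by (simp add: vec_eq_iff)
  qed
  have "open V1" using V1 by (simp add: biholomorphic_def)
  have "biholomorphic (\<psi> ` V1) W ((\<lambda>w. vupd w j (D w)) \<circ> \<phi>) (\<psi> \<circ> \<tau>)"
    by (rule biholomorphic_compose[OF biholomorphic_restrict[OF bi \<open>open V1\<close> V1(2)] V1(1)])
  moreover have "\<psi> ` V1 \<subseteq> U" using bi V1 by (auto simp: biholomorphic_def homeomorphism_def)
  ultimately show ?thesis using that[of "\<psi> ` V1"] V1 by (auto simp: o_def)
qed

section \<open>Symmetric functions of the roots of a holomorphic function\<close>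

subsection \<open>Newton's identities\<close>

text \<open>The reversed characteristic polynomial: its coefficients are the signed elementary
  symmetric functions of the values \<open>c p\<close>, and values equal to \<open>0\<close> lower
  its degree instead of creating roots.\<close>

definition root_poly :: "'a set \<Rightarrow> ('a \<Rightarrow> nat) \<Rightarrow> ('a \<Rightarrow> complex) \<Rightarrow> complex poly" where
  "root_poly Z m c = (\<Prod>p\<in>Z. [:1, - c p:] ^ m p)"

lemma geometric_fps: "(1 - fps_const c * fps_X) * Abs_fps (\<lambda>j. c ^ j) = (1 :: complex fps)"
proof (rule fps_ext)
  fix n show "fps_nth ((1 - fps_const c * fps_X) * Abs_fps (\<lambda>j. c ^ j)) n = fps_nth 1 n"
    by (cases n) (simp_all add: left_diff_distrib mult.assoc)
qed

text \<open>The logarithmic derivative of \<open>(1 - c X) ^ m\<close> is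
  \<open>- m c / (1 - c X)\<close>, a geometric series; summed over \<open>Z\<close>, its
  coefficients are the power sums.\<close>

lemma fps_deriv_root_poly:
  assumes "finite Z"
  shows "fps_deriv (fps_of_poly (root_poly Z m c)) =
    - (fps_of_poly (root_poly Z m c) * Abs_fps (\<lambda>j. \<Sum>p\<in>Z. of_nat (m p) * c p ^ Suc j))"
  using assms
proof induction
  case empty
  then show ?case by (simp add: root_poly_def fps_eq_iff)
next
  case (insert p Z)
  let ?f = "fps_of_poly (root_poly Z m c)"
  let ?l = "1 - fps_const (c p) * fps_X :: complex fps"
  have l: "fps_of_poly [:1, - c p:] = ?l"
    by (simp add: fps_of_poly_pCons fps_eq_iff algebra_simps)
  have 1: "fps_of_poly (root_poly (insert p Z) m c) = ?l ^ m p * ?f"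
    using insert by (simp add: root_poly_def fps_of_poly_mult fps_of_poly_power l)
  have 2: "fps_deriv (?l ^ m p) = - (?l ^ m p * Abs_fps (\<lambda>j. of_nat (m p) * c p ^ Suc j))"
  proof (cases "m p")
    case 0 then show ?thesis by (simp add: fps_eq_iff)
  next
    case (Suc k)
    have "Abs_fps (\<lambda>j. of_nat (m p) * c p ^ Suc j) = fps_const (of_nat (m p) * c p) * Abs_fps (\<lambda>j. c p ^ j)"
      by (simp add: fps_eq_iff)
    then have "?l ^ m p * Abs_fps (\<lambda>j. of_nat (m p) * c p ^ Suc j) =
        ?l ^ k * fps_const (of_nat (m p) * c p) * (?l * Abs_fps (\<lambda>j. c p ^ j))"
      by (simp add: Suc mult_ac)
    also have "\<dots> = ?l ^ k * fps_const (of_nat (m p) * c p)"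
      unfolding geometric_fps by simp
    also have "\<dots> = - fps_deriv (?l ^ m p)"
    proof -
      have "fps_deriv ?l = - fps_const (c p)" by simp
      moreover have "fps_deriv (?l ^ Suc k) = fps_const (of_nat (Suc k)) * fps_deriv ?l * ?l ^ k"
        using fps_deriv_power[of ?l "Suc k"] by (simp add: mult_ac del: power_Suc fps_deriv_power)
      ultimately show ?thesis
        by (simp add: Suc mult_ac del: power_Suc fps_const_mult of_nat_Suc flip: fps_const_mult)
    qed
    finally show ?thesis by simp
  qed
  have 3: "Abs_fps (\<lambda>j. \<Sum>q\<in>insert p Z. of_nat (m q) * c q ^ Suc j) =
    Abs_fps (\<lambda>j. of_nat (m p) * c p ^ Suc j) + Abs_fps (\<lambda>j. \<Sum>q\<in>Z. of_nat (m q) * c q ^ Suc j)"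
    using insert by (simp add: fps_eq_iff)
  show ?case
    unfolding 1 3 fps_deriv_mult 2 insert.IH by (simp add: algebra_simps)
qed

text \<open>Newton's identities, obtained by comparing coefficients in
  \<open>fps_deriv_root_poly\<close> and solving for the next one.\<close>

lemma coeff_root_poly_Suc:
  assumes "finite Z"
  shows "coeff (root_poly Z m c) (Suc k) =
    - (\<Sum>j\<le>k. coeff (root_poly Z m c) j * (\<Sum>p\<in>Z. of_nat (m p) * c p ^ Suc (k - j))) / of_nat (Suc k)"
proof -
  have "of_nat (Suc k) * coeff (root_poly Z m c) (Suc k) = fps_nth (fps_deriv (fps_of_poly (root_poly Z m c))) k"
    by simp
  also have "\<dots> = - (\<Sum>j\<le>k. coeff (root_poly Z m c) j * (\<Sum>p\<in>Z. of_nat (m p) * c p ^ Suc (k - j)))"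
    unfolding fps_deriv_root_poly[OF assms] by (simp add: fps_mult_nth atMost_atLeast0)
  finally show ?thesis by (simp add: field_simps del: of_nat_Suc)
qed

lemma coeff_root_poly_0: "finite Z \<Longrightarrow> coeff (root_poly Z m c) 0 = 1"
  by (simp add: root_poly_def coeff_0_prod_list poly_prod poly_power flip: poly_0_coeff_0)

lemma degree_root_poly:
  assumes "finite Z"
  shows "degree (root_poly Z m c) = (\<Sum>p\<in>{p\<in>Z. c p \<noteq> 0}. m p)"
proof -
  have "degree (root_poly Z m c) = (\<Sum>p\<in>Z. degree ([:1, - c p:] ^ m p))"
    unfolding root_poly_def by (rule degree_prod_eq_sum_degree) auto
  also have "\<dots> = (\<Sum>p\<in>Z. if c p \<noteq> 0 then m p else 0)"
    by (rule sum.cong) (auto simp: degree_power_eq)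
  also have "\<dots> = (\<Sum>p\<in>{p\<in>Z. c p \<noteq> 0}. m p)"
    by (simp add: sum.inter_filter[OF assms])
  finally show ?thesis .
qed

text \<open>The degree of \<open>root_poly\<close> is the weighted number of nonzero values. A
  coefficient at or above this degree vanishes exactly when the count drops below \<open>k\<close>,
  so that a drop of the count becomes the vanishing of a function.\<close>

lemma coeff_root_poly_eq_0_iff:
  assumes "finite Z" "(\<Sum>p\<in>{p\<in>Z. c p \<noteq> 0}. m p) \<le> k"
  shows "coeff (root_poly Z m c) k = 0 \<longleftrightarrow> (\<Sum>p\<in>{p\<in>Z. c p \<noteq> 0}. m p) < k"
proof -
  have "root_poly Z m c \<noteq> 0" using assms by (simp add: root_poly_def)
  then show ?thesis
    using degree_root_poly[OF assms(1), of m c] assms(2) coeff_eq_0[of "root_poly Z m c" k]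
      leading_coeff_neq_0[of "root_poly Z m c"]
    by (cases "degree (root_poly Z m c) = k") auto
qed

lemma holomorphic_Cn_transform:
  assumes "holomorphic_Cn f U" "open U" "\<And>z. z \<in> U \<Longrightarrow> f z = g z"
  shows "holomorphic_Cn g U"
  using assms unfolding holomorphic_Cn_def
  by (metis (no_types, lifting) has_derivative_transform_within_open)

lemma holomorphic_Cn_local:
  assumes "\<And>z. z \<in> U \<Longrightarrow> \<exists>V. open V \<and> z \<in> V \<and> holomorphic_Cn f V"
  shows "holomorphic_Cn f U"
  using assms unfolding holomorphic_Cn_def by blast

text \<open>Individual roots need not depend holomorphically on \<open>z\<close>, but their power
  sums do, and Newton's identities carry this over to the coefficients.\<close>

lemma holomorphic_coeff_root_poly:
  assumes fin: "\<And>z. z \<in> U \<Longrightarrow> finite (Z z)"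
    and ps: "\<And>k. holomorphic_Cn (\<lambda>z. \<Sum>p\<in>Z z. of_nat (m z p) * c z p ^ Suc k) U"
    and "open U"
  shows "holomorphic_Cn (\<lambda>z. coeff (root_poly (Z z) (m z) (c z)) k) U"
proof (induction k rule: less_induct)
  case (less k)
  show ?case
  proof (cases k)
    case 0
    show ?thesis
      by (rule holomorphic_Cn_transform[OF holomorphic_Cn_const[of 1] \<open>open U\<close>])
        (simp add: 0 coeff_root_poly_0 fin)
  next
    case (Suc l)
    have "holomorphic_Cn (\<lambda>z. - (\<Sum>j\<le>l. coeff (root_poly (Z z) (m z) (c z)) j *
        (\<Sum>p\<in>Z z. of_nat (m z p) * c z p ^ Suc (l - j))) / of_nat (Suc l)) U"
      by (intro holomorphic_Cn_divide holomorphic_Cn_uminus holomorphic_Cn_sum holomorphic_Cn_mult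
          less ps holomorphic_Cn_const) (auto simp: Suc simp del: of_nat_Suc)
    then show ?thesis unfolding Suc
      by (rule holomorphic_Cn_transform[OF _ \<open>open U\<close>]) (simp add: coeff_root_poly_Suc[OF fin])
  qed
qed

subsection \<open>Roots in a disc\<close>

definition roots_in :: "(complex ^ 'n \<Rightarrow> complex) \<Rightarrow> 'n \<Rightarrow> complex \<Rightarrow> real \<Rightarrow> complex ^ 'n \<Rightarrow> complex set" where
  "roots_in f i c r z = {p \<in> ball c r. f (vupd z i p) = 0}"

definition root_mult :: "(complex ^ 'n \<Rightarrow> complex) \<Rightarrow> 'n \<Rightarrow> complex ^ 'n \<Rightarrow> complex \<Rightarrow> nat" where
  "root_mult f i z p = nat (zorder (\<lambda>t. f (vupd z i t)) p)"

text \<open>One disc that serves all base points of \<open>B\<close>: no zero crosses its boundary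
  circle, so over a connected \<open>B\<close> the number of zeros inside cannot change.\<close>

definition regular_disc ::
  "(complex ^ 'n \<Rightarrow> complex) \<Rightarrow> (complex ^ 'n) set \<Rightarrow> 'n \<Rightarrow> complex \<Rightarrow> real \<Rightarrow> (complex ^ 'n) set \<Rightarrow> bool" where
  "regular_disc f \<Omega> i c r B \<longleftrightarrow> open \<Omega> \<and> open B \<and> r > 0 \<and> holomorphic_Cn f \<Omega> \<and>
     (\<forall>z\<in>B. \<forall>t\<in>cball c r. vupd z i t \<in> \<Omega>) \<and> (\<forall>z\<in>B. \<forall>t\<in>sphere c r. f (vupd z i t) \<noteq> 0)"

lemma vupd_tube:
  fixes z0 :: "complex ^ 'n"
  assumes W: "open W" and K: "compact K" and "\<And>t. t \<in> K \<Longrightarrow> vupd z0 i t \<in> W"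
  obtains \<epsilon> where "\<epsilon> > 0" "\<And>z t. z \<in> ball z0 \<epsilon> \<Longrightarrow> t \<in> K \<Longrightarrow> vupd z i t \<in> W"
proof -
  have "continuous_on UNIV (\<lambda>p :: (complex ^ 'n) \<times> complex. vupd (fst p) i (snd p))"
    by (intro continuous_intros)
  then have op: "open {p. vupd (fst p) i (snd p) \<in> W}"
    using open_vimage[OF W] by (simp add: vimage_def)
  have "{z0} \<times> K \<subseteq> {p. vupd (fst p) i (snd p) \<in> W}" using assms by auto
  then obtain X0 where X0: "z0 \<in> X0" "open X0" "X0 \<times> K \<subseteq> {p. vupd (fst p) i (snd p) \<in> W}"
    using Elementary_Topology.tube_lemma[OF K op] by blast
  then obtain \<epsilon> where \<epsilon>: "\<epsilon> > 0" "ball z0 \<epsilon> \<subseteq> X0" using open_contains_ball by blast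
  show ?thesis
  proof (rule that[OF \<epsilon>(1)])
    fix z t assume "z \<in> ball z0 \<epsilon>" "t \<in> K"
    then have "(z, t) \<in> X0 \<times> K" using \<epsilon> by blast
    then show "vupd z i t \<in> W" using X0(3) by auto
  qed
qed

lemma regular_disc_exists:
  assumes "open \<Omega>" "holomorphic_Cn f \<Omega>" "r > 0"
    and "\<And>t. t \<in> cball c r \<Longrightarrow> vupd z0 i t \<in> \<Omega>" "\<And>t. t \<in> sphere c r \<Longrightarrow> f (vupd z0 i t) \<noteq> 0"
  obtains \<epsilon> where "\<epsilon> > 0" "\<And>\<delta>. \<delta> \<le> \<epsilon> \<Longrightarrow> regular_disc f \<Omega> i c r (ball z0 \<delta>)"
proof -
  obtain \<epsilon>1 where 1: "\<epsilon>1 > 0" "\<And>z t. z \<in> ball z0 \<epsilon>1 \<Longrightarrow> t \<in> cball c r \<Longrightarrow> vupd z i t \<in> \<Omega>"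
    using vupd_tube[OF assms(1) compact_cball assms(4)] by blast
  have "open (f -` (- {0}) \<inter> \<Omega>)"
    using continuous_on_open_vimage[OF assms(1), of f] holomorphic_Cn_continuous_on[OF assms(2)] by blast
  then obtain \<epsilon>2 where 2: "\<epsilon>2 > 0" "\<And>z t. z \<in> ball z0 \<epsilon>2 \<Longrightarrow> t \<in> sphere c r \<Longrightarrow> vupd z i t \<in> f -` (- {0}) \<inter> \<Omega>"
    using vupd_tube[of "f -` (- {0}) \<inter> \<Omega>" "sphere c r" z0 i] assms by auto
  show ?thesis
  proof (rule that[of "min \<epsilon>1 \<epsilon>2"])
    show "min \<epsilon>1 \<epsilon>2 > 0" using 1 2 by simp
    fix \<delta> assume "\<delta> \<le> min \<epsilon>1 \<epsilon>2"
    then have "ball z0 \<delta> \<subseteq> ball z0 \<epsilon>1" "ball z0 \<delta> \<subseteq> ball z0 \<epsilon>2" by auto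
    then have "vupd z i t \<in> \<Omega>" if "z \<in> ball z0 \<delta>" "t \<in> cball c r" for z t using 1 that by blast
    moreover have "f (vupd z i t) \<noteq> 0" if "z \<in> ball z0 \<delta>" "t \<in> sphere c r" for z t
      using 2(2)[of z t] that \<open>ball z0 \<delta> \<subseteq> ball z0 \<epsilon>2\<close> by blast
    ultimately show "regular_disc f \<Omega> i c r (ball z0 \<delta>)"
      using assms(1-3) unfolding regular_disc_def by blast
  qed
qed

text \<open>The argument principle with weight \<open>g\<close>. The circle winds once about the
  zeros inside and not about those outside, so the weighted sum over the roots becomes an integral
  over a fixed circle that depends on \<open>z\<close> through the integrand only.\<close>

lemma
  assumes rd: "regular_disc f \<Omega> i c r B" and z: "z \<in> B"
  shows finite_roots_in: "finite (roots_in f i c r z)"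
    and root_mult_pos: "p \<in> roots_in f i c r z \<Longrightarrow> root_mult f i z p > 0"
    and root_sum_integral: "holomorphic_Cn g \<Omega> \<Longrightarrow>
      (\<Sum>p\<in>roots_in f i c r z. of_nat (root_mult f i z p) * g (vupd z i p)) =
      1 / (2 * pi * \<i>) * contour_integral (circlepath c r)
        (\<lambda>t. pd i f (vupd z i t) * g (vupd z i t) / f (vupd z i t))"
proof -
  let ?F = "\<lambda>t. f (vupd z i t)"
  have r: "r > 0" and \<Omega>: "open \<Omega>" and holf: "holomorphic_Cn f \<Omega>"
    and in_\<Omega>: "\<And>t. t \<in> cball c r \<Longrightarrow> vupd z i t \<in> \<Omega>"
    and nz: "\<And>t. t \<in> sphere c r \<Longrightarrow> ?F t \<noteq> 0"
    using rd z unfolding regular_disc_def by auto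
  let ?T = "(\<lambda>t. vupd z i t) -` \<Omega>"
  have "open ?T"
    by (rule open_vimage[OF \<Omega>]) (intro continuous_intros)
  moreover have "cball c r \<subseteq> ?T" using in_\<Omega> by auto
  ultimately obtain e where e: "e > 0" "(\<Union>x\<in>cball c r. ball x e) \<subseteq> ?T"
    using compact_subset_open_imp_ball_epsilon_subset[OF compact_cball] by metis
  \<comment> \<open>The argument principle needs an open connected domain around the closed disc. A
    point \<open>w\<close> of the larger disc is compared with its contraction \<open>x\<close>
    towards \<open>c\<close> by the factor \<open>r / (r + e)\<close>, which lies within
    \<open>e\<close> of \<open>w\<close>.\<close>
  have S': "ball c (r + e) \<subseteq> ?T"
  proof
    fix w assume w: "w \<in> ball c (r + e)"
    define x where "x = c + (r / (r + e)) *\<^sub>R (w - c)"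
    have w': "norm (w - c) < r + e" using w by (simp add: dist_norm norm_minus_commute)
    have "dist c x = r / (r + e) * norm (w - c)" using r e by (simp add: x_def dist_norm)
    also have "\<dots> \<le> r / (r + e) * (r + e)" using w' r e by (intro mult_left_mono) auto
    also have "\<dots> = r" using r e by simp
    finally have 1: "x \<in> cball c r" by simp
    have "w - x = (e / (r + e)) *\<^sub>R (w - c)"
    proof -
      have "w - x = (1 - r / (r + e)) *\<^sub>R (w - c)" by (simp add: x_def algebra_simps)
      moreover have "1 - r / (r + e) = e / (r + e)" using r e by (simp add: field_simps)
      ultimately show ?thesis by simp
    qed
    then have "dist x w = e / (r + e) * norm (w - c)" using r e by (simp add: dist_norm norm_minus_commute[of x w])
    also have "\<dots> < e / (r + e) * (r + e)" using w' r e by (intro mult_strict_left_mono) auto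
    also have "\<dots> = e" using r e by simp
    finally have "w \<in> ball x e" by simp
    with 1 e show "w \<in> ?T" by blast
  qed
  \<comment> \<open>An intermediate radius: its closed disc is a compact part of the disc of radius
    \<open>r + e\<close>, so it contains finitely many zeros.\<close>
  define R where "R = r + e / 2"
  have R: "r < R" "R < r + e" using e by (auto simp: R_def)
  have SR: "ball c R \<subseteq> ?T" using S' R subset_ball[of R "r + e" c] by auto
  have holS': "?F holomorphic_on ball c (r + e)"
    by (rule holomorphic_on_vupd[OF holf]) (use S' in auto)
  have fin: "finite {w \<in> cball c R. ?F w = 0}"
  proof (cases "?F constant_on ball c (r + e)")
    case True
    then obtain k where k: "\<And>w. w \<in> ball c (r + e) \<Longrightarrow> ?F w = k" unfolding constant_on_def by blast
    have "c + of_real r \<in> sphere c r" using r by (simp add: dist_norm)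
    then have "k \<noteq> 0" using nz[of "c + of_real r"] k[of "c + of_real r"] e r by (simp add: dist_norm)
    then have "{w \<in> cball c R. ?F w = 0} = {}" using k R by auto
    then show ?thesis by (metis finite.emptyI)
  next
    case False
    then show ?thesis
      by (intro holomorphic_compact_finite_zeros[OF holS']) (use R in auto)
  qed
  define pz where "pz = {w \<in> ball c R. ?F w = 0}"
  have finpz: "finite pz" by (rule finite_subset[OF _ fin]) (auto simp: pz_def)
  have sub: "roots_in f i c r z \<subseteq> pz" using R by (auto simp: roots_in_def pz_def)
  show "finite (roots_in f i c r z)" using sub finpz finite_subset by blast
  have holR: "?F holomorphic_on ball c R" by (rule holomorphic_on_subset[OF holS']) (use R in auto)
  have zpos: "zorder ?F p > 0" if "p \<in> pz" for p
  proof -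
    have "open (ball c R - (pz - {p}))" using finpz by (intro open_Diff finite_imp_closed) auto
    moreover have "p \<in> ball c R - (pz - {p})" using that by (auto simp: pz_def)
    ultimately have "\<forall>\<^sub>F t in at p. t \<in> (ball c R - (pz - {p})) - {p}" by (rule eventually_at_in_open)
    then have "\<forall>\<^sub>F t in at p. ?F t \<noteq> 0" by eventually_elim (auto simp: pz_def)
    then have "\<exists>\<^sub>F t in at p. ?F t \<noteq> 0" by (rule eventually_frequently[rotated]) simp
    from zorder_pos_iff[OF holR _ _ this] that show ?thesis by (auto simp: pz_def)
  qed
  show "root_mult f i z p > 0" if "p \<in> roots_in f i c r z"
    using zpos sub that by (auto simp: root_mult_def)
  show "(\<Sum>p\<in>roots_in f i c r z. of_nat (root_mult f i z p) * g (vupd z i p)) =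
      1 / (2 * pi * \<i>) * contour_integral (circlepath c r)
        (\<lambda>t. pd i f (vupd z i t) * g (vupd z i t) / f (vupd z i t))" if g: "holomorphic_Cn g \<Omega>"
  proof -
    let ?h = "\<lambda>t. g (vupd z i t)"
    have pz': "{w \<in> ball c R. ?F w = 0 \<or> w \<in> {}} = pz" by (simp add: pz_def)
    have wn: "winding_number (circlepath c r) p = (if p \<in> ball c r then 1 else 0)" if "p \<in> pz" for p
    proof (cases "p \<in> ball c r")
      case True
      then show ?thesis using winding_number_circlepath[of p c r] by (simp add: dist_norm norm_minus_commute)
    next
      case False
      have "p \<notin> sphere c r" using nz that by (auto simp: pz_def)
      then have "p \<notin> cball c r" using False by auto
      then have "winding_number (circlepath c r) p = 0"
        using r by (intro winding_number_zero_outside[of _ "cball c r"]) auto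
      then show ?thesis using False by simp
    qed
    have "contour_integral (circlepath c r) (\<lambda>t. deriv ?F t * ?h t / ?F t) =
      2 * pi * \<i> * (\<Sum>p\<in>{w \<in> ball c R. ?F w = 0 \<or> w \<in> {}}. winding_number (circlepath c r) p * ?h p * zorder ?F p)"
    proof (rule argument_principle)
      show "?F holomorphic_on ball c R - {}" using holR by simp
      show "?h holomorphic_on ball c R"
        by (rule holomorphic_on_vupd[OF g]) (use SR in auto)
      show "path_image (circlepath c r) \<subseteq> ball c R - {w \<in> ball c R. ?F w = 0 \<or> w \<in> {}}"
        using r R nz by auto
      show "\<forall>w. w \<notin> ball c R \<longrightarrow> winding_number (circlepath c r) w = 0"
        using r R by (auto intro!: winding_number_zero_outside[of _ "cball c r"])
      show "finite {w \<in> ball c R. ?F w = 0 \<or> w \<in> {}}" using finpz pz' by simp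
    qed auto
    also have "(\<Sum>p\<in>{w \<in> ball c R. ?F w = 0 \<or> w \<in> {}}. winding_number (circlepath c r) p * ?h p * zorder ?F p)
      = (\<Sum>p\<in>pz. if p \<in> ball c r then ?h p * zorder ?F p else 0)"
      unfolding pz' by (rule sum.cong) (auto simp: wn)
    also have "\<dots> = (\<Sum>p\<in>{p\<in>pz. p \<in> ball c r}. ?h p * zorder ?F p)"
      by (rule sum.inter_filter[OF finpz, symmetric])
    also have "{p\<in>pz. p \<in> ball c r} = roots_in f i c r z"
      using R by (auto simp: pz_def roots_in_def)
    also have "(\<Sum>p\<in>roots_in f i c r z. ?h p * zorder ?F p) =
       (\<Sum>p\<in>roots_in f i c r z. of_nat (root_mult f i z p) * ?h p)"
    proof (rule sum.cong)
      fix p assume "p \<in> roots_in f i c r z"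
      then have "zorder ?F p > 0" using zpos sub by blast
      then show "?h p * zorder ?F p = of_nat (root_mult f i z p) * ?h p"
        by (simp add: root_mult_def)
    qed simp
    finally show ?thesis by (simp add: deriv_vupd)
  qed
qed

text \<open>The integral representation is holomorphic in \<open>z\<close> even where roots collide,
  since the integrand has no poles on the circle.\<close>

lemma holomorphic_root_sum:
  assumes rd: "regular_disc f \<Omega> i c r B" and g: "holomorphic_Cn g \<Omega>"
  shows "holomorphic_Cn (\<lambda>z. \<Sum>p\<in>roots_in f i c r z. of_nat (root_mult f i z p) * g (vupd z i p)) B"
proof -
  have r: "r > 0" and \<Omega>: "open \<Omega>" and B: "open B" and f: "holomorphic_Cn f \<Omega>"
    and in_\<Omega>: "\<And>z t. z \<in> B \<Longrightarrow> t \<in> sphere c r \<Longrightarrow> vupd z i t \<in> \<Omega>"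
    and nz: "\<And>z t. z \<in> B \<Longrightarrow> t \<in> sphere c r \<Longrightarrow> f (vupd z i t) \<noteq> 0"
    using rd unfolding regular_disc_def by auto
  have comp: "continuous_on (B \<times> sphere c r) (\<lambda>p. h (vupd (fst p) i (snd p)))" if "holomorphic_Cn h \<Omega>" for h
  proof (rule continuous_on_compose2[OF holomorphic_Cn_continuous_on[OF that]])
    show "continuous_on (B \<times> sphere c r) (\<lambda>p. vupd (fst p) i (snd p))" by (intro continuous_intros)
    show "(\<lambda>p. vupd (fst p) i (snd p)) ` (B \<times> sphere c r) \<subseteq> \<Omega>"
    proof
      fix w assume "w \<in> (\<lambda>p. vupd (fst p) i (snd p)) ` (B \<times> sphere c r)"
      then obtain z t where "z \<in> B" "t \<in> sphere c r" "w = vupd z i t" by auto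
      then show "w \<in> \<Omega>" using in_\<Omega> by simp
    qed
  qed
  have "holomorphic_Cn (\<lambda>z. 1 / (2 * pi * \<i>) * contour_integral (circlepath c r)
        (\<lambda>t. pd i f (vupd z i t) * g (vupd z i t) / f (vupd z i t))) B"
  proof (intro holomorphic_Cn_mult holomorphic_Cn_const holomorphic_Cn_contour_integral[OF B r])
    show "holomorphic_Cn (\<lambda>z. pd i f (vupd z i t) * g (vupd z i t) / f (vupd z i t)) B"
      if "t \<in> sphere c r" for t
    proof -
      have v: "holomorphic_Cn (\<lambda>z. h (vupd z i t)) B" if "holomorphic_Cn h \<Omega>" for h
        by (rule holomorphic_Cn_vupd[OF that]) (use in_\<Omega>[OF _ \<open>t \<in> sphere c r\<close>] in auto)
      show ?thesis
        by (intro holomorphic_Cn_divide holomorphic_Cn_mult v f g holomorphic_Cn_pd \<Omega>) (rule nz[OF _ that])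
    qed
    show "continuous_on (B \<times> sphere c r) (\<lambda>(z, t). pd i f (vupd z i t) * g (vupd z i t) / f (vupd z i t))"
      unfolding split_beta
      by (intro continuous_on_divide continuous_on_mult comp f g holomorphic_Cn_pd \<Omega>) (simp add: nz mem_Times_iff)
  qed
  then show ?thesis
    by (rule holomorphic_Cn_transform[OF _ B]) (simp add: root_sum_integral[OF rd _ g])
qed

text \<open>The case \<open>g = 1\<close> of the root sum: a continuous function with integer values
  on a connected set.\<close>

lemma root_count_constant:
  assumes rd: "regular_disc f \<Omega> i c r B" and "connected B"
  obtains N where "\<And>z. z \<in> B \<Longrightarrow> (\<Sum>p\<in>roots_in f i c r z. root_mult f i z p) = N"
proof -
  let ?n = "\<lambda>z. (\<Sum>p\<in>roots_in f i c r z. root_mult f i z p)"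
  have "holomorphic_Cn (\<lambda>z. of_nat (?n z)) B"
    using holomorphic_root_sum[OF rd holomorphic_Cn_const[of 1]] by simp
  then have "continuous_on B (\<lambda>z. of_nat (?n z) :: complex)" by (rule holomorphic_Cn_continuous_on)
  then have "(\<lambda>z. of_nat (?n z) :: complex) constant_on B"
  proof (rule continuous_discrete_range_constant[OF \<open>connected B\<close>])
    fix x
    show "\<exists>e>0. \<forall>y. y \<in> B \<and> of_nat (?n y) \<noteq> (of_nat (?n x) :: complex) \<longrightarrow> e \<le> norm (of_nat (?n y) - (of_nat (?n x) :: complex))"
    proof (intro exI[of _ 1] conjI allI impI)
      fix y assume "y \<in> B \<and> of_nat (?n y) \<noteq> (of_nat (?n x) :: complex)"
      then have "1 \<le> \<bar>int (?n y) - int (?n x)\<bar>" by (simp only: of_nat_eq_iff) linarith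
      then have "1 \<le> real_of_int \<bar>int (?n y) - int (?n x)\<bar>" by linarith
      also have "\<dots> = norm (of_int (int (?n y) - int (?n x)) :: complex)"
        by (simp only: norm_of_int of_int_abs)
      finally show "1 \<le> norm (of_nat (?n y) - (of_nat (?n x) :: complex))" by simp
    qed simp
  qed
  then obtain k where "\<And>z. z \<in> B \<Longrightarrow> of_nat (?n z) = (k :: complex)" unfolding constant_on_def by blast
  then have "?n z = ?n z'" if "z \<in> B" "z' \<in> B" for z z' using that by (metis of_nat_eq_iff)
  then show ?thesis using that by metis
qed

text \<open>The coefficient at the constant number \<open>N\<close> of roots is, up to sign, the
  product of the values of \<open>G\<close> over the roots with multiplicity, that is, the norm of
  \<open>G\<close>.\<close>

lemma holomorphic_norm:
  assumes rd: "regular_disc f \<Omega> i c r B" and "connected B" and G: "holomorphic_Cn G \<Omega>"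
  obtains h where "holomorphic_Cn h B" "\<And>z. z \<in> B \<Longrightarrow> h z = 0 \<longleftrightarrow> (\<exists>p\<in>roots_in f i c r z. G (vupd z i p) = 0)"
proof -
  obtain N where N: "\<And>z. z \<in> B \<Longrightarrow> (\<Sum>p\<in>roots_in f i c r z. root_mult f i z p) = N"
    using root_count_constant[OF assms(1,2)] by blast
  define h where "h z = coeff (root_poly (roots_in f i c r z) (root_mult f i z) (\<lambda>p. G (vupd z i p))) N" for z
  have "holomorphic_Cn h B"
    unfolding h_def
  proof (rule holomorphic_coeff_root_poly)
    show "open B" using rd by (simp add: regular_disc_def)
    show "holomorphic_Cn (\<lambda>z. \<Sum>p\<in>roots_in f i c r z. of_nat (root_mult f i z p) * G (vupd z i p) ^ Suc k) B" for k
      by (rule holomorphic_root_sum[OF rd holomorphic_Cn_power[OF G]])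
  qed (rule finite_roots_in[OF rd])
  moreover have "h z = 0 \<longleftrightarrow> (\<exists>p\<in>roots_in f i c r z. G (vupd z i p) = 0)" if z: "z \<in> B" for z
  proof -
    let ?Z = "roots_in f i c r z" and ?m = "root_mult f i z"
    let ?Z' = "{p \<in> ?Z. G (vupd z i p) \<noteq> 0}"
    note fin = finite_roots_in[OF rd z]
    have le: "sum ?m ?Z' \<le> N"
      unfolding N[OF z, symmetric] by (rule sum_mono2[OF fin]) auto
    have "sum ?m ?Z' < N \<longleftrightarrow> ?Z' \<noteq> ?Z"
    proof
      assume "sum ?m ?Z' < N" then show "?Z' \<noteq> ?Z" using N[OF z] by auto
    next
      assume "?Z' \<noteq> ?Z"
      then obtain p where "p \<in> ?Z - ?Z'" by blast
      then show "sum ?m ?Z' < N"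
        unfolding N[OF z, symmetric] using root_mult_pos[OF rd z]
        by (intro sum_strict_mono2[OF fin]) auto
    qed
    then show ?thesis
      using coeff_root_poly_eq_0_iff[OF fin le] unfolding h_def by auto
  qed
  ultimately show ?thesis using that by blast
qed

section \<open>Finite projections of analytic sets\<close>

definition analytic_in :: "(complex ^ 'n) set \<Rightarrow> (complex ^ 'n) set \<Rightarrow> bool" where
  "analytic_in S B \<longleftrightarrow> (\<exists>F. finite F \<and> (\<forall>f\<in>F. holomorphic_Cn f B) \<and> S \<inter> B = {z \<in> B. \<forall>f\<in>F. f z = 0})"

lemma analytic_in_empty: "analytic_in {} B"
  unfolding analytic_in_def by (rule exI[of _ "{\<lambda>_. 1}"]) auto

lemma analytic_in_Un:
  assumes "analytic_in S B" "analytic_in T B"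
  shows "analytic_in (S \<union> T) B"
proof -
  obtain F where F: "finite F" "\<forall>f\<in>F. holomorphic_Cn f B" "S \<inter> B = {z \<in> B. \<forall>f\<in>F. f z = 0}"
    using assms(1) unfolding analytic_in_def by blast
  obtain G where G: "finite G" "\<forall>f\<in>G. holomorphic_Cn f B" "T \<inter> B = {z \<in> B. \<forall>f\<in>G. f z = 0}"
    using assms(2) unfolding analytic_in_def by blast
  let ?H = "(\<lambda>(f,g). (\<lambda>z. f z * g z)) ` (F \<times> G)"
  have "(S \<union> T) \<inter> B = {z \<in> B. (\<forall>f\<in>F. f z = 0) \<or> (\<forall>g\<in>G. g z = 0)}" using F(3) G(3) by blast
  also have "\<dots> = {z \<in> B. \<forall>h\<in>?H. h z = 0}" by auto
  finally have "(S \<union> T) \<inter> B = {z \<in> B. \<forall>h\<in>?H. h z = 0}" .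
  moreover have "\<forall>h\<in>?H. holomorphic_Cn h B" using F G by (auto intro!: holomorphic_Cn_mult)
  moreover have "finite ?H" using F(1) G(1) by simp
  ultimately show ?thesis unfolding analytic_in_def by (intro exI[of _ ?H] conjI)
qed

lemma analytic_in_UN:
  assumes "finite A" "\<And>a. a \<in> A \<Longrightarrow> analytic_in (S a) B"
  shows "analytic_in (\<Union>a\<in>A. S a) B"
  using assms by (induction A) (auto intro: analytic_in_Un analytic_in_empty)

text \<open>Elimination. Norms of the single functions in \<open>F\<close> do not detect a common
  zero, since different functions may vanish at different roots. The norms of sufficiently many
  combinations \<open>G s\<close>, with coefficients \<open>s ^ l\<close>, force one root to serve
  all of them.\<close>

lemma analytic_projection_disc:
  fixes F :: "(complex ^ 'n \<Rightarrow> complex) set"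
  assumes rd: "regular_disc f \<Omega> i c r B" and "connected B"
    and F: "finite F" "\<And>g. g \<in> F \<Longrightarrow> holomorphic_Cn g \<Omega>" "f \<in> F"
  shows "analytic_in {z. \<exists>t\<in>ball c r. \<forall>g\<in>F. g (vupd z i t) = 0} B"
proof -
  obtain N where N: "\<And>z. z \<in> B \<Longrightarrow> (\<Sum>p\<in>roots_in f i c r z. root_mult f i z p) = N"
    using root_count_constant[OF assms(1,2)] by blast
  obtain gs where gs: "set gs = F" using F(1) finite_list by blast
  define k where "k = length gs"
  define G where "G s z = (\<Sum>l<k. of_nat s ^ l * (gs ! l) z)" for s :: nat and z
  have G: "holomorphic_Cn (G s) \<Omega>" for s
    unfolding G_def by (intro holomorphic_Cn_sum holomorphic_Cn_mult holomorphic_Cn_const F(2))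
      (auto simp: gs[symmetric] k_def)
  have "\<exists>h. holomorphic_Cn h B \<and> (\<forall>z\<in>B. h z = 0 \<longleftrightarrow> (\<exists>p\<in>roots_in f i c r z. G s (vupd z i p) = 0))" for s
    using holomorphic_norm[OF assms(1,2) G] by metis
  then obtain h where h: "\<And>s. holomorphic_Cn (h s) B"
    "\<And>s z. z \<in> B \<Longrightarrow> h s z = 0 \<longleftrightarrow> (\<exists>p\<in>roots_in f i c r z. G s (vupd z i p) = 0)" by metis
  \<comment> \<open>At most \<open>N\<close> roots share \<open>N * k + 1\<close> values of
    \<open>s\<close>, so some root receives more than \<open>k\<close> of them; a polynomial in
    \<open>s\<close> of degree at most \<open>k\<close> with that many zeros is zero.\<close>
  define M where "M = Suc (N * k)"
  have "{z. \<exists>t\<in>ball c r. \<forall>g\<in>F. g (vupd z i t) = 0} \<inter> B = {z \<in> B. \<forall>h\<in>h ` {..<M}. h z = 0}"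
  proof (intro equalityI subsetI)
    fix z assume "z \<in> {z. \<exists>t\<in>ball c r. \<forall>g\<in>F. g (vupd z i t) = 0} \<inter> B"
    then obtain t where t: "z \<in> B" "t \<in> ball c r" "\<forall>g\<in>F. g (vupd z i t) = 0" by blast
    then have "t \<in> roots_in f i c r z" using F(3) by (simp add: roots_in_def)
    moreover have "G s (vupd z i t) = 0" for s
      unfolding G_def using t(3) gs by (intro sum.neutral) (auto simp: k_def)
    ultimately show "z \<in> {z \<in> B. \<forall>h\<in>h ` {..<M}. h z = 0}" using t(1) h(2) by blast
  next
    fix z assume "z \<in> {z \<in> B. \<forall>h\<in>h ` {..<M}. h z = 0}"
    then have z: "z \<in> B" and *: "\<And>s. s < M \<Longrightarrow> h s z = 0" by auto
    let ?Z = "roots_in f i c r z"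
    have fin: "finite ?Z" by (rule finite_roots_in[OF rd z])
    have "card ?Z \<le> N"
    proof -
      have "card ?Z = (\<Sum>p\<in>?Z. 1)" by simp
      also have "\<dots> \<le> (\<Sum>p\<in>?Z. root_mult f i z p)"
        using root_mult_pos[OF rd z] by (intro sum_mono) (auto simp: Suc_le_eq)
      finally show ?thesis using N[OF z] by simp
    qed
    have cover: "{..<M} = (\<Union>p\<in>?Z. {s \<in> {..<M}. G s (vupd z i p) = 0})"
      using * h(2)[OF z] by blast
    have "\<exists>p\<in>?Z. card {s \<in> {..<M}. G s (vupd z i p) = 0} > k"
    proof (rule ccontr)
      assume "\<not> ?thesis"
      then have "(\<Sum>p\<in>?Z. card {s \<in> {..<M}. G s (vupd z i p) = 0}) \<le> (\<Sum>p\<in>?Z. k)"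
        by (intro sum_mono) (auto simp: not_less)
      moreover have "card {..<M} \<le> (\<Sum>p\<in>?Z. card {s \<in> {..<M}. G s (vupd z i p) = 0})"
        by (subst cover, rule card_UN_le[OF fin])
      ultimately have "M \<le> card ?Z * k" by simp
      also have "\<dots> \<le> N * k" using \<open>card ?Z \<le> N\<close> by simp
      finally show False by (simp add: M_def)
    qed
    then obtain p where p: "p \<in> ?Z" "card {s \<in> {..<M}. G s (vupd z i p) = 0} > k" by blast
    define P where "P = (\<Sum>l<k. monom ((gs ! l) (vupd z i p)) l)"
    have P: "poly P (of_nat s) = G s (vupd z i p)" for s
      by (simp add: P_def G_def poly_sum poly_monom mult.commute)
    have "P = 0"
    proof (rule ccontr)
      assume "P \<noteq> 0"
      have "of_nat ` {s \<in> {..<M}. G s (vupd z i p) = 0} \<subseteq> {x. poly P x = 0}" using P by auto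
      then have "card ((of_nat :: nat \<Rightarrow> complex) ` {s \<in> {..<M}. G s (vupd z i p) = 0}) \<le> card {x. poly P x = 0}"
        by (rule card_mono[OF poly_roots_finite[OF \<open>P \<noteq> 0\<close>]])
      also have "\<dots> \<le> degree P" by (rule card_poly_roots_bound[OF \<open>P \<noteq> 0\<close>])
      also have "degree P \<le> k"
        unfolding P_def by (intro degree_sum_le) (auto intro: order_trans[OF degree_monom_le])
      finally have "card {s \<in> {..<M}. G s (vupd z i p) = 0} \<le> k"
        by (subst (asm) card_image) (auto simp: inj_on_def)
      with p show False by simp
    qed
    have "(gs ! l) (vupd z i p) = 0" if "l < k" for l
    proof -
      have "coeff P l = (gs ! l) (vupd z i p)"
        using that by (simp add: P_def coeff_sum)
      with \<open>P = 0\<close> show ?thesis by simp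
    qed
    then have "\<forall>g\<in>F. g (vupd z i p) = 0" by (auto simp: gs[symmetric] in_set_conv_nth k_def)
    then show "z \<in> {z. \<exists>t\<in>ball c r. \<forall>g\<in>F. g (vupd z i t) = 0} \<inter> B"
      using z p(1) by (auto simp: roots_in_def)
  qed
  then show ?thesis unfolding analytic_in_def using h(1)
    by (intro exI[of _ "h ` {..<M}"]) auto
qed

section \<open>Fibres along one coordinate axis\<close>

lemma closed_fibre: "closed X \<Longrightarrow> closed {t. vupd z i t \<in> X}"
  using closed_vimage[of X "\<lambda>t. vupd z i t"] by (simp add: vimage_def continuous_intros)

text \<open>By the identity theorem a limit point of the interior again lies in the interior. The
  interior is therefore open and closed in the plane, and boundedness leaves only the empty
  set.\<close>

lemma interior_fibre:
  assumes X: "closed_analytic_set X" and bnd: "bounded {t. vupd z i t \<in> X}"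
  shows "interior {t. vupd z i t \<in> X} = {}"
proof (rule ccontr)
  let ?T = "{t. vupd z i t \<in> X}"
  assume ne: "interior ?T \<noteq> {}"
  have clT: "closed ?T" using X by (simp add: closed_analytic_set_def closed_fibre)
  have "t \<in> interior ?T" if t: "t \<in> closure (interior ?T)" for t
  proof -
    have "t \<in> ?T" using t clT closure_mono[OF interior_subset, of ?T] by (metis closure_closed subsetD)
    then obtain U F where UF: "open U" "vupd z i t \<in> U" "\<forall>f\<in>F. holomorphic_Cn f U"
      "X \<inter> U = {z \<in> U. \<forall>f\<in>F. f z = 0}"
      using X unfolding closed_analytic_set_def by blast
    have "open ((\<lambda>t. vupd z i t) -` U)" by (rule open_vimage[OF UF(1)]) (intro continuous_intros)
    then obtain \<rho> where \<rho>: "\<rho> > 0" "ball t \<rho> \<subseteq> (\<lambda>t. vupd z i t) -` U"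
      using UF(2) open_contains_ball by (metis vimageI2)
    have "s \<in> ?T" if s: "s \<in> ball t \<rho>" for s
    proof -
      have "f (vupd z i s) = 0" if f: "f \<in> F" for f
      proof -
        have hol: "(\<lambda>s. f (vupd z i s)) holomorphic_on ball t \<rho>"
          by (rule holomorphic_on_vupd[of f U]) (use UF(3) f \<rho> in auto)
        have "interior ?T \<inter> ball t \<rho> \<noteq> {}"
        proof -
          obtain y where "y \<in> interior ?T" "dist y t < \<rho>" using t \<rho>(1) closure_approachable by blast
          then have "y \<in> interior ?T \<inter> ball t \<rho>" by (simp add: dist_commute)
          then show ?thesis by blast
        qed
        moreover have "f (vupd z i s) = 0" if "s \<in> interior ?T \<inter> ball t \<rho>" for s
        proof -
          have "vupd z i s \<in> X \<inter> U" using that \<rho>(2) interior_subset by blast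
          then show ?thesis using UF(4) f by blast
        qed
        ultimately show ?thesis
          using analytic_continuation_open[where s="interior ?T \<inter> ball t \<rho>" and s'="ball t \<rho>"
              and f="\<lambda>s. f (vupd z i s)" and g="\<lambda>_. 0"] hol s by auto
      qed
      then have "vupd z i s \<in> X \<inter> U" using UF(4) \<rho>(2) s by blast
      then show ?thesis by blast
    qed
    then show ?thesis using \<rho>(1) mem_interior by (metis subsetI)
  qed
  then have "closed (interior ?T)" by (metis closure_subset_eq subsetI)
  then have "interior ?T = UNIV" using ne clopen[of "interior ?T"] by simp
  then have "?T = UNIV" using interior_subset by blast
  then show False using bnd not_bounded_UNIV[where 'a = complex] by simp
qed

text \<open>As the fibre has empty interior, some local equation \<open>f\<close> is not identically
  zero on the line near \<open>t\<close>; its zeros are isolated, which provides a circle free of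
  zeros.\<close>

lemma fibre_isolated:
  assumes X: "closed_analytic_set X" and bnd: "bounded {t. vupd z i t \<in> X}"
    and t: "vupd z i t \<in> X" and "e > 0"
  obtains \<Omega> F f r where "open \<Omega>" "finite F" "\<And>g. g \<in> F \<Longrightarrow> holomorphic_Cn g \<Omega>"
    "X \<inter> \<Omega> = {z \<in> \<Omega>. \<forall>g\<in>F. g z = 0}" "f \<in> F" "0 < r" "r < e"
    "\<And>s. s \<in> cball t r \<Longrightarrow> vupd z i s \<in> \<Omega>" "\<And>s. s \<in> cball t r - {t} \<Longrightarrow> f (vupd z i s) \<noteq> 0"
proof -
  obtain U F where UF: "open U" "vupd z i t \<in> U" "finite F" "\<forall>f\<in>F. holomorphic_Cn f U"
    "X \<inter> U = {z \<in> U. \<forall>f\<in>F. f z = 0}"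
    using X t unfolding closed_analytic_set_def by blast
  have "open ((\<lambda>t. vupd z i t) -` U)" by (rule open_vimage[OF UF(1)]) (intro continuous_intros)
  then obtain \<rho> where \<rho>: "\<rho> > 0" "ball t \<rho> \<subseteq> (\<lambda>t. vupd z i t) -` U"
    using UF(2) open_contains_ball by (metis vimageI2)
  have "\<exists>f\<in>F. \<exists>s\<in>ball t \<rho>. f (vupd z i s) \<noteq> 0"
  proof (rule ccontr)
    assume "\<not> ?thesis"
    then have "vupd z i s \<in> X" if "s \<in> ball t \<rho>" for s using UF(5) \<rho>(2) that by blast
    then have "t \<in> interior {t. vupd z i t \<in> X}" using \<rho>(1) mem_interior by blast
    then show False using interior_fibre[OF X bnd] by blast
  qed
  then obtain f s where f: "f \<in> F" "s \<in> ball t \<rho>" "f (vupd z i s) \<noteq> 0" by blast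
  have "f (vupd z i t) = 0" using UF(2,5) t f by blast
  have hol: "(\<lambda>s. f (vupd z i s)) holomorphic_on ball t \<rho>"
    by (rule holomorphic_on_vupd[of f U]) (use UF(4) f \<rho> in auto)
  obtain r0 where r0: "0 < r0" "ball t r0 \<subseteq> ball t \<rho>" "\<And>s. s \<in> ball t r0 - {t} \<Longrightarrow> f (vupd z i s) \<noteq> 0"
    using isolated_zeros[OF hol open_ball connected_ball _ \<open>f (vupd z i t) = 0\<close> f(2,3)] \<rho>(1) by auto
  define r where "r = min r0 e / 2"
  have r: "0 < r" "r < r0" "r < e" using r0(1) \<open>e > 0\<close> by (auto simp: r_def)
  have sub: "cball t r \<subseteq> ball t r0" using r by auto
  show ?thesis
  proof (rule that[OF UF(1,3) _ UF(5) f(1) r(1,3)])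
    show "holomorphic_Cn g U" if "g \<in> F" for g using UF(4) that by blast
    show "vupd z i s \<in> U" if "s \<in> cball t r" for s using that sub r0(2) \<rho>(2) by blast
    show "f (vupd z i s) \<noteq> 0" if "s \<in> cball t r - {t}" for s using that sub r0(3) by blast
  qed
qed

text \<open>An infinite compact fibre would have an accumulation point, contrary to
  \<open>fibre_isolated\<close>.\<close>

lemma finite_fibre:
  assumes X: "closed_analytic_set X" and bnd: "bounded {t. vupd z i t \<in> X}"
  shows "finite {t. vupd z i t \<in> X}"
proof (rule ccontr)
  let ?T = "{t. vupd z i t \<in> X}"
  assume inf: "infinite ?T"
  have clT: "closed ?T" using X by (simp add: closed_analytic_set_def closed_fibre)
  then have "compact ?T" using bnd compact_eq_bounded_closed by blast
  then obtain t where t: "t \<in> ?T" "t islimpt ?T"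
    using inf compact_eq_Bolzano_Weierstrass by blast
  have tX: "vupd z i t \<in> X" using t(1) by simp
  obtain \<Omega> F f r where "open \<Omega>" "finite F" "\<And>g. g \<in> F \<Longrightarrow> holomorphic_Cn g \<Omega>"
    and *: "X \<inter> \<Omega> = {z \<in> \<Omega>. \<forall>g\<in>F. g z = 0}" "f \<in> F" "0 < r" and "r < 1"
    and **: "\<And>s. s \<in> cball t r \<Longrightarrow> vupd z i s \<in> \<Omega>" "\<And>s. s \<in> cball t r - {t} \<Longrightarrow> f (vupd z i s) \<noteq> 0"
    by (rule fibre_isolated[OF X bnd tX zero_less_one]) (rule that)
  obtain s where s: "s \<in> ?T" "s \<noteq> t" "dist s t < r"
    using t(2) *(3) islimpt_approachable by blast
  then have "s \<in> cball t r - {t}" by (simp add: dist_commute)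
  then have "f (vupd z i s) \<noteq> 0" "vupd z i s \<in> \<Omega>" using ** by auto
  with *(1,2) s(1) show False by blast
qed

text \<open>For closed \<open>X\<close> this is properness of the projection of \<open>X\<close>
  along axis \<open>i\<close>.\<close>

definition fibres_locally_bounded :: "'n \<Rightarrow> (complex ^ 'n) set \<Rightarrow> bool" where
  "fibres_locally_bounded i X \<longleftrightarrow> (\<forall>z0. \<exists>\<epsilon>>0. \<exists>R. \<forall>z\<in>ball z0 \<epsilon>. \<forall>t. vupd z i t \<in> X \<longrightarrow> norm t \<le> R)"

lemma fibres_locally_bounded_imp_bounded:
  assumes "fibres_locally_bounded i X" shows "bounded {t. vupd z i t \<in> X}"
  using assms unfolding fibres_locally_bounded_def bounded_iff
  by (metis centre_in_ball mem_Collect_eq)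

text \<open>Over a small ball all of \<open>X\<close> is caught by disjoint discs around the points
  of the central fibre, and inside each disc the roots of a single equation \<open>f t\<close>
  contain the fibre.\<close>

lemma fibre_cover:
  fixes X :: "(complex ^ 'n) set"
  assumes X: "closed_analytic_set X" and lb: "fibres_locally_bounded i X"
  defines "T z0 \<equiv> {t. vupd z0 i t \<in> X}"
  obtains \<Omega> F f r \<epsilon> where "finite (T z0)" "\<epsilon> > 0"
    "\<And>t. t \<in> T z0 \<Longrightarrow> regular_disc (f t) (\<Omega> t) i t (r t) (ball z0 \<epsilon>)"
    "\<And>t. t \<in> T z0 \<Longrightarrow> finite (F t)" "\<And>t g. t \<in> T z0 \<Longrightarrow> g \<in> F t \<Longrightarrow> holomorphic_Cn g (\<Omega> t)"
    "\<And>t. t \<in> T z0 \<Longrightarrow> f t \<in> F t" "\<And>t. t \<in> T z0 \<Longrightarrow> X \<inter> \<Omega> t = {z \<in> \<Omega> t. \<forall>g\<in>F t. g z = 0}"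
    "\<And>t t'. t \<in> T z0 \<Longrightarrow> t' \<in> T z0 \<Longrightarrow> t \<noteq> t' \<Longrightarrow> ball t (r t) \<inter> ball t' (r t') = {}"
    "\<And>z s. z \<in> ball z0 \<epsilon> \<Longrightarrow> vupd z i s \<in> X \<Longrightarrow> \<exists>t\<in>T z0. s \<in> ball t (r t)"
proof -
  have bnd: "bounded (T z0)" unfolding T_def by (rule fibres_locally_bounded_imp_bounded[OF lb])
  have fin: "finite (T z0)" using finite_fibre[OF X] bnd unfolding T_def by blast
  define P where "P t \<Omega> F f r \<epsilon> \<longleftrightarrow> \<epsilon> > 0 \<and> (\<forall>\<delta>\<le>\<epsilon>. regular_disc f \<Omega> i t r (ball z0 \<delta>)) \<and>
      finite F \<and> (\<forall>g\<in>F. holomorphic_Cn g \<Omega>) \<and> f \<in> F \<and> X \<inter> \<Omega> = {z \<in> \<Omega>. \<forall>g\<in>F. g z = 0} \<and>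
      (\<forall>t'\<in>T z0. t' \<noteq> t \<longrightarrow> 2 * r < dist t t')" for t \<Omega> F f r \<epsilon>
  have "\<exists>\<Omega> F f r \<epsilon>. P t \<Omega> F f r \<epsilon>" if t: "t \<in> T z0" for t
  proof -
    obtain d where d: "d > 0" "\<forall>x\<in>T z0. x \<noteq> t \<longrightarrow> d \<le> dist t x" using finite_set_avoid[OF fin] by blast
    obtain \<Omega> F f r where *: "open \<Omega>" "finite F" "\<And>g. g \<in> F \<Longrightarrow> holomorphic_Cn g \<Omega>"
      "X \<inter> \<Omega> = {z \<in> \<Omega>. \<forall>g\<in>F. g z = 0}" "f \<in> F" "0 < r" "r < d / 2"
      "\<And>s. s \<in> cball t r \<Longrightarrow> vupd z0 i s \<in> \<Omega>" "\<And>s. s \<in> cball t r - {t} \<Longrightarrow> f (vupd z0 i s) \<noteq> 0"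
      by (rule fibre_isolated[OF X bnd[unfolded T_def] t[unfolded T_def mem_Collect_eq] half_gt_zero[OF d(1)]])
        (rule that)
    have nz: "f (vupd z0 i s) \<noteq> 0" if "s \<in> sphere t r" for s
      using *(9)[of s] that *(6) by auto
    obtain \<epsilon> where "\<epsilon> > 0" "\<And>\<delta>. \<delta> \<le> \<epsilon> \<Longrightarrow> regular_disc f \<Omega> i t r (ball z0 \<delta>)"
      using regular_disc_exists[OF *(1) *(3)[OF *(5)] *(6) *(8) nz] by blast
    moreover have "\<forall>t'\<in>T z0. t' \<noteq> t \<longrightarrow> 2 * r < dist t t'" using d *(7) by force
    ultimately have "P t \<Omega> F f r \<epsilon>"
      unfolding P_def using *(2-5) by (intro conjI) blast+
    then show ?thesis by blast
  qed
  then obtain \<Omega> F f r e where P: "\<And>t. t \<in> T z0 \<Longrightarrow> P t (\<Omega> t) (F t) (f t) (r t) (e t)"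
    by metis
  have Q: "e t > 0" "\<And>\<delta>. \<delta> \<le> e t \<Longrightarrow> regular_disc (f t) (\<Omega> t) i t (r t) (ball z0 \<delta>)"
    "finite (F t)" "\<And>g. g \<in> F t \<Longrightarrow> holomorphic_Cn g (\<Omega> t)" "f t \<in> F t" "X \<inter> \<Omega> t = {z \<in> \<Omega> t. \<forall>g\<in>F t. g z = 0}"
    "\<And>t'. t' \<in> T z0 \<Longrightarrow> t' \<noteq> t \<Longrightarrow> 2 * r t < dist t t'" if "t \<in> T z0" for t
    using P[OF that] unfolding P_def by blast+
  obtain \<epsilon>0 R where \<epsilon>0: "\<epsilon>0 > 0" "\<And>z t. z \<in> ball z0 \<epsilon>0 \<Longrightarrow> vupd z i t \<in> X \<Longrightarrow> norm t \<le> R"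
    using lb unfolding fibres_locally_bounded_def by metis
  \<comment> \<open>The bounded part of the line outside the discs is compact and misses
    \<open>X\<close> over \<open>z0\<close>; by the tube argument it still misses \<open>X\<close>
    over nearby points.\<close>
  define K where "K = cball 0 R - (\<Union>t\<in>T z0. ball t (r t))"
  have "compact K" unfolding K_def by (intro compact_diff compact_cball open_UN) auto
  moreover have "vupd z0 i t \<in> - X" if "t \<in> K" for t
  proof
    assume "vupd z0 i t \<in> X"
    then have t: "t \<in> T z0" by (simp add: T_def)
    then have "r t > 0" using Q(2)[OF t order_refl] by (simp add: regular_disc_def)
    then have "t \<in> ball t (r t)" by simp
    with t that show False unfolding K_def by blast
  qed
  moreover have "open (- X)" using X by (simp add: closed_analytic_set_def open_Compl)
  ultimately obtain \<epsilon>1 where \<epsilon>1: "\<epsilon>1 > 0" "\<And>z t. z \<in> ball z0 \<epsilon>1 \<Longrightarrow> t \<in> K \<Longrightarrow> vupd z i t \<in> - X"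
    using vupd_tube by metis
  define \<epsilon> where "\<epsilon> = Min ({\<epsilon>0, \<epsilon>1} \<union> e ` T z0)"
  have \<epsilon>: "\<epsilon> \<le> \<epsilon>0" "\<epsilon> \<le> \<epsilon>1" "\<And>t. t \<in> T z0 \<Longrightarrow> \<epsilon> \<le> e t" unfolding \<epsilon>_def by (rule Min_le; simp add: fin)+
  have "\<epsilon> > 0" unfolding \<epsilon>_def using fin \<epsilon>0(1) \<epsilon>1(1) Q(1) by (subst Min_gr_iff) auto
  show ?thesis
  proof (rule that[OF fin \<open>\<epsilon> > 0\<close>])
    show "ball t (r t) \<inter> ball t' (r t') = {}" if "t \<in> T z0" "t' \<in> T z0" "t \<noteq> t'" for t t'
    proof -
      have "2 * r t < dist t t'" "2 * r t' < dist t t'"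
        using Q(7)[of t t'] Q(7)[of t' t] that by (auto simp: dist_commute)
      then show ?thesis by (intro disjoint_ballI) linarith
    qed
    show "\<exists>t\<in>T z0. s \<in> ball t (r t)" if zs: "z \<in> ball z0 \<epsilon>" "vupd z i s \<in> X" for z s
    proof -
      have "z \<in> ball z0 \<epsilon>0" "z \<in> ball z0 \<epsilon>1" using zs(1) \<epsilon> by auto
      then have "s \<in> cball 0 R" "s \<notin> K" using \<epsilon>0(2) \<epsilon>1(2) zs(2) by auto
      then show ?thesis unfolding K_def by blast
    qed
    show "regular_disc (f t) (\<Omega> t) i t (r t) (ball z0 \<epsilon>)" if "t \<in> T z0" for t
      using Q(2)[OF that \<epsilon>(3)[OF that]] .
  qed (rule Q; assumption)+
qed

text \<open>The finite mapping theorem for a coordinate projection: locally the image is a finite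
  union of the sets treated in \<open>analytic_projection_disc\<close>, one for each disc of
  \<open>fibre_cover\<close>.\<close>

theorem closed_analytic_set_projection:
  fixes X :: "(complex ^ 'n) set"
  assumes X: "closed_analytic_set X" and lb: "fibres_locally_bounded i X"
  shows "closed_analytic_set {z. \<exists>t. vupd z i t \<in> X}"
  unfolding closed_analytic_set_def
proof
  let ?Y = "{z. \<exists>t. vupd z i t \<in> X}"
  have "\<exists>e>0. ball z0 e \<subseteq> - ?Y" if "z0 \<notin> ?Y" for z0
  proof -
    obtain r \<epsilon> where *: "\<epsilon> > 0"
      "\<And>z s. z \<in> ball z0 \<epsilon> \<Longrightarrow> vupd z i s \<in> X \<Longrightarrow> \<exists>t\<in>{t. vupd z0 i t \<in> X}. s \<in> ball t (r t)"
      by (rule fibre_cover[OF X lb, of z0]) (rule that)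
    have "ball z0 \<epsilon> \<subseteq> - ?Y" using *(2) that by blast
    then show ?thesis using *(1) by blast
  qed
  then have "open (- ?Y)" unfolding open_contains_ball by blast
  then show "closed ?Y" by (simp add: closed_def)
  show "\<forall>a\<in>?Y. \<exists>U F. open U \<and> a \<in> U \<and> finite F \<and> (\<forall>f\<in>F. holomorphic_Cn f U) \<and> ?Y \<inter> U = {z \<in> U. \<forall>f\<in>F. f z = 0}"
  proof
    fix z0 assume "z0 \<in> ?Y"
    let ?T = "{t. vupd z0 i t \<in> X}"
    obtain \<Omega> F f r \<epsilon> where *: "finite ?T" "\<epsilon> > 0"
      "\<And>t. t \<in> ?T \<Longrightarrow> regular_disc (f t) (\<Omega> t) i t (r t) (ball z0 \<epsilon>)"
      "\<And>t. t \<in> ?T \<Longrightarrow> finite (F t)" "\<And>t g. t \<in> ?T \<Longrightarrow> g \<in> F t \<Longrightarrow> holomorphic_Cn g (\<Omega> t)"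
      "\<And>t. t \<in> ?T \<Longrightarrow> f t \<in> F t" "\<And>t. t \<in> ?T \<Longrightarrow> X \<inter> \<Omega> t = {z \<in> \<Omega> t. \<forall>g\<in>F t. g z = 0}"
      "\<And>z s. z \<in> ball z0 \<epsilon> \<Longrightarrow> vupd z i s \<in> X \<Longrightarrow> \<exists>t\<in>?T. s \<in> ball t (r t)"
      by (rule fibre_cover[OF X lb, of z0]) (rule that)
    let ?S = "\<lambda>t. {z. \<exists>s\<in>ball t (r t). \<forall>g\<in>F t. g (vupd z i s) = 0}"
    have "analytic_in (\<Union>t\<in>?T. ?S t) (ball z0 \<epsilon>)"
    proof (rule analytic_in_UN[OF *(1)])
      fix t assume t: "t \<in> ?T"
      show "analytic_in (?S t) (ball z0 \<epsilon>)"
        by (rule analytic_projection_disc[OF *(3)[OF t] connected_ball *(4)[OF t] *(5)[OF t] *(6)[OF t]])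
    qed
    moreover have "(\<Union>t\<in>?T. ?S t) \<inter> ball z0 \<epsilon> = ?Y \<inter> ball z0 \<epsilon>"
    proof -
      have iff: "vupd z i s \<in> X \<longleftrightarrow> (\<forall>g\<in>F t. g (vupd z i s) = 0)"
        if "t \<in> ?T" "s \<in> ball t (r t)" "z \<in> ball z0 \<epsilon>" for t s z
      proof -
        have "s \<in> cball t (r t)" using that(2) by simp
        then have "vupd z i s \<in> \<Omega> t" using *(3)[OF that(1)] that(3) unfolding regular_disc_def by blast
        then show ?thesis using *(7)[OF that(1)] by blast
      qed
      have "(\<exists>t\<in>?T. z \<in> ?S t) \<longleftrightarrow> z \<in> ?Y" if z: "z \<in> ball z0 \<epsilon>" for z
      proof
        assume "\<exists>t\<in>?T. z \<in> ?S t"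
        then obtain t s where "t \<in> ?T" "s \<in> ball t (r t)" "\<forall>g\<in>F t. g (vupd z i s) = 0" by blast
        then show "z \<in> ?Y" using iff z by blast
      next
        assume "z \<in> ?Y"
        then obtain s where s: "vupd z i s \<in> X" by blast
        obtain t where "t \<in> ?T" "s \<in> ball t (r t)" using *(8)[OF z s] by (elim bexE)
        then show "\<exists>t\<in>?T. z \<in> ?S t" using iff s z by blast
      qed
      then have key: "z \<in> (\<Union>t\<in>?T. ?S t) \<longleftrightarrow> z \<in> ?Y" if "z \<in> ball z0 \<epsilon>" for z
        using that by (simp only: UN_iff)
      have gen: "A \<inter> B = C \<inter> B" if "\<And>z. z \<in> B \<Longrightarrow> z \<in> A \<longleftrightarrow> z \<in> C" for A B C :: "(complex ^ 'n) set"
        using that by blast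
      show ?thesis by (rule gen[OF key])
    qed
    ultimately have "analytic_in ?Y (ball z0 \<epsilon>)" unfolding analytic_in_def by simp
    then obtain G where "finite G" "\<forall>f\<in>G. holomorphic_Cn f (ball z0 \<epsilon>)"
      "?Y \<inter> ball z0 \<epsilon> = {z \<in> ball z0 \<epsilon>. \<forall>f\<in>G. f z = 0}"
      unfolding analytic_in_def by (elim exE conjE)
    then show "\<exists>U F. open U \<and> z0 \<in> U \<and> finite F \<and> (\<forall>f\<in>F. holomorphic_Cn f U) \<and> ?Y \<inter> U = {z \<in> U. \<forall>f\<in>F. f z = 0}"
      using *(2) by (intro exI[of _ "ball z0 \<epsilon>"] exI[of _ G] conjI) (assumption | simp)+
  qed
qed

section \<open>Generic sheets of an analytic hypersurface\<close>

text \<open>With a fixed total, splitting a multiplicity strictly lowers the sum of squares. This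
  sum therefore measures how far the roots have separated.\<close>

lemma sum_power2_eq_iff:
  fixes m :: "'a \<Rightarrow> nat"
  assumes "finite A" "\<And>a. a \<in> A \<Longrightarrow> m a > 0"
  shows "(\<Sum>a\<in>A. m a ^ 2) \<le> (\<Sum>a\<in>A. m a) ^ 2"
    and "(\<Sum>a\<in>A. m a) ^ 2 \<le> (\<Sum>a\<in>A. m a ^ 2) \<Longrightarrow> card A \<le> 1"
proof -
  have eq: "(\<Sum>a\<in>A. m a) ^ 2 = (\<Sum>a\<in>A. m a * (\<Sum>b\<in>A. m b))"
    by (simp add: power2_eq_square sum_distrib_right)
  have le: "m a ^ 2 \<le> m a * (\<Sum>b\<in>A. m b)" if "a \<in> A" for a
    using that assms(1) member_le_sum[of a A m] by (simp add: power2_eq_square)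
  then show "(\<Sum>a\<in>A. m a ^ 2) \<le> (\<Sum>a\<in>A. m a) ^ 2" unfolding eq by (rule sum_mono)
  show "card A \<le> 1" if "(\<Sum>a\<in>A. m a) ^ 2 \<le> (\<Sum>a\<in>A. m a ^ 2)"
  proof (rule ccontr)
    assume "\<not> card A \<le> 1"
    then obtain a b where ab: "a \<in> A" "b \<in> A" "a \<noteq> b"
      by (metis One_nat_def assms(1) card_le_Suc0_iff_eq)
    have "m a < (\<Sum>c\<in>A. m c)"
    proof -
      have "(\<Sum>c\<in>{a}. m c) < (\<Sum>c\<in>A. m c)"
        using ab assms by (intro sum_strict_mono2[where b=b]) auto
      then show ?thesis by simp
    qed
    then have "m a ^ 2 < m a * (\<Sum>b\<in>A. m b)" using assms(2)[OF ab(1)] by (simp add: power2_eq_square)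
    then have "(\<Sum>a\<in>A. m a ^ 2) < (\<Sum>a\<in>A. m a) ^ 2" unfolding eq
      by (intro sum_strict_mono_ex1 assms(1)) (use le ab(1) in auto)
    with that show False by simp
  qed
qed

text \<open>A root of multiplicity \<open>m\<close> at \<open>z1\<close> continues as roots of total
  multiplicity \<open>m\<close>, and a splitting would push the sum of squares below its value at
  \<open>z1\<close>, which \<open>max\<close> excludes. Hence each small disc carries exactly one
  root over every nearby point.\<close>

lemma roots_in_constant_multiplicity:
  fixes z1 :: "complex ^ 'n"
  assumes rd: "regular_disc f \<Omega> i c r B" and B: "connected B" and z1: "z1 \<in> B"
    and max: "\<And>z. z \<in> B \<Longrightarrow> (\<Sum>p\<in>roots_in f i c r z1. root_mult f i z1 p ^ 2) \<le> (\<Sum>p\<in>roots_in f i c r z. root_mult f i z p ^ 2)"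
  defines "A \<equiv> roots_in f i c r z1"
  obtains \<epsilon> \<rho> \<alpha> where "\<epsilon> > 0" "ball z1 \<epsilon> \<subseteq> B"
    "\<And>a. a \<in> A \<Longrightarrow> \<rho> a > 0" "\<And>a. a \<in> A \<Longrightarrow> ball a (\<rho> a) \<subseteq> ball c r"
    "\<And>a b. a \<in> A \<Longrightarrow> b \<in> A \<Longrightarrow> a \<noteq> b \<Longrightarrow> ball a (\<rho> a) \<inter> ball b (\<rho> b) = {}"
    "\<And>a. a \<in> A \<Longrightarrow> holomorphic_Cn (\<alpha> a) (ball z1 \<epsilon>)"
    "\<And>a z. a \<in> A \<Longrightarrow> z \<in> ball z1 \<epsilon> \<Longrightarrow> roots_in f i a (\<rho> a) z = {\<alpha> a z}"
    "\<And>z. z \<in> ball z1 \<epsilon> \<Longrightarrow> roots_in f i c r z = (\<lambda>a. \<alpha> a z) ` A"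
proof -
  have \<Omega>: "open \<Omega>" and opB: "open B" and hol: "holomorphic_Cn f \<Omega>"
    and in_\<Omega>: "\<And>z t. z \<in> B \<Longrightarrow> t \<in> cball c r \<Longrightarrow> vupd z i t \<in> \<Omega>"
    using rd unfolding regular_disc_def by auto
  have finA: "finite A" unfolding A_def by (rule finite_roots_in[OF rd z1])
  have "\<exists>\<rho>>0. cball a \<rho> \<subseteq> ball c r \<and> (\<forall>b\<in>A. b \<noteq> a \<longrightarrow> 2 * \<rho> < dist a b)" if a: "a \<in> A" for a
  proof -
    obtain d where d: "d > 0" "\<forall>x\<in>A. x \<noteq> a \<longrightarrow> d \<le> dist a x" using finite_set_avoid[OF finA] by blast
    have "a \<in> ball c r" using a by (simp add: A_def roots_in_def)
    then obtain e where e: "e > 0" "cball a e \<subseteq> ball c r" using open_contains_cball open_ball by metis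
    have "cball a (min e (d/4)) \<subseteq> ball c r" using e(2) by auto
    moreover have "2 * min e (d/4) < d" using d(1) e(1) by (simp add: min_def)
    ultimately show ?thesis using d e(1) by (intro exI[of _ "min e (d/4)"]) force
  qed
  then obtain \<rho> where \<rho>: "\<And>a. a \<in> A \<Longrightarrow> \<rho> a > 0" "\<And>a. a \<in> A \<Longrightarrow> cball a (\<rho> a) \<subseteq> ball c r"
    "\<And>a b. a \<in> A \<Longrightarrow> b \<in> A \<Longrightarrow> b \<noteq> a \<Longrightarrow> 2 * \<rho> a < dist a b" by metis
  have disj: "ball a (\<rho> a) \<inter> ball b (\<rho> b) = {}" if "a \<in> A" "b \<in> A" "a \<noteq> b" for a b
  proof -
    have "2 * \<rho> a < dist a b" "2 * \<rho> b < dist a b"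
      using \<rho>(3)[of a b] \<rho>(3)[of b a] that by (auto simp: dist_commute)
    then show ?thesis by (intro disjoint_ballI) linarith
  qed
  have sub: "ball a (\<rho> a) \<subseteq> ball c r" if "a \<in> A" for a using \<rho>(2)[OF that] ball_subset_cball by blast
  have "\<exists>e>0. \<forall>\<delta>\<le>e. regular_disc f \<Omega> i a (\<rho> a) (ball z1 \<delta>)" if a: "a \<in> A" for a
  proof -
    have 1: "vupd z1 i t \<in> \<Omega>" if "t \<in> cball a (\<rho> a)" for t
      using in_\<Omega>[OF z1, of t] \<rho>(2)[OF a] that by auto
    have 2: "f (vupd z1 i t) \<noteq> 0" if "t \<in> sphere a (\<rho> a)" for t
    proof
      assume "f (vupd z1 i t) = 0"
      moreover have "t \<in> cball a (\<rho> a)" using that by simp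
      then have "t \<in> ball c r" using \<rho>(2)[OF a] by blast
      ultimately have t: "t \<in> A" by (simp add: A_def roots_in_def)
      have "dist a t = \<rho> a" using that by simp
      moreover have "t \<noteq> a" using calculation \<rho>(1)[OF a] by auto
      ultimately show False using \<rho>(3)[OF a t] \<rho>(1)[OF a] by linarith
    qed
    show ?thesis using regular_disc_exists[OF \<Omega> hol \<rho>(1)[OF a] 1 2] by metis
  qed
  then obtain e where e: "\<And>a. a \<in> A \<Longrightarrow> e a > 0" "\<And>a \<delta>. a \<in> A \<Longrightarrow> \<delta> \<le> e a \<Longrightarrow> regular_disc f \<Omega> i a (\<rho> a) (ball z1 \<delta>)"
    by metis
  obtain e0 where e0: "e0 > 0" "ball z1 e0 \<subseteq> B" using opB z1 open_contains_ball by metis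
  define \<epsilon> where "\<epsilon> = Min (insert e0 (e ` A))"
  have "\<epsilon> > 0" unfolding \<epsilon>_def using finA e0(1) e(1) by (subst Min_gr_iff) auto
  have \<epsilon>: "\<epsilon> \<le> e0" "\<And>a. a \<in> A \<Longrightarrow> \<epsilon> \<le> e a" unfolding \<epsilon>_def by (rule Min_le; simp add: finA)+
  have VB: "ball z1 \<epsilon> \<subseteq> B" using e0(2) \<epsilon>(1) subset_ball[of \<epsilon> e0 z1] by blast
  have rda: "regular_disc f \<Omega> i a (\<rho> a) (ball z1 \<epsilon>)" if "a \<in> A" for a using e(2)[OF that \<epsilon>(2)[OF that]] .
  let ?Z = "\<lambda>z. roots_in f i c r z" and ?Za = "\<lambda>a z. roots_in f i a (\<rho> a) z" and ?m = "root_mult f i"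
  have z1V: "z1 \<in> ball z1 \<epsilon>" using \<open>\<epsilon> > 0\<close> by simp
  have Za1: "?Za a z1 = {a}" if a: "a \<in> A" for a
  proof (intro equalityI subsetI)
    fix p assume p: "p \<in> ?Za a z1"
    then have "p \<in> A" using sub[OF a] by (auto simp: A_def roots_in_def)
    moreover have "dist a p < \<rho> a" using p by (simp add: roots_in_def)
    ultimately show "p \<in> {a}" using \<rho>(3)[OF a, of p] \<rho>(1)[OF a] by force
  next
    fix p assume "p \<in> {a}"
    then show "p \<in> ?Za a z1" using a \<rho>(1)[OF a] by (simp add: A_def roots_in_def)
  qed
  have count: "(\<Sum>p\<in>?Za a z. ?m z p) = ?m z1 a" if a: "a \<in> A" and z: "z \<in> ball z1 \<epsilon>" for a z
  proof -
    obtain N where N: "\<And>z. z \<in> ball z1 \<epsilon> \<Longrightarrow> (\<Sum>p\<in>?Za a z. ?m z p) = N"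
      using root_count_constant[OF rda[OF a] connected_ball] by metis
    show ?thesis using N[OF z] N[OF z1V] Za1[OF a] by simp
  qed
  have Zsub: "(\<Union>a\<in>A. ?Za a z) \<subseteq> ?Z z" for z
    using sub by (fastforce simp: roots_in_def)
  have disjZ: "?Za a z \<inter> ?Za b z = {}" if "a \<in> A" "b \<in> A" "a \<noteq> b" for a b z
    using disj[OF that] by (auto simp only: roots_in_def)
  have fina: "finite (?Za a z)" if "a \<in> A" "z \<in> ball z1 \<epsilon>" for a z by (rule finite_roots_in[OF rda[OF that(1)] that(2)])
  have posa: "?m z p > 0" if "a \<in> A" "z \<in> ball z1 \<epsilon>" "p \<in> ?Za a z" for a z p
    by (rule root_mult_pos[OF rda[OF that(1)] that(2,3)])
  obtain N where N: "\<And>z. z \<in> B \<Longrightarrow> (\<Sum>p\<in>?Z z. ?m z p) = N"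
    using root_count_constant[OF rd B] by metis
  \<comment> \<open>No root lies elsewhere: the small discs already account for the full number
    \<open>N\<close>.\<close>
  have ZU: "?Z z = (\<Union>a\<in>A. ?Za a z)" if z: "z \<in> ball z1 \<epsilon>" for z
  proof (rule ccontr)
    have zB: "z \<in> B" using VB z by blast
    assume "?Z z \<noteq> (\<Union>a\<in>A. ?Za a z)"
    then obtain p where p: "p \<in> ?Z z" "p \<notin> (\<Union>a\<in>A. ?Za a z)" using Zsub by blast
    have "(\<Sum>p\<in>(\<Union>a\<in>A. ?Za a z). ?m z p) < (\<Sum>p\<in>?Z z. ?m z p)"
      using Zsub p root_mult_pos[OF rd zB] by (intro sum_strict_mono2[OF finite_roots_in[OF rd zB], where b=p]) auto
    moreover have "(\<Sum>p\<in>(\<Union>a\<in>A. ?Za a z). ?m z p) = (\<Sum>a\<in>A. \<Sum>p\<in>?Za a z. ?m z p)"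
      using fina[OF _ z] disjZ by (intro sum.UNION_disjoint[OF finA]) blast+
    moreover have "\<dots> = (\<Sum>a\<in>A. ?m z1 a)" using count[OF _ z] by (intro sum.cong) auto
    moreover have "\<dots> = N" using N[OF z1] by (simp add: A_def)
    ultimately show False using N[OF zB] by simp
  qed
  have m1: "?m z1 a > 0" if "a \<in> A" for a
    by (rule root_mult_pos[OF rd z1]) (use that in \<open>simp add: A_def\<close>)
  have single: "\<exists>q. ?Za a z = {q}" if a: "a \<in> A" and z: "z \<in> ball z1 \<epsilon>" for a z
  proof -
    have zB: "z \<in> B" using VB z by blast
    have le: "(\<Sum>p\<in>?Za b z. ?m z p ^ 2) \<le> ?m z1 b ^ 2" if "b \<in> A" for b
      using sum_power2_eq_iff(1)[of "?Za b z" "?m z", OF fina[OF that z] posa[OF that z]] count[OF that z] by simp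
    have "?m z1 a ^ 2 \<le> (\<Sum>p\<in>?Za a z. ?m z p ^ 2)"
    proof (rule ccontr)
      assume "\<not> ?thesis"
      then have "(\<Sum>p\<in>?Za a z. ?m z p ^ 2) < ?m z1 a ^ 2" by simp
      then have "(\<Sum>b\<in>A. \<Sum>p\<in>?Za b z. ?m z p ^ 2) < (\<Sum>b\<in>A. ?m z1 b ^ 2)"
        by (intro sum_strict_mono_ex1[OF finA]) (use le a in auto)
      moreover have "(\<Sum>p\<in>?Z z. ?m z p ^ 2) = (\<Sum>b\<in>A. \<Sum>p\<in>?Za b z. ?m z p ^ 2)"
        unfolding ZU[OF z] using fina[OF _ z] disjZ by (intro sum.UNION_disjoint[OF finA]) blast+
      ultimately show False using max[OF zB] by (simp add: A_def)
    qed
    then have "card (?Za a z) \<le> 1"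
      using sum_power2_eq_iff(2)[of "?Za a z" "?m z", OF fina[OF a z] posa[OF a z]] count[OF a z] by simp
    moreover have "?Za a z \<noteq> {}"
    proof
      assume "?Za a z = {}"
      then have "?m z1 a = 0" using count[OF a z] by simp
      then show False using m1[OF a] by simp
    qed
    ultimately have "card (?Za a z) = 1" using fina[OF a z] by (simp add: Suc_le_eq card_gt_0_iff le_antisym)
    then show ?thesis by (rule card_1_singletonE) blast
  qed
  \<comment> \<open>The mean of the roots in the small disc, weighted by multiplicity. As a root sum
    divided by a constant it is holomorphic, and it equals the single root there.\<close>
  define \<alpha> where "\<alpha> a z = (\<Sum>p\<in>?Za a z. of_nat (?m z p) * (vupd z i p $ i)) / of_nat (?m z1 a)" for a z
  have \<alpha>: "?Za a z = {\<alpha> a z}" if a: "a \<in> A" and z: "z \<in> ball z1 \<epsilon>" for a z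
  proof -
    obtain q where q: "?Za a z = {q}" using single[OF a z] by blast
    then have "?m z q = ?m z1 a" using count[OF a z] by simp
    then have "\<alpha> a z = q" using m1[OF a] by (simp add: \<alpha>_def q)
    with q show ?thesis by simp
  qed
  show ?thesis
  proof (rule that[OF \<open>\<epsilon> > 0\<close> VB \<rho>(1) sub disj])
    show "holomorphic_Cn (\<alpha> a) (ball z1 \<epsilon>)" if a: "a \<in> A" for a
      unfolding \<alpha>_def using m1[OF a]
      by (intro holomorphic_Cn_divide holomorphic_root_sum[OF rda[OF a]] holomorphic_Cn_coord holomorphic_Cn_const) simp
    show "roots_in f i a (\<rho> a) z = {\<alpha> a z}" if "a \<in> A" "z \<in> ball z1 \<epsilon>" for a z using \<alpha>[OF that] .
    show "roots_in f i c r z = (\<lambda>a. \<alpha> a z) ` A" if z: "z \<in> ball z1 \<epsilon>" for z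
    proof -
      have "(\<Union>a\<in>A. ?Za a z) = (\<Union>a\<in>A. {\<alpha> a z})" using \<alpha>[OF _ z] by (intro SUP_cong) auto
      then show ?thesis unfolding ZU[OF z] by auto
    qed
  qed
qed

text \<open>The ordinary discriminant vanishes identically when \<open>f\<close> has a repeated
  factor. Instead the ordered pairs of distinct roots are counted with multiplicity; this count is
  largest exactly where the sum of squares is smallest, and the coefficient of
  \<open>root_poly\<close> over pairs at the largest count is nonzero exactly there.\<close>

lemma root_discriminant:
  assumes rd: "regular_disc f \<Omega> i c r B" and B: "connected B" "B \<noteq> {}"
  obtains \<delta> where "holomorphic_Cn \<delta> B" "\<exists>z\<in>B. \<delta> z \<noteq> 0"
    "\<And>z1 z. z1 \<in> B \<Longrightarrow> \<delta> z1 \<noteq> 0 \<Longrightarrow> z \<in> B \<Longrightarrow>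
      (\<Sum>p\<in>roots_in f i c r z1. root_mult f i z1 p ^ 2) \<le> (\<Sum>p\<in>roots_in f i c r z. root_mult f i z p ^ 2)"
proof -
  let ?Z = "\<lambda>z. roots_in f i c r z" and ?m = "root_mult f i"
  let ?mm = "\<lambda>z p. ?m z (fst p) * ?m z (snd p)" and ?c = "\<lambda>p :: complex \<times> complex. (fst p - snd p) ^ 2"
  obtain N where N: "\<And>z. z \<in> B \<Longrightarrow> (\<Sum>p\<in>?Z z. ?m z p) = N"
    using root_count_constant[OF rd B(1)] by metis
  have opB: "open B" using rd by (simp add: regular_disc_def)
  have fin: "finite (?Z z)" if "z \<in> B" for z by (rule finite_roots_in[OF rd that])
  define cnt where "cnt z = (\<Sum>p\<in>{p\<in>?Z z \<times> ?Z z. ?c p \<noteq> 0}. ?mm z p)" for z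
  \<comment> \<open>All ordered pairs have total weight \<open>N ^ 2\<close>; those on the diagonal
    contribute the sum of squares.\<close>
  have cnt: "cnt z + (\<Sum>p\<in>?Z z. ?m z p ^ 2) = N ^ 2" if z: "z \<in> B" for z
  proof -
    let ?D = "(\<lambda>p. (p, p)) ` ?Z z"
    have "N ^ 2 = (\<Sum>p\<in>?Z z \<times> ?Z z. ?mm z p)"
      unfolding N[OF z, symmetric] power2_eq_square sum_product sum.cartesian_product by (simp add: split_beta)
    also have "?Z z \<times> ?Z z = {p\<in>?Z z \<times> ?Z z. ?c p \<noteq> 0} \<union> ?D" by auto
    also have "(\<Sum>p\<in>{p\<in>?Z z \<times> ?Z z. ?c p \<noteq> 0} \<union> ?D. ?mm z p) = cnt z + (\<Sum>p\<in>?D. ?mm z p)"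
      unfolding cnt_def using fin[OF z] by (intro sum.union_disjoint) auto
    also have "(\<Sum>p\<in>?D. ?mm z p) = (\<Sum>p\<in>?Z z. ?m z p ^ 2)"
      by (subst sum.reindex) (auto simp: inj_on_def power2_eq_square)
    finally show ?thesis by simp
  qed
  obtain zm where zm: "zm \<in> B" "\<And>z. z \<in> B \<Longrightarrow> cnt z \<le> cnt zm"
  proof -
    obtain z0 where "z0 \<in> B" using B(2) by blast
    moreover have "cnt z < Suc (N ^ 2)" if "z \<in> B" for z using cnt[OF that] by linarith
    ultimately have "\<exists>x. x \<in> B \<and> (\<forall>y. y \<in> B \<longrightarrow> cnt y \<le> cnt x)"
      by (intro ex_has_greatest_nat[of "\<lambda>z. z \<in> B" z0 cnt "Suc (N ^ 2)"]) simp_all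
    then show ?thesis using that by blast
  qed
  define \<delta> where "\<delta> z = coeff (root_poly (?Z z \<times> ?Z z) (?mm z) ?c) (cnt zm)" for z
  have 0: "\<delta> z = 0 \<longleftrightarrow> cnt z < cnt zm" if z: "z \<in> B" for z
    unfolding \<delta>_def cnt_def
    by (rule coeff_root_poly_eq_0_iff) (use fin[OF z] zm(2)[OF z] in \<open>auto simp: cnt_def\<close>)
  have "holomorphic_Cn \<delta> B"
    unfolding \<delta>_def
  proof (rule holomorphic_coeff_root_poly[OF _ _ opB])
    show "finite (?Z z \<times> ?Z z)" if "z \<in> B" for z using fin[OF that] by simp
    fix k
    let ?n = "2 * Suc k"
    let ?S = "\<lambda>j z. \<Sum>p\<in>?Z z. of_nat (?m z p) * p ^ j" and ?S' = "\<lambda>j z. \<Sum>p\<in>?Z z. of_nat (?m z p) * (- p) ^ j"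
    have "holomorphic_Cn (\<lambda>z. \<Sum>p\<in>?Z z. of_nat (?m z p) * (vupd z i p $ i) ^ j) B" for j
      by (rule holomorphic_root_sum[OF rd, of "\<lambda>w. (w $ i) ^ j"]) (intro holomorphic_Cn_power holomorphic_Cn_coord)
    then have S: "holomorphic_Cn (?S j) B" for j by simp
    have "holomorphic_Cn (\<lambda>z. \<Sum>p\<in>?Z z. of_nat (?m z p) * (- (vupd z i p $ i)) ^ j) B" for j
      by (rule holomorphic_root_sum[OF rd, of "\<lambda>w. (- (w $ i)) ^ j"])
        (intro holomorphic_Cn_power holomorphic_Cn_uminus holomorphic_Cn_coord)
    then have S': "holomorphic_Cn (?S' j) B" for j by simp
    \<comment> \<open>Even powers of \<open>p - q\<close> expand binomially into products of power
      sums in \<open>p\<close> and in \<open>- q\<close>, which are holomorphic root sums.\<close>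
    have eq: "(\<Sum>p\<in>?Z z \<times> ?Z z. of_nat (?mm z p) * ?c p ^ Suc k) = (\<Sum>j\<le>?n. of_nat (?n choose j) * (?S j z * ?S' (?n - j) z))" for z
    proof -
      have "(\<Sum>p\<in>?Z z \<times> ?Z z. of_nat (?mm z p) * ?c p ^ Suc k) =
        (\<Sum>p\<in>?Z z. \<Sum>q\<in>?Z z. of_nat (?m z p) * of_nat (?m z q) * (p + (- q)) ^ ?n)"
        unfolding sum.cartesian_product by (intro sum.cong) (auto simp: power_mult[symmetric] simp del: power_Suc mult_Suc_right)
      also have "\<dots> = (\<Sum>p\<in>?Z z. \<Sum>q\<in>?Z z. \<Sum>j\<le>?n. of_nat (?n choose j) * ((of_nat (?m z p) * p ^ j) * (of_nat (?m z q) * (- q) ^ (?n - j))))"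
        unfolding binomial_ring sum_distrib_left by (intro sum.cong refl) (simp only: mult_ac)
      also have "\<dots> = (\<Sum>j\<le>?n. \<Sum>p\<in>?Z z. \<Sum>q\<in>?Z z. of_nat (?n choose j) * ((of_nat (?m z p) * p ^ j) * (of_nat (?m z q) * (- q) ^ (?n - j))))"
        by (simp only: sum.swap[of _ "{..?n}" "?Z z"])
      also have "\<dots> = (\<Sum>j\<le>?n. of_nat (?n choose j) * (?S j z * ?S' (?n - j) z))"
        unfolding sum_product unfolding sum_distrib_left by (rule refl)
      finally show ?thesis .
    qed
    show "holomorphic_Cn (\<lambda>z. \<Sum>p\<in>?Z z \<times> ?Z z. of_nat (?mm z p) * ?c p ^ Suc k) B"
      unfolding eq by (intro holomorphic_Cn_sum holomorphic_Cn_mult holomorphic_Cn_const S S')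
  qed
  moreover have "\<exists>z\<in>B. \<delta> z \<noteq> 0" using 0[OF zm(1)] zm(1) by auto
  moreover have "(\<Sum>p\<in>?Z z1. ?m z1 p ^ 2) \<le> (\<Sum>p\<in>?Z z. ?m z p ^ 2)" if "z1 \<in> B" "\<delta> z1 \<noteq> 0" "z \<in> B" for z1 z
  proof -
    have "cnt z \<le> cnt z1" using 0[OF that(1)] that(2) zm(2)[OF that(3)] by linarith
    then show ?thesis using cnt[OF that(1)] cnt[OF that(3)] by linarith
  qed
  ultimately show ?thesis using that by blast
qed

section \<open>Sheets inside an analytic set\<close>

lemma dist_vupd [simp]: "dist (vupd z i s) (vupd z i t) = dist s t"
proof -
  have "vupd z i s - vupd z i t = axis i (s - t)" by (simp add: vec_eq_iff axis_def)
  then show ?thesis by (simp add: dist_norm)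
qed

lemma norm_vupd_0_le: "norm (vupd z i 0) \<le> norm z"
  unfolding norm_vec_def by (rule L2_set_mono) auto

lemma dist_vupd_le: "dist (vupd z i t) (vupd w i t) \<le> dist z w"
proof -
  have "vupd z i t - vupd w i t = vupd (z - w) i 0" by (simp add: vec_eq_iff)
  then show ?thesis using norm_vupd_0_le[of "z - w" i] by (simp add: dist_norm)
qed

text \<open>What survives of pure dimension after projection to a hypersurface: near a dense set of
  its points \<open>H\<close> contains a continuous graph over the base, so no smaller piece of
  \<open>H\<close> stands alone.\<close>

definition graph_dense :: "'n \<Rightarrow> (complex ^ 'n) set \<Rightarrow> bool" where
  "graph_dense i H \<longleftrightarrow> (\<forall>p\<in>H. \<forall>e>0. \<exists>q\<in>H. dist p q < e \<and>
     (\<exists>g. isCont g q \<and> g q = q $ i \<and> (\<exists>\<eta>>0. \<forall>w\<in>ball q \<eta>. vupd w i (g w) \<in> H)))"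

text \<open>Let \<open>Z\<close> be the part of the base over which the sheet lies in
  \<open>H\<close>. The interior of \<open>Z\<close> is dense in \<open>Z\<close>, because by
  \<open>iso\<close> every graph in \<open>H\<close> near the sheet coincides with it; the identity
  theorem makes this interior closed in \<open>V\<close>. Connectedness of \<open>V\<close>
  decides.\<close>

lemma sheet_alternative:
  fixes H :: "(complex ^ 'n) set"
  assumes H: "closed_analytic_set H" and gd: "graph_dense i H"
    and V: "open V" "connected V" and \<alpha>: "holomorphic_Cn \<alpha> V"
    and iso: "\<And>z. z \<in> V \<Longrightarrow> \<exists>\<eta>>0. \<forall>x\<in>V \<inter> ball z \<eta>. \<forall>s\<in>ball (\<alpha> z) \<eta>. vupd x i s \<in> H \<longrightarrow> s = \<alpha> x"
  shows "(\<forall>z\<in>V. vupd z i (\<alpha> z) \<in> H) \<or> (\<forall>z\<in>V. vupd z i (\<alpha> z) \<notin> H)"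
proof -
  define Z where "Z = {z \<in> V. vupd z i (\<alpha> z) \<in> H}"
  have cont\<alpha>: "continuous_on V \<alpha>" by (rule holomorphic_Cn_continuous_on[OF \<alpha>])
  have contv: "continuous_on V (\<lambda>z. vupd z i (\<alpha> z))" by (intro continuous_intros cont\<alpha>)
  have dense: "\<exists>w\<in>interior Z. dist z w < e" if z: "z \<in> Z" and e: "e > 0" for z e
  proof -
    have zV: "z \<in> V" and zH: "vupd z i (\<alpha> z) \<in> H" using z by (auto simp: Z_def)
    obtain \<eta> where \<eta>: "\<eta> > 0" "\<And>x s. x \<in> V \<inter> ball z \<eta> \<Longrightarrow> s \<in> ball (\<alpha> z) \<eta> \<Longrightarrow> vupd x i s \<in> H \<Longrightarrow> s = \<alpha> x"
      using iso[OF zV] by blast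
    obtain \<zeta> where \<zeta>: "\<zeta> > 0" "ball z \<zeta> \<subseteq> V" using V(1) zV open_contains_ball by metis
    define \<mu> where "\<mu> = min (min \<eta> e) \<zeta>"
    have \<mu>: "\<mu> > 0" "\<mu> \<le> \<eta>" "\<mu> \<le> e" "\<mu> \<le> \<zeta>" using \<eta>(1) e \<zeta>(1) by (auto simp: \<mu>_def)
    obtain q g \<theta> where q: "q \<in> H" "dist (vupd z i (\<alpha> z)) q < \<mu>" "isCont g q" "g q = q $ i"
      "\<theta> > 0" "\<forall>w\<in>ball q \<theta>. vupd w i (g w) \<in> H"
      using gd zH \<mu>(1) unfolding graph_dense_def by metis
    \<comment> \<open>The base point of \<open>q\<close>, with coordinate \<open>i\<close> reset to
      that of \<open>z\<close>, so that \<open>w\<close> is close to \<open>z\<close> in the whole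
      space.\<close>
    define w where "w = vupd q i (z $ i)"
    have "dist z w \<le> dist (vupd z i (\<alpha> z)) q"
    proof -
      have "dist (vupd (vupd z i (\<alpha> z)) i (z $ i)) (vupd q i (z $ i)) \<le> dist (vupd z i (\<alpha> z)) q"
        by (rule dist_vupd_le)
      then show ?thesis by (simp add: w_def)
    qed
    then have zw: "dist z w < \<mu>" using q(2) by linarith
    have "dist (\<alpha> z) (q $ i) \<le> dist (vupd z i (\<alpha> z)) q"
      using dist_vec_nth_le[of "vupd z i (\<alpha> z)" i q] by simp
    then have qi: "dist (\<alpha> z) (q $ i) < \<mu>" using q(2) by linarith
    define g' where "g' x = g (vupd x i (q $ i))" for x
    have "isCont g' w"
      unfolding g'_def
    proof (rule isCont_o2[of _ "\<lambda>x. vupd x i (q $ i)"])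
      show "isCont (\<lambda>x. vupd x i (q $ i)) w"
        using continuous_on_vupd[of UNIV "\<lambda>x. x" "\<lambda>_. q $ i" i]
        by (simp add: continuous_on_eq_continuous_at)
      show "isCont g (vupd w i (q $ i))" using q(3) by (simp add: w_def)
    qed
    moreover have g'w: "g' w = q $ i" using q(4) by (simp add: g'_def w_def)
    moreover have "\<eta> - dist (\<alpha> z) (q $ i) > 0" using qi \<mu> by simp
    ultimately obtain \<theta>' where \<theta>': "\<theta>' > 0" "\<And>x. dist x w < \<theta>' \<Longrightarrow> dist (g' x) (q $ i) < \<eta> - dist (\<alpha> z) (q $ i)"
      unfolding continuous_at_eps_delta by metis
    have \<theta>'2: "g' x \<in> ball (\<alpha> z) \<eta>" if "x \<in> ball w \<theta>'" for x
      using \<theta>'(2)[of x] that dist_triangle[of "\<alpha> z" "g' x" "q $ i"] by (simp add: dist_commute)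
    have wV: "w \<in> ball z \<mu>" using zw by simp
    then obtain \<theta>'' where \<theta>'': "\<theta>'' > 0" "ball w \<theta>'' \<subseteq> ball z \<mu>" by (meson open_ball open_contains_ball)
    define \<kappa> where "\<kappa> = min \<theta> (min \<theta>' \<theta>'')"
    have \<kappa>: "\<kappa> > 0" "\<kappa> \<le> \<theta>" "\<kappa> \<le> \<theta>'" "\<kappa> \<le> \<theta>''" using q(5) \<theta>'(1) \<theta>''(1) by (auto simp: \<kappa>_def)
    have "ball w \<kappa> \<subseteq> Z"
    proof
      fix x assume x: "x \<in> ball w \<kappa>"
      have "vupd (vupd x i (q $ i)) i (g (vupd x i (q $ i))) \<in> H"
      proof -
        have "dist q (vupd x i (q $ i)) \<le> dist w x"
          using dist_vupd_le[of w i "q $ i" x] by (simp add: w_def)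
        then have "vupd x i (q $ i) \<in> ball q \<theta>" using x \<kappa> by simp
        then show ?thesis using q(6) by blast
      qed
      then have "vupd x i (g' x) \<in> H" by (simp add: g'_def)
      moreover have "x \<in> ball w \<theta>''" using x \<kappa> by simp
      then have xz: "x \<in> ball z \<mu>" using \<theta>''(2) by blast
      then have xV: "x \<in> V" using \<zeta>(2) \<mu>(4) by (auto simp: subset_iff)
      moreover have "x \<in> ball z \<eta>" using xz \<mu>(2) by simp
      moreover have "g' x \<in> ball (\<alpha> z) \<eta>" using \<theta>'2 x \<kappa>(3) by simp
      ultimately have "g' x = \<alpha> x" using \<eta>(2) by blast
      with \<open>vupd x i (g' x) \<in> H\<close> xV show "x \<in> Z" by (simp add: Z_def)
    qed
    then have "w \<in> interior Z" using \<kappa>(1) mem_interior by blast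
    then show ?thesis using zw \<mu>(3) by (intro bexI[of _ w]) auto
  qed
  have closedZ: "z \<in> interior Z" if z: "z \<in> V" "z \<in> closure (interior Z)" for z
  proof -
    have "closed H" using H by (simp add: closed_analytic_set_def)
    have "vupd z i (\<alpha> z) \<in> H"
    proof -
      obtain x where x: "\<And>n. x n \<in> interior Z" "x \<longlonglongrightarrow> z" using z(2) closure_sequential by blast
      have xV: "x n \<in> V" "vupd (x n) i (\<alpha> (x n)) \<in> H" for n
        using x(1)[of n] interior_subset[of Z] by (auto simp: Z_def)
      have "(\<lambda>n. vupd (x n) i (\<alpha> (x n))) \<longlonglongrightarrow> vupd z i (\<alpha> z)"
        using continuous_on_tendsto_compose[OF contv x(2) z(1)] xV(1) by simp
      then show ?thesis using closed_sequentially[OF \<open>closed H\<close>, of "\<lambda>n. vupd (x n) i (\<alpha> (x n))"] xV(2) by blast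
    qed
    then obtain U F where UF: "open U" "vupd z i (\<alpha> z) \<in> U" "\<forall>f\<in>F. holomorphic_Cn f U"
      "H \<inter> U = {z \<in> U. \<forall>f\<in>F. f z = 0}"
      using H unfolding closed_analytic_set_def by blast
    have "open ((\<lambda>z. vupd z i (\<alpha> z)) -` U \<inter> V)" using contv V(1) UF(1) continuous_on_open_vimage by blast
    moreover have "z \<in> (\<lambda>z. vupd z i (\<alpha> z)) -` U \<inter> V" using UF(2) z(1) by simp
    ultimately obtain \<rho> where \<rho>: "\<rho> > 0" "ball z \<rho> \<subseteq> (\<lambda>z. vupd z i (\<alpha> z)) -` U \<inter> V"
      using open_contains_ball by blast
    have zero: "f (vupd x i (\<alpha> x)) = 0" if f: "f \<in> F" and x: "x \<in> ball z \<rho>" for f x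
    proof (rule holomorphic_Cn_eq_0_on_convex[where U="ball z \<rho>" and V="interior Z \<inter> ball z \<rho>"
          and f="\<lambda>x. f (vupd x i (\<alpha> x))" and w=x])
      have "holomorphic_Cn f U" "holomorphic_Cn \<alpha> (ball z \<rho>)"
        using UF(3) f \<alpha> \<rho>(2) holomorphic_Cn_subset by blast+
      moreover have "vupd x i (\<alpha> x) \<in> U" if "x \<in> ball z \<rho>" for x using \<rho>(2) that by blast
      ultimately show "holomorphic_Cn (\<lambda>x. f (vupd x i (\<alpha> x))) (ball z \<rho>)"
        using holomorphic_Cn_vupd[of f U "\<lambda>x. x" "ball z \<rho>" \<alpha> i] by simp
      obtain y where "y \<in> interior Z" "dist y z < \<rho>" using z(2) \<rho>(1) closure_approachable by blast
      then show "interior Z \<inter> ball z \<rho> \<noteq> {}" by (auto simp: dist_commute)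
      fix y assume y: "y \<in> interior Z \<inter> ball z \<rho>"
      then have "y \<in> Z" using interior_subset by blast
      then have "vupd y i (\<alpha> y) \<in> H \<inter> U" using y \<rho>(2) by (auto simp: Z_def)
      then show "f (vupd y i (\<alpha> y)) = 0" using UF(4) f by blast
    qed (use x in auto)
    have "ball z \<rho> \<subseteq> Z"
    proof
      fix x assume x: "x \<in> ball z \<rho>"
      then have "vupd x i (\<alpha> x) \<in> U" "x \<in> V" using \<rho>(2) by auto
      moreover then have "vupd x i (\<alpha> x) \<in> H \<inter> U" using zero[OF _ x] UF(4) by blast
      ultimately show "x \<in> Z" by (simp add: Z_def)
    qed
    then show ?thesis using \<rho>(1) mem_interior by blast
  qed
  show ?thesis
  proof (cases "Z = {}")
    case True then show ?thesis by (auto simp: Z_def)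
  next
    case False
    then have ne: "interior Z \<noteq> {}" using dense[of _ 1] by auto
    have ZV: "interior Z \<subseteq> V" using interior_subset[of Z] by (auto simp: Z_def)
    have "openin (top_of_set V) (interior Z)" using ZV by (simp add: openin_open_eq V(1))
    moreover have "closedin (top_of_set V) (interior Z)"
    proof -
      have "interior Z = V \<inter> closure (interior Z)"
        using ZV closedZ closure_subset[of "interior Z"] by auto
      then show ?thesis by (metis closed_closure closedin_closed_Int)
    qed
    ultimately have "interior Z = V" using V(2) ne unfolding connected_clopen by blast
    then have "V \<subseteq> Z" using interior_subset[of Z] by blast
    then show ?thesis by (auto simp: Z_def)
  qed
qed

text \<open>Base points near which \<open>H\<close> is a disjoint union of holomorphic sheets. The
  index type \<open>complex \<times> complex\<close> accommodates pairs of a disc centre from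
  \<open>fibre_cover\<close> and a root in that disc.\<close>

definition unramified :: "'n \<Rightarrow> (complex ^ 'n) set \<Rightarrow> (complex ^ 'n) set" where
  "unramified i H = {z0. \<exists>V (A :: (complex \<times> complex) set) \<alpha>. open V \<and> z0 \<in> V \<and> finite A \<and>
     (\<forall>a\<in>A. holomorphic_Cn (\<alpha> a) V) \<and>
     (\<forall>z\<in>V. inj_on (\<lambda>a. \<alpha> a z) A \<and> {t. vupd z i t \<in> H} = (\<lambda>a. \<alpha> a z) ` A)}"

lemma nonzero_point_finite:
  assumes "finite T" "open B" "convex B" "B \<noteq> {}"
    and hol: "\<And>t. t \<in> T \<Longrightarrow> holomorphic_Cn (\<delta> t) B" and ne: "\<And>t. t \<in> T \<Longrightarrow> \<exists>z\<in>B. \<delta> t z \<noteq> 0"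
  shows "\<exists>z\<in>B. \<forall>t\<in>T. \<delta> t z \<noteq> 0"
  using assms(1) hol ne
proof (induction T)
  case empty
  then show ?case using assms(4) by blast
next
  case (insert t T)
  let ?W = "{z \<in> B. \<forall>t\<in>T. \<delta> t z \<noteq> 0}"
  have "?W \<noteq> {}" using insert by blast
  moreover have "open ?W"
  proof -
    have "continuous_on B (\<lambda>z. \<Prod>t\<in>T. \<delta> t z)"
      by (intro holomorphic_Cn_continuous_on holomorphic_Cn_prod) (use insert.prems(1) in blast)
    then have "open ((\<lambda>z. \<Prod>t\<in>T. \<delta> t z) -` (- {0}) \<inter> B)"
      using continuous_on_open_vimage[OF assms(2)] by blast
    moreover have "(\<lambda>z. \<Prod>t\<in>T. \<delta> t z) -` (- {0}) \<inter> B = ?W" using insert.hyps(1) by auto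
    ultimately show ?thesis by simp
  qed
  ultimately have "\<exists>z\<in>?W. \<delta> t z \<noteq> 0"
    using holomorphic_Cn_eq_0_on_convex[OF insert.prems(1)[of t] assms(2,3), of ?W] insert.prems(2)[of t] by blast
  then show ?case by blast
qed

text \<open>The product of the discriminants of all discs over \<open>z0\<close> is holomorphic and
  not identically zero. Off its zeros the roots form sheets; since the roots of \<open>f t\<close>
  may include points outside \<open>H\<close>, \<open>sheet_alternative\<close> decides which sheets
  belong to \<open>H\<close>.\<close>

lemma unramified_thin:
  fixes H :: "(complex ^ 'n) set"
  assumes H: "closed_analytic_set H" and lb: "fibres_locally_bounded i H" and gd: "graph_dense i H"
  obtains \<epsilon> \<delta> where "\<epsilon> > 0" "holomorphic_Cn \<delta> (ball z0 \<epsilon>)" "\<exists>z\<in>ball z0 \<epsilon>. \<delta> z \<noteq> 0"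
    "\<And>z. z \<in> ball z0 \<epsilon> \<Longrightarrow> \<delta> z \<noteq> 0 \<Longrightarrow> z \<in> unramified i H"
proof -
  let ?T = "{t. vupd z0 i t \<in> H}"
  obtain \<Omega> F f r \<epsilon> where fin: "finite ?T" and \<epsilon>: "\<epsilon> > 0"
    and rd: "\<And>t. t \<in> ?T \<Longrightarrow> regular_disc (f t) (\<Omega> t) i t (r t) (ball z0 \<epsilon>)"
    and "\<And>t. t \<in> ?T \<Longrightarrow> finite (F t)" "\<And>t g. t \<in> ?T \<Longrightarrow> g \<in> F t \<Longrightarrow> holomorphic_Cn g (\<Omega> t)"
    and fF: "\<And>t. t \<in> ?T \<Longrightarrow> f t \<in> F t" and H\<Omega>: "\<And>t. t \<in> ?T \<Longrightarrow> H \<inter> \<Omega> t = {z \<in> \<Omega> t. \<forall>g\<in>F t. g z = 0}"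
    and disj: "\<And>t t'. t \<in> ?T \<Longrightarrow> t' \<in> ?T \<Longrightarrow> t \<noteq> t' \<Longrightarrow> ball t (r t) \<inter> ball t' (r t') = {}"
    and cov: "\<And>z s. z \<in> ball z0 \<epsilon> \<Longrightarrow> vupd z i s \<in> H \<Longrightarrow> \<exists>t\<in>?T. s \<in> ball t (r t)"
    by (rule fibre_cover[OF H lb, of z0]) (rule that)
  let ?B = "ball z0 \<epsilon>"
  have neB: "?B \<noteq> {}" using \<epsilon> by simp
  let ?R = "\<lambda>t z. roots_in (f t) i t (r t) z"
  define Q where "Q t d \<longleftrightarrow> holomorphic_Cn d ?B \<and> (\<exists>z\<in>?B. d z \<noteq> 0) \<and> (\<forall>z1\<in>?B. d z1 \<noteq> 0 \<longrightarrow> (\<forall>z\<in>?B.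
      (\<Sum>p\<in>?R t z1. root_mult (f t) i z1 p ^ 2) \<le> (\<Sum>p\<in>?R t z. root_mult (f t) i z p ^ 2)))" for t d
  have "\<exists>d. Q t d" if t: "t \<in> ?T" for t
  proof (rule root_discriminant[OF rd[OF t] connected_ball neB])
    fix d assume "holomorphic_Cn d ?B" "\<exists>z\<in>?B. d z \<noteq> 0" and
      *: "\<And>z1 z. z1 \<in> ?B \<Longrightarrow> d z1 \<noteq> 0 \<Longrightarrow> z \<in> ?B \<Longrightarrow>
      (\<Sum>p\<in>?R t z1. root_mult (f t) i z1 p ^ 2) \<le> (\<Sum>p\<in>?R t z. root_mult (f t) i z p ^ 2)"
    then have "Q t d" unfolding Q_def by (intro conjI ballI impI *)
    then show ?thesis by blast
  qed
  then obtain \<delta> where Q: "\<And>t. t \<in> ?T \<Longrightarrow> Q t (\<delta> t)" by metis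
  have \<delta>: "holomorphic_Cn (\<delta> t) ?B" "\<exists>z\<in>?B. \<delta> t z \<noteq> 0" if "t \<in> ?T" for t
    using Q[OF that] unfolding Q_def by blast+
  have \<delta>3: "(\<Sum>p\<in>?R t z1. root_mult (f t) i z1 p ^ 2) \<le> (\<Sum>p\<in>?R t z. root_mult (f t) i z p ^ 2)"
    if "t \<in> ?T" "z1 \<in> ?B" "\<delta> t z1 \<noteq> 0" "z \<in> ?B" for t z1 z
    using Q[OF that(1)] that(2-) unfolding Q_def by blast
  have rootH: "s \<in> ?R t z" if "t \<in> ?T" "z \<in> ?B" "s \<in> ball t (r t)" "vupd z i s \<in> H" for t z s
  proof -
    have "s \<in> cball t (r t)" using that(3) by simp
    then have "vupd z i s \<in> \<Omega> t" using rd[OF that(1)] that(2) unfolding regular_disc_def by blast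
    then have "f t (vupd z i s) = 0" using H\<Omega>[OF that(1)] fF[OF that(1)] that(4) by blast
    then show ?thesis using that(3) by (simp add: roots_in_def)
  qed
  have unr: "z1 \<in> unramified i H" if z1: "z1 \<in> ?B" and nz: "\<And>t. t \<in> ?T \<Longrightarrow> \<delta> t z1 \<noteq> 0" for z1
  proof -
    define P where "P t e \<rho> \<alpha> \<longleftrightarrow> e > 0 \<and> ball z1 e \<subseteq> ?B \<and> (\<forall>a\<in>?R t z1. \<rho> a > 0) \<and>
        (\<forall>a\<in>?R t z1. ball a (\<rho> a) \<subseteq> ball t (r t)) \<and>
        (\<forall>a\<in>?R t z1. \<forall>b\<in>?R t z1. a \<noteq> b \<longrightarrow> ball a (\<rho> a) \<inter> ball b (\<rho> b) = {}) \<and>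
        (\<forall>a\<in>?R t z1. holomorphic_Cn (\<alpha> a) (ball z1 e)) \<and>
        (\<forall>a\<in>?R t z1. \<forall>z\<in>ball z1 e. roots_in (f t) i a (\<rho> a) z = {\<alpha> a z}) \<and>
        (\<forall>z\<in>ball z1 e. ?R t z = (\<lambda>a. \<alpha> a z) ` ?R t z1)" for t e and \<rho> :: "complex \<Rightarrow> real" and \<alpha>
    have "\<exists>e \<rho> \<alpha>. P t e \<rho> \<alpha>" if t: "t \<in> ?T" for t
    proof -
      obtain e \<rho> \<alpha> where "e > 0" "ball z1 e \<subseteq> ?B"
        "\<And>a. a \<in> ?R t z1 \<Longrightarrow> \<rho> a > 0" "\<And>a. a \<in> ?R t z1 \<Longrightarrow> ball a (\<rho> a) \<subseteq> ball t (r t)"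
        "\<And>a b. a \<in> ?R t z1 \<Longrightarrow> b \<in> ?R t z1 \<Longrightarrow> a \<noteq> b \<Longrightarrow> ball a (\<rho> a) \<inter> ball b (\<rho> b) = {}"
        "\<And>a. a \<in> ?R t z1 \<Longrightarrow> holomorphic_Cn (\<alpha> a) (ball z1 e)"
        "\<And>a z. a \<in> ?R t z1 \<Longrightarrow> z \<in> ball z1 e \<Longrightarrow> roots_in (f t) i a (\<rho> a) z = {\<alpha> a z}"
        "\<And>z. z \<in> ball z1 e \<Longrightarrow> ?R t z = (\<lambda>a. \<alpha> a z) ` ?R t z1"
        by (rule roots_in_constant_multiplicity[OF rd[OF t] connected_ball z1 \<delta>3[OF t z1 nz[OF t]]]) (assumption, rule that)
      then have "P t e \<rho> \<alpha>" unfolding P_def by (intro conjI ballI impI)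
      then show ?thesis by blast
    qed
    then obtain e \<rho> \<alpha> where P: "\<And>t. t \<in> ?T \<Longrightarrow> P t (e t) (\<rho> t) (\<alpha> t)" by metis
    have Psub: "\<forall>a\<in>?R t z1. ball a (\<rho> t a) \<subseteq> ball t (r t)" if "t \<in> ?T" for t
      using P[OF that] unfolding P_def by (elim conjE)
    have Pdisj: "\<forall>a\<in>?R t z1. \<forall>b\<in>?R t z1. a \<noteq> b \<longrightarrow> ball a (\<rho> t a) \<inter> ball b (\<rho> t b) = {}" if "t \<in> ?T" for t
      using P[OF that] unfolding P_def by (elim conjE)
    have Phol: "\<forall>a\<in>?R t z1. holomorphic_Cn (\<alpha> t a) (ball z1 (e t))" if "t \<in> ?T" for t
      using P[OF that] unfolding P_def by (elim conjE)
    have Prt: "\<forall>a\<in>?R t z1. \<forall>z\<in>ball z1 (e t). roots_in (f t) i a (\<rho> t a) z = {\<alpha> t a z}" if "t \<in> ?T" for t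
      using P[OF that] unfolding P_def by (elim conjE)
    have Pim: "\<forall>z\<in>ball z1 (e t). ?R t z = (\<lambda>a. \<alpha> t a z) ` ?R t z1" if "t \<in> ?T" for t
      using P[OF that] unfolding P_def by (elim conjE)
    have et: "e t > 0" if "t \<in> ?T" for t
      using P[OF that] unfolding P_def by (elim conjE)
    define E where "E = Min (insert 1 (e ` ?T))"
    obtain e0 where e0: "e0 > 0" "ball z1 e0 \<subseteq> ?B" using z1 by (meson open_ball open_contains_ball)
    have "finite (insert 1 (e ` ?T))" using fin by (intro finite.insertI finite_imageI)
    then have E0: "E > 0" unfolding E_def
    proof (subst Min_gr_iff)
      show "\<forall>a\<in>insert 1 (e ` ?T). 0 < a" using et zero_less_one[where 'a = real] by blast
    qed simp_all
    have Ee: "E \<le> e t" if "t \<in> ?T" for t unfolding E_def by (rule Min_le) (use fin that in auto)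
    define V where "V = ball z1 (min E e0)"
    have V: "open V" "connected V" "z1 \<in> V" "V \<subseteq> ?B" using E0 e0 by (auto simp: V_def)
    have Vt: "V \<subseteq> ball z1 (e t)" if "t \<in> ?T" for t using Ee[OF that] by (auto simp: V_def)
    have alt: "(\<forall>z\<in>V. vupd z i (\<alpha> t a z) \<in> H) \<or> (\<forall>z\<in>V. vupd z i (\<alpha> t a z) \<notin> H)"
      if t: "t \<in> ?T" and a: "a \<in> ?R t z1" for t a
    proof (rule sheet_alternative[OF H gd V(1,2)])
      show "holomorphic_Cn (\<alpha> t a) V"
        by (rule holomorphic_Cn_subset[OF bspec[OF Phol[OF t] a] Vt[OF t]])
      fix z assume z: "z \<in> V"
      have rts: "roots_in (f t) i a (\<rho> t a) x = {\<alpha> t a x}" if "x \<in> V" for x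
        by (rule Prt[OF t, rule_format, OF a subsetD[OF Vt[OF t] that]])
      have "\<alpha> t a z \<in> ball a (\<rho> t a)" using rts[OF z] unfolding roots_in_def by blast
      then obtain \<eta> where \<eta>: "\<eta> > 0" "ball (\<alpha> t a z) \<eta> \<subseteq> ball a (\<rho> t a)" by (meson open_ball open_contains_ball)
      have "s = \<alpha> t a x" if "x \<in> V \<inter> ball z \<eta>" "s \<in> ball (\<alpha> t a z) \<eta>" "vupd x i s \<in> H" for x s
      proof -
        have s: "s \<in> ball a (\<rho> t a)" using that(2) \<eta>(2) by blast
        then have "s \<in> ball t (r t)" using bspec[OF Psub[OF t] a] by blast
        then have "s \<in> ?R t x" using rootH[OF t _ _ that(3)] V(4) that(1) by blast
        then have "s \<in> roots_in (f t) i a (\<rho> t a) x" using s by (simp add: roots_in_def)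
        then show ?thesis using rts that(1) by blast
      qed
      then show "\<exists>\<eta>>0. \<forall>x\<in>V \<inter> ball z \<eta>. \<forall>s\<in>ball (\<alpha> t a z) \<eta>. vupd x i s \<in> H \<longrightarrow> s = \<alpha> t a x"
        using \<eta>(1) by blast
    qed
    \<comment> \<open>The sheets that meet \<open>H\<close> over \<open>z1\<close>; by
      \<open>alt\<close> these lie in \<open>H\<close> over all of \<open>V\<close>, while the
      remaining ones avoid it.\<close>
    define A where "A = {p \<in> Sigma ?T (\<lambda>t. ?R t z1). vupd z1 i (\<alpha> (fst p) (snd p) z1) \<in> H}"
    have finA: "finite A"
    proof -
      have "finite (Sigma ?T (\<lambda>t. ?R t z1))"
        using fin finite_roots_in[OF rd z1] by (intro finite_SigmaI) auto
      then show ?thesis unfolding A_def by simp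
    qed
    let ?\<alpha> = "\<lambda>p. \<alpha> (fst p) (snd p)"
    have inH: "vupd z i (?\<alpha> p z) \<in> H" if "p \<in> A" "z \<in> V" for p z
      using alt[of "fst p" "snd p"] that V(3) unfolding A_def by auto
    have inball: "?\<alpha> p z \<in> ball (snd p) (\<rho> (fst p) (snd p))" "ball (snd p) (\<rho> (fst p) (snd p)) \<subseteq> ball (fst p) (r (fst p))"
      if p: "p \<in> A" and z: "z \<in> V" for p z
    proof -
      have t: "fst p \<in> ?T" and a: "snd p \<in> ?R (fst p) z1" using p unfolding A_def by auto
      have "roots_in (f (fst p)) i (snd p) (\<rho> (fst p) (snd p)) z = {?\<alpha> p z}"
        by (rule Prt[OF t, rule_format, OF a subsetD[OF Vt[OF t] z]])
      then show "?\<alpha> p z \<in> ball (snd p) (\<rho> (fst p) (snd p))" unfolding roots_in_def by blast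
      show "ball (snd p) (\<rho> (fst p) (snd p)) \<subseteq> ball (fst p) (r (fst p))"
        by (rule bspec[OF Psub[OF t] a])
    qed
    have "inj_on (\<lambda>p. ?\<alpha> p z) A" if z: "z \<in> V" for z
    proof (rule inj_onI)
      fix p q assume p: "p \<in> A" and q: "q \<in> A" and eq: "?\<alpha> p z = ?\<alpha> q z"
      have tp: "fst p \<in> ?T" "snd p \<in> ?R (fst p) z1" and tq: "fst q \<in> ?T" "snd q \<in> ?R (fst q) z1"
        using p q unfolding A_def by auto
      have "fst p = fst q"
        using disj[OF tp(1) tq(1)] inball[OF p z] inball[OF q z] eq by (metis IntI emptyE subsetD)
      moreover have "snd p = snd q"
      proof (rule ccontr)
        assume ne: "snd p \<noteq> snd q"
        have "ball (snd p) (\<rho> (fst p) (snd p)) \<inter> ball (snd q) (\<rho> (fst p) (snd q)) = {}"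
          using Pdisj[OF tp(1), rule_format, OF tp(2) _ ne] tq(2) \<open>fst p = fst q\<close> by simp
        then show False using inball(1)[OF p z] inball(1)[OF q z] eq \<open>fst p = fst q\<close> by (metis IntI emptyE)
      qed
      ultimately show "p = q" by (rule prod_eqI)
    qed
    moreover have "{t. vupd z i t \<in> H} = (\<lambda>p. ?\<alpha> p z) ` A" if z: "z \<in> V" for z
    proof (intro equalityI subsetI)
      fix s assume "s \<in> {t. vupd z i t \<in> H}"
      then have s: "vupd z i s \<in> H" by simp
      have zB: "z \<in> ?B" using z V(4) by blast
      obtain t where t: "t \<in> ?T" "s \<in> ball t (r t)" using cov[OF zB s] by (elim bexE)
      have "s \<in> ?R t z" by (rule rootH[OF t(1) zB t(2) s])
      moreover have "?R t z = (\<lambda>a. \<alpha> t a z) ` ?R t z1"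
        by (rule bspec[OF Pim[OF t(1)] subsetD[OF Vt[OF t(1)] z]])
      ultimately obtain a where a: "a \<in> ?R t z1" "s = \<alpha> t a z" by blast
      have "vupd z1 i (\<alpha> t a z1) \<in> H" using alt[OF t(1) a(1)] s a(2) z V(3) by blast
      then have "(t, a) \<in> A" using t(1) a(1) unfolding A_def by auto
      then show "s \<in> (\<lambda>p. ?\<alpha> p z) ` A" using a(2) by force
    next
      fix s assume "s \<in> (\<lambda>p. ?\<alpha> p z) ` A"
      then show "s \<in> {t. vupd z i t \<in> H}" using inH[OF _ z] by blast
    qed
    moreover have "holomorphic_Cn (?\<alpha> p) V" if "p \<in> A" for p
    proof -
      have t: "fst p \<in> ?T" and a: "snd p \<in> ?R (fst p) z1" using that unfolding A_def by auto
      show ?thesis by (rule holomorphic_Cn_subset[OF bspec[OF Phol[OF t] a] Vt[OF t]])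
    qed
    ultimately show ?thesis unfolding unramified_def using V(1,3) finA
      by (intro CollectI exI[of _ V] exI[of _ A] exI[of _ ?\<alpha>] conjI ballI) assumption+
  qed
  show ?thesis
  proof (rule that[OF \<epsilon>])
    show "holomorphic_Cn (\<lambda>z. \<Prod>t\<in>?T. \<delta> t z) ?B" by (intro holomorphic_Cn_prod \<delta>(1))
    show "\<exists>z\<in>?B. (\<Prod>t\<in>?T. \<delta> t z) \<noteq> 0"
    proof -
      have "\<exists>z\<in>?B. \<forall>t\<in>?T. \<delta> t z \<noteq> 0"
        by (rule nonzero_point_finite[OF fin open_ball convex_ball neB]) (rule \<delta>; assumption)+
      then obtain z where "z \<in> ?B" "\<forall>t\<in>?T. \<delta> t z \<noteq> 0" by (elim bexE)
      then have "(\<Prod>t\<in>?T. \<delta> t z) \<noteq> 0" by (subst prod_zero_iff[OF fin]) blast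
      then show ?thesis using \<open>z \<in> ?B\<close> by (rule bexI)
    qed
    show "z \<in> unramified i H" if "z \<in> ?B" "(\<Prod>t\<in>?T. \<delta> t z) \<noteq> 0" for z
    proof (rule unr[OF that(1)])
      show "\<delta> t z \<noteq> 0" if "t \<in> ?T" for t
      proof
        assume "\<delta> t z = 0"
        then have "(\<Prod>t\<in>?T. \<delta> t z) = 0" using that by (intro prod_zero[OF fin] bexI)
        with \<open>(\<Prod>t\<in>?T. \<delta> t z) \<noteq> 0\<close> show False by (rule notE)
      qed
    qed
  qed
qed

section \<open>Removable singularities and polynomial growth\<close>

lemma holomorphic_extend_finite:
  assumes "finite Z" "open S" "f holomorphic_on S - Z" "\<And>z. z \<in> S - Z \<Longrightarrow> norm (f z) \<le> M"
  shows "\<exists>g. g holomorphic_on S \<and> (\<forall>z\<in>S - Z. g z = f z)"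
  using assms
proof (induction Z arbitrary: f S)
  case empty
  then show ?case by auto
next
  case (insert \<xi> Z)
  have *: "S - insert \<xi> Z = (S - {\<xi>}) - Z" by blast
  have "\<exists>g. g holomorphic_on S - {\<xi>} \<and> (\<forall>z\<in>(S - {\<xi>}) - Z. g z = f z)"
    by (rule insert.IH) (use insert.prems * in auto)
  then obtain g where g: "g holomorphic_on S - {\<xi>}" "\<And>z. z \<in> (S - {\<xi>}) - Z \<Longrightarrow> g z = f z" by blast
  show ?case
  proof (cases "\<xi> \<in> S")
    case False
    then show ?thesis using g by (intro exI[of _ g]) auto
  next
    case True
    have "open (S - Z)" using insert.hyps(1) insert.prems(1) by (simp add: finite_imp_closed open_Diff)
    moreover have "\<xi> \<in> S - Z" using True insert.hyps by blast
    ultimately have "eventually (\<lambda>z. z \<in> S - Z - {\<xi>}) (at \<xi>)" by (rule eventually_at_in_open)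
    then have "eventually (\<lambda>z. norm (g z) \<le> M) (at \<xi>)"
    proof eventually_elim
      case (elim z)
      then have "z \<in> (S - {\<xi>}) - Z" by blast
      then show ?case using g(2)[of z] insert.prems(3)[of z] * by simp
    qed
    moreover have "\<xi> \<in> interior S" using True insert.prems(1) by (simp add: interior_open)
    ultimately obtain h where h: "h holomorphic_on S" "\<And>z. z \<in> S - {\<xi>} \<Longrightarrow> h z = g z"
      using holomorphic_on_extend_bounded[OF g(1)] by blast
    have "h z = f z" if "z \<in> S - insert \<xi> Z" for z using h(2)[of z] g(2)[of z] that by auto
    then show ?thesis using h(1) by blast
  qed
qed

lemma tube_ball:
  fixes \<kappa> :: "'a::metric_space \<Rightarrow> 'b::metric_space \<Rightarrow> 'c::topological_space"
  assumes W: "open W" and K: "compact K" and \<kappa>: "continuous_on UNIV (\<lambda>p. \<kappa> (fst p) (snd p))"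
    and "\<And>t. t \<in> K \<Longrightarrow> \<kappa> z0 t \<in> W"
  obtains \<epsilon> where "\<epsilon> > 0" "\<And>z t. z \<in> ball z0 \<epsilon> \<Longrightarrow> t \<in> K \<Longrightarrow> \<kappa> z t \<in> W"
proof -
  have op: "open {p. \<kappa> (fst p) (snd p) \<in> W}"
    using open_vimage[OF W \<kappa>] by (simp add: vimage_def)
  have "{z0} \<times> K \<subseteq> {p. \<kappa> (fst p) (snd p) \<in> W}" using assms by auto
  then obtain X0 where X0: "z0 \<in> X0" "open X0" "X0 \<times> K \<subseteq> {p. \<kappa> (fst p) (snd p) \<in> W}"
    using Elementary_Topology.tube_lemma[OF K op] by blast
  then obtain \<epsilon> where \<epsilon>: "\<epsilon> > 0" "ball z0 \<epsilon> \<subseteq> X0" using open_contains_ball by blast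
  show ?thesis
  proof (rule that[OF \<epsilon>(1)])
    fix z t assume "z \<in> ball z0 \<epsilon>" "t \<in> K"
    then have "(z, t) \<in> X0 \<times> K" using \<epsilon> by blast
    then show "\<kappa> z t \<in> W" using X0(3) by auto
  qed
qed

lemma continuous_on_scalar_vec [continuous_intros]:
  "continuous_on S f \<Longrightarrow> continuous_on S (\<lambda>x. f x *s (v :: complex ^ 'n))"
  unfolding vector_scalar_mult_def by (intro continuous_on_vec_lambda continuous_intros)

text \<open>The extension is a Cauchy integral of \<open>q\<close> over translates of one circle, in
  a direction \<open>v\<close> along which \<delta> is not identically zero. On each single line
  \<open>q\<close> has finitely many singularities in the disc, all removable by boundedness, so the
  integral reproduces \<open>q\<close>.\<close>

lemma riemann_extension:
  fixes q :: "complex ^ 'n \<Rightarrow> complex"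
  assumes "\<epsilon> > 0" and \<delta>: "holomorphic_Cn \<delta> (ball z0 \<epsilon>)" and w: "w \<in> ball z0 \<epsilon>" "\<delta> w \<noteq> 0"
    and q: "holomorphic_Cn q {z \<in> ball z0 \<epsilon>. \<delta> z \<noteq> 0}"
    and M: "\<And>z. z \<in> ball z0 \<epsilon> \<Longrightarrow> \<delta> z \<noteq> 0 \<Longrightarrow> norm (q z) \<le> M"
  obtains \<rho> Q where "\<rho> > 0" "\<rho> \<le> \<epsilon>" "holomorphic_Cn Q (ball z0 \<rho>)"
    "\<And>z. z \<in> ball z0 \<rho> \<Longrightarrow> \<delta> z \<noteq> 0 \<Longrightarrow> Q z = q z"
proof -
  let ?B = "ball z0 \<epsilon>" and ?G = "{z \<in> ball z0 \<epsilon>. \<delta> z \<noteq> 0}"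
  have opG: "open ?G"
  proof -
    have "open (\<delta> -` (- {0}) \<inter> ?B)"
      using continuous_on_open_vimage[OF open_ball] holomorphic_Cn_continuous_on[OF \<delta>] by blast
    moreover have "\<delta> -` (- {0}) \<inter> ?B = ?G" by auto
    ultimately show ?thesis by simp
  qed
  show ?thesis
  proof (cases "\<delta> z0 = 0")
    case False
    then have "z0 \<in> ?G" using \<open>\<epsilon> > 0\<close> by simp
    then obtain \<rho> where "\<rho> > 0" "ball z0 \<rho> \<subseteq> ?G" using opG open_contains_ball by blast
    then have "min \<rho> \<epsilon> > 0" "min \<rho> \<epsilon> \<le> \<epsilon>" "ball z0 (min \<rho> \<epsilon>) \<subseteq> ?G" using \<open>\<epsilon> > 0\<close> by auto
    then show ?thesis using that[of "min \<rho> \<epsilon>" q] holomorphic_Cn_subset[OF q] by blast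
  next
    case True
    \<comment> \<open>Along this direction \<delta> vanishes at parameter \<open>0\<close> but not
      at parameter \<open>1\<close>, so its zero at \<open>0\<close> is isolated on the
      line.\<close>
    define v where "v = w - z0"
    note line = holomorphic_Cn_line[OF \<delta> open_ball, of z0 v]
    let ?S = "{t. z0 + t *s v \<in> ?B}"
    have nv: "norm (t *s v) = norm t * norm v" for t :: complex
    proof -
      have "L2_set (\<lambda>i. norm t * norm (v $ i)) UNIV = norm t * L2_set (\<lambda>i. norm (v $ i)) UNIV"
        by (rule L2_set_right_distrib[symmetric]) simp
      then show ?thesis by (simp add: norm_vec_def norm_mult)
    qed
    have S_eq: "?S = {t. norm t * norm v < \<epsilon>}" by (simp add: dist_norm nv)
    have v0: "norm v > 0" using True w by (auto simp: v_def)
    have S_ball: "?S = ball 0 (\<epsilon> / norm v)"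
      unfolding S_eq using v0 by (auto simp: dist_norm field_simps)
    have 1: "1 \<in> ?S" "\<delta> (z0 + 1 *s v) \<noteq> 0" using w by (auto simp: v_def)
    have 0: "0 \<in> ?S" "\<delta> (z0 + 0 *s v) = 0" using True \<open>\<epsilon> > 0\<close> by (auto simp: S_eq)
    obtain r0 where r0: "0 < r0" "ball 0 r0 \<subseteq> ?S" "\<And>t. t \<in> ball 0 r0 - {0} \<Longrightarrow> \<delta> (z0 + t *s v) \<noteq> 0"
    proof (rule isolated_zeros[OF line(1) line(2) _ 0 1])
      show "connected ?S" unfolding S_ball by simp
    qed (rule that)
    define r where "r = r0 / 2"
    have r: "r > 0" "cball 0 r \<subseteq> ball 0 r0" using r0(1) by (auto simp: r_def)
    have cont\<kappa>: "continuous_on UNIV (\<lambda>p. fst p + snd p *s v)" by (intro continuous_intros)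
    obtain \<rho>1 where \<rho>1: "\<rho>1 > 0" "\<And>z t. z \<in> ball z0 \<rho>1 \<Longrightarrow> t \<in> cball 0 r \<Longrightarrow> z + t *s v \<in> ?B"
      by (rule tube_ball[OF open_ball compact_cball cont\<kappa>, of 0 r z0 z0 \<epsilon>]) (use r(2) r0(2) in blast, rule that)
    have sph: "z0 + t *s v \<in> ?G" if "t \<in> sphere 0 r" for t
    proof -
      have "t \<in> cball 0 r" "t \<noteq> 0" using that r(1) by auto
      then have "t \<in> ball 0 r0 - {0}" using r(2) by blast
      then show ?thesis using r0(2,3) by blast
    qed
    obtain \<rho>2 where \<rho>2: "\<rho>2 > 0" "\<And>z t. z \<in> ball z0 \<rho>2 \<Longrightarrow> t \<in> sphere 0 r \<Longrightarrow> z + t *s v \<in> ?G"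
      by (rule tube_ball[OF opG compact_sphere cont\<kappa> sph]) (assumption, rule that)
    define \<rho> where "\<rho> = min \<epsilon> (min \<rho>1 \<rho>2)"
    have \<rho>: "\<rho> > 0" "\<rho> \<le> \<epsilon>" "ball z0 \<rho> \<subseteq> ball z0 \<rho>1" "ball z0 \<rho> \<subseteq> ball z0 \<rho>2"
      using \<open>\<epsilon> > 0\<close> \<rho>1(1) \<rho>2(1) by (auto simp: \<rho>_def)
    define Q where "Q z = 1 / (2 * pi * \<i>) * contour_integral (circlepath 0 r) (\<lambda>t. q (z + t *s v) / t)" for z
    have inG: "z + t *s v \<in> ?G" if "z \<in> ball z0 \<rho>" "t \<in> sphere 0 r" for z t
      using \<rho>2(2) \<rho>(4) that by blast
    show ?thesis
    proof (rule that[OF \<rho>(1,2)])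
      show "holomorphic_Cn Q (ball z0 \<rho>)"
        unfolding Q_def
      proof (intro holomorphic_Cn_mult holomorphic_Cn_const holomorphic_Cn_contour_integral[OF open_ball r(1)])
        show "holomorphic_Cn (\<lambda>z. q (z + t *s v) / t) (ball z0 \<rho>)" if t: "t \<in> sphere 0 r" for t
        proof (intro holomorphic_Cn_divide holomorphic_Cn_const)
          have "(\<lambda>z. z + t *s v) ` ball z0 \<rho> \<subseteq> ?G" using inG[OF _ t] by blast
          then show "holomorphic_Cn (\<lambda>z. q (z + t *s v)) (ball z0 \<rho>)"
            by (intro holomorphic_Cn_compose[OF q, of "\<lambda>z. z + t *s v"]) (auto intro!: holomorphic_Cn_add)
        qed (use t r(1) in auto)
        show "continuous_on (ball z0 \<rho> \<times> sphere 0 r) (\<lambda>(z, t). q (z + t *s v) / t)"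
          unfolding split_beta
        proof (intro continuous_on_divide)
          show "continuous_on (ball z0 \<rho> \<times> sphere 0 r) (\<lambda>p. q (fst p + snd p *s v))"
            by (rule continuous_on_compose2[OF holomorphic_Cn_continuous_on[OF q]])
              (use inG in \<open>force intro!: continuous_intros\<close>)+
        qed (use r(1) in \<open>auto intro!: continuous_intros\<close>)
      qed
      fix z assume z: "z \<in> ball z0 \<rho>" "\<delta> z \<noteq> 0"
      let ?S = "{t. z + t *s v \<in> ?B}" and ?\<phi> = "\<lambda>t. \<delta> (z + t *s v)" and ?q = "\<lambda>t. q (z + t *s v)"
      note line = holomorphic_Cn_line[OF \<delta> open_ball, of z v]
      have Ssub: "cball 0 r \<subseteq> ?S" using \<rho>1(2) \<rho>(3) z(1) by blast
      have convS: "convex ?S"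
      proof -
        have "?S = {t. norm ((z - z0) + t *s v) < \<epsilon>}" by (simp add: dist_norm norm_minus_commute algebra_simps)
        also have "convex \<dots>"
        proof (rule convexI)
          fix x y :: complex and a b :: real
          assume xy: "x \<in> {t. norm ((z - z0) + t *s v) < \<epsilon>}" "y \<in> {t. norm ((z - z0) + t *s v) < \<epsilon>}" "0 \<le> a" "0 \<le> b" "a + b = 1"
          have "(z - z0) + (a *\<^sub>R x + b *\<^sub>R y) *s v = a *\<^sub>R ((z - z0) + x *s v) + b *\<^sub>R ((z - z0) + y *s v)"
          proof -
            have "a *\<^sub>R (z - z0) + b *\<^sub>R (z - z0) = z - z0" using xy(5) by (simp flip: scaleR_add_left)
            moreover have "(a *\<^sub>R x + b *\<^sub>R y) *s v = a *\<^sub>R (x *s v) + b *\<^sub>R (y *s v)"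
              by (simp add: vec_eq_iff algebra_simps)
            ultimately show ?thesis by (simp add: scaleR_add_right algebra_simps)
          qed
          moreover have "convex (ball (0 :: complex ^ 'n) \<epsilon>)" by simp
          ultimately show "a *\<^sub>R x + b *\<^sub>R y \<in> {t. norm ((z - z0) + t *s v) < \<epsilon>}"
            using convexD[OF \<open>convex (ball 0 \<epsilon>)\<close>, of "(z - z0) + x *s v" "(z - z0) + y *s v" a b] xy by simp
        qed
        finally show ?thesis .
      qed
      \<comment> \<open>If \<delta> is constant on the line through \<open>z\<close>, its value
        there is \<open>\<delta> z\<close>, which is nonzero. This covers the degenerate case of
        finiteness of the zeros.\<close>
      have nc: "\<not> ?\<phi> constant_on ?S \<or> (\<forall>t\<in>?S. ?\<phi> t \<noteq> 0)"
      proof (rule ccontr)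
        assume "\<not> ?thesis"
        then obtain t where "?\<phi> constant_on ?S" "t \<in> ?S" "?\<phi> t = 0" by blast
        moreover have "(0::complex) \<in> cball 0 r" using r(1) by simp
        then have "0 \<in> ?S" using Ssub by blast
        ultimately have "?\<phi> 0 = 0" unfolding constant_on_def by metis
        then show False using z(2) by simp
      qed
      have fin: "finite {t \<in> cball 0 r. ?\<phi> t = 0}"
      proof (cases "?\<phi> constant_on ?S")
        case True
        then have "{t \<in> cball 0 r. ?\<phi> t = 0} = {}" using nc Ssub by blast
        then show ?thesis by (metis finite.emptyI)
      next
        case False
        then show ?thesis
          by (intro holomorphic_compact_finite_zeros[OF line(1,2) convex_connected[OF convS]] Ssub) auto
      qed
      let ?Z = "{t \<in> cball 0 r. ?\<phi> t = 0}"
      \<comment> \<open>Continuity and holomorphy on the closed disc require a slightly larger one.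
        Since the circle is free of zeros, the enlargement can be chosen without new zeros.\<close>
      obtain R where R: "R > r" "ball 0 R \<subseteq> ?S" "\<And>t. t \<in> ball 0 R \<Longrightarrow> ?\<phi> t = 0 \<Longrightarrow> t \<in> ball 0 r"
      proof -
        let ?W = "{t. z + t *s v \<in> ?G}"
        have opW: "open ?W" using holomorphic_Cn_line(2)[OF holomorphic_Cn_const opG] .
        have opU: "open (?W \<union> ball 0 r)" using opW by blast
        have subU: "cball 0 r \<subseteq> ?W \<union> ball 0 r"
        proof
          fix t assume "t \<in> cball (0::complex) r"
          then have "t \<in> ball 0 r \<or> t \<in> sphere 0 r" by auto
          then show "t \<in> ?W \<union> ball 0 r" using inG[OF z(1)] by blast
        qed
        obtain e where e: "e > 0" "(\<Union>t\<in>cball 0 r. ball t e) \<subseteq> ?W \<union> ball 0 r"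
          by (rule compact_subset_open_imp_ball_epsilon_subset[OF compact_cball opU subU]) (rule that)
        have R: "t \<in> ?W \<union> ball 0 r" if "t \<in> ball 0 (r + e)" for t
        proof (cases "t \<in> cball 0 r")
          case True
          then have "t \<in> (\<Union>t\<in>cball 0 r. ball t e)" using e(1) by (intro UN_I[of t]) auto
          then show ?thesis using e(2) by blast
        next
          case False
          define s where "s = (r / norm t) *\<^sub>R t"
          have nt: "norm t > r" "norm t < r + e" using False that by auto
          have "t \<noteq> 0" using nt r(1) by auto
          then have "norm s = r" using r(1) by (simp add: s_def)
          moreover have "dist s t < e"
          proof -
            have "s - t = (r / norm t - 1) *\<^sub>R t" by (simp add: s_def algebra_simps)
            then have "dist s t = \<bar>r / norm t - 1\<bar> * norm t" by (simp add: dist_norm)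
            also have "\<dots> = norm t - r" using nt r(1) \<open>t \<noteq> 0\<close> by (simp add: abs_if field_simps)
            finally show ?thesis using nt by simp
          qed
          ultimately have "t \<in> (\<Union>t\<in>cball 0 r. ball t e)" by (intro UN_I[of s]) auto
          then show ?thesis using e(2) by blast
        qed
        show ?thesis
        proof (rule that[of "r + e"])
          show "ball 0 (r + e) \<subseteq> ?S"
          proof
            fix t :: complex assume "t \<in> ball 0 (r + e)"
            from R[OF this] show "t \<in> ?S" using Ssub ball_subset_cball by blast
          qed
          show "t \<in> ball 0 r" if "t \<in> ball 0 (r + e)" "?\<phi> t = 0" for t using R[OF that(1)] that(2) by blast
        qed (use e in simp)
      qed
      let ?T = "ball 0 R"
      have holq: "?q holomorphic_on ?T - ?Z"
      proof -
        have "?T - ?Z \<subseteq> {t. z + t *s v \<in> ?G}"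
        proof
          fix t assume t: "t \<in> ?T - ?Z"
          have "?\<phi> t \<noteq> 0"
          proof
            assume "?\<phi> t = 0"
            then have "t \<in> ball 0 r" using R(3) t by blast
            then have "t \<in> ?Z" using \<open>?\<phi> t = 0\<close> ball_subset_cball by blast
            then show False using t by blast
          qed
          then show "t \<in> {t. z + t *s v \<in> ?G}" using R(2) t by blast
        qed
        then show ?thesis using holomorphic_Cn_line(1)[OF q opG, of z v] holomorphic_on_subset by blast
      qed
      have "norm (?q t) \<le> M" if t: "t \<in> ?T - ?Z" for t
      proof -
        have "?\<phi> t \<noteq> 0"
        proof
          assume "?\<phi> t = 0"
          then have "t \<in> ball 0 r" using R(3) t by blast
          then have "t \<in> ?Z" using \<open>?\<phi> t = 0\<close> ball_subset_cball by blast
          then show False using t by blast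
        qed
        then show ?thesis using M R(2) t by blast
      qed
      then obtain g where g: "g holomorphic_on ?T" "\<forall>t\<in>?T - ?Z. g t = ?q t"
        using holomorphic_extend_finite[OF fin open_ball holq] by blast
      have g0: "g 0 = q z"
      proof -
        have "0 \<in> ?T - ?Z" using R(1) r(1) z(2) by auto
        then have "g 0 = ?q 0" using g(2) by blast
        then show ?thesis by simp
      qed
      have gs: "g t = ?q t" if "t \<in> sphere 0 r" for t
      proof -
        have "?\<phi> t \<noteq> 0" using inG[OF z(1) that] by blast
        moreover have "t \<in> ?T" using that R(1) by simp
        ultimately show ?thesis using g(2) by blast
      qed
      have "((\<lambda>t. g t / (t - 0)) has_contour_integral 2 * of_real pi * \<i> * g 0) (circlepath 0 r)"
      proof (rule Cauchy_integral_circlepath)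
        have "cball 0 r \<subseteq> ?T" using R(1) by auto
        then show "continuous_on (cball 0 r) g"
          using g(1) holomorphic_on_imp_continuous_on holomorphic_on_subset by blast
        have "ball 0 r \<subseteq> ?T" using R(1) by auto
        then show "g holomorphic_on ball 0 r" using g(1) holomorphic_on_subset by blast
      qed (use r(1) in simp)
      then have "((\<lambda>t. ?q t / t) has_contour_integral 2 * of_real pi * \<i> * g 0) (circlepath 0 r)"
        by (rule has_contour_integral_eq) (use gs r(1) in auto)
      then have "contour_integral (circlepath 0 r) (\<lambda>t. ?q t / t) = 2 * of_real pi * \<i> * g 0"
        by (rule contour_integral_unique)
      then show "Q z = q z" by (simp add: Q_def g0)
    qed
  qed
qed

section \<open>Extension across thin sets\<close>

definition thin_complement :: "(complex ^ 'n) set \<Rightarrow> bool" where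
  "thin_complement D \<longleftrightarrow> open D \<and> (\<forall>z0. \<exists>\<epsilon>>0. \<exists>\<delta>. holomorphic_Cn \<delta> (ball z0 \<epsilon>) \<and> (\<exists>z\<in>ball z0 \<epsilon>. \<delta> z \<noteq> 0) \<and>
     (\<forall>z\<in>ball z0 \<epsilon>. \<delta> z \<noteq> 0 \<longrightarrow> z \<in> D))"

lemma nonzero_on_smaller_ball:
  assumes "holomorphic_Cn \<delta> (ball z0 \<epsilon>)" "\<exists>z\<in>ball z0 \<epsilon>. \<delta> z \<noteq> 0" "0 < \<rho>" "\<rho> \<le> \<epsilon>"
  shows "\<exists>z\<in>ball z0 \<rho>. \<delta> z \<noteq> 0"
proof (rule ccontr)
  assume *: "\<not> ?thesis"
  have "ball z0 \<rho> \<subseteq> ball z0 \<epsilon>" using assms by auto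
  then have "\<delta> w = 0" if "w \<in> ball z0 \<epsilon>" for w
    using holomorphic_Cn_eq_0_on_convex[OF assms(1) open_ball convex_ball open_ball _ _ _ that, of z0 \<rho>] * assms(3)
    by auto
  then show False using assms(2) by blast
qed

lemma thin_complement_dense:
  assumes "thin_complement D" "e > 0"
  shows "\<exists>z\<in>D. dist z0 z < e"
proof -
  obtain \<epsilon> \<delta> where *: "\<epsilon> > 0" "holomorphic_Cn \<delta> (ball z0 \<epsilon>)" "\<exists>z\<in>ball z0 \<epsilon>. \<delta> z \<noteq> 0"
    "\<forall>z\<in>ball z0 \<epsilon>. \<delta> z \<noteq> 0 \<longrightarrow> z \<in> D" using assms(1) unfolding thin_complement_def by metis
  have "\<exists>z\<in>ball z0 (min \<epsilon> e). \<delta> z \<noteq> 0" by (rule nonzero_on_smaller_ball[OF *(2,3)]) (use *(1) assms(2) in auto)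
  then show ?thesis using *(4) by auto
qed

lemma thin_complement_closure: "thin_complement D \<Longrightarrow> closure D = UNIV"
  using thin_complement_dense by (fastforce simp: closure_approachable dist_commute)

text \<open>Each local extension is the continuous extension of \<open>q\<close> from the dense set
  \<open>D\<close>, so any two of them agree on overlaps.\<close>

lemma extension_across_thin:
  fixes q :: "complex ^ 'n \<Rightarrow> complex"
  assumes D: "thin_complement D" and q: "holomorphic_Cn q D"
    and bd: "\<And>z0. \<exists>\<epsilon>>0. \<exists>M. \<forall>z\<in>D \<inter> ball z0 \<epsilon>. norm (q z) \<le> M"
  obtains Q where "holomorphic_Cn Q UNIV" "\<And>z. z \<in> D \<Longrightarrow> Q z = q z"
proof -
  have opD: "open D" using D by (simp add: thin_complement_def)
  have contq: "continuous_on D q" by (rule holomorphic_Cn_continuous_on[OF q])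
  have loc: "\<exists>\<rho>>0. \<exists>F. holomorphic_Cn F (ball z0 \<rho>) \<and> (\<forall>z\<in>ball z0 \<rho> \<inter> D. F z = q z)" for z0
  proof -
    obtain \<epsilon> \<delta> where *: "\<epsilon> > 0" "holomorphic_Cn \<delta> (ball z0 \<epsilon>)" "\<exists>z\<in>ball z0 \<epsilon>. \<delta> z \<noteq> 0"
      "\<forall>z\<in>ball z0 \<epsilon>. \<delta> z \<noteq> 0 \<longrightarrow> z \<in> D" using D unfolding thin_complement_def by metis
    obtain \<epsilon>' M where M: "\<epsilon>' > 0" "\<forall>z\<in>D \<inter> ball z0 \<epsilon>'. norm (q z) \<le> M" using bd by metis
    define e where "e = min \<epsilon> \<epsilon>'"
    have e: "e > 0" "e \<le> \<epsilon>" "ball z0 e \<subseteq> ball z0 \<epsilon>" "ball z0 e \<subseteq> ball z0 \<epsilon>'" using *(1) M(1) by (auto simp: e_def)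
    obtain w where w: "w \<in> ball z0 e" "\<delta> w \<noteq> 0" using nonzero_on_smaller_ball[OF *(2,3) e(1,2)] by blast
    have \<delta>e: "holomorphic_Cn \<delta> (ball z0 e)" by (rule holomorphic_Cn_subset[OF *(2) e(3)])
    have sub: "{z \<in> ball z0 e. \<delta> z \<noteq> 0} \<subseteq> D" using *(4) e(3) by blast
    obtain \<rho> F where F: "\<rho> > 0" "\<rho> \<le> e" "holomorphic_Cn F (ball z0 \<rho>)" "\<And>z. z \<in> ball z0 \<rho> \<Longrightarrow> \<delta> z \<noteq> 0 \<Longrightarrow> F z = q z"
    proof (rule riemann_extension[OF e(1) \<delta>e w holomorphic_Cn_subset[OF q sub]])
      show "norm (q z) \<le> M" if "z \<in> ball z0 e" "\<delta> z \<noteq> 0" for z using M(2) e(4) sub that by blast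
    qed (rule that)
    \<comment> \<open>\<open>riemann_extension\<close> yields equality only where \<delta> is
      nonzero, but \<open>D\<close> may contain zeros of \<delta>. A difference at such a point
      would persist on an open set, on which \<delta> would have to vanish.\<close>
    have "F z = q z" if z: "z \<in> ball z0 \<rho> \<inter> D" for z
    proof (rule ccontr)
      assume "F z \<noteq> q z"
      have "open (ball z0 \<rho> \<inter> D)" using opD by blast
      moreover have "continuous_on (ball z0 \<rho> \<inter> D) (\<lambda>z. F z - q z)"
        by (intro continuous_intros continuous_on_subset[OF contq] continuous_on_subset[OF holomorphic_Cn_continuous_on[OF F(3)]]) auto
      ultimately have "open ((\<lambda>z. F z - q z) -` (- {0}) \<inter> (ball z0 \<rho> \<inter> D))"
        using continuous_on_open_vimage by blast
      moreover have "z \<in> (\<lambda>z. F z - q z) -` (- {0}) \<inter> (ball z0 \<rho> \<inter> D)" using z \<open>F z \<noteq> q z\<close> by simp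
      moreover have "\<delta> x = 0" if "x \<in> (\<lambda>z. F z - q z) -` (- {0}) \<inter> (ball z0 \<rho> \<inter> D)" for x
      proof (rule ccontr)
        assume "\<delta> x \<noteq> 0"
        then have "F x = q x" using F(4) that by blast
        then show False using that by simp
      qed
      moreover have "(\<lambda>z. F z - q z) -` (- {0}) \<inter> (ball z0 \<rho> \<inter> D) \<subseteq> ball z0 e" using F(2) by auto
      ultimately have "\<delta> w = 0"
        using holomorphic_Cn_eq_0_on_convex[OF \<delta>e open_ball convex_ball _ _ _ _ w(1)] by blast
      then show False using w(2) by blast
    qed
    then show ?thesis using F(1,3) by blast
  qed
  \<comment> \<open>The limit along \<open>D\<close> avoids a choice among the local
    extensions.\<close>
  define Q where "Q z = Lim (at z within D) q" for z
  have QF: "Q z = F z" if F: "holomorphic_Cn F (ball z0 \<rho>)" "\<forall>z\<in>ball z0 \<rho> \<inter> D. F z = q z" and z: "z \<in> ball z0 \<rho>" for F z0 \<rho> z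
  proof -
    have "isCont F z" by (rule holomorphic_Cn_isCont[OF F(1) z])
    then have "(F \<longlongrightarrow> F z) (at z within D)" by (simp add: isCont_def tendsto_within_subset[of F _ z UNIV])
    moreover have "eventually (\<lambda>x. F x = q x) (at z within D)"
    proof -
      have "eventually (\<lambda>x. x \<in> ball z0 \<rho>) (at z within D)"
        using z eventually_at_in_open'[OF open_ball z] by (rule_tac filter_leD[OF at_le]) auto
      moreover have "eventually (\<lambda>x. x \<in> D) (at z within D)" by (simp add: eventually_at_filter)
      ultimately show ?thesis by eventually_elim (use F(2) in blast)
    qed
    ultimately have "(q \<longlongrightarrow> F z) (at z within D)" by (rule Lim_transform_eventually)
    moreover have "at z within D \<noteq> bot"
    proof -
      have "z islimpt D"
      proof (subst islimpt_approachable, intro allI impI)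
        fix e :: real assume "e > 0"
        have "z islimpt (UNIV :: (complex ^ 'n) set)" by (rule islimpt_UNIV)
        then obtain y where y: "y \<noteq> z" "dist y z < e / 2"
          using \<open>e > 0\<close> islimpt_approachable[of z UNIV] by (metis half_gt_zero)
        then have "dist y z > 0" by simp
        then obtain x where x: "x \<in> D" "dist y x < dist y z" using thin_complement_dense[OF D] by blast
        then have "x \<noteq> z" by auto
        moreover have "dist x z < e"
          using dist_triangle[of x z y] x(2) y(2) by (simp add: dist_commute)
        ultimately show "\<exists>x'\<in>D. x' \<noteq> z \<and> dist x' z < e" using x(1) by blast
      qed
      then show ?thesis by (simp add: trivial_limit_within)
    qed
    ultimately show ?thesis unfolding Q_def by (intro tendsto_Lim)
  qed
  have "holomorphic_Cn Q UNIV"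
  proof (rule holomorphic_Cn_local)
    fix z0 :: "complex ^ 'n"
    obtain \<rho> F where F: "\<rho> > 0" "holomorphic_Cn F (ball z0 \<rho>)" "\<forall>z\<in>ball z0 \<rho> \<inter> D. F z = q z" using loc by blast
    have "holomorphic_Cn Q (ball z0 \<rho>)"
      by (rule holomorphic_Cn_transform[OF F(2) open_ball]) (simp add: QF[OF F(2,3)])
    then show "\<exists>V. open V \<and> z0 \<in> V \<and> holomorphic_Cn Q V" using F(1) by (intro exI[of _ "ball z0 \<rho>"]) simp
  qed
  moreover have "Q z = q z" if "z \<in> D" for z
  proof -
    obtain \<rho> F where F: "\<rho> > 0" "holomorphic_Cn F (ball z \<rho>)" "\<forall>x\<in>ball z \<rho> \<inter> D. F x = q x" using loc by blast
    have "z \<in> ball z \<rho>" using F(1) by simp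
    then show ?thesis using QF[OF F(2,3)] F(3) that by auto
  qed
  ultimately show ?thesis using that by blast
qed

section \<open>Polynomial functions\<close>

definition polyfun :: "(complex ^ 'n \<Rightarrow> complex) \<Rightarrow> bool" where
  "polyfun f \<longleftrightarrow> (\<exists>p. f = poly_eval p)"

abbreviation monomial_fun :: "('n::finite \<Rightarrow>\<^sub>0 nat) \<Rightarrow> complex ^ 'n \<Rightarrow> complex" where
  "monomial_fun \<alpha> z \<equiv> (\<Prod>i\<in>UNIV. z $ i ^ Poly_Mapping.lookup \<alpha> i)"

lemma poly_eval_superset:
  assumes "finite K" "Poly_Mapping.keys p \<subseteq> K"
  shows "poly_eval p z = (\<Sum>\<alpha>\<in>K. Poly_Mapping.lookup p \<alpha> * monomial_fun \<alpha> z)"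
  unfolding poly_eval_def using assms
  by (intro sum.mono_neutral_left) (auto simp: in_keys_iff)

lemma poly_eval_add: "poly_eval (p + q) z = poly_eval p z + poly_eval q z"
proof -
  let ?K = "Poly_Mapping.keys p \<union> Poly_Mapping.keys q"
  have "poly_eval (p + q) z = (\<Sum>\<alpha>\<in>?K. Poly_Mapping.lookup (p + q) \<alpha> * monomial_fun \<alpha> z)"
    by (rule poly_eval_superset) (auto dest: subsetD[OF keys_add])
  also have "\<dots> = (\<Sum>\<alpha>\<in>?K. Poly_Mapping.lookup p \<alpha> * monomial_fun \<alpha> z) + (\<Sum>\<alpha>\<in>?K. Poly_Mapping.lookup q \<alpha> * monomial_fun \<alpha> z)"
    by (simp add: lookup_add distrib_right sum.distrib)
  also have "\<dots> = poly_eval p z + poly_eval q z"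
    using poly_eval_superset[of ?K p z] poly_eval_superset[of ?K q z] by simp
  finally show ?thesis .
qed

lemma poly_eval_single: "poly_eval (Poly_Mapping.single \<alpha> c) z = c * monomial_fun \<alpha> z"
  by (cases "c = 0") (simp_all add: poly_eval_def)

lemma polyfun_monomial: "polyfun (\<lambda>z. c * monomial_fun \<alpha> z)"
  unfolding polyfun_def by (rule exI[of _ "Poly_Mapping.single \<alpha> c"]) (simp add: poly_eval_single fun_eq_iff)

lemma polyfun_const [simp]: "polyfun (\<lambda>_. c)"
  using polyfun_monomial[of c 0] by simp

lemma polyfun_add:
  assumes "polyfun f" "polyfun g" shows "polyfun (\<lambda>z. f z + g z)"
proof -
  obtain p q where "f = poly_eval p" "g = poly_eval q" using assms by (auto simp: polyfun_def)
  then show ?thesis unfolding polyfun_def by (intro exI[of _ "p + q"]) (simp add: fun_eq_iff poly_eval_add)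
qed

lemma polyfun_sum: "(\<And>i. i \<in> I \<Longrightarrow> polyfun (f i)) \<Longrightarrow> polyfun (\<lambda>z. \<Sum>i\<in>I. f i z)"
  by (induction I rule: infinite_finite_induct) (auto intro: polyfun_add)

lemma monomial_fun_plus_single:
  "monomial_fun (\<alpha> + Poly_Mapping.single j 1) z = z $ j * monomial_fun \<alpha> z"
proof -
  have "(\<Prod>i\<in>UNIV. z $ i ^ Poly_Mapping.lookup (Poly_Mapping.single j (1::nat)) i) = (\<Prod>i\<in>UNIV. if i = j then z $ i else 1)"
    by (intro prod.cong) (auto simp: lookup_single)
  then show ?thesis by (simp add: lookup_add power_add prod.distrib mult.commute)
qed

lemma polyfun_coord_mult:
  assumes "polyfun f" shows "polyfun (\<lambda>z. z $ j * f z)"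
proof -
  obtain p where p: "f = poly_eval p" using assms by (auto simp: polyfun_def)
  have "(\<lambda>z. z $ j * f z) = (\<lambda>z. \<Sum>\<alpha>\<in>Poly_Mapping.keys p. Poly_Mapping.lookup p \<alpha> * monomial_fun (\<alpha> + Poly_Mapping.single j 1) z)"
    unfolding p poly_eval_def monomial_fun_plus_single by (simp add: sum_distrib_left mult_ac)
  then show ?thesis using polyfun_sum[OF polyfun_monomial] by simp
qed

lemma polyfun_cmult:
  assumes "polyfun f" shows "polyfun (\<lambda>z. c * f z)"
proof -
  obtain p where p: "f = poly_eval p" using assms by (auto simp: polyfun_def)
  have "(\<lambda>z. c * f z) = (\<lambda>z. \<Sum>\<alpha>\<in>Poly_Mapping.keys p. (c * Poly_Mapping.lookup p \<alpha>) * monomial_fun \<alpha> z)"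
    unfolding p poly_eval_def by (simp add: sum_distrib_left mult_ac)
  then show ?thesis using polyfun_sum[OF polyfun_monomial] by simp
qed

lemma polyfun_mult:
  assumes f: "polyfun f" and g: "polyfun g" shows "polyfun (\<lambda>z. f z * g z)"
proof -
  obtain p where p: "g = poly_eval p" using g by (auto simp: polyfun_def)
  have 1: "polyfun (\<lambda>z. z $ j ^ k * h z)" if "polyfun h" for j k and h :: "complex ^ 'a \<Rightarrow> complex"
    by (induction k) (auto simp: that mult.assoc intro: polyfun_coord_mult)
  have 2: "polyfun (\<lambda>z. (\<Prod>i\<in>I. z $ i ^ k i) * f z)" if "finite I" for I and k :: "'a \<Rightarrow> nat"
    using that by (induction I) (auto simp: f mult.assoc intro: 1)
  have "(\<lambda>z. f z * g z) = (\<lambda>z. \<Sum>\<alpha>\<in>Poly_Mapping.keys p. Poly_Mapping.lookup p \<alpha> * (monomial_fun \<alpha> z * f z))"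
    unfolding p poly_eval_def by (simp add: sum_distrib_left mult_ac)
  then show ?thesis by (simp add: polyfun_sum polyfun_cmult 2)
qed

lemma polyfun_coord [simp]: "polyfun (\<lambda>z. z $ j)"
  using polyfun_coord_mult[OF polyfun_const[of 1], of j] by simp

lemma polyfun_power: "polyfun f \<Longrightarrow> polyfun (\<lambda>z. f z ^ k)"
  by (induction k) (auto intro: polyfun_mult)

lemma polyfun_prod: "(\<And>i. i \<in> I \<Longrightarrow> polyfun (f i)) \<Longrightarrow> polyfun (\<lambda>z. \<Prod>i\<in>I. f i z)"
  by (induction I rule: infinite_finite_induct) (auto intro: polyfun_mult)

lemma polyfun_holomorphic: "polyfun f \<Longrightarrow> holomorphic_Cn f U"
  unfolding polyfun_def poly_eval_def
  by (auto intro!: holomorphic_Cn_sum holomorphic_Cn_mult holomorphic_Cn_prod holomorphic_Cn_power)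

section \<open>Entire functions of polynomial growth\<close>

lemma higher_deriv_vupd: "(deriv ^^ l) (\<lambda>t. f (vupd z i t)) s = (pd i ^^ l) f (vupd z i s)"
proof (induction l arbitrary: s)
  case (Suc l)
  have "(deriv ^^ l) (\<lambda>t. f (vupd z i t)) = (\<lambda>s. (pd i ^^ l) f (vupd z i s))" using Suc by blast
  then show ?case by (simp add: deriv_vupd)
qed simp

lemma norm_vupd_le: "norm (vupd z i t) \<le> norm z + norm t"
proof -
  have "vupd z i t = vupd z i 0 + axis i t" by (simp add: vec_eq_iff axis_def)
  then have "norm (vupd z i t) \<le> norm (vupd z i 0) + norm (axis i t)" by (metis norm_triangle_ineq)
  then show ?thesis using norm_vupd_0_le[of z i] by simp
qed

text \<open>Liouville's theorem one variable at a time, by induction over the set \<open>S\<close>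
  of coordinates on which \<open>f\<close> may depend. The Taylor coefficients in coordinate
  \<open>i\<close> no longer depend on that coordinate and inherit the growth bound through Cauchy's
  inequality on the unit circle.\<close>

lemma polyfun_of_growth_aux:
  assumes "finite S" "holomorphic_Cn f UNIV" "M \<ge> 0" "\<And>z. norm (f z) \<le> M * (1 + norm z) ^ k"
    "\<And>z w. (\<forall>i\<in>S. z $ i = w $ i) \<Longrightarrow> f z = f w"
  shows "polyfun f"
  using assms
proof (induction S arbitrary: f M)
  case empty
  have "f 0 = f z" for z by (rule empty.prems(4)) simp
  then have "(\<lambda>_. f 0) = f" by (rule ext)
  then show ?case by (rule subst) simp
next
  case (insert i S)
  define c where "c l z = (pd i ^^ l) f (vupd z i 0) / fact l" for l z
  have hol1: "(\<lambda>t. f (vupd z i t)) holomorphic_on UNIV" for z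
    by (rule holomorphic_on_vupd[OF insert.prems(1)]) auto
  have holpd: "holomorphic_Cn ((pd i ^^ l) f) UNIV" for l
    by (induction l) (auto intro: holomorphic_Cn_pd insert.prems(1))
  have hol: "holomorphic_Cn (c l) UNIV" for l
    unfolding c_def by (intro holomorphic_Cn_divide holomorphic_Cn_const holomorphic_Cn_vupd[OF holpd[of l], where g="\<lambda>z. z" and h="\<lambda>_. 0"]) auto
  have bound: "norm (f (vupd z i t)) \<le> M * 2 ^ k * (1 + norm z) ^ k" if "norm t \<le> 1" for z t
  proof -
    have "norm (f (vupd z i t)) \<le> M * (1 + norm (vupd z i t)) ^ k" by (rule insert.prems(3))
    also have "\<dots> \<le> M * (2 * (1 + norm z)) ^ k"
    proof (intro mult_left_mono power_mono)
      show "1 + norm (vupd z i t) \<le> 2 * (1 + norm z)"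
      proof -
        have *: "x \<le> y + w \<Longrightarrow> w \<le> 1 \<Longrightarrow> 0 \<le> y \<Longrightarrow> 1 + x \<le> 2 * (1 + y)" for x y w :: real by simp
        show ?thesis by (rule *[OF norm_vupd_le that norm_ge_zero])
      qed
    qed (use insert.prems(2) in auto)
    finally show ?thesis unfolding power_mult_distrib by (simp only: mult.assoc)
  qed
  have cb: "norm (c l z) \<le> (M * 2 ^ k) * (1 + norm z) ^ k" for l z
  proof -
    have "norm ((deriv ^^ l) (\<lambda>t. f (vupd z i t)) 0) \<le> fact l * (M * 2 ^ k * (1 + norm z) ^ k) / 1 ^ l"
    proof (rule Cauchy_inequality)
      show "(\<lambda>t. f (vupd z i t)) holomorphic_on ball 0 1" using hol1 holomorphic_on_subset by blast
      show "continuous_on (cball 0 1) (\<lambda>t. f (vupd z i t))"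
        using hol1 holomorphic_on_imp_continuous_on continuous_on_subset by blast
      show "norm (f (vupd z i x)) \<le> M * 2 ^ k * (1 + norm z) ^ k" if "norm (0 - x) = 1" for x
        using bound[of x z] that by simp
    qed simp
    then show ?thesis by (simp add: c_def higher_deriv_vupd norm_divide field_simps)
  qed
  have inv: "c l z = c l w" if "\<forall>j\<in>S. z $ j = w $ j" for l z w
  proof -
    have "(\<lambda>t. f (vupd z i t)) = (\<lambda>t. f (vupd w i t))"
      using that by (intro ext insert.prems(4)) auto
    then show ?thesis by (simp add: c_def flip: higher_deriv_vupd)
  qed
  have poly: "polyfun (c l)" for l
    by (rule insert.IH[OF hol _ cb inv]) (use insert.prems(2) in auto)
  have exp: "f z = (\<Sum>l\<le>k. c l z * (z $ i) ^ l)" for z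
  proof -
    \<comment> \<open>For \<open>norm t \<ge> 1\<close> one has
      \<open>1 + norm (vupd z i t) \<le> (2 + norm z) * norm t\<close>, so the restriction to the
      line grows at most like \<open>norm t ^ k\<close>.\<close>
    define B where "B = M * (2 + norm z) ^ k"
    have "norm (f (vupd z i t)) \<le> B * norm t ^ k" if "1 \<le> norm t" for t
    proof -
      have "norm (f (vupd z i t)) \<le> M * (1 + norm (vupd z i t)) ^ k" by (rule insert.prems(3))
      also have "\<dots> \<le> M * ((2 + norm z) * norm t) ^ k"
      proof (intro mult_left_mono power_mono)
        have "norm z * 1 \<le> norm z * norm t" using that by (intro mult_left_mono) auto
        then show "1 + norm (vupd z i t) \<le> (2 + norm z) * norm t"
          using norm_vupd_le[of z i t] that by (simp add: algebra_simps)
      qed (use insert.prems(2) in auto)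
      finally show ?thesis by (simp add: power_mult_distrib B_def mult.assoc)
    qed
    then have "f (vupd z i (z $ i)) = (\<Sum>l\<le>k. (deriv ^^ l) (\<lambda>t. f (vupd z i t)) 0 / fact l * (z $ i) ^ l)"
      by (intro Liouville_polynomial[OF hol1]) auto
    then show ?thesis by (simp add: c_def higher_deriv_vupd)
  qed
  have "polyfun (\<lambda>z. \<Sum>l\<le>k. c l z * (z $ i) ^ l)"
    by (intro polyfun_sum polyfun_mult poly polyfun_power polyfun_coord)
  moreover have "f = (\<lambda>z. \<Sum>l\<le>k. c l z * (z $ i) ^ l)" by (rule ext) (rule exp)
  ultimately show ?case by simp
qed

lemma polyfun_of_growth:
  fixes f :: "complex ^ 'n \<Rightarrow> complex"
  assumes "holomorphic_Cn f UNIV" "\<And>z. norm (f z) \<le> M * (1 + norm z) ^ k"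
  shows "polyfun f"
proof (rule polyfun_of_growth_aux[OF finite[of UNIV] assms(1)])
  show "norm (f z) \<le> \<bar>M\<bar> * (1 + norm z) ^ k" for z
    by (rule order_trans[OF assms(2) mult_right_mono[OF abs_ge_self]]) simp
  show "f z = f w" if "\<forall>i\<in>UNIV. z $ i = w $ i" for z w using that by (metis UNIV_I vec_eq_iff)
qed simp

section \<open>Hypersurfaces of linear growth are algebraic\<close>

text \<open>Valid also when some \<open>c p\<close> vanishes: then the degree drops and both sides
  are zero.\<close>

lemma coeff_root_poly_card:
  assumes "finite Z" shows "coeff (root_poly Z (\<lambda>_. 1) c) (card Z) = (\<Prod>p\<in>Z. - c p)"
  using assms
proof induction
  case empty
  then show ?case by (simp add: root_poly_def)
next
  case (insert x Z)
  have "degree (root_poly Z (\<lambda>_. 1) c) \<le> card Z"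
    using degree_root_poly[OF insert.hyps(1), of "\<lambda>_. 1" c] insert.hyps(1)
    by (simp add: card_mono)
  then have "coeff (root_poly Z (\<lambda>_. 1) c) (Suc (card Z)) = 0" by (intro coeff_eq_0) simp
  moreover have "root_poly (insert x Z) (\<lambda>_. 1) c = [:1, - c x:] * root_poly Z (\<lambda>_. 1) c"
    using insert.hyps by (simp add: root_poly_def)
  ultimately show ?case using insert by simp
qed

text \<open>The fibre points are among the roots of the equations \<open>f t\<close> of the covering
  discs, whose numbers with multiplicity are constant on the ball.\<close>

lemma fibre_card_locally_bounded:
  fixes H :: "(complex ^ 'n) set"
  assumes H: "closed_analytic_set H" and lb: "fibres_locally_bounded i H"
  shows "\<exists>\<epsilon>>0. \<exists>M. \<forall>z\<in>ball z0 \<epsilon>. card {t. vupd z i t \<in> H} \<le> M"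
proof -
  let ?T = "{t. vupd z0 i t \<in> H}"
  obtain \<Omega> F f r \<epsilon> where fin: "finite ?T" and \<epsilon>: "\<epsilon> > 0"
    and rd: "\<And>t. t \<in> ?T \<Longrightarrow> regular_disc (f t) (\<Omega> t) i t (r t) (ball z0 \<epsilon>)"
    and "\<And>t. t \<in> ?T \<Longrightarrow> finite (F t)" "\<And>t g. t \<in> ?T \<Longrightarrow> g \<in> F t \<Longrightarrow> holomorphic_Cn g (\<Omega> t)"
    and fF: "\<And>t. t \<in> ?T \<Longrightarrow> f t \<in> F t" and H\<Omega>: "\<And>t. t \<in> ?T \<Longrightarrow> H \<inter> \<Omega> t = {z \<in> \<Omega> t. \<forall>g\<in>F t. g z = 0}"
    and disj: "\<And>t t'. t \<in> ?T \<Longrightarrow> t' \<in> ?T \<Longrightarrow> t \<noteq> t' \<Longrightarrow> ball t (r t) \<inter> ball t' (r t') = {}"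
    and cov: "\<And>z s. z \<in> ball z0 \<epsilon> \<Longrightarrow> vupd z i s \<in> H \<Longrightarrow> \<exists>t\<in>?T. s \<in> ball t (r t)"
    by (rule fibre_cover[OF H lb, of z0]) (rule that)
  let ?R = "\<lambda>t z. roots_in (f t) i t (r t) z"
  have "\<exists>N. \<forall>z\<in>ball z0 \<epsilon>. (\<Sum>p\<in>?R t z. root_mult (f t) i z p) = N" if "t \<in> ?T" for t
    by (rule root_count_constant[OF rd[OF that] connected_ball]) blast
  then obtain N where N: "\<And>t z. t \<in> ?T \<Longrightarrow> z \<in> ball z0 \<epsilon> \<Longrightarrow> (\<Sum>p\<in>?R t z. root_mult (f t) i z p) = N t" by metis
  have "card {t. vupd z i t \<in> H} \<le> (\<Sum>t\<in>?T. N t)" if z: "z \<in> ball z0 \<epsilon>" for z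
  proof -
    have finR: "finite (?R t z)" if "t \<in> ?T" for t by (rule finite_roots_in[OF rd[OF that] z])
    have "{t. vupd z i t \<in> H} \<subseteq> (\<Union>t\<in>?T. ?R t z)"
    proof
      fix s assume "s \<in> {t. vupd z i t \<in> H}"
      then have s: "vupd z i s \<in> H" by simp
      obtain t where t: "t \<in> ?T" "s \<in> ball t (r t)" using cov[OF z s] by (elim bexE)
      have "s \<in> cball t (r t)" using t(2) by simp
      then have "vupd z i s \<in> \<Omega> t" using rd[OF t(1)] z unfolding regular_disc_def by blast
      then have "f t (vupd z i s) = 0" using H\<Omega>[OF t(1)] fF[OF t(1)] s by blast
      then have "s \<in> ?R t z" using t(2) by (simp add: roots_in_def)
      then show "s \<in> (\<Union>t\<in>?T. ?R t z)" using t(1) by blast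
    qed
    then have "card {t. vupd z i t \<in> H} \<le> card (\<Union>t\<in>?T. ?R t z)"
      by (rule card_mono[rotated]) (use fin finR in blast)
    also have "\<dots> \<le> (\<Sum>t\<in>?T. card (?R t z))" by (rule card_UN_le[OF fin])
    also have "\<dots> \<le> (\<Sum>t\<in>?T. N t)"
    proof (rule sum_mono)
      fix t assume t: "t \<in> ?T"
      have "card (?R t z) = (\<Sum>p\<in>?R t z. 1)" by simp
      also have "\<dots> \<le> (\<Sum>p\<in>?R t z. root_mult (f t) i z p)"
      proof (rule sum_mono)
        fix p assume "p \<in> ?R t z"
        from root_mult_pos[OF rd[OF t] z this] show "1 \<le> root_mult (f t) i z p" by simp
      qed
      finally show "card (?R t z) \<le> N t" using N[OF t z] by simp
    qed
    finally show ?thesis .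
  qed
  then show ?thesis using \<epsilon> by blast
qed

text \<open>Being unramified is a property of the base point, unaffected by coordinate
  \<open>i\<close>; so a point of \<open>D\<close> can be moved along its fibre into
  \<open>H\<close> without leaving \<open>D\<close>.\<close>

lemma unramified_vupd:
  assumes "z \<in> unramified i H" shows "vupd z i s \<in> unramified i H"
proof -
  obtain V A \<alpha> where V: "open V" "z \<in> V" "finite (A :: (complex \<times> complex) set)"
    "\<forall>a\<in>A. holomorphic_Cn (\<alpha> a) V"
    "\<forall>z\<in>V. inj_on (\<lambda>a. \<alpha> a z) A \<and> {t. vupd z i t \<in> H} = (\<lambda>a. \<alpha> a z) ` A"
    using assms unfolding unramified_def by (elim CollectE exE conjE)
  let ?c = "\<lambda>y. vupd y i (z $ i)"
  let ?V = "?c -` V"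
  have "open ?V" by (rule open_vimage[OF V(1)]) (intro continuous_intros)
  moreover have "vupd z i s \<in> ?V" using V(2) by simp
  moreover have "holomorphic_Cn (\<lambda>y. \<alpha> a (?c y)) ?V" if "a \<in> A" for a
    by (rule holomorphic_Cn_vupd[of "\<alpha> a" V "\<lambda>y. y" ?V "\<lambda>_. z $ i"]) (use V(4) that in auto)
  moreover have "inj_on (\<lambda>a. \<alpha> a (?c y)) A \<and> {t. vupd y i t \<in> H} = (\<lambda>a. \<alpha> a (?c y)) ` A" if "y \<in> ?V" for y
    using bspec[OF V(5), of "?c y"] that by simp
  ultimately show ?thesis unfolding unramified_def using V(3)
    by (intro CollectI exI[of _ ?V] exI[of _ A] exI[of _ "\<lambda>a y. \<alpha> a (?c y)"] conjI ballI) (assumption | blast)+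
qed

text \<open>Near an unramified point the sum runs over finitely many holomorphic sheets. The shift
  by \<open>g\<close> allows power sums of \<open>z $ i - t\<close> to be treated directly.\<close>

lemma holomorphic_fibre_sum:
  assumes g: "holomorphic_Cn g UNIV"
  shows "holomorphic_Cn (\<lambda>z. \<Sum>t\<in>{t. vupd z i t \<in> H}. (g z - t) ^ k) (unramified i H)"
proof (rule holomorphic_Cn_local)
  fix z assume "z \<in> unramified i H"
  then obtain V A \<alpha> where V: "open V" "z \<in> V" "finite (A :: (complex \<times> complex) set)"
    "\<forall>a\<in>A. holomorphic_Cn (\<alpha> a) V"
    "\<forall>z\<in>V. inj_on (\<lambda>a. \<alpha> a z) A \<and> {t. vupd z i t \<in> H} = (\<lambda>a. \<alpha> a z) ` A"
    unfolding unramified_def by (elim CollectE exE conjE)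
  have "holomorphic_Cn (\<lambda>z. \<Sum>a\<in>A. (g z - \<alpha> a z) ^ k) V"
    by (intro holomorphic_Cn_sum holomorphic_Cn_power holomorphic_Cn_diff holomorphic_Cn_subset[OF g])
      (use V(4) in auto)
  then have "holomorphic_Cn (\<lambda>z. \<Sum>t\<in>{t. vupd z i t \<in> H}. (g z - t) ^ k) V"
  proof (rule holomorphic_Cn_transform[OF _ V(1)])
    fix y assume y: "y \<in> V"
    have "inj_on (\<lambda>a. \<alpha> a y) A" "{t. vupd y i t \<in> H} = (\<lambda>a. \<alpha> a y) ` A" using bspec[OF V(5) y] by auto
    then show "(\<Sum>a\<in>A. (g y - \<alpha> a y) ^ k) = (\<Sum>t\<in>{t. vupd y i t \<in> H}. (g y - t) ^ k)"
      by (simp only: sum.reindex o_def)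
  qed
  then show "\<exists>V. open V \<and> z \<in> V \<and> holomorphic_Cn (\<lambda>z. \<Sum>t\<in>{t. vupd z i t \<in> H}. (g z - t) ^ k) V"
    using V(1,2) by blast
qed

lemma closed_superset_thin:
  assumes "thin_complement D" "closed C" "D \<subseteq> C" shows "C = UNIV"
  using thin_complement_closure[OF assms(1)] closure_minimal[OF assms(3,2)] by blast

lemma fibres_locally_bounded_of_growth:
  fixes H :: "(complex ^ 'n) set"
  assumes gr: "\<And>z t. vupd z i t \<in> H \<Longrightarrow> norm t \<le> K * (1 + norm z)"
  shows "fibres_locally_bounded i H"
  unfolding fibres_locally_bounded_def
proof (intro allI, rule exI[of _ 1], intro conjI)
  fix z0 :: "complex ^ 'n"
  show "\<exists>R. \<forall>z\<in>ball z0 1. \<forall>t. vupd z i t \<in> H \<longrightarrow> norm t \<le> R"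
  proof (intro exI[of _ "\<bar>K\<bar> * (2 + norm z0)"] ballI allI impI)
    fix z t assume z: "z \<in> ball z0 1" and t: "vupd z i t \<in> H"
    have "norm z \<le> norm z0 + norm (z - z0)" by (metis norm_triangle_sub)
    then have "1 + norm z \<le> 2 + norm z0" using z by (simp add: dist_norm norm_minus_commute)
    then have "K * (1 + norm z) \<le> \<bar>K\<bar> * (2 + norm z0)" by (intro mult_mono) auto
    then show "norm t \<le> \<bar>K\<bar> * (2 + norm z0)" using gr[OF t] by simp
  qed
qed simp

text \<open>\<open>P z\<close> is the product of \<open>t - z $ i\<close> over the fibre, up to sign
  the characteristic polynomial of the branched cover evaluated at \<open>z $ i\<close>. Power sums
  of the differences \<open>z $ i - t\<close> yield it in one piece. They extend across the branch
  locus by local boundedness, and the linear growth of the sheets makes them polynomials.\<close>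

theorem hypersurface_polynomial:
  fixes H :: "(complex ^ 'n) set"
  assumes H: "closed_analytic_set H" and gd: "graph_dense i H"
    and gr: "\<And>z t. vupd z i t \<in> H \<Longrightarrow> norm t \<le> K * (1 + norm z)" and b: "b \<notin> H"
  obtains P where "polyfun P" "\<And>z. z \<in> H \<Longrightarrow> P z = 0" "P b \<noteq> 0"
proof -
  define L where "L = max K 0"
  have L0: "L \<ge> 0" by (simp add: L_def)
  have gr': "norm t \<le> L * (1 + norm z)" if "vupd z i t \<in> H" for z t
  proof -
    have "K * (1 + norm z) \<le> L * (1 + norm z)" by (intro mult_right_mono) (auto simp: L_def)
    then show ?thesis using gr[OF that] by simp
  qed
  have lb: "fibres_locally_bounded i H" by (rule fibres_locally_bounded_of_growth[OF gr])
  define D where "D = unramified i H"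
  define T where "T z = {t. vupd z i t \<in> H}" for z
  have thin: "thin_complement D"
    unfolding thin_complement_def D_def
  proof (intro conjI allI)
    show "open (unramified i H)"
    proof (subst open_subopen, intro ballI)
      fix z assume "z \<in> unramified i H"
      then obtain V A \<alpha> where V: "open V" "z \<in> V" "finite (A :: (complex \<times> complex) set)"
        "\<forall>a\<in>A. holomorphic_Cn (\<alpha> a) V"
        "\<forall>z\<in>V. inj_on (\<lambda>a. \<alpha> a z) A \<and> {t. vupd z i t \<in> H} = (\<lambda>a. \<alpha> a z) ` A"
        unfolding unramified_def by (elim CollectE exE conjE)
      have "V \<subseteq> unramified i H"
        unfolding unramified_def using V
        by (intro subsetI CollectI exI[of _ V] exI[of _ A] exI[of _ \<alpha>] conjI)
      then show "\<exists>T. open T \<and> z \<in> T \<and> T \<subseteq> unramified i H" using V(1,2) by blast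
    qed
    fix z0 :: "complex ^ 'n"
    obtain \<epsilon> \<delta> where "\<epsilon> > 0" "holomorphic_Cn \<delta> (ball z0 \<epsilon>)" "\<exists>z\<in>ball z0 \<epsilon>. \<delta> z \<noteq> 0"
      "\<And>z. z \<in> ball z0 \<epsilon> \<Longrightarrow> \<delta> z \<noteq> 0 \<Longrightarrow> z \<in> unramified i H"
      by (rule unramified_thin[OF H lb gd]) (rule that)
    then show "\<exists>\<epsilon>>0. \<exists>\<delta>. holomorphic_Cn \<delta> (ball z0 \<epsilon>) \<and> (\<exists>z\<in>ball z0 \<epsilon>. \<delta> z \<noteq> 0) \<and>
       (\<forall>z\<in>ball z0 \<epsilon>. \<delta> z \<noteq> 0 \<longrightarrow> z \<in> unramified i H)"
      by (intro exI[of _ \<epsilon>] exI[of _ \<delta>] conjI ballI impI)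
  qed
  have finT: "finite (T z)" for z
    unfolding T_def by (rule finite_fibre[OF H fibres_locally_bounded_imp_bounded[OF lb]])
  define S where "S k z = (\<Sum>t\<in>T z. (z $ i - t) ^ k)" for k z
  have holS: "holomorphic_Cn (S k) D" for k
    unfolding S_def T_def D_def by (rule holomorphic_fibre_sum) simp
  have Sb: "norm (S k z) \<le> card (T z) * ((1 + L) * (1 + norm z)) ^ k" for k z
  proof -
    have "norm (S k z) \<le> (\<Sum>t\<in>T z. norm ((z $ i - t) ^ k))" unfolding S_def by (rule norm_sum)
    also have "\<dots> \<le> (\<Sum>t\<in>T z. ((1 + L) * (1 + norm z)) ^ k)"
    proof (rule sum_mono)
      fix t assume "t \<in> T z"
      then have "norm t \<le> L * (1 + norm z)" using gr' by (simp add: T_def)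
      moreover have "norm (z $ i) \<le> norm z" by (rule Finite_Cartesian_Product.norm_nth_le)
      ultimately have "norm (z $ i - t) \<le> (1 + L) * (1 + norm z)"
        using norm_triangle_ineq4[of "z $ i" t] by (simp add: algebra_simps)
      then show "norm ((z $ i - t) ^ k) \<le> ((1 + L) * (1 + norm z)) ^ k"
        by (simp add: norm_power power_mono)
    qed
    finally show ?thesis by simp
  qed
  have "\<exists>Q. holomorphic_Cn Q UNIV \<and> (\<forall>z\<in>D. Q z = S k z)" for k
  proof (rule extension_across_thin[OF thin holS[of k]])
    fix z0 :: "complex ^ 'n"
    obtain \<epsilon> M where \<epsilon>: "\<epsilon> > 0" "\<forall>z\<in>ball z0 \<epsilon>. card (T z) \<le> M"
      using fibre_card_locally_bounded[OF H lb, of z0] unfolding T_def by blast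
    have "norm (S k z) \<le> M * ((1 + L) * (2 + norm z0)) ^ k" if z: "z \<in> ball z0 (min \<epsilon> 1)" for z
    proof -
      have "norm z \<le> norm z0 + norm (z - z0)" by (metis norm_triangle_sub)
      then have "1 + norm z \<le> 2 + norm z0" using z by (simp add: dist_norm norm_minus_commute)
      then have "((1 + L) * (1 + norm z)) ^ k \<le> ((1 + L) * (2 + norm z0)) ^ k"
        using L0 by (intro power_mono mult_left_mono) auto
      moreover have "card (T z) \<le> M" using \<epsilon>(2) z by simp
      ultimately have "card (T z) * ((1 + L) * (1 + norm z)) ^ k \<le> M * ((1 + L) * (2 + norm z0)) ^ k"
        using L0 by (intro mult_mono) auto
      then show ?thesis using Sb[of k z] by linarith
    qed
    then have "\<exists>M. \<forall>z\<in>D \<inter> ball z0 (min \<epsilon> 1). norm (S k z) \<le> M" by blast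
    moreover have "min \<epsilon> 1 > 0" using \<epsilon>(1) by simp
    ultimately show "\<exists>\<epsilon>>0. \<exists>M. \<forall>z\<in>D \<inter> ball z0 \<epsilon>. norm (S k z) \<le> M" by blast
  qed blast
  then obtain Q where Q: "\<And>k. holomorphic_Cn (Q k) UNIV" "\<And>k z. z \<in> D \<Longrightarrow> Q k z = S k z" by metis
  have contQ: "continuous_on UNIV (Q k)" for k by (rule holomorphic_Cn_continuous_on[OF Q(1)])
  \<comment> \<open>The power sum with exponent \<open>0\<close> counts the sheets. Its entire
    extension has natural values on a dense set, hence everywhere, and is constant.\<close>
  obtain N where N: "\<And>z. z \<in> D \<Longrightarrow> card (T z) = N"
  proof -
    have Q0: "Q 0 z = of_nat (card (T z))" if "z \<in> D" for z using Q(2)[OF that, of 0] by (simp add: S_def)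
    have "closed (Q 0 -` \<nat>)" by (rule closed_vimage[OF closed_Nats contQ])
    moreover have "D \<subseteq> Q 0 -` \<nat>" using Q0 by auto
    ultimately have nat: "Q 0 -` \<nat> = UNIV" by (rule closed_superset_thin[OF thin])
    have "Q 0 constant_on UNIV"
    proof (rule continuous_discrete_range_constant[OF connected_UNIV contQ])
      fix x
      show "\<exists>e>0. \<forall>y. y \<in> UNIV \<and> Q 0 y \<noteq> Q 0 x \<longrightarrow> e \<le> norm (Q 0 y - Q 0 x)"
      proof (intro exI[of _ 1] conjI allI impI)
        fix y assume ne: "y \<in> UNIV \<and> Q 0 y \<noteq> Q 0 x"
        obtain m n where mn: "Q 0 x = of_nat m" "Q 0 y = of_nat n" using nat by (metis Nats_cases UNIV_I vimageE)
        then have "1 \<le> \<bar>int n - int m\<bar>" using ne by auto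
        then have "1 \<le> real_of_int \<bar>int n - int m\<bar>" by linarith
        also have "\<dots> = norm (of_int (int n - int m) :: complex)"
          by (simp only: norm_of_int of_int_abs)
        finally show "1 \<le> norm (Q 0 y - Q 0 x)" by (simp add: mn)
      qed simp
    qed
    then obtain c where c: "\<And>z. Q 0 z = c" unfolding constant_on_def by blast
    have "card (T z) = card (T z')" if "z \<in> D" "z' \<in> D" for z z'
      using Q0[OF that(1)] Q0[OF that(2)] c by (metis of_nat_eq_iff)
    then show ?thesis using that by metis
  qed
  have polyQ: "polyfun (Q k)" for k
  proof (rule polyfun_of_growth[OF Q(1)])
    let ?C = "{z. norm (Q k z) \<le> (N * (1 + L) ^ k) * (1 + norm z) ^ k}"
    have "closed ?C" by (intro closed_Collect_le continuous_intros contQ)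
    moreover have "D \<subseteq> ?C"
    proof
      fix z assume z: "z \<in> D"
      show "z \<in> ?C" using Sb[of k z] Q(2)[OF z, of k] N[OF z] by (simp add: power_mult_distrib mult.assoc)
    qed
    ultimately have "?C = UNIV" by (rule closed_superset_thin[OF thin])
    then show "norm (Q k z) \<le> (N * (1 + L) ^ k) * (1 + norm z) ^ k" for z by blast
  qed
  let ?c = "\<lambda>k z. coeff (root_poly (T z) (\<lambda>_. 1) (\<lambda>t. z $ i - t)) k"
  have "\<exists>R. polyfun R \<and> (\<forall>z\<in>D. R z = ?c k z)" for k
  proof (induction k rule: less_induct)
    case (less k)
    show ?case
    proof (cases k)
      case 0
      then show ?thesis by (intro exI[of _ "\<lambda>_. 1"]) (simp add: coeff_root_poly_0 finT)
    next
      case (Suc l)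
      have "\<exists>R. polyfun R \<and> (\<forall>z\<in>D. R z = ?c j z)" if "j \<le> l" for j using less[of j] that Suc by simp
      then obtain R where R: "\<And>j. j \<le> l \<Longrightarrow> polyfun (R j)" "\<And>j z. j \<le> l \<Longrightarrow> z \<in> D \<Longrightarrow> R j z = ?c j z" by metis
      define G where "G = (\<lambda>z. (- 1 / of_nat (Suc l)) * (\<Sum>j\<le>l. R j z * Q (Suc (l - j)) z))"
      have "polyfun G"
        unfolding G_def by (intro polyfun_cmult polyfun_sum polyfun_mult polyQ R(1)) simp
      moreover have "G z = ?c (Suc l) z" if z: "z \<in> D" for z
      proof -
        have "(\<Sum>j\<le>l. R j z * Q (Suc (l - j)) z) = (\<Sum>j\<le>l. ?c j z * (\<Sum>p\<in>T z. of_nat 1 * (z $ i - p) ^ Suc (l - j)))"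
          using R(2)[OF _ z] Q(2)[OF z] by (intro sum.cong) (auto simp: S_def)
        then show ?thesis unfolding G_def coeff_root_poly_Suc[OF finT] by simp
      qed
      ultimately show ?thesis unfolding Suc by blast
    qed
  qed
  then obtain P where P: "polyfun P" "\<And>z. z \<in> D \<Longrightarrow> P z = ?c N z" by metis
  have contP: "continuous_on UNIV P"
    by (rule holomorphic_Cn_continuous_on[OF polyfun_holomorphic[OF P(1)]])
  have PD: "P z = (\<Prod>t\<in>T z. - (z $ i - t))" if "z \<in> D" for z
    using P(2)[OF that] coeff_root_poly_card[OF finT[of z], of "\<lambda>t. z $ i - t"] N[OF that] by simp
  have zero: "P z = 0" if "z \<in> D" "z \<in> H" for z
  proof -
    have "z $ i \<in> T z" using that(2) by (simp add: T_def)
    then show ?thesis unfolding PD[OF that(1)] by (intro prod_zero finT) auto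
  qed
  \<comment> \<open>So far \<open>P\<close> vanishes on the points of \<open>H\<close> over
    \<open>D\<close> only. The graphs of \<open>graph_dense\<close> provide such points arbitrarily
    close to \<open>p\<close>.\<close>
  have "P p = 0" if p: "p \<in> H" for p
  proof -
    have "\<exists>w\<in>D \<inter> H. dist w p < e" if e: "e > 0" for e
    proof -
      obtain q g \<theta> where q: "q \<in> H" "dist p q < e / 2" "isCont g q" "g q = q $ i"
        "\<theta> > 0" "\<forall>w\<in>ball q \<theta>. vupd w i (g w) \<in> H"
        using gd p half_gt_zero[OF e] unfolding graph_dense_def by metis
      have "isCont (\<lambda>w. vupd w i (g w)) q"
      proof -
        have "isCont (\<lambda>w. if j = i then g w else w $ j) q" for j
          using q(3) by (cases "j = i") auto
        then have "((\<lambda>w. \<chi> j. if j = i then g w else w $ j) \<longlongrightarrow> (\<chi> j. if j = i then g q else q $ j)) (at q)"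
          unfolding isCont_def by (rule tendsto_vec_lambda)
        then show ?thesis by (simp add: isCont_def vupd_def)
      qed
      then obtain d where d: "d > 0" "\<And>w. dist w q < d \<Longrightarrow> dist (vupd w i (g w)) (vupd q i (g q)) < e / 2"
        unfolding continuous_at_eps_delta using half_gt_zero[OF e] by metis
      obtain w where w: "w \<in> D" "dist q w < min d \<theta>"
        using thin_complement_dense[OF thin, of "min d \<theta>" q] d(1) q(5) by auto
      let ?w = "vupd w i (g w)"
      have "?w \<in> D" using w(1) unramified_vupd unfolding D_def by blast
      moreover have "?w \<in> H" using q(6) w(2) by simp
      moreover have "dist ?w p < e"
      proof -
        have "dist ?w q < e / 2" using d(2)[of w] w(2) q(4) by (simp add: dist_commute)
        then show ?thesis using dist_triangle[of ?w p q] q(2) by (simp add: dist_commute)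
      qed
      ultimately show ?thesis by blast
    qed
    then have "p \<in> closure (D \<inter> H)" unfolding closure_approachable by blast
    moreover have "closed (P -` {0})" by (rule closed_vimage[OF closed_singleton contP])
    moreover have "D \<inter> H \<subseteq> P -` {0}" using zero by blast
    ultimately show ?thesis using closure_minimal[of "D \<inter> H" "P -` {0}"] by blast
  qed
  moreover have "P b \<noteq> 0"
  proof -
    have "open (- H)" using H by (simp add: closed_analytic_set_def open_Compl)
    then obtain e where e: "e > 0" "ball b e \<subseteq> - H" using b open_contains_ball by blast
    \<comment> \<open>Near \<open>b\<close> every factor has modulus at least \<open>e / 2\<close>,
      since \<open>b\<close> has distance at least \<open>e\<close> from \<open>H\<close>; the lower
      bound passes from the dense set \<open>D\<close> to \<open>b\<close> itself.\<close>
    let ?C = "{z. (e / 2) ^ N \<le> norm (P z)} \<union> - ball b (e / 2)"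
    have "closed {z. (e / 2) ^ N \<le> norm (P z)}" by (intro closed_Collect_le continuous_intros contP)
    then have "closed ?C" by (intro closed_Un closed_Compl) auto
    moreover have "D \<subseteq> ?C"
    proof
      fix z assume z: "z \<in> D"
      show "z \<in> ?C"
      proof (cases "z \<in> ball b (e / 2)")
        case True
        have "norm (- (z $ i - t)) \<ge> e / 2" if t: "t \<in> T z" for t
        proof -
          have "vupd z i t \<notin> ball b e" using e(2) t by (auto simp: T_def)
          then have "e \<le> dist b (vupd z i t)" by simp
          also have "\<dots> \<le> dist b z + dist z (vupd z i t)" by (rule dist_triangle)
          also have "dist z (vupd z i t) = dist (z $ i) t" using dist_vupd[of z i "z $ i" t] by simp
          finally show ?thesis using True by (simp add: dist_norm norm_minus_commute)
        qed
        then have "(\<Prod>t\<in>T z. e / 2) \<le> (\<Prod>t\<in>T z. norm (- (z $ i - t)))"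
          using e(1) by (intro prod_mono) auto
        then have "(e / 2) ^ N \<le> norm (P z)"
          unfolding PD[OF z] prod_norm[symmetric] using N[OF z] by simp
        then show ?thesis by simp
      qed simp
    qed
    ultimately have "?C = UNIV" by (rule closed_superset_thin[OF thin])
    then have "b \<in> ?C" by blast
    then have "(e / 2) ^ N \<le> norm (P b)" using e(1) by simp
    moreover have "(e / 2) ^ N > 0" using e(1) by simp
    ultimately show ?thesis by auto
  qed
  ultimately show ?thesis using that P(1) by blast
qed

section \<open>Regular points and local sections\<close>

lemma homeomorphismD':
  assumes "homeomorphism U V \<phi> \<psi>"
  shows "\<And>z. z \<in> U \<Longrightarrow> \<phi> z \<in> V" "\<And>z. z \<in> U \<Longrightarrow> \<psi> (\<phi> z) = z" "\<And>w. w \<in> V \<Longrightarrow> \<psi> w \<in> U" "\<And>w. w \<in> V \<Longrightarrow> \<phi> (\<psi> w) = w"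
    "continuous_on U \<phi>" "continuous_on V \<psi>"
  using assms unfolding homeomorphism_def by auto

lemma biholomorphicD:
  assumes "biholomorphic U V \<phi> \<psi>"
  shows "open U" "open V" "homeomorphism U V \<phi> \<psi>" "\<And>i. holomorphic_Cn (\<lambda>z. \<phi> z $ i) U" "\<And>i. holomorphic_Cn (\<lambda>w. \<psi> w $ i) V"
  using assms unfolding biholomorphic_def by auto

lemma biholomorphic_id: "open U \<Longrightarrow> biholomorphic U U (\<lambda>z. z) (\<lambda>z. z)"
  unfolding biholomorphic_def by (simp add: homeomorphism_ident)

lemma norm_scalar_vec: "norm (t *s v) = norm t * norm (v :: complex ^ 'n)"
proof -
  have "L2_set (\<lambda>i. norm t * norm (v $ i)) UNIV = norm t * L2_set (\<lambda>i. norm (v $ i)) UNIV"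
    by (rule L2_set_right_distrib[symmetric]) simp
  then show ?thesis by (simp add: norm_vec_def norm_mult)
qed

lemma connected_line_ball: "connected {t :: complex. a + t *s v \<in> ball a \<rho>}"
proof (cases "v = 0")
  case True
  then have "{t :: complex. a + t *s v \<in> ball a \<rho>} = (if \<rho> > 0 then UNIV else {})"
    by (auto simp: dist_norm norm_scalar_vec)
  then show ?thesis by (simp add: connected_UNIV)
next
  case False
  then have "norm v > 0" by simp
  then have "{t :: complex. a + t *s v \<in> ball a \<rho>} = ball 0 (\<rho> / norm v)"
    by (auto simp: dist_norm norm_scalar_vec pos_less_divide_eq)
  then show ?thesis by simp
qed

text \<open>The iterated directional derivatives of \<open>G\<close> along \<open>v\<close> are the
  derivatives of its restriction to the line. All of them vanish at parameter \<open>0\<close>,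
  hence so does the restriction.\<close>

lemma vanishes_along_line:
  fixes G :: "complex ^ 'n \<Rightarrow> complex"
  assumes "\<rho> > 0" and w: "a + v \<in> ball a \<rho>"
    and hol: "\<And>n. holomorphic_Cn (((\<lambda>D z. \<Sum>j\<in>UNIV. v $ j * pd j D z) ^^ n) G) (ball a \<rho>)"
    and 0: "\<And>n. ((\<lambda>D z. \<Sum>j\<in>UNIV. v $ j * pd j D z) ^^ n) G a = 0"
  shows "G (a + v) = 0"
proof -
  define Gn where "Gn n = ((\<lambda>D z. \<Sum>j\<in>UNIV. v $ j * pd j D z) ^^ n) G" for n
  let ?S = "{t :: complex. a + t *s v \<in> ball a \<rho>}"
  let ?h = "\<lambda>n t. Gn n (a + t *s v)"
  have holG: "holomorphic_Cn (Gn n) (ball a \<rho>)" for n unfolding Gn_def by (rule hol)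
  have S: "open ?S" by (rule holomorphic_Cn_line(2)[OF holG open_ball])
  have hh: "?h n holomorphic_on ?S" for n by (rule holomorphic_Cn_line(1)[OF holG open_ball])
  have d: "deriv (?h n) t = ?h (Suc n) t" if t: "t \<in> ?S" for n t
  proof -
    have at: "a + t *s v \<in> ball a \<rho>" using t by simp
    have "((\<lambda>t. Gn n (a + t *s v)) has_field_derivative (\<Sum>j\<in>UNIV. v $ j * pd j (Gn n) (a + t *s v))) (at t)"
    proof (rule holomorphic_Cn_curve_derivative[where \<gamma>="\<lambda>t. a + t *s v" and D=v,
          OF holomorphic_Cn_has_derivative[OF holG at]])
      show "((\<lambda>t. (a + t *s v) $ j) has_field_derivative v $ j) (at t)" for j
        by (auto intro!: derivative_eq_intros)
    qed (simp add: sum_distrib_left mult.assoc)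
    then show ?thesis by (simp add: DERIV_imp_deriv Gn_def)
  qed
  have hd: "(deriv ^^ n) (?h 0) t = ?h n t" if "t \<in> ?S" for n t
    using that
  proof (induction n arbitrary: t)
    case (Suc n)
    have "eventually (\<lambda>x. x \<in> ?S) (nhds t)" using S Suc.prems by (rule eventually_nhds_in_open)
    then have "eventually (\<lambda>x. (deriv ^^ n) (?h 0) x = ?h n x) (nhds t)"
      by eventually_elim (rule Suc.IH)
    then have "deriv ((deriv ^^ n) (?h 0)) t = deriv (?h n) t" by (intro deriv_cong_ev) simp_all
    then show ?case using d[OF Suc.prems, of n] by simp
  qed simp
  have "?h 0 1 = 0"
  proof (rule holomorphic_fun_eq_0_on_connected[OF hh S connected_line_ball])
    show "(deriv ^^ n) (?h 0) 0 = 0" for n using hd[of 0 n] 0[of n] \<open>\<rho> > 0\<close> by (simp add: Gn_def)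
  qed (use \<open>\<rho> > 0\<close> w in auto)
  then show ?thesis by (simp add: Gn_def)
qed

text \<open>Among charts near \<open>a\<close> that meet \<open>X\<close>, take one with the largest
  number of coordinates vanishing on \<open>X\<close>. A function vanishing on \<open>X\<close> with
  a nonzero derivative in a remaining direction would provide one more such coordinate. So all
  derivatives along the remaining coordinate subspace vanish on \<open>X\<close>, and the equations
  of \<open>X\<close> vanish on that subspace near the point.\<close>

lemma regular_point_dense:
  fixes X :: "(complex ^ 'n) set"
  assumes X: "closed_analytic_set X" and a: "a \<in> X" and e: "e > 0"
  shows "\<exists>k z. regular_point X k z \<and> dist a z < e"
proof -
  obtain U0 F where U0: "open U0" "a \<in> U0" "\<forall>f\<in>F. holomorphic_Cn f U0" "X \<inter> U0 = {z \<in> U0. \<forall>f\<in>F. f z = 0}"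
    using X a unfolding closed_analytic_set_def by blast
  define U where "U = U0 \<inter> ball a e"
  have U: "open U" "a \<in> U" "U \<subseteq> U0" "U \<subseteq> ball a e" using U0(1,2) e by (auto simp: U_def)
  have XU: "z \<in> X \<longleftrightarrow> (\<forall>f\<in>F. f z = 0)" if "z \<in> U" for z
  proof -
    have "z \<in> U0" using that U(3) by blast
    then show ?thesis using U0(4) by blast
  qed
  define valid where "valid J \<longleftrightarrow> (\<exists>U1 V \<phi> \<psi> z1. biholomorphic U1 V \<phi> \<psi> \<and> U1 \<subseteq> U \<and> z1 \<in> X \<inter> U1 \<and>
      (\<forall>z\<in>X \<inter> U1. \<forall>i\<in>J. \<phi> z $ i = 0))" for J :: "'n set"
  have "valid {}" unfolding valid_def
    by (intro exI[of _ U] exI[of _ "\<lambda>z. z"] exI[of _ a] conjI) (use U a biholomorphic_id in auto)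
  then obtain J where J: "valid J" "\<And>J'. valid J' \<Longrightarrow> card J' \<le> card J"
    using ex_has_greatest_nat[of valid "{}" card "Suc CARD('n)"] card_mono[OF finite[of "UNIV :: 'n set"]]
    by (metis finite less_Suc_eq_le top_greatest)
  obtain U1 V \<phi> \<psi> z1 where bi: "biholomorphic U1 V \<phi> \<psi>" and U1: "U1 \<subseteq> U" and z1: "z1 \<in> X \<inter> U1"
    and \<phi>0: "\<forall>z\<in>X \<inter> U1. \<forall>i\<in>J. \<phi> z $ i = 0" using J(1) unfolding valid_def by (elim exE conjE)
  note bd = biholomorphicD[OF bi]
  note hd = homeomorphismD'[OF bd(3)]
  have step: "pd j D (\<phi> z) = 0"
    if D: "holomorphic_Cn D V" "\<forall>z\<in>X \<inter> U1. D (\<phi> z) = 0" and j: "j \<notin> J" and z: "z \<in> X \<inter> U1" for D j z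
  proof (rule ccontr)
    assume nz: "pd j D (\<phi> z) \<noteq> 0"
    have zU: "z \<in> U1" using z by blast
    obtain U' V' \<psi>' where *: "U' \<subseteq> U1" "\<psi> (\<phi> z) \<in> U'" "biholomorphic U' V' (\<lambda>z. vupd (\<phi> z) j (D (\<phi> z))) \<psi>'"
      by (rule biholomorphic_replace_coordinate[OF bi D(1) hd(1)[OF zU] nz]) (rule that)
    have "valid (insert j J)" unfolding valid_def
    proof (intro exI conjI ballI)
      show "biholomorphic U' V' (\<lambda>z. vupd (\<phi> z) j (D (\<phi> z))) \<psi>'" by (rule *(3))
      show "U' \<subseteq> U" using *(1) U1 by blast
      show "z \<in> X \<inter> U'" using *(2) z hd(2)[OF zU] by simp
      fix x i assume x: "x \<in> X \<inter> U'" and i: "i \<in> insert j J"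
      have x1: "x \<in> X \<inter> U1" using x *(1) by blast
      show "vupd (\<phi> x) j (D (\<phi> x)) $ i = 0"
        using i bspec[OF D(2) x1] bspec[OF \<phi>0 x1] by (cases "i = j") auto
    qed
    then have "card (insert j J) \<le> card J" by (rule J(2))
    then show False using j by simp
  qed
  define w1 where "w1 = \<phi> z1"
  have z1': "z1 \<in> U1" "z1 \<in> X" using z1 by auto
  have w1V: "w1 \<in> V" unfolding w1_def by (rule hd(1)[OF z1'(1)])
  obtain \<rho> where \<rho>: "\<rho> > 0" "ball w1 \<rho> \<subseteq> V" using bd(2) w1V open_contains_ball by blast
  have zero: "f (\<psi> w) = 0" if f: "f \<in> F" and w: "w \<in> ball w1 \<rho>" "\<forall>i\<in>J. w $ i = 0" for f w
  proof -
    define v where "v = w - w1"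
    have v0: "v $ i = 0" if "i \<in> J" for i
      using w(2) that bspec[OF \<phi>0 z1] by (simp add: v_def w1_def)
    define G where "G n = ((\<lambda>D z. \<Sum>j\<in>UNIV. v $ j * pd j D z) ^^ n) (\<lambda>w. f (\<psi> w))" for n
    \<comment> \<open>Each derivative vanishes on \<open>X\<close> again, so the maximality argument
      in \<open>step\<close> applies to it in turn.\<close>
    have G: "holomorphic_Cn (G n) V \<and> (\<forall>z\<in>X \<inter> U1. G n (\<phi> z) = 0)" for n
    proof (induction n)
      case 0
      have "holomorphic_Cn (\<lambda>w. f (\<psi> w)) V"
      proof (rule holomorphic_Cn_compose[OF _ bd(5)])
        show "holomorphic_Cn f U0" using U0(3) f by blast
        show "\<psi> ` V \<subseteq> U0" using hd(3) U1 U(3) by blast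
      qed
      moreover have "f (\<psi> (\<phi> z)) = 0" if z: "z \<in> X \<inter> U1" for z
      proof -
        have "z \<in> U1" using z by blast
        moreover have "z \<in> U" using z U1 by blast
        ultimately show ?thesis using XU[of z] z f hd(2)[of z] by simp
      qed
      ultimately show ?case by (simp add: G_def)
    next
      case (Suc n)
      have GS: "G (Suc n) = (\<lambda>z. \<Sum>j\<in>UNIV. v $ j * pd j (G n) z)" by (simp add: G_def)
      have "holomorphic_Cn (G (Suc n)) V"
        unfolding GS using Suc bd(2)
        by (intro holomorphic_Cn_sum holomorphic_Cn_mult holomorphic_Cn_const holomorphic_Cn_pd) auto
      moreover have "G (Suc n) (\<phi> z) = 0" if z: "z \<in> X \<inter> U1" for z
        unfolding GS
      proof (rule sum.neutral, rule ballI)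
        fix j show "v $ j * pd j (G n) (\<phi> z) = 0"
          using v0[of j] step[of "G n" j z] Suc z by (cases "j \<in> J") auto
      qed
      ultimately show ?case by blast
    qed
    have "(\<lambda>w. f (\<psi> w)) (w1 + v) = 0"
    proof (rule vanishes_along_line[OF \<rho>(1)])
      show "w1 + v \<in> ball w1 \<rho>" using w(1) by (simp add: v_def)
      show "holomorphic_Cn (((\<lambda>D z. \<Sum>j\<in>UNIV. v $ j * pd j D z) ^^ n) (\<lambda>w. f (\<psi> w))) (ball w1 \<rho>)" for n
        using G[of n] holomorphic_Cn_subset[OF _ \<rho>(2)] unfolding G_def by blast
      show "((\<lambda>D z. \<Sum>j\<in>UNIV. v $ j * pd j D z) ^^ n) (\<lambda>w. f (\<psi> w)) w1 = 0" for n
        using G[of n] z1 unfolding G_def w1_def by blast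
    qed
    then show ?thesis by (simp add: v_def)
  qed
  let ?V2 = "ball w1 \<rho>"
  note bi2 = biholomorphicD[OF biholomorphic_restrict[OF bi open_ball \<rho>(2)]]
  have sub2: "\<psi> ` ?V2 \<subseteq> U1" using hd(3) \<rho>(2) by blast
  have img: "\<phi> ` (X \<inter> \<psi> ` ?V2) = {w \<in> ?V2. \<forall>i. i \<notin> - J \<longrightarrow> w $ i = 0}"
  proof (intro equalityI subsetI)
    fix w assume "w \<in> \<phi> ` (X \<inter> \<psi> ` ?V2)"
    then obtain w' where w': "w' \<in> ?V2" "\<psi> w' \<in> X" "w = \<phi> (\<psi> w')" by auto
    have "w = w'" using w' hd(4) \<rho>(2) by auto
    moreover have "\<psi> w' \<in> X \<inter> U1" using w' sub2 by blast
    then have "\<forall>i\<in>J. \<phi> (\<psi> w') $ i = 0" by (rule bspec[OF \<phi>0])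
    ultimately show "w \<in> {w \<in> ?V2. \<forall>i. i \<notin> - J \<longrightarrow> w $ i = 0}" using w' by simp
  next
    fix w assume w: "w \<in> {w \<in> ?V2. \<forall>i. i \<notin> - J \<longrightarrow> w $ i = 0}"
    then have wV: "w \<in> ?V2" "w \<in> V" "\<forall>i\<in>J. w $ i = 0" using \<rho>(2) by auto
    have "\<psi> w \<in> U" using hd(3)[OF wV(2)] U1 by blast
    then have "\<psi> w \<in> X" using XU zero[OF _ wV(1,3)] by blast
    then have "\<psi> w \<in> X \<inter> \<psi> ` ?V2" using wV(1) by blast
    then have "\<phi> (\<psi> w) \<in> \<phi> ` (X \<inter> \<psi> ` ?V2)" by (rule imageI)
    then show "w \<in> \<phi> ` (X \<inter> \<psi> ` ?V2)" using hd(4)[OF wV(2)] by simp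
  qed
  have "regular_point X (card (- J)) z1"
    unfolding regular_point_def
  proof (intro conjI exI)
    show "z1 \<in> X" by (rule z1'(2))
    show "z1 \<in> \<psi> ` ?V2" using \<rho>(1) hd(2)[OF z1'(1)] by (auto simp: w1_def image_iff intro!: bexI[of _ "\<phi> z1"])
    show "\<phi> ` (X \<inter> \<psi> ` ?V2) = {w \<in> ?V2. \<forall>i. i \<notin> - J \<longrightarrow> w $ i = 0}" by (rule img)
  qed (use bi2 in auto)
  moreover have "dist a z1 < e" using z1'(1) U1 U(4) by (auto simp: subset_iff)
  ultimately show ?thesis by blast
qed

lemma regular_point_dim_le: "regular_point (X :: (complex ^ 'n) set) k z \<Longrightarrow> k \<le> CARD('n)"
  unfolding regular_point_def by (auto intro: card_mono)

lemma closure_UN_finite: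
  "finite K \<Longrightarrow> closure (\<Union>k\<in>K. S k) = (\<Union>k\<in>K. closure (S k))"
  by (induction K rule: finite_induct) (simp_all add: closure_Un)

text \<open>The set of candidate dimensions is finite and, by density of regular points, nonempty,
  so \<open>Max\<close> is a member of it.\<close>

lemma pure_dim_regular_dense:
  fixes X :: "(complex ^ 'n) set"
  assumes "closed_pure_dim_analytic d X" "a \<in> X"
  shows "a \<in> closure {z. regular_point X d z}"
proof -
  have X: "closed_analytic_set X" and dim: "analytic_dim_at X a = d"
    using assms unfolding closed_pure_dim_analytic_def by auto
  let ?K = "{k. a \<in> closure {z. regular_point X k z}}"
  have "?K \<subseteq> {..CARD('n)}"
  proof
    fix k assume "k \<in> ?K"
    then have "{z. regular_point X k z} \<noteq> {}" using closure_empty by force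
    then obtain z where "regular_point X k z" by blast
    then show "k \<in> {..CARD('n)}" using regular_point_dim_le by simp
  qed
  then have "finite ?K" using finite_subset by blast
  moreover have "?K \<noteq> {}"
  proof -
    have "a \<in> closure (\<Union>k\<le>CARD('n). {z. regular_point X k z})"
      unfolding closure_approachable
    proof (intro allI impI)
      fix e :: real assume "e > 0"
      then obtain k z where "regular_point X k z" "dist a z < e" using regular_point_dense[OF X assms(2)] by blast
      then show "\<exists>y\<in>(\<Union>k\<le>CARD('n). {z. regular_point X k z}). dist y a < e"
        using regular_point_dim_le by (intro bexI[of _ z]) (auto simp: dist_commute)
    qed
    also have "\<dots> = (\<Union>k\<le>CARD('n). closure {z. regular_point X k z})" by (rule closure_UN_finite) simp
    finally show ?thesis by blast
  qed
  ultimately have "Max ?K \<in> ?K" by (rule Max_in)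
  then show ?thesis using dim unfolding analytic_dim_at_def by simp
qed


text \<open>A section of the projection to the coordinates in \<open>I\<close>, written as a map on
  a ball of the whole space.\<close>

definition has_local_section :: "'n set \<Rightarrow> (complex ^ 'n) set \<Rightarrow> complex ^ 'n \<Rightarrow> bool" where
  "has_local_section I X z \<longleftrightarrow> z \<in> X \<and> (\<exists>\<gamma> \<eta>. \<eta> > 0 \<and> isCont \<gamma> z \<and> \<gamma> z = z \<and>
     (\<forall>w\<in>ball z \<eta>. \<gamma> w \<in> X \<and> (\<forall>i\<in>I. \<gamma> w $ i = w $ i)))"

text \<open>Chart coordinates of the manifold are exchanged for ambient coordinates in
  \<open>I\<close>, as many as possible. If a chart direction \<open>j\<close> is left over, no
  coordinate in \<open>I\<close> varies along it, so a whole disc in \<open>X\<close> lies in one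
  fibre of the projection, against finiteness. Once all are exchanged, the coordinates in
  \<open>I\<close> form a chart, and the section is its inverse.\<close>

lemma local_section_near_regular_point:
  fixes X :: "(complex ^ 'n) set"
  assumes fibres: "\<And>w. finite {z \<in> X. \<forall>i\<in>I. z $ i = w $ i}" and "card I = d"
    and reg: "regular_point X d a" and e: "e > 0"
  shows "\<exists>z. has_local_section I X z \<and> dist a z < e"
proof -
  have aX: "a \<in> X" using reg unfolding regular_point_def by (rule conjunct1)
  obtain U0 \<phi> \<psi> I' and V0 :: "(complex ^ 'n) set" where U0: "open U0" "a \<in> U0" "open V0" "homeomorphism U0 V0 \<phi> \<psi>"
    "\<forall>i. holomorphic_Cn (\<lambda>z. \<phi> z $ i) U0" "\<forall>i. holomorphic_Cn (\<lambda>w. \<psi> w $ i) V0"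
    and I': "card I' = d" and img: "\<phi> ` (X \<inter> U0) = {w \<in> V0. \<forall>i. i \<notin> I' \<longrightarrow> w $ i = 0}"
    using reg unfolding regular_point_def by blast
  note hd = homeomorphismD'[OF U0(4)]
  define V1 where "V1 = \<psi> -` ball a e \<inter> V0"
  have V1: "open V1" "V1 \<subseteq> V0" "\<And>w. w \<in> V1 \<Longrightarrow> dist a (\<psi> w) < e"
    using continuous_on_open_vimage[OF U0(3)] hd(6) by (auto simp: V1_def)
  define M where "M = {w \<in> V1. \<forall>i. i \<notin> I' \<longrightarrow> w $ i = 0}"
  have inX: "\<psi> w \<in> X" if "w \<in> M" for w
  proof -
    have "w \<in> \<phi> ` (X \<inter> U0)" unfolding img using that V1(2) by (auto simp: M_def)
    then show ?thesis using hd(2) by auto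
  qed
  have \<phi>a: "\<phi> a \<in> M"
  proof -
    have "\<phi> a \<in> {w \<in> V0. \<forall>i. i \<notin> I' \<longrightarrow> w $ i = 0}" using img aX U0(2) by blast
    then show ?thesis using hd(2)[OF U0(2)] e by (auto simp: M_def V1_def)
  qed
  define valid where "valid A \<longleftrightarrow> (\<exists>\<tau> U' V' \<Theta> \<Psi> w1. A \<subseteq> I' \<and> inj_on \<tau> A \<and> \<tau> ` A \<subseteq> I \<and> biholomorphic U' V' \<Theta> \<Psi> \<and>
      U' \<subseteq> V1 \<and> w1 \<in> U' \<inter> M \<and> (\<forall>w\<in>U'. \<forall>i. \<Theta> w $ i = (if i \<in> A then \<psi> w $ \<tau> i else w $ i)))" for A :: "'n set"
  have "valid {}" unfolding valid_def
    by (intro exI[of _ V1] exI[of _ "\<lambda>z. z"] exI[of _ "\<phi> a"] conjI)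
      (use V1(1) \<phi>a biholomorphic_id in \<open>auto simp: M_def\<close>)
  then obtain A where A: "valid A" "\<And>A'. valid A' \<Longrightarrow> card A' \<le> card A"
    using ex_has_greatest_nat[of valid "{}" card "Suc CARD('n)"] card_mono[OF finite[of "UNIV :: 'n set"]]
    by (metis finite less_Suc_eq_le top_greatest)
  obtain \<tau> U' V' \<Theta> \<Psi> w1 where AI: "A \<subseteq> I'" and inj: "inj_on \<tau> A" and \<tau>I: "\<tau> ` A \<subseteq> I" and bi: "biholomorphic U' V' \<Theta> \<Psi>"
    and U': "U' \<subseteq> V1" and w1: "w1 \<in> U' \<inter> M" and \<Theta>: "\<forall>w\<in>U'. \<forall>i. \<Theta> w $ i = (if i \<in> A then \<psi> w $ \<tau> i else w $ i)"
    using A(1) unfolding valid_def by (elim exE conjE)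
  note bd = biholomorphicD[OF bi]
  note h = homeomorphismD'[OF bd(3)]
  have \<Psi>M: "\<Psi> u \<in> M" if u: "u \<in> V'" "\<forall>i. i \<notin> I' \<longrightarrow> u $ i = 0" for u
  proof -
    have "\<Psi> u $ i = 0" if "i \<notin> I'" for i
    proof -
      have "\<Theta> (\<Psi> u) $ i = (if i \<in> A then \<psi> (\<Psi> u) $ \<tau> i else \<Psi> u $ i)" using \<Theta> h(3)[OF u(1)] by blast
      moreover have "i \<notin> A" using that AI by blast
      ultimately show ?thesis using h(4)[OF u(1)] u(2) that by simp
    qed
    then show ?thesis using h(3)[OF u(1)] U' by (auto simp: M_def)
  qed
  have \<Theta>i: "u $ i = \<psi> (\<Psi> u) $ \<tau> i" if "u \<in> V'" "i \<in> A" for u i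
  proof -
    have "\<Theta> (\<Psi> u) $ i = (if i \<in> A then \<psi> (\<Psi> u) $ \<tau> i else \<Psi> u $ i)" using \<Theta> h(3)[OF that(1)] by blast
    then show ?thesis using h(4)[OF that(1)] that(2) by simp
  qed
  have A_eq: "A = I'"
  proof (rule ccontr)
    assume "A \<noteq> I'"
    then obtain j where j: "j \<in> I'" "j \<notin> A" using AI by blast
    have holD: "holomorphic_Cn (\<lambda>u. \<psi> (\<Psi> u) $ l) V'" for l
    proof (rule holomorphic_Cn_compose[OF _ bd(5)])
      show "holomorphic_Cn (\<lambda>w. \<psi> w $ l) V0" using U0(6) by blast
      show "\<Psi> ` V' \<subseteq> V0" using h(3) U' V1(2) by blast
    qed
    have pd0: "pd j (\<lambda>u. \<psi> (\<Psi> u) $ l) u = 0" if l: "l \<in> I" "l \<notin> \<tau> ` A" and u: "u \<in> V'" "\<forall>i. i \<notin> I' \<longrightarrow> u $ i = 0" for l u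
    proof (rule ccontr)
      assume nz: "pd j (\<lambda>u. \<psi> (\<Psi> u) $ l) u \<noteq> 0"
      obtain U2 V2 \<Psi>2 where *: "U2 \<subseteq> U'" "\<Psi> u \<in> U2" "biholomorphic U2 V2 (\<lambda>z. vupd (\<Theta> z) j (\<psi> (\<Psi> (\<Theta> z)) $ l)) \<Psi>2"
        by (rule biholomorphic_replace_coordinate[OF bi holD u(1) nz]) (rule that)
      have "valid (insert j A)" unfolding valid_def
      proof (intro exI conjI)
        show "insert j A \<subseteq> I'" using AI j by blast
        show "inj_on (\<tau>(j := l)) (insert j A)" using inj l(2) j(2) by (auto simp: inj_on_def)
        show "(\<tau>(j := l)) ` insert j A \<subseteq> I" using \<tau>I l(1) by auto
        show "biholomorphic U2 V2 (\<lambda>z. vupd (\<Theta> z) j (\<psi> (\<Psi> (\<Theta> z)) $ l)) \<Psi>2" by (rule *(3))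
        show "U2 \<subseteq> V1" using *(1) U' by blast
        show "\<Psi> u \<in> U2 \<inter> M" using *(2) \<Psi>M[OF u] by blast
        show "\<forall>w\<in>U2. \<forall>i. vupd (\<Theta> w) j (\<psi> (\<Psi> (\<Theta> w)) $ l) $ i = (if i \<in> insert j A then \<psi> w $ (\<tau>(j := l)) i else w $ i)"
        proof (intro ballI allI)
          fix w i assume "w \<in> U2"
          then have w: "w \<in> U'" using *(1) by blast
          have "\<Theta> w $ i = (if i \<in> A then \<psi> w $ \<tau> i else w $ i)" using \<Theta> w by blast
          then show "vupd (\<Theta> w) j (\<psi> (\<Psi> (\<Theta> w)) $ l) $ i = (if i \<in> insert j A then \<psi> w $ (\<tau>(j := l)) i else w $ i)"
            using h(2)[OF w] by simp
        qed
      qed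
      then have "card (insert j A) \<le> card A" by (rule A(2))
      then show False using j(2) by simp
    qed
    define u1 where "u1 = \<Theta> w1"
    have w1': "w1 \<in> U'" "w1 \<in> M" using w1 by auto
    have u1V: "u1 \<in> V'" unfolding u1_def by (rule h(1)[OF w1'(1)])
    have u10: "\<forall>i. i \<notin> I' \<longrightarrow> u1 $ i = 0"
    proof (intro allI impI)
      fix i assume i: "i \<notin> I'"
      have "\<Theta> w1 $ i = (if i \<in> A then \<psi> w1 $ \<tau> i else w1 $ i)" using \<Theta> w1'(1) by blast
      moreover have "i \<notin> A" using i AI by blast
      ultimately show "u1 $ i = 0" using i w1'(2) by (simp add: u1_def M_def)
    qed
    obtain \<rho> where \<rho>: "\<rho> > 0" "ball u1 \<rho> \<subseteq> V'" using bd(2) u1V open_contains_ball by blast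
    let ?c = "\<lambda>s. vupd u1 j s"
    have cV: "?c s \<in> V'" if "s \<in> ball (u1 $ j) \<rho>" for s
    proof -
      have "dist u1 (?c s) = dist (u1 $ j) s" using dist_vupd[of u1 j "u1 $ j" s] by simp
      then have "?c s \<in> ball u1 \<rho>" using that by simp
      then show ?thesis using \<rho>(2) by blast
    qed
    have c0: "\<forall>i. i \<notin> I' \<longrightarrow> ?c s $ i = 0" for s using u10 j(1) by auto
    have const: "\<psi> (\<Psi> (?c s)) $ l = \<psi> (\<Psi> u1) $ l" if s: "s \<in> ball (u1 $ j) \<rho>" and l: "l \<in> I" for s l
    proof (cases "l \<in> \<tau> ` A")
      case True
      then obtain i where i: "i \<in> A" "l = \<tau> i" by blast
      have "i \<noteq> j" using i(1) j(2) by blast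
      then show ?thesis using \<Theta>i[OF cV[OF s] i(1)] \<Theta>i[OF u1V i(1)] i(2) by simp
    next
      case False
      let ?f = "\<lambda>s. \<psi> (\<Psi> (?c s)) $ l"
      have "?f holomorphic_on ball (u1 $ j) \<rho>"
        by (rule holomorphic_on_vupd[OF holD]) (use cV in auto)
      moreover have "deriv ?f s = 0" if "s \<in> ball (u1 $ j) \<rho>" for s
        using deriv_vupd[of "\<lambda>u. \<psi> (\<Psi> u) $ l" u1 j s] pd0[OF l False cV[OF that] c0] by simp
      ultimately have "(?f has_field_derivative 0) (at s within ball (u1 $ j) \<rho>)" if "s \<in> ball (u1 $ j) \<rho>" for s
        using that holomorphic_derivI[of ?f "ball (u1 $ j) \<rho>" s] by (metis open_ball has_field_derivative_at_within)
      then have "\<exists>c. \<forall>s\<in>ball (u1 $ j) \<rho>. ?f s = c"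
        by (intro has_field_derivative_zero_constant convex_ball)
      then obtain c where c: "\<forall>s\<in>ball (u1 $ j) \<rho>. ?f s = c" by blast
      have "?f s = ?f (u1 $ j)" using bspec[OF c s] bspec[OF c, of "u1 $ j"] \<rho>(1) by simp
      then show ?thesis by simp
    qed
    have "inj_on (\<lambda>s. \<psi> (\<Psi> (?c s))) (ball (u1 $ j) \<rho>)"
    proof (rule inj_onI)
      fix s t assume st: "s \<in> ball (u1 $ j) \<rho>" "t \<in> ball (u1 $ j) \<rho>" "\<psi> (\<Psi> (?c s)) = \<psi> (\<Psi> (?c t))"
      have "\<Psi> (?c s) \<in> V0" "\<Psi> (?c t) \<in> V0" using h(3)[OF cV[OF st(1)]] h(3)[OF cV[OF st(2)]] U' V1(2) by auto
      then have "\<Psi> (?c s) = \<Psi> (?c t)" using st(3) hd(4) by metis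
      then have "?c s = ?c t" using h(4)[OF cV[OF st(1)]] h(4)[OF cV[OF st(2)]] by metis
      then show "s = t" by simp
    qed
    moreover have "(\<lambda>s. \<psi> (\<Psi> (?c s))) ` ball (u1 $ j) \<rho> \<subseteq> {z \<in> X. \<forall>i\<in>I. z $ i = \<psi> (\<Psi> u1) $ i}"
      using inX \<Psi>M[OF cV c0] const by auto
    ultimately have "finite (ball (u1 $ j) \<rho>)"
      using fibres[of "\<psi> (\<Psi> u1)"] finite_subset finite_image_iff by blast
    then show False using uncountable_ball[OF \<rho>(1)] countable_finite by blast
  qed
  have \<tau>: "\<tau> ` I' = I"
  proof (rule card_subset_eq)
    show "card (\<tau> ` I') = card I" using card_image inj A_eq I' assms(2) by metis
  qed (use \<tau>I A_eq in auto)
  have w1': "w1 \<in> U'" "w1 \<in> M" using w1 by auto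
  define z where "z = \<psi> w1"
  \<comment> \<open>Chart coordinate \<open>i\<close> is read off from the ambient coordinate
    \<open>\<tau> i\<close>; the chart coordinates outside \<open>I'\<close> are those that vanish
    on \<open>X\<close>.\<close>
  define \<kappa> where "\<kappa> w = (\<chi> i. if i \<in> I' then w $ \<tau> i else 0)" for w :: "complex ^ 'n"
  have cont\<kappa>: "continuous_on UNIV \<kappa>"
    unfolding \<kappa>_def
  proof (rule continuous_on_vec_lambda)
    fix i show "continuous_on UNIV (\<lambda>w. if i \<in> I' then w $ \<tau> i else 0)"
      by (cases "i \<in> I'") (auto intro!: continuous_intros)
  qed
  have \<kappa>z: "\<kappa> z = \<Theta> w1"
  proof (rule vec_eq_iff[THEN iffD2], rule allI)
    fix i
    have "\<Theta> w1 $ i = (if i \<in> A then \<psi> w1 $ \<tau> i else w1 $ i)" using \<Theta> w1'(1) by blast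
    then show "\<kappa> z $ i = \<Theta> w1 $ i" using A_eq w1'(2) by (auto simp: \<kappa>_def z_def M_def)
  qed
  have opW: "open (\<kappa> -` V')" by (rule open_vimage[OF bd(2) cont\<kappa>])
  have zW: "z \<in> \<kappa> -` V'" using \<kappa>z h(1)[OF w1'(1)] by simp
  obtain \<eta> where \<eta>: "\<eta> > 0" "ball z \<eta> \<subseteq> \<kappa> -` V'" using opW zW open_contains_ball by blast
  define \<gamma> where "\<gamma> w = \<psi> (\<Psi> (\<kappa> w))" for w
  have \<kappa>0: "\<forall>i. i \<notin> I' \<longrightarrow> \<kappa> w $ i = 0" for w by (simp add: \<kappa>_def)
  have "continuous_on (\<kappa> -` V') \<gamma>"
    unfolding \<gamma>_def
  proof (rule continuous_on_compose2[OF hd(6)])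
    show "continuous_on (\<kappa> -` V') (\<lambda>w. \<Psi> (\<kappa> w))"
      by (rule continuous_on_compose2[OF h(6) continuous_on_subset[OF cont\<kappa>]]) auto
    show "(\<lambda>w. \<Psi> (\<kappa> w)) ` (\<kappa> -` V') \<subseteq> V0" using h(3) U' V1(2) by blast
  qed
  then have "isCont \<gamma> z" using opW zW by (simp add: continuous_on_eq_continuous_at)
  moreover have "\<gamma> z = z" unfolding \<gamma>_def \<kappa>z using h(2)[OF w1'(1)] by (simp add: z_def)
  moreover have "\<gamma> w \<in> X \<and> (\<forall>i\<in>I. \<gamma> w $ i = w $ i)" if w: "w \<in> ball z \<eta>" for w
  proof
    have wV: "\<kappa> w \<in> V'" using w \<eta>(2) by blast
    show "\<gamma> w \<in> X" unfolding \<gamma>_def by (rule inX[OF \<Psi>M[OF wV \<kappa>0]])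
    show "\<forall>i\<in>I. \<gamma> w $ i = w $ i"
    proof
      fix l assume "l \<in> I"
      then obtain i where i: "i \<in> I'" "l = \<tau> i" using \<tau> by blast
      then show "\<gamma> w $ l = w $ l" using \<Theta>i[OF wV, of i] A_eq by (simp add: \<gamma>_def \<kappa>_def)
    qed
  qed
  moreover have "z \<in> X" unfolding z_def by (rule inX[OF w1'(2)])
  ultimately have "has_local_section I X z" unfolding has_local_section_def using \<eta>(1) by blast
  moreover have "dist a z < e" unfolding z_def using V1(3) w1'(1) U' by blast
  ultimately show ?thesis by blast
qed

section \<open>Analytic sets contained in a cone over a coordinate subspace\<close>

subsection \<open>Linear changes of coordinates\<close>

definition clinear_iso :: "(complex ^ 'n \<Rightarrow> complex ^ 'n) \<Rightarrow> bool" where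
  "clinear_iso T \<longleftrightarrow> (\<forall>x y. T (x + y) = T x + T y) \<and> (\<forall>c x. T (c *s x) = c *s T x) \<and> bij T"

lemma clinear_isoD:
  assumes "clinear_iso T"
  shows "T (x + y) = T x + T y" "T (c *s x) = c *s T x" "bij T"
  using assms unfolding clinear_iso_def by auto

lemma clinear_iso_inv:
  assumes "clinear_iso T" shows "clinear_iso (inv T)"
proof -
  note T = clinear_isoD[OF assms]
  have I: "T (inv T x) = x" "inv T (T x) = x" for x
    using T(3) by (simp_all add: bij_is_surj surj_f_inv_f bij_is_inj)
  show ?thesis unfolding clinear_iso_def
  proof (intro conjI allI)
    show "inv T (x + y) = inv T x + inv T y" for x y using I T(1) by metis
    show "inv T (c *s x) = c *s inv T x" for c x using I T(2) by metis
    show "bij (inv T)" by (rule bij_imp_bij_inv[OF T(3)])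
  qed
qed

lemma clinear_iso_nth:
  fixes T :: "complex ^ 'n \<Rightarrow> complex ^ 'n"
  assumes "clinear_iso T" shows "T z $ i = (\<Sum>j\<in>UNIV. z $ j * T (axis j 1) $ i)"
proof -
  note T = clinear_isoD[OF assms]
  have T0: "T 0 = 0" using T(1)[of 0 0] by simp
  have "T (\<Sum>j\<in>A. f j) = (\<Sum>j\<in>A. T (f j))" if "finite A" for A and f :: "'n \<Rightarrow> complex ^ 'n"
    using that by induction (simp_all add: T0 T(1))
  then have "T (\<Sum>j\<in>UNIV. z $ j *s axis j 1) = (\<Sum>j\<in>UNIV. z $ j *s T (axis j 1))" by (simp add: T(2))
  then show ?thesis by (simp add: basis_expansion)
qed

lemma polyfun_clinear_iso:
  assumes "clinear_iso T" shows "polyfun (\<lambda>z. T z $ i)"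
proof -
  have "polyfun (\<lambda>z. \<Sum>j\<in>UNIV. z $ j * T (axis j 1) $ i)"
    by (intro polyfun_sum polyfun_mult polyfun_coord polyfun_const)
  moreover have "(\<lambda>z. \<Sum>j\<in>UNIV. z $ j * T (axis j 1) $ i) = (\<lambda>z. T z $ i)"
    by (rule ext) (rule clinear_iso_nth[OF assms, symmetric])
  ultimately show ?thesis by (rule back_subst)
qed

lemma polyfun_compose:
  assumes "polyfun P" "\<And>i. polyfun (\<lambda>z. g z $ i)" shows "polyfun (\<lambda>z. P (g z))"
proof -
  obtain p where p: "P = poly_eval p" using assms(1) by (auto simp: polyfun_def)
  show ?thesis unfolding p poly_eval_def
    by (intro polyfun_sum polyfun_mult polyfun_const polyfun_prod polyfun_power assms(2))
qed

lemma clinear_iso_holomorphic: "clinear_iso T \<Longrightarrow> holomorphic_Cn (\<lambda>z. T z $ i) U"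
  by (intro polyfun_holomorphic polyfun_clinear_iso)

lemma clinear_iso_continuous:
  assumes "clinear_iso T" shows "continuous_on S T"
proof -
  have "continuous_on S (\<lambda>z. \<chi> i. T z $ i)"
    by (intro continuous_on_vec_lambda holomorphic_Cn_continuous_on clinear_iso_holomorphic assms)
  then show ?thesis by simp
qed

lemma image_eq_vimage_inv: "bij T \<Longrightarrow> T ` S = inv T -` S"
  by (metis bij_imp_bij_inv bij_vimage_eq_inv_image inv_inv_eq)

lemma closed_analytic_set_linear:
  fixes T :: "complex ^ 'n \<Rightarrow> complex ^ 'n"
  assumes T: "clinear_iso T" and X: "closed_analytic_set X"
  shows "closed_analytic_set (T ` X)"
  unfolding closed_analytic_set_def
proof
  note T' = clinear_iso_inv[OF T]
  note bij = clinear_isoD(3)[OF T]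
  have I: "inv T (T x) = x" "T (inv T x) = x" for x
    using bij by (simp_all add: bij_is_surj surj_f_inv_f bij_is_inj)
  have iX: "x \<in> T ` X \<longleftrightarrow> inv T x \<in> X" for x using image_eq_vimage_inv[OF bij, of X] by blast
  show "closed (T ` X)"
    unfolding image_eq_vimage_inv[OF bij]
    by (rule closed_vimage) (use X clinear_iso_continuous[OF T'] in \<open>auto simp: closed_analytic_set_def\<close>)
  show "\<forall>a\<in>T ` X. \<exists>U F. open U \<and> a \<in> U \<and> finite F \<and> (\<forall>f\<in>F. holomorphic_Cn f U) \<and> T ` X \<inter> U = {z \<in> U. \<forall>f\<in>F. f z = 0}"
  proof
    fix a assume "a \<in> T ` X"
    then have "inv T a \<in> X" using iX by blast
    then obtain U F where UF: "open U" "inv T a \<in> U" "finite F" "\<forall>f\<in>F. holomorphic_Cn f U" "X \<inter> U = {z \<in> U. \<forall>f\<in>F. f z = 0}"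
      using X unfolding closed_analytic_set_def by blast
    let ?U = "inv T -` U" and ?F = "(\<lambda>f z. f (inv T z)) ` F"
    have "open ?U" by (rule open_vimage[OF UF(1) clinear_iso_continuous[OF T']])
    moreover have "holomorphic_Cn g ?U" if g: "g \<in> ?F" for g
    proof -
      obtain f where f: "f \<in> F" "g = (\<lambda>z. f (inv T z))" using g by blast
      show ?thesis unfolding f(2)
        by (rule holomorphic_Cn_compose[of f U]) (use UF(4) f(1) clinear_iso_holomorphic[OF T'] in auto)
    qed
    moreover have "T ` X \<inter> ?U = {z \<in> ?U. \<forall>f\<in>?F. f z = 0}"
    proof (rule set_eqI)
      fix x
      have "x \<in> T ` X \<inter> ?U \<longleftrightarrow> inv T x \<in> X \<inter> U" by (simp add: iX)
      also have "\<dots> \<longleftrightarrow> x \<in> {z \<in> ?U. \<forall>f\<in>?F. f z = 0}" unfolding UF(5) by simp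
      finally show "x \<in> T ` X \<inter> ?U \<longleftrightarrow> x \<in> {z \<in> ?U. \<forall>f\<in>?F. f z = 0}" .
    qed
    ultimately show "\<exists>U F. open U \<and> a \<in> U \<and> finite F \<and> (\<forall>f\<in>F. holomorphic_Cn f U) \<and> T ` X \<inter> U = {z \<in> U. \<forall>f\<in>F. f z = 0}"
      using UF(2,3) by (intro exI[of _ ?U] exI[of _ ?F]) auto
  qed
qed

lemma regular_point_linear:
  fixes T :: "complex ^ 'n \<Rightarrow> complex ^ 'n"
  assumes T: "clinear_iso T" and reg: "regular_point X d a"
  shows "regular_point (T ` X) d (T a)"
proof -
  note T' = clinear_iso_inv[OF T]
  note bij = clinear_isoD(3)[OF T]
  have I: "inv T (T x) = x" "T (inv T x) = x" for x
    using bij by (simp_all add: bij_is_surj surj_f_inv_f bij_is_inj)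
  obtain U \<phi> \<psi> I' and V :: "(complex ^ 'n) set" where U: "open U" "a \<in> U" "open V" "homeomorphism U V \<phi> \<psi>"
    "\<forall>i. holomorphic_Cn (\<lambda>z. \<phi> z $ i) U" "\<forall>i. holomorphic_Cn (\<lambda>w. \<psi> w $ i) V"
    and I': "card I' = d" and img: "\<phi> ` (X \<inter> U) = {w \<in> V. \<forall>i. i \<notin> I' \<longrightarrow> w $ i = 0}" and aX: "a \<in> X"
    using reg unfolding regular_point_def by blast
  have bi: "biholomorphic U V \<phi> \<psi>" unfolding biholomorphic_def using U by blast
  have biT: "biholomorphic (T ` U) U (inv T) T"
    unfolding biholomorphic_def
  proof (intro conjI allI)
    show "open (T ` U)" unfolding image_eq_vimage_inv[OF bij]
      by (rule open_vimage[OF U(1) clinear_iso_continuous[OF T']])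
    show "homeomorphism (T ` U) U (inv T) T"
      by (rule homeomorphismI) (use I clinear_iso_continuous[OF T] clinear_iso_continuous[OF T'] in auto)
  qed (use U(1) clinear_iso_holomorphic[OF T] clinear_iso_holomorphic[OF T'] in auto)
  note b = biholomorphicD[OF biholomorphic_compose[OF biT bi]]
  show ?thesis unfolding regular_point_def
  proof (intro conjI exI)
    show "T a \<in> T ` X" using aX by blast
    show "T a \<in> T ` U" using U(2) by blast
    have "T ` X \<inter> T ` U = T ` (X \<inter> U)" using bij by (simp add: bij_is_inj image_Int)
    then have "(\<phi> \<circ> inv T) ` (T ` X \<inter> T ` U) = \<phi> ` (X \<inter> U)" by (simp add: image_image I)
    then show "(\<phi> \<circ> inv T) ` (T ` X \<inter> T ` U) = {w \<in> V. \<forall>i. i \<notin> I' \<longrightarrow> w $ i = 0}" using img by simp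
    show "card I' = d" by (rule I')
  qed (use b in auto)
qed

text \<open>The form in which pure dimension enters the construction of polynomials; it passes to
  linear images.\<close>

definition regular_dense :: "nat \<Rightarrow> (complex ^ 'n) set \<Rightarrow> bool" where
  "regular_dense d X \<longleftrightarrow> closed_analytic_set X \<and> (\<forall>a\<in>X. \<forall>e>0. \<exists>z. regular_point X d z \<and> dist a z < e)"

lemma pure_dim_regular_dense':
  assumes "closed_pure_dim_analytic d X" shows "regular_dense d X"
  unfolding regular_dense_def
proof (intro conjI ballI allI impI)
  show "closed_analytic_set X" using assms by (simp add: closed_pure_dim_analytic_def)
  fix a and e :: real assume "a \<in> X" "e > 0"
  then show "\<exists>z. regular_point X d z \<and> dist a z < e"
    using pure_dim_regular_dense[OF assms, of a] unfolding closure_approachable by (auto simp: dist_commute)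
qed

lemma regular_dense_linear:
  assumes T: "clinear_iso T" and X: "regular_dense d X"
  shows "regular_dense d (T ` X)"
  unfolding regular_dense_def
proof (intro conjI ballI allI impI)
  show "closed_analytic_set (T ` X)"
    using closed_analytic_set_linear[OF T] X by (simp add: regular_dense_def)
  fix b and e :: real assume b: "b \<in> T ` X" and e: "e > 0"
  then obtain a where a: "a \<in> X" "b = T a" by blast
  have "isCont T a" using clinear_iso_continuous[OF T, of UNIV] by (simp add: continuous_on_eq_continuous_at)
  then obtain \<delta> where \<delta>: "\<delta> > 0" "\<And>x. dist x a < \<delta> \<Longrightarrow> dist (T x) (T a) < e"
    unfolding continuous_at_eps_delta using e by blast
  obtain z where z: "regular_point X d z" "dist a z < \<delta>" using X a(1) \<delta>(1) unfolding regular_dense_def by blast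
  have "regular_point (T ` X) d (T z)" by (rule regular_point_linear[OF T z(1)])
  moreover have "dist b (T z) < e" using \<delta>(2)[of z] z(2) a(2) by (simp add: dist_commute)
  ultimately show "\<exists>z. regular_point (T ` X) d z \<and> dist b z < e" by blast
qed

subsection \<open>Cylinders over coordinate projections\<close>

text \<open>The full preimage of the image of \<open>X\<close> under the projection that forgets the
  coordinates in \<open>J\<close>. The space stays fixed, so coordinates can be eliminated one at a
  time.\<close>

definition cylinder :: "'n set \<Rightarrow> (complex ^ 'n) set \<Rightarrow> (complex ^ 'n) set" where
  "cylinder J X = {z. \<exists>z'\<in>X. \<forall>k. k \<notin> J \<longrightarrow> z' $ k = z $ k}"

definition cone_over :: "'n set \<Rightarrow> real \<Rightarrow> (complex ^ 'n) set \<Rightarrow> bool" where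
  "cone_over I K X \<longleftrightarrow> (\<forall>z\<in>X. \<forall>i. i \<notin> I \<longrightarrow> norm (z $ i) \<le> K * (1 + (\<Sum>j\<in>I. norm (z $ j))))"

lemma cylinder_empty [simp]: "cylinder {} X = X"
  unfolding cylinder_def by (auto simp: vec_eq_iff[symmetric])

lemma cylinder_insert:
  assumes "i \<notin> J" shows "cylinder (insert i J) X = {z. \<exists>t. vupd z i t \<in> cylinder J X}"
proof (intro equalityI subsetI)
  fix z assume "z \<in> cylinder (insert i J) X"
  then obtain z' where z': "z' \<in> X" "\<forall>k. k \<notin> insert i J \<longrightarrow> z' $ k = z $ k" unfolding cylinder_def by blast
  then have "vupd z i (z' $ i) \<in> cylinder J X" unfolding cylinder_def by auto
  then show "z \<in> {z. \<exists>t. vupd z i t \<in> cylinder J X}" by blast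
next
  fix z assume "z \<in> {z. \<exists>t. vupd z i t \<in> cylinder J X}"
  then obtain t z' where z': "z' \<in> X" "\<forall>k. k \<notin> J \<longrightarrow> z' $ k = vupd z i t $ k" unfolding cylinder_def by blast
  then have "\<forall>k. k \<notin> insert i J \<longrightarrow> z' $ k = z $ k" by simp
  then show "z \<in> cylinder (insert i J) X" using z'(1) unfolding cylinder_def by blast
qed

lemma cylinder_growth:
  fixes X :: "(complex ^ 'n) set"
  assumes c: "cone_over I K X" and i: "i \<notin> I" "i \<notin> J" "J \<inter> I = {}" and t: "vupd z i t \<in> cylinder J X"
  shows "norm t \<le> (\<bar>K\<bar> * (1 + card I)) * (1 + norm z)"
proof -
  obtain z' where z': "z' \<in> X" "\<forall>k. k \<notin> J \<longrightarrow> z' $ k = vupd z i t $ k" using t unfolding cylinder_def by blast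
  have ti: "z' $ i = t" using z'(2) i(2) by simp
  have zj: "z' $ j = z $ j" if "j \<in> I" for j using z'(2) that i by auto
  have "norm t \<le> K * (1 + (\<Sum>j\<in>I. norm (z' $ j)))" using c z'(1) i(1) ti unfolding cone_over_def by blast
  also have "\<dots> \<le> \<bar>K\<bar> * (1 + (\<Sum>j\<in>I. norm (z' $ j)))"
    by (intro mult_right_mono) (auto intro!: add_nonneg_nonneg sum_nonneg)
  also have "(\<Sum>j\<in>I. norm (z' $ j)) \<le> (\<Sum>j\<in>I. norm z)"
    using zj by (intro sum_mono) (simp add: Finite_Cartesian_Product.norm_nth_le)
  then have "1 + (\<Sum>j\<in>I. norm (z' $ j)) \<le> 1 + card I * norm z" by simp
  also have "\<dots> \<le> (1 + card I) * (1 + norm z)" by (simp add: algebra_simps)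
  finally show ?thesis by (simp add: mult_left_mono mult.assoc)
qed

text \<open>Each elimination is a projection with locally bounded fibres: the cone condition bounds
  every coordinate outside \<open>I\<close> by those in \<open>I\<close>, and the latter are never
  eliminated.\<close>

lemma closed_analytic_cylinder:
  fixes X :: "(complex ^ 'n) set"
  assumes X: "closed_analytic_set X" and c: "cone_over I K X" and "J \<inter> I = {}"
  shows "closed_analytic_set (cylinder J X)"
  using finite[of J] assms(3)
proof (induction J rule: finite_induct)
  case empty
  then show ?case using X by simp
next
  case (insert i J)
  have i: "i \<notin> I" "i \<notin> J" "J \<inter> I = {}" using insert by auto
  have "fibres_locally_bounded i (cylinder J X)"
    by (rule fibres_locally_bounded_of_growth[OF cylinder_growth[OF c i]])
  then show ?case unfolding cylinder_insert[OF i(2)]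
    by (intro closed_analytic_set_projection insert.IH i(3))
qed

text \<open>Freeing one coordinate at a time, each step admits only the finitely many values allowed
  by a fibre of the cylinder.\<close>

lemma finite_cone_fibre:
  fixes X :: "(complex ^ 'n) set"
  assumes X: "closed_analytic_set X" and c: "cone_over I K X"
  shows "finite {z \<in> X. \<forall>i\<in>I. z $ i = w $ i}"
proof -
  have "J \<inter> I = {} \<Longrightarrow> finite {z \<in> X. \<forall>k. k \<notin> J \<longrightarrow> z $ k = w $ k}" for J w
    using finite[of J]
  proof (induction J arbitrary: w rule: finite_induct)
    case empty
    have "{z \<in> X. \<forall>k. k \<notin> {} \<longrightarrow> z $ k = w $ k} \<subseteq> {w}" by (auto simp: vec_eq_iff)
    then show ?case using finite_subset by blast
  next
    case (insert i J)
    have i: "i \<notin> I" "i \<notin> J" "J \<inter> I = {}" using insert by auto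
    let ?T = "{t. vupd w i t \<in> cylinder J X}"
    have "fibres_locally_bounded i (cylinder J X)"
      by (rule fibres_locally_bounded_of_growth[OF cylinder_growth[OF c i]])
    then have "finite ?T"
      by (intro finite_fibre closed_analytic_cylinder[OF X c i(3)] fibres_locally_bounded_imp_bounded)
    moreover have "{z \<in> X. \<forall>k. k \<notin> insert i J \<longrightarrow> z $ k = w $ k} \<subseteq> (\<Union>t\<in>?T. {z \<in> X. \<forall>k. k \<notin> J \<longrightarrow> z $ k = vupd w i t $ k})"
    proof
      fix z assume z: "z \<in> {z \<in> X. \<forall>k. k \<notin> insert i J \<longrightarrow> z $ k = w $ k}"
      then have *: "z \<in> X" "\<forall>k. k \<notin> J \<longrightarrow> z $ k = vupd w i (z $ i) $ k" by auto
      then have "vupd w i (z $ i) \<in> cylinder J X" unfolding cylinder_def by blast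
      then show "z \<in> (\<Union>t\<in>?T. {z \<in> X. \<forall>k. k \<notin> J \<longrightarrow> z $ k = vupd w i t $ k})" using * by blast
    qed
    moreover have "finite {z \<in> X. \<forall>k. k \<notin> J \<longrightarrow> z $ k = vupd w i t $ k}" for t by (rule insert.IH[OF i(3)])
    ultimately show ?case by (meson finite_UN_I finite_subset)
  qed
  from this[of "- I" w] show ?thesis by (simp add: Ball_def)
qed

text \<open>Near any point of \<open>X\<close> there is one with a local section over the
  coordinates in \<open>I\<close>; the \<open>i\<close>-th component of the section is the function
  whose graph lies in the cylinder.\<close>

lemma graph_dense_cylinder:
  fixes X :: "(complex ^ 'n) set"
  assumes X: "regular_dense d X" and c: "cone_over I K X" and "card I = d" and i: "i \<notin> I"
  shows "graph_dense i (cylinder (- insert i I) X)"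
  unfolding graph_dense_def
proof (intro ballI allI impI)
  let ?J = "- insert i I"
  let ?H = "cylinder ?J X"
  fix p and e :: real assume p: "p \<in> ?H" and e: "e > 0"
  have caX: "closed_analytic_set X" using X by (simp add: regular_dense_def)
  obtain z' where z': "z' \<in> X" "\<forall>k. k \<notin> ?J \<longrightarrow> z' $ k = p $ k" using p unfolding cylinder_def by blast
  obtain z0 where z0: "regular_point X d z0" "dist z' z0 < e / 2"
    using X z'(1) half_gt_zero[OF e] unfolding regular_dense_def by blast
  obtain z1 where z1: "has_local_section I X z1" "dist z0 z1 < e / 2"
    using local_section_near_regular_point[OF finite_cone_fibre[OF caX c] \<open>card I = d\<close> z0(1) half_gt_zero[OF e]] by blast
  have d1: "dist z' z1 < e" using dist_triangle[of z' z1 z0] z0(2) z1(2) by linarith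
  obtain \<gamma> \<eta> where \<gamma>: "z1 \<in> X" "\<eta> > 0" "isCont \<gamma> z1" "\<gamma> z1 = z1" "\<forall>w\<in>ball z1 \<eta>. \<gamma> w \<in> X \<and> (\<forall>i\<in>I. \<gamma> w $ i = w $ i)"
    using z1(1) unfolding has_local_section_def by blast
  \<comment> \<open>The coordinates in \<open>?J\<close> are free in the cylinder and are kept from
    \<open>p\<close>; the others come from \<open>z1\<close>, where a section exists. So
    \<open>q\<close> is as close to \<open>p\<close> as \<open>z1\<close> is to
    \<open>z'\<close>.\<close>
  define q where "q = (\<chi> k. if k \<in> ?J then p $ k else z1 $ k)"
  have qH: "q \<in> ?H" unfolding cylinder_def using \<gamma>(1) by (auto simp: q_def intro!: bexI[of _ z1])
  have "dist p q \<le> dist z' z1"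
    unfolding dist_norm norm_vec_def
    by (rule L2_set_mono) (use z'(2) in \<open>auto simp: q_def\<close>)
  then have dpq: "dist p q < e" using d1 by linarith
  \<comment> \<open>Carries a neighbourhood of \<open>q\<close> into the domain of the section; only
    the coordinates in \<open>I\<close> are transferred.\<close>
  define \<zeta> where "\<zeta> w = (\<chi> k. if k \<in> I then w $ k else z1 $ k)" for w :: "complex ^ 'n"
  have \<zeta>q: "\<zeta> q = z1" by (auto simp: \<zeta>_def q_def vec_eq_iff)
  have d\<zeta>: "dist (\<zeta> v) (\<zeta> w) \<le> dist v w" for v w
    unfolding dist_norm norm_vec_def by (rule L2_set_mono) (auto simp: \<zeta>_def)
  have "isCont \<zeta> q" unfolding continuous_at_eps_delta using d\<zeta> by (meson le_less_trans)
  moreover have "isCont \<gamma> (\<zeta> q)" using \<gamma>(3) \<zeta>q by simp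
  ultimately have cont\<gamma>: "isCont (\<lambda>w. \<gamma> (\<zeta> w)) q" by (rule isCont_o2)
  define g where "g w = \<gamma> (\<zeta> w) $ i" for w
  have "isCont g q" unfolding g_def using cont\<gamma> by (rule isCont_vec_nth)
  moreover have "g q = q $ i"
  proof -
    have "g q = z1 $ i" unfolding g_def \<zeta>q \<gamma>(4) ..
    then show ?thesis using i by (simp add: q_def)
  qed
  moreover have "vupd w i (g w) \<in> ?H" if w: "w \<in> ball q \<eta>" for w
  proof -
    have "dist z1 (\<zeta> w) \<le> dist q w" using d\<zeta>[of q w] \<zeta>q by simp
    then have "\<zeta> w \<in> ball z1 \<eta>" using w by simp
    then have *: "\<gamma> (\<zeta> w) \<in> X" "\<forall>i\<in>I. \<gamma> (\<zeta> w) $ i = \<zeta> w $ i" using \<gamma>(5) by auto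
    have "\<forall>k. k \<notin> ?J \<longrightarrow> \<gamma> (\<zeta> w) $ k = vupd w i (g w) $ k"
      using *(2) i by (auto simp: g_def \<zeta>_def)
    then show ?thesis unfolding cylinder_def using *(1) by blast
  qed
  ultimately have "\<exists>g. isCont g q \<and> g q = q $ i \<and> (\<exists>\<eta>>0. \<forall>w\<in>ball q \<eta>. vupd w i (g w) \<in> ?H)"
    using \<gamma>(2) by blast
  then show "\<exists>q\<in>?H. dist p q < e \<and> (\<exists>g. isCont g q \<and> g q = q $ i \<and> (\<exists>\<eta>>0. \<forall>w\<in>ball q \<eta>. vupd w i (g w) \<in> ?H))"
    using qH dpq by blast
qed

subsection \<open>Separation by polynomials\<close>

text \<open>Coefficients on a moment curve: with distinct exponents \<open>en j\<close>, each
  difference of \<open>z\<close> and \<open>b\<close> gives a nonzero polynomial in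
  \<open>s\<close>, and \<open>s\<close> has to avoid finitely many roots. The exponent
  \<open>0\<close> at \<open>i\<close> normalises \<open>c i = 1\<close>.\<close>

lemma separating_form:
  fixes b :: "complex ^ 'n"
  assumes fin: "finite \<Phi>" and ne: "\<And>z. z \<in> \<Phi> \<Longrightarrow> \<exists>j. j \<notin> I \<and> z $ j \<noteq> b $ j" and i: "i \<notin> I"
  obtains c :: "'n \<Rightarrow> complex" where "c i = 1" "\<And>z. z \<in> \<Phi> \<Longrightarrow> (\<Sum>j\<in>-I. c j * z $ j) \<noteq> (\<Sum>j\<in>-I. c j * b $ j)"
proof -
  obtain ix :: "'n \<Rightarrow> nat" where ix: "inj ix" using finite_imp_inj_to_nat_seg[OF finite[of UNIV]] by blast
  define en where "en j = (if j = i then 0 else Suc (ix j))" for j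
  have en: "inj en" using ix unfolding inj_def en_def by auto
  define p where "p z = (\<Sum>j\<in>-I. monom (z $ j - b $ j) (en j))" for z
  have ev: "poly (p z) s = (\<Sum>j\<in>-I. s ^ en j * z $ j) - (\<Sum>j\<in>-I. s ^ en j * b $ j)" for z s
    by (simp add: p_def poly_sum poly_monom algebra_simps sum_subtractf)
  have p0: "p z \<noteq> 0" if z: "z \<in> \<Phi>" for z
  proof -
    obtain j where j: "j \<notin> I" "z $ j \<noteq> b $ j" using ne[OF z] by blast
    have "coeff (p z) (en j) = (\<Sum>k\<in>-I. if k = j then z $ j - b $ j else 0)"
      unfolding p_def coeff_sum using en by (intro sum.cong) (auto simp: inj_def)
    then have "coeff (p z) (en j) = z $ j - b $ j" using j(1) by simp
    then show ?thesis using j(2) by auto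
  qed
  have "finite (\<Union>z\<in>\<Phi>. {s. poly (p z) s = 0})" using fin p0 poly_roots_finite by blast
  then obtain s where s: "s \<notin> (\<Union>z\<in>\<Phi>. {s. poly (p z) s = 0})"
    using ex_new_if_finite[OF infinite_UNIV_char_0] by blast
  show ?thesis
  proof (rule that[of "\<lambda>j. s ^ en j"])
    show "s ^ en i = 1" by (simp add: en_def)
    show "(\<Sum>j\<in>-I. s ^ en j * z $ j) \<noteq> (\<Sum>j\<in>-I. s ^ en j * b $ j)" if "z \<in> \<Phi>" for z
      using s that ev[of z s] by auto
  qed
qed

text \<open>The shear \<open>S\<close> makes the separating form the coordinate \<open>i\<close>;
  all coordinates except \<open>i\<close> and those in \<open>I\<close> are then projected away. The
  image of \<open>b\<close> stays off the image of \<open>X\<close>, because the form separates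
  \<open>b\<close> from the points of \<open>X\<close> that share its coordinates in
  \<open>I\<close>.\<close>

lemma cone_polynomial:
  fixes X :: "(complex ^ 'n) set"
  assumes X: "regular_dense d X" and c: "cone_over I K X" and d: "card I = d" and i: "i \<notin> I" and b: "b \<notin> X"
  obtains P where "polyfun P" "\<And>z. z \<in> X \<Longrightarrow> P z = 0" "P b \<noteq> 0"
proof -
  have caX: "closed_analytic_set X" using X by (simp add: regular_dense_def)
  let ?\<Phi> = "{z \<in> X. \<forall>i\<in>I. z $ i = b $ i}"
  have ne: "\<exists>j. j \<notin> I \<and> z $ j \<noteq> b $ j" if "z \<in> ?\<Phi>" for z
  proof (rule ccontr)
    assume "\<not> ?thesis"
    then have "z = b" using that by (auto simp: vec_eq_iff)
    then show False using that b by blast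
  qed
  obtain a :: "'n \<Rightarrow> complex" where a: "a i = 1" "\<And>z. z \<in> ?\<Phi> \<Longrightarrow> (\<Sum>j\<in>-I. a j * z $ j) \<noteq> (\<Sum>j\<in>-I. a j * b $ j)"
    by (rule separating_form[OF finite_cone_fibre[OF caX c] ne i]) (assumption, rule that)
  define l where "l z = (\<Sum>j\<in>-I. a j * z $ j)" for z :: "complex ^ 'n"
  define S where "S z = vupd z i (l z)" for z
  have l_vupd: "l (vupd z i t) = l z + t - z $ i" for z t
  proof -
    have *: "l x = x $ i + (\<Sum>j\<in>- I - {i}. a j * x $ j)" for x
      unfolding l_def using i a(1) by (subst sum.remove[of "- I" i]) auto
    have "(\<Sum>j\<in>- I - {i}. a j * vupd z i t $ j) = (\<Sum>j\<in>- I - {i}. a j * z $ j)" by (rule sum.cong) auto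
    then show ?thesis unfolding * by simp
  qed
  have S: "clinear_iso S"
    unfolding clinear_iso_def
  proof (intro conjI allI)
    show "S (x + y) = S x + S y" for x y
      by (auto simp: S_def l_def vec_eq_iff algebra_simps sum.distrib)
    show "S (k *s x) = k *s S x" for k x
      by (auto simp: S_def l_def vec_eq_iff sum_distrib_left mult_ac)
    \<comment> \<open>By \<open>l_vupd\<close>, replacing coordinate \<open>i\<close> by
      \<open>2 * z $ i - l z\<close> gives the form the value \<open>z $ i\<close>, so this map
      inverts \<open>S\<close>.\<close>
    let ?S' = "\<lambda>z. vupd z i (2 * z $ i - l z)"
    have "?S' (S z) = z" "S (?S' z) = z" for z by (simp_all add: S_def l_vupd)
    then show "bij S" by (intro bij_betw_byWitness[where f'="?S'"]) auto
  qed
  \<comment> \<open>The new coordinate \<open>i\<close> combines the old coordinates outside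
    \<open>I\<close> with coefficients \<open>a j\<close>, each bounded by the old cone
    condition.\<close>
  define K' where "K' = \<bar>K\<bar> * (1 + (\<Sum>j\<in>-I. norm (a j)))"
  have A0: "(\<Sum>j\<in>-I. norm (a j)) \<ge> 0" by (intro sum_nonneg) simp
  have cS: "cone_over I K' (S ` X)"
    unfolding cone_over_def
  proof (intro ballI allI impI)
    fix y k assume "y \<in> S ` X" and k: "k \<notin> I"
    then obtain z where z: "z \<in> X" "y = S z" by blast
    let ?s = "1 + (\<Sum>j\<in>I. norm (z $ j))"
    have s0: "?s \<ge> 0" by (intro add_nonneg_nonneg sum_nonneg) auto
    have zb: "norm (z $ j) \<le> \<bar>K\<bar> * ?s" if "j \<notin> I" for j
    proof -
      have "norm (z $ j) \<le> K * ?s" using c z(1) that unfolding cone_over_def by blast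
      also have "\<dots> \<le> \<bar>K\<bar> * ?s" by (rule mult_right_mono[OF abs_ge_self s0])
      finally show ?thesis .
    qed
    have sy: "(\<Sum>j\<in>I. norm (y $ j)) = (\<Sum>j\<in>I. norm (z $ j))"
      using i by (intro sum.cong) (auto simp: z(2) S_def)
    have K0: "\<bar>K\<bar> * ?s \<ge> 0" using s0 by simp
    have "norm (y $ k) \<le> \<bar>K\<bar> * ?s * (1 + (\<Sum>j\<in>-I. norm (a j)))"
    proof (cases "k = i")
      case True
      have "norm (y $ k) \<le> (\<Sum>j\<in>-I. norm (a j * z $ j))" using True by (simp add: z(2) S_def l_def norm_sum)
      also have "\<dots> \<le> (\<Sum>j\<in>-I. norm (a j) * (\<bar>K\<bar> * ?s))"
        using zb by (intro sum_mono) (auto simp: norm_mult intro!: mult_left_mono)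
      also have "\<dots> = (\<bar>K\<bar> * ?s) * (\<Sum>j\<in>-I. norm (a j))" by (simp add: sum_distrib_right mult.commute)
      finally show ?thesis using K0 by (simp add: distrib_left)
    next
      case False
      have "norm (y $ k) \<le> \<bar>K\<bar> * ?s" using False zb[OF k] by (simp add: z(2) S_def)
      also have "\<dots> \<le> \<bar>K\<bar> * ?s * (1 + (\<Sum>j\<in>-I. norm (a j)))"
        using mult_left_mono[of 1 "1 + (\<Sum>j\<in>-I. norm (a j))", OF _ K0] A0 by simp
      finally show ?thesis .
    qed
    then show "norm (y $ k) \<le> K' * (1 + (\<Sum>j\<in>I. norm (y $ j)))"
      unfolding sy K'_def by (simp add: mult_ac)
  qed
  let ?J = "- insert i I"
  let ?H = "cylinder ?J (S ` X)"
  have rdS: "regular_dense d (S ` X)" by (rule regular_dense_linear[OF S X])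
  have caS: "closed_analytic_set (S ` X)" using rdS by (simp add: regular_dense_def)
  have Hca: "closed_analytic_set ?H" by (rule closed_analytic_cylinder[OF caS cS]) auto
  have gd: "graph_dense i ?H" by (rule graph_dense_cylinder[OF rdS cS d i])
  have gr: "norm t \<le> (\<bar>K'\<bar> * (1 + card I)) * (1 + norm z)" if "vupd z i t \<in> ?H" for z t
    by (rule cylinder_growth[OF cS i _ _ that]) auto
  have Sb: "S b \<notin> ?H"
  proof
    assume "S b \<in> ?H"
    then obtain z where z: "z \<in> X" "\<forall>k. k \<notin> ?J \<longrightarrow> S z $ k = S b $ k" unfolding cylinder_def by blast
    have "z $ k = b $ k" if "k \<in> I" for k
    proof -
      have "S z $ k = S b $ k" using z(2) that by blast
      moreover have "k \<noteq> i" using that i by blast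
      ultimately show ?thesis by (simp add: S_def)
    qed
    moreover have "S z $ i = S b $ i" using z(2) by blast
    then have "l z = l b" by (simp add: S_def)
    ultimately show False using a(2)[of z] z(1) by (simp add: l_def)
  qed
  obtain P where P: "polyfun P" "\<And>z. z \<in> ?H \<Longrightarrow> P z = 0" "P (S b) \<noteq> 0"
    by (rule hypersurface_polynomial[OF Hca gd gr Sb]) (assumption, rule that)
  show ?thesis
  proof (rule that[of "\<lambda>z. P (S z)"])
    show "polyfun (\<lambda>z. P (S z))" by (intro polyfun_compose[OF P(1)] polyfun_clinear_iso S)
    show "P (S z) = 0" if "z \<in> X" for z
    proof (rule P(2))
      show "S z \<in> ?H" unfolding cylinder_def using that by blast
    qed
    show "P (S b) \<noteq> 0" by (rule P(3))
  qed
qed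

text \<open>The case in which no coordinate is left for a separating form. Regular points of full
  dimension are interior, and by the identity theorem the interior of \<open>X\<close> is
  closed.\<close>

lemma regular_dense_full:
  fixes X :: "(complex ^ 'n) set"
  assumes X: "regular_dense CARD('n) X" and "X \<noteq> {}"
  shows "X = UNIV"
proof -
  have caX: "closed_analytic_set X" using X by (simp add: regular_dense_def)
  have dense: "\<exists>w\<in>interior X. dist z w < e" if z: "z \<in> X" and e: "e > 0" for z e
  proof -
    obtain a where a: "regular_point X CARD('n) a" "dist z a < e" using X z e unfolding regular_dense_def by blast
    obtain U \<phi> \<psi> I' and V :: "(complex ^ 'n) set" where U: "open U" "a \<in> U" "homeomorphism U V \<phi> \<psi>"
      and I': "card I' = CARD('n)" and img: "\<phi> ` (X \<inter> U) = {w \<in> V. \<forall>i. i \<notin> I' \<longrightarrow> w $ i = 0}"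
      using a(1) unfolding regular_point_def by blast
    note hd = homeomorphismD'[OF U(3)]
    have "I' = UNIV" by (rule card_subset_eq) (use I' in auto)
    then have img': "\<phi> ` (X \<inter> U) = V" using img by simp
    have "U \<subseteq> X"
    proof
      fix x assume x: "x \<in> U"
      then have "\<phi> x \<in> \<phi> ` (X \<inter> U)" using hd(1) img' by blast
      then obtain y where y: "y \<in> X" "y \<in> U" "\<phi> x = \<phi> y" by blast
      have "x = \<psi> (\<phi> x)" using hd(2)[OF x] by (rule sym)
      also have "\<dots> = y" unfolding y(3) by (rule hd(2)[OF y(2)])
      finally have "x = y" .
      then show "x \<in> X" using y(1) by simp
    qed
    then have "U \<subseteq> interior X" using U(1) by (rule interior_maximal)
    then have "a \<in> interior X" using U(2) by (rule subsetD)
    then show ?thesis using a(2) by blast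
  qed
  have "z \<in> interior X" if z: "z \<in> closure (interior X)" for z
  proof -
    have "closed X" using caX by (simp add: closed_analytic_set_def)
    then have "z \<in> X" using z closure_minimal[OF interior_subset] by blast
    then obtain U F where UF: "open U" "z \<in> U" "\<forall>f\<in>F. holomorphic_Cn f U" "X \<inter> U = {z \<in> U. \<forall>f\<in>F. f z = 0}"
      using caX unfolding closed_analytic_set_def by blast
    obtain \<rho> where \<rho>: "\<rho> > 0" "ball z \<rho> \<subseteq> U" using UF(1,2) open_contains_ball by blast
    have "ball z \<rho> \<subseteq> X"
    proof
      fix x assume x: "x \<in> ball z \<rho>"
      have "f x = 0" if f: "f \<in> F" for f
      proof (rule holomorphic_Cn_eq_0_on_convex[where U="ball z \<rho>" and V="interior X \<inter> ball z \<rho>" and f=f and w=x])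
        show "holomorphic_Cn f (ball z \<rho>)" using UF(3) f \<rho>(2) holomorphic_Cn_subset by blast
        obtain y where "y \<in> interior X" "dist y z < \<rho>" using z \<rho>(1) closure_approachable by blast
        then show "interior X \<inter> ball z \<rho> \<noteq> {}" by (auto simp: dist_commute)
        fix y assume y: "y \<in> interior X \<inter> ball z \<rho>"
        then have "y \<in> X \<inter> U" using interior_subset \<rho>(2) by blast
        then show "f y = 0" using UF(4) f by blast
      qed (use x in auto)
      then show "x \<in> X" using UF(4) \<rho>(2) x by blast
    qed
    then show ?thesis using \<rho>(1) mem_interior by blast
  qed
  then have "closed (interior X)" by (metis closure_subset_eq subsetI)
  moreover have "interior X \<noteq> {}" using dense[of _ 1] assms(2) by force
  ultimately have "interior X = UNIV" using clopen[of "interior X"] by simp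
  then show ?thesis using interior_subset by blast
qed

theorem algebraic_of_cone:
  fixes X :: "(complex ^ 'n) set"
  assumes X: "closed_pure_dim_analytic d X" and T: "clinear_iso T" and d: "card I = d"
    and c: "cone_over I K (T ` X)"
  shows "algebraic_set X"
proof -
  have rd: "regular_dense d X" by (rule pure_dim_regular_dense'[OF X])
  have rdT: "regular_dense d (T ` X)" by (rule regular_dense_linear[OF T rd])
  have sep: "\<exists>P. polyfun P \<and> (\<forall>z\<in>X. P z = 0) \<and> P b \<noteq> 0" if b: "b \<notin> X" for b
  proof -
    have Tb: "T b \<notin> T ` X" using b clinear_isoD(3)[OF T] by (auto simp: bij_def inj_def)
    have "I \<noteq> UNIV"
    proof
      assume "I = UNIV"
      then have "d = CARD('n)" using d by simp
      moreover have "X \<noteq> {}" using X by (simp add: closed_pure_dim_analytic_def)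
      ultimately have "X = UNIV" using rd regular_dense_full by blast
      then show False using b by blast
    qed
    then obtain i where i: "i \<notin> I" by blast
    obtain P where P: "polyfun P" "\<And>z. z \<in> T ` X \<Longrightarrow> P z = 0" "P (T b) \<noteq> 0"
      by (rule cone_polynomial[OF rdT c d i Tb]) (rule that)
    have "polyfun (\<lambda>z. P (T z))" by (intro polyfun_compose[OF P(1)] polyfun_clinear_iso T)
    then show ?thesis using P(2,3) by (intro exI[of _ "\<lambda>z. P (T z)"]) auto
  qed
  let ?P = "{p. \<forall>z\<in>X. poly_eval p z = 0}"
  have "X = {z. \<forall>p\<in>?P. poly_eval p z = 0}"
  proof (intro equalityI subsetI)
    fix b assume b: "b \<in> {z. \<forall>p\<in>?P. poly_eval p z = 0}"
    show "b \<in> X"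
    proof (rule ccontr)
      assume "b \<notin> X"
      then obtain P where P: "polyfun P" "\<forall>z\<in>X. P z = 0" "P b \<noteq> 0" using sep by blast
      then obtain p where "P = poly_eval p" unfolding polyfun_def by blast
      then show False using P(2,3) b by blast
    qed
  qed simp
  then show ?thesis unfolding algebraic_set_def by (rule exI)
qed

section \<open>Definable sets\<close>

lemma Rn_iff: "x \<in> Rn m \<longleftrightarrow> (\<forall>i\<ge>m. x i = 0)"
  by (simp add: topspace_Euclidean_space)

context ominimal_expansion
begin

text \<open>Definability of a predicate rather than of a set, so that formulas can be assembled by
  introduction rules along their logical structure.\<close>

definition dfn :: "nat \<Rightarrow> ((nat \<Rightarrow> real) \<Rightarrow> bool) \<Rightarrow> bool" where
  "dfn m P \<longleftrightarrow> {x \<in> Rn m. P x} \<in> D m"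

lemma dfn_cong: "(\<And>x. x \<in> Rn m \<Longrightarrow> P x \<longleftrightarrow> Q x) \<Longrightarrow> dfn m P \<longleftrightarrow> dfn m Q"
proof -
  assume "\<And>x. x \<in> Rn m \<Longrightarrow> P x \<longleftrightarrow> Q x"
  then have "{x \<in> Rn m. P x} = {x \<in> Rn m. Q x}" by blast
  then show ?thesis by (simp add: dfn_def)
qed

lemma dfn_cong': "dfn m P \<Longrightarrow> (\<And>x. x \<in> Rn m \<Longrightarrow> P x \<longleftrightarrow> Q x) \<Longrightarrow> dfn m Q"
  using dfn_cong by blast

lemma dfn_not: assumes "dfn m P" shows "dfn m (\<lambda>x. \<not> P x)"
proof -
  have eq: "Rn m - {x \<in> Rn m. P x} = {x \<in> Rn m. \<not> P x}" by blast
  show ?thesis using definable_compl[OF assms[unfolded dfn_def]] unfolding eq dfn_def .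
qed

lemma dfn_or: assumes "dfn m P" "dfn m Q" shows "dfn m (\<lambda>x. P x \<or> Q x)"
proof -
  have eq: "{x \<in> Rn m. P x} \<union> {x \<in> Rn m. Q x} = {x \<in> Rn m. P x \<or> Q x}" by blast
  show ?thesis using definable_Un[OF assms[unfolded dfn_def]] unfolding eq dfn_def .
qed

lemma dfn_and: assumes "dfn m P" "dfn m Q" shows "dfn m (\<lambda>x. P x \<and> Q x)"
  using dfn_not[OF dfn_or[OF dfn_not[OF assms(1)] dfn_not[OF assms(2)]]] by simp

lemma dfn_imp: assumes "dfn m P" "dfn m Q" shows "dfn m (\<lambda>x. P x \<longrightarrow> Q x)"
  using dfn_or[OF dfn_not[OF assms(1)] assms(2)] by (simp only: imp_conv_disj)

lemma dfn_iff: assumes "dfn m P" "dfn m Q" shows "dfn m (\<lambda>x. P x \<longleftrightarrow> Q x)"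
  using dfn_and[OF dfn_imp[OF assms] dfn_imp[OF assms(2,1)]] by (simp only: iff_conv_conj_imp)

lemma dfn_const: "dfn m (\<lambda>_. c)"
proof -
  have "dfn m (\<lambda>_. False)" using definable_empty by (simp add: dfn_def)
  then show ?thesis using dfn_not[of m "\<lambda>_. False"] by (cases c) simp_all
qed

lemma dfn_ball_lessThan: "(\<And>i. i < (n::nat) \<Longrightarrow> dfn m (P i)) \<Longrightarrow> dfn m (\<lambda>x. \<forall>i<n. P i x)"
proof (induction n)
  case 0
  then show ?case by (simp add: dfn_const)
next
  case (Suc n)
  have "dfn m (\<lambda>x. (\<forall>i<n. P i x) \<and> P n x)" by (rule dfn_and) (use Suc in auto)
  then show ?case by (rule dfn_cong') (auto simp: less_Suc_eq)
qed

lemma dfn_weaken: assumes "dfn m P" shows "dfn (Suc m) (\<lambda>x. P (x(m := 0)))"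
proof -
  have eq: "{x \<in> Rn (Suc m). x(m := 0) \<in> {x \<in> Rn m. P x}} = {x \<in> Rn (Suc m). P (x(m := 0))}"
    by (auto simp: Rn_iff)
  show ?thesis using definable_cylinder_right[OF assms[unfolded dfn_def]] unfolding eq dfn_def .
qed

lemma dfn_shift: assumes "dfn m P" shows "dfn (n + m) (\<lambda>x. P (\<lambda>i. x (i + n)))"
proof (induction n)
  case 0
  then show ?case using assms by simp
next
  case (Suc n)
  have eq: "{x \<in> Rn (Suc (n + m)). (\<lambda>i. x (Suc i)) \<in> {x \<in> Rn (n + m). P (\<lambda>i. x (i + n))}} =
      {x \<in> Rn (Suc (n + m)). P (\<lambda>i. x (i + Suc n))}"
    by (auto simp: Rn_iff)
  show ?case using definable_cylinder_left[OF Suc[unfolded dfn_def]] unfolding eq dfn_def add_Suc .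
qed

text \<open>The bound variable becomes the last coordinate \<open>y m\<close>, and
  \<open>y(m := 0)\<close> is the point of \<open>Rn m\<close> before quantification.\<close>

lemma dfn_ex:
  assumes "dfn (Suc m) (\<lambda>y. R (y(m := 0)) (y m))" shows "dfn m (\<lambda>x. \<exists>t. R x t)"
proof -
  have eq: "(\<lambda>x. x(m := 0)) ` {y \<in> Rn (Suc m). R (y(m := 0)) (y m)} = {x \<in> Rn m. \<exists>t. R x t}"
  proof (intro equalityI subsetI)
    fix x assume "x \<in> (\<lambda>x. x(m := 0)) ` {y \<in> Rn (Suc m). R (y(m := 0)) (y m)}"
    then obtain y where "y \<in> Rn (Suc m)" "R (y(m := 0)) (y m)" "x = y(m := 0)" by blast
    then show "x \<in> {x \<in> Rn m. \<exists>t. R x t}" by (auto simp: Rn_iff)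
  next
    fix x assume "x \<in> {x \<in> Rn m. \<exists>t. R x t}"
    then obtain t where t: "x \<in> Rn m" "R x t" by blast
    have x: "(x(m := t))(m := 0) = x" using t(1) by (auto simp: Rn_iff fun_eq_iff)
    then have "x(m := t) \<in> {y \<in> Rn (Suc m). R (y(m := 0)) (y m)}" using t by (auto simp: Rn_iff)
    then show "x \<in> (\<lambda>x. x(m := 0)) ` {y \<in> Rn (Suc m). R (y(m := 0)) (y m)}" using x by (intro image_eqI[of _ _ "x(m := t)"]) simp_all
  qed
  show ?thesis using definable_projection[OF assms[unfolded dfn_def]] unfolding eq dfn_def .
qed

lemma dfn_all:
  assumes "dfn (Suc m) (\<lambda>y. R (y(m := 0)) (y m))" shows "dfn m (\<lambda>x. \<forall>t. R x t)"
  using dfn_not[OF dfn_ex[of m "\<lambda>x t. \<not> R x t", OF dfn_not[OF assms]]] by simp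

end

definition cat :: "nat \<Rightarrow> (nat \<Rightarrow> real) \<Rightarrow> (nat \<Rightarrow> real) \<Rightarrow> nat \<Rightarrow> real" where
  "cat m x y = (\<lambda>i. if i < m then x i else y (i - m))"

context ominimal_expansion
begin

lemma dfn_ex_block:
  assumes "dfn (m + k) Q" shows "dfn m (\<lambda>x. \<exists>y\<in>Rn k. Q (cat m x y))"
  using assms
proof (induction k arbitrary: Q)
  case 0
  have eq: "Q x \<longleftrightarrow> (\<exists>y\<in>Rn 0. Q (cat m x y))" if "x \<in> Rn m" for x
  proof -
    have c: "cat m x y = x" if "y \<in> Rn 0" for y
      using \<open>x \<in> Rn m\<close> that by (auto simp: Rn_iff cat_def fun_eq_iff)
    have "(\<lambda>_. 0) \<in> Rn 0" by (simp add: Rn_iff)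
    then show ?thesis using c by metis
  qed
  have "dfn m Q" using 0 by simp
  then show ?case by (rule dfn_cong') (rule eq)
next
  case (Suc k)
  have "dfn (Suc (m + k)) (\<lambda>y. Q ((y(m + k := 0))(m + k := y (m + k))))" using Suc.prems by simp
  then have "dfn (m + k) (\<lambda>x. \<exists>t. Q (x(m + k := t)))" by (rule dfn_ex)
  then have "dfn m (\<lambda>x. \<exists>y\<in>Rn k. \<exists>t. Q ((cat m x y)(m + k := t)))" by (rule Suc.IH)
  then show ?case
  proof (rule dfn_cong')
    fix x assume x: "x \<in> Rn m"
    show "(\<exists>y\<in>Rn k. \<exists>t. Q ((cat m x y)(m + k := t))) \<longleftrightarrow> (\<exists>y\<in>Rn (Suc k). Q (cat m x y))"
    proof
      assume "\<exists>y\<in>Rn k. \<exists>t. Q ((cat m x y)(m + k := t))"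
      then obtain y t where y: "y \<in> Rn k" "Q ((cat m x y)(m + k := t))" by blast
      have "(cat m x y)(m + k := t) = cat m x (y(k := t))" by (auto simp: cat_def fun_eq_iff)
      moreover have "y(k := t) \<in> Rn (Suc k)" using y(1) by (auto simp: Rn_iff)
      ultimately show "\<exists>y\<in>Rn (Suc k). Q (cat m x y)" using y(2) by metis
    next
      assume "\<exists>y\<in>Rn (Suc k). Q (cat m x y)"
      then obtain y where y: "y \<in> Rn (Suc k)" "Q (cat m x y)" by blast
      have "(cat m x (y(k := 0)))(m + k := y k) = cat m x y" by (auto simp: cat_def fun_eq_iff)
      moreover have "y(k := 0) \<in> Rn k" using y(1) by (auto simp: Rn_iff)
      ultimately show "\<exists>y\<in>Rn k. \<exists>t. Q ((cat m x y)(m + k := t))" using y(2) by metis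
    qed
  qed
qed

lemma dfn_diagonal: "i < m \<Longrightarrow> j < m \<Longrightarrow> dfn m (\<lambda>x. x i = x j)"
  using definable_diagonal by (simp add: dfn_def)

text \<open>The structure offers cylinders, diagonals and projections. A substitution of variables
  is composed of these: a block of new coordinates is adjoined, equated one by one with the chosen
  old ones, and the block is projected away.\<close>

lemma dfn_reindex:
  assumes "dfn k P" "\<And>i. i < k \<Longrightarrow> \<sigma> i < m"
  shows "dfn m (\<lambda>x. P (\<lambda>i. if i < k then x (\<sigma> i) else 0))"
proof -
  have "dfn (m + k) (\<lambda>z. P (\<lambda>i. z (i + m)))" by (rule dfn_shift[OF assms(1)])
  moreover have "dfn (m + k) (\<lambda>z. \<forall>i<k. z (i + m) = z (\<sigma> i))"
    by (intro dfn_ball_lessThan dfn_diagonal) (simp_all add: assms(2) trans_less_add1)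
  ultimately have "dfn (m + k) (\<lambda>z. P (\<lambda>i. z (i + m)) \<and> (\<forall>i<k. z (i + m) = z (\<sigma> i)))" by (rule dfn_and)
  from dfn_ex_block[OF this] show ?thesis
  proof (rule dfn_cong')
    fix x assume x: "x \<in> Rn m"
    let ?y = "\<lambda>i. if i < k then x (\<sigma> i) else 0"
    have c1: "(\<lambda>i. cat m x y (i + m)) = y" for y by (simp add: cat_def)
    have c2: "cat m x y (\<sigma> i) = x (\<sigma> i)" if "i < k" for y i using assms(2)[OF that] by (simp add: cat_def)
    have y: "y = ?y" if "y \<in> Rn k" "\<forall>i<k. cat m x y (i + m) = cat m x y (\<sigma> i)" for y
    proof
      fix i show "y i = ?y i"
        using that c2[of i y] fun_cong[OF c1[of y], of i] by (cases "i < k") (auto simp: Rn_iff)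
    qed
    have y': "?y \<in> Rn k" "\<forall>i<k. cat m x ?y (i + m) = cat m x ?y (\<sigma> i)"
      using c2[of _ ?y] fun_cong[OF c1[of ?y]] by (auto simp: Rn_iff)
    show "(\<exists>y\<in>Rn k. P (\<lambda>i. cat m x y (i + m)) \<and> (\<forall>i<k. cat m x y (i + m) = cat m x y (\<sigma> i))) \<longleftrightarrow> P ?y"
      unfolding c1
    proof
      assume "\<exists>z\<in>Rn k. P z \<and> (\<forall>i<k. cat m x z (i + m) = cat m x z (\<sigma> i))"
      then obtain z where z: "z \<in> Rn k" "P z" "\<forall>i<k. cat m x z (i + m) = cat m x z (\<sigma> i)" by blast
      from z(2) show "P ?y" unfolding y[OF z(1,3)] .
    next
      assume "P ?y"
      with y' show "\<exists>z\<in>Rn k. P z \<and> (\<forall>i<k. cat m x z (i + m) = cat m x z (\<sigma> i))"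
        by (intro bexI[of _ ?y] conjI)
    qed
  qed
qed

text \<open>Functions with definable graph. Only the restriction of \<open>f\<close> to
  \<open>Rn m\<close> is recorded, since \<open>x(m := 0)\<close> lies there.\<close>

definition dterm :: "nat \<Rightarrow> ((nat \<Rightarrow> real) \<Rightarrow> real) \<Rightarrow> bool" where
  "dterm m f \<longleftrightarrow> dfn (Suc m) (\<lambda>x. x m = f (x(m := 0)))"

lemma dterm_cong: "dterm m f \<Longrightarrow> (\<And>x. x \<in> Rn m \<Longrightarrow> f x = g x) \<Longrightarrow> dterm m g"
  unfolding dterm_def by (erule dfn_cong') (auto simp: Rn_iff)

lemma dfn_subst:
  assumes "dfn (Suc m) Q" "dterm m f" shows "dfn m (\<lambda>x. Q (x(m := f x)))"
proof -
  have "dfn (Suc m) (\<lambda>x. x m = f (x(m := 0)) \<and> Q x)"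
    by (rule dfn_and) (use assms in \<open>auto simp: dterm_def\<close>)
  then have "dfn (Suc m) (\<lambda>y. y m = f (y(m := 0)) \<and> Q ((y(m := 0))(m := y m)))" by simp
  from dfn_ex[of m "\<lambda>x t. t = f x \<and> Q (x(m := t))", OF this] show ?thesis by simp
qed

lemma dterm_coord: "i < m \<Longrightarrow> dterm m (\<lambda>x. x i)"
  unfolding dterm_def by (rule dfn_cong'[OF dfn_diagonal[of m "Suc m" i]]) auto

lemma dterm_const: "dterm m (\<lambda>_. r)"
proof -
  have "dfn 1 (\<lambda>x. x 0 = r)" using definable_singleton by (simp add: dfn_def)
  from dfn_reindex[OF this, of "\<lambda>_. m" "Suc m"] show ?thesis by (simp add: dterm_def)
qed

lemma dterm_reindex:
  assumes "dterm k f" "\<And>i. i < k \<Longrightarrow> \<sigma> i < m"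
  shows "dterm m (\<lambda>x. f (\<lambda>i. if i < k then x (\<sigma> i) else 0))"
proof -
  have "dfn (Suc m) (\<lambda>x. (\<lambda>x. x k = f (x(k := 0))) (\<lambda>i. if i < Suc k then x ((if i = k then m else \<sigma> i)) else 0))"
    by (rule dfn_reindex[OF assms(1)[unfolded dterm_def]]) (use assms(2) less_SucI in \<open>auto simp: less_Suc_eq\<close>)
  then show ?thesis unfolding dterm_def
  proof (rule dfn_cong')
    fix x assume "x \<in> Rn (Suc m)"
    have "(\<lambda>i. if i < Suc k then x (if i = k then m else \<sigma> i) else 0)(k := 0) = (\<lambda>i. if i < k then (x(m := 0)) (\<sigma> i) else 0)"
      using assms(2) by (fastforce simp: fun_eq_iff less_Suc_eq)
    then show "(\<lambda>x. x k = f (x(k := 0))) (\<lambda>i. if i < Suc k then x (if i = k then m else \<sigma> i) else 0) \<longleftrightarrow>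
        x m = f (\<lambda>i. if i < k then (x(m := 0)) (\<sigma> i) else 0)" by simp
  qed
qed

lemma dterm_weaken: assumes "dterm m f" shows "dterm (Suc m) (\<lambda>x. f (x(m := 0)))"
proof (rule dterm_cong[OF dterm_reindex[OF assms, of "\<lambda>i. i" "Suc m"]])
  fix x assume "x \<in> Rn (Suc m)"
  then have "(\<lambda>i. if i < m then x i else 0) = x(m := 0)" by (auto simp: Rn_iff fun_eq_iff)
  then show "f (\<lambda>i. if i < m then x i else 0) = f (x(m := 0))" by simp
qed simp

lemma dfn_subst2:
  assumes Q: "dfn (Suc (Suc m)) Q" and f: "dterm m f" and g: "dterm m g"
  shows "dfn m (\<lambda>x. Q (x(m := f x, Suc m := g x)))"
proof -
  have "dfn (Suc m) (\<lambda>x. Q (x(Suc m := g (x(m := 0)))))" by (rule dfn_subst[OF Q dterm_weaken[OF g]])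
  from dfn_subst[OF this f] show ?thesis
  proof (rule dfn_cong')
    fix x assume "x \<in> Rn m"
    then have "(x(m := f x))(m := 0) = x" by (auto simp: Rn_iff fun_eq_iff)
    then show "Q ((x(m := f x))(Suc m := g ((x(m := f x))(m := 0)))) \<longleftrightarrow> Q (x(m := f x, Suc m := g x))" by simp
  qed
qed

lemma dfn_eq: "dterm m f \<Longrightarrow> dterm m g \<Longrightarrow> dfn m (\<lambda>x. f x = g x)"
  using dfn_subst2[OF dfn_diagonal[of m "Suc (Suc m)" "Suc m"]] by simp

lemma dterm_op:
  assumes R: "dfn 3 (\<lambda>x. x 2 = h (x 0) (x 1))" and f: "dterm m f" and g: "dterm m g"
  shows "dterm m (\<lambda>x. h (f x) (g x))"
proof -
  let ?\<sigma> = "\<lambda>i. if i = 0 then Suc m else if i = (1::nat) then Suc (Suc m) else m"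
  have "dfn (Suc (Suc (Suc m))) (\<lambda>x. (\<lambda>x. x 2 = h (x 0) (x 1)) (\<lambda>i. if i < 3 then x (?\<sigma> i) else 0))"
    by (rule dfn_reindex[OF R]) auto
  then have Q: "dfn (Suc (Suc (Suc m))) (\<lambda>x. x m = h (x (Suc m)) (x (Suc (Suc m))))" by simp
  from dfn_subst2[OF Q dterm_weaken[OF f] dterm_weaken[OF g]] show ?thesis
    unfolding dterm_def by simp
qed

lemma dterm_add: "dterm m f \<Longrightarrow> dterm m g \<Longrightarrow> dterm m (\<lambda>x. f x + g x)"
  by (rule dterm_op) (use definable_plus in \<open>simp_all add: dfn_def\<close>)

lemma dterm_mult: "dterm m f \<Longrightarrow> dterm m g \<Longrightarrow> dterm m (\<lambda>x. f x * g x)"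
  by (rule dterm_op) (use definable_times in \<open>simp_all add: dfn_def\<close>)

lemma dterm_uminus: "dterm m f \<Longrightarrow> dterm m (\<lambda>x. - f x)"
  using dterm_mult[OF dterm_const[of m "-1"]] by simp

lemma dterm_diff: "dterm m f \<Longrightarrow> dterm m g \<Longrightarrow> dterm m (\<lambda>x. f x - g x)"
  using dterm_add[OF _ dterm_uminus] by simp

lemma dterm_sum: "finite I \<Longrightarrow> (\<And>i. i \<in> I \<Longrightarrow> dterm m (f i)) \<Longrightarrow> dterm m (\<lambda>x. \<Sum>i\<in>I. f i x)"
  by (induction I rule: finite_induct) (auto intro: dterm_add dterm_const)

text \<open>The order is recovered from the field operations: a real number is nonnegative exactly
  if it is a square.\<close>

lemma dfn_le: assumes "dterm m f" "dterm m g" shows "dfn m (\<lambda>x. f x \<le> g x)"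
proof -
  have "dfn (Suc m) (\<lambda>y. g (y(m := 0)) = f (y(m := 0)) + y m * y m)"
    by (intro dfn_eq dterm_add dterm_mult dterm_weaken assms dterm_coord) auto
  then have "dfn m (\<lambda>x. \<exists>t. g x = f x + t * t)" by (rule dfn_ex)
  then show ?thesis
  proof (rule dfn_cong')
    fix x
    show "(\<exists>t. g x = f x + t * t) \<longleftrightarrow> f x \<le> g x"
    proof
      assume "f x \<le> g x"
      then have "g x = f x + sqrt (g x - f x) * sqrt (g x - f x)" by simp
      then show "\<exists>t. g x = f x + t * t" by blast
    qed auto
  qed
qed

lemma dfn_less: "dterm m f \<Longrightarrow> dterm m g \<Longrightarrow> dfn m (\<lambda>x. f x < g x)"
  using dfn_not[OF dfn_le[of m g f]] by (simp add: not_le)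

section \<open>Fibres over a fixed point as subsets of the line\<close>

lemma dfn_coord_subst:
  assumes "dfn (Suc m) P" shows "dfn m (\<lambda>x. P (x(m := r)))"
  using dfn_subst[OF assms dterm_const] .

text \<open>Only the last coordinate can be replaced by a constant directly. So the free coordinate
  is first moved to position \<open>0\<close>, where it survives while the entries of
  \<open>x\<close> are substituted from the last one downwards.\<close>

lemma fibre_definable:
  assumes P: "dfn (Suc k) P" and x: "x \<in> Rn k"
  shows "dfn 1 (\<lambda>y. P (x(k := y 0)))"
proof -
  \<comment> \<open>At stage \<open>j\<close> the last \<open>j\<close> entries of \<open>x\<close>
    have been substituted. The free variable sits at position \<open>0\<close>, and the entries not
    yet substituted are shifted up by one.\<close>
  let ?v = "\<lambda>j y i. if i < Suc k then (if i = k then y 0 else if i < k - j then y (Suc i) else x i) else 0"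
  have "j \<le> k \<Longrightarrow> dfn (Suc (k - j)) (\<lambda>y. P (?v j y))" for j
  proof (induction j)
    case 0
    have "dfn (Suc (k - 0)) (\<lambda>y. P (\<lambda>i. if i < Suc k then y (if i = k then 0 else Suc i) else 0))"
      unfolding diff_zero by (rule dfn_reindex[OF P]) auto
    then show ?case
    proof (rule dfn_cong')
      fix y :: "nat \<Rightarrow> real"
      have "(\<lambda>i. if i < Suc k then y (if i = k then 0 else Suc i) else 0) = ?v 0 y" by (auto simp: fun_eq_iff)
      then show "P (\<lambda>i. if i < Suc k then y (if i = k then 0 else Suc i) else 0) \<longleftrightarrow> P (?v 0 y)" by simp
    qed
  next
    case (Suc j)
    then have "dfn (Suc (k - j)) (\<lambda>y. P (?v j y))" by simp
    moreover have e: "Suc (k - j) = Suc (Suc (k - Suc j))" using Suc.prems by simp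
    ultimately have "dfn (Suc (k - Suc j)) (\<lambda>y. P (?v j (y(Suc (k - Suc j) := x (k - Suc j)))))"
      using dfn_coord_subst[of "Suc (k - Suc j)" "\<lambda>y. P (?v j y)"] by simp
    then show ?case
    proof (rule dfn_cong')
      fix y :: "nat \<Rightarrow> real"
      have "?v j (y(Suc (k - Suc j) := x (k - Suc j))) i = ?v (Suc j) y i" for i
        using Suc.prems by (cases "i = k - Suc j") auto
      then have "?v j (y(Suc (k - Suc j) := x (k - Suc j))) = ?v (Suc j) y" by blast
      then show "P (?v j (y(Suc (k - Suc j) := x (k - Suc j)))) \<longleftrightarrow> P (?v (Suc j) y)" by simp
    qed
  qed
  from this[of k] have "dfn 1 (\<lambda>y. P (?v k y))" by simp
  then show ?thesis
  proof (rule dfn_cong')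
    fix y :: "nat \<Rightarrow> real"
    have "?v k y = x(k := y 0)" using x by (auto simp: Rn_iff fun_eq_iff)
    then show "P (?v k y) \<longleftrightarrow> P (x(k := y 0))" by simp
  qed
qed

lemma fibre_intervals:
  assumes P: "dfn (Suc k) P" and x: "x \<in> Rn k"
  obtains \<I> where "finite \<I>" "\<And>I. I \<in> \<I> \<Longrightarrow> is_interval I" "{t. P (x(k := t))} = \<Union>\<I>"
proof -
  have "{y \<in> Rn 1. P (x(k := y 0))} \<in> D 1" using fibre_definable[OF P x] by (simp add: dfn_def)
  from ominimal[OF this] obtain \<I> where \<I>: "finite \<I>" "\<forall>I\<in>\<I>. is_interval I"
    "(\<lambda>y. y 0) ` {y \<in> Rn 1. P (x(k := y 0))} = \<Union>\<I>"
    by (elim exE conjE) (rule that)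
  have eq: "(\<lambda>y. y 0) ` {y \<in> Rn 1. P (x(k := y 0))} = {t. P (x(k := t))}"
  proof (intro equalityI subsetI)
    fix t assume "t \<in> {t. P (x(k := t))}"
    then have "(\<lambda>i. if i = 0 then t else 0) \<in> {y \<in> Rn 1. P (x(k := y 0))}" by (auto simp: Rn_iff)
    then show "t \<in> (\<lambda>y. y 0) ` {y \<in> Rn 1. P (x(k := y 0))}" by (rule image_eqI[rotated]) simp
  qed auto
  show ?thesis
  proof (rule that[OF \<I>(1)])
    show "is_interval I" if "I \<in> \<I>" for I using bspec[OF \<I>(2) that] .
    show "{t. P (x(k := t))} = \<Union>\<I>" using \<I>(3) unfolding eq .
  qed
qed

end

text \<open>By convexity, if points of \<open>I\<close> accumulate at \<open>t\<close> from the
  right, then \<open>I\<close> contains everything between \<open>t\<close> and any of its points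
  beyond \<open>t\<close>.\<close>

lemma interval_right_germ:
  fixes I :: "real set"
  assumes "is_interval I" shows "\<exists>q>t. {t<..<q} \<subseteq> I \<or> {t<..<q} \<inter> I = {}"
proof (cases "\<exists>q>t. {t<..<q} \<inter> I = {}")
  case False
  then obtain v where v: "v \<in> I" "v > t" by (metis disjoint_iff greaterThanLessThan_iff gt_ex)
  have "s \<in> I" if s: "s \<in> {t<..<v}" for s
  proof -
    obtain u where u: "u \<in> {t<..<s}" "u \<in> I" using False s by (auto simp: disjoint_iff)
    then show ?thesis using assms v(1) s mem_is_interval_1_I[OF assms u(2) v(1)] by simp
  qed
  then show ?thesis using v(2) by blast
qed blast

lemma intervals_right_germ:
  fixes t :: real
  assumes "finite \<I>" "\<And>I. I \<in> \<I> \<Longrightarrow> is_interval I"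
  shows "\<exists>q>t. {t<..<q} \<subseteq> \<Union>\<I> \<or> {t<..<q} \<inter> \<Union>\<I> = {}"
  using assms
proof (induction \<I>)
  case empty
  then show ?case using gt_ex by auto
next
  case (insert I \<I>)
  obtain q1 where q1: "q1 > t" "{t<..<q1} \<subseteq> \<Union>\<I> \<or> {t<..<q1} \<inter> \<Union>\<I> = {}" using insert by blast
  obtain q2 where q2: "q2 > t" "{t<..<q2} \<subseteq> I \<or> {t<..<q2} \<inter> I = {}" using interval_right_germ[of I t] insert.prems by blast
  have "{t<..<min q1 q2} \<subseteq> {t<..<q1}" "{t<..<min q1 q2} \<subseteq> {t<..<q2}" by auto
  then show ?case using q1 q2 by (intro exI[of _ "min q1 q2"]) auto
qed

text \<open>The statement for right germs, reflected at the origin.\<close>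

lemma intervals_left_germ:
  fixes t :: real
  assumes "finite \<I>" "\<And>I. I \<in> \<I> \<Longrightarrow> is_interval I"
  shows "\<exists>p<t. {p<..<t} \<subseteq> \<Union>\<I> \<or> {p<..<t} \<inter> \<Union>\<I> = {}"
proof -
  have "\<exists>q>-t. {-t<..<q} \<subseteq> \<Union>((`) uminus ` \<I>) \<or> {-t<..<q} \<inter> \<Union>((`) uminus ` \<I>) = {}"
  proof (rule intervals_right_germ)
    fix J assume "J \<in> (`) uminus ` \<I>"
    then obtain I where "I \<in> \<I>" "J = uminus ` I" by blast
    then show "is_interval J" using assms(2) by (simp add: is_interval_neg_translationI)
  qed (use assms in auto)
  then obtain q where q: "q > -t" "{-t<..<q} \<subseteq> \<Union>((`) uminus ` \<I>) \<or> {-t<..<q} \<inter> \<Union>((`) uminus ` \<I>) = {}" by blast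
  have mem: "- s \<in> \<Union>((`) uminus ` \<I>) \<longleftrightarrow> s \<in> \<Union>\<I>" for s by force
  have mem': "- s \<in> {-t<..<q} \<longleftrightarrow> s \<in> {-q<..<t}" for s by auto
  have "{-q<..<t} \<subseteq> \<Union>\<I> \<or> {-q<..<t} \<inter> \<Union>\<I> = {}"
    using q(2)
  proof
    assume "{-t<..<q} \<subseteq> \<Union>((`) uminus ` \<I>)"
    then have "{-q<..<t} \<subseteq> \<Union>\<I>" using mem mem' by blast
    then show ?thesis by blast
  next
    assume "{-t<..<q} \<inter> \<Union>((`) uminus ` \<I>) = {}"
    then have "{-q<..<t} \<inter> \<Union>\<I> = {}" using mem mem' by blast
    then show ?thesis by blast
  qed
  then show ?thesis using q(1) by (intro exI[of _ "-q"]) auto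
qed

section \<open>Boxes and the Baire property\<close>

definition obox :: "nat \<Rightarrow> (nat \<Rightarrow> real) \<Rightarrow> (nat \<Rightarrow> real) \<Rightarrow> (nat \<Rightarrow> real) set" where
  "obox k a b = {x \<in> Rn k. \<forall>i<k. a i < x i \<and> x i < b i}"

definition subbox :: "nat \<Rightarrow> (nat \<Rightarrow> real) \<Rightarrow> (nat \<Rightarrow> real) \<Rightarrow> (nat \<Rightarrow> real) \<Rightarrow> (nat \<Rightarrow> real) \<Rightarrow> bool" where
  "subbox k a' b' a b \<longleftrightarrow> (\<forall>i<k. a i \<le> a' i \<and> a' i < b' i \<and> b' i \<le> b i)"

lemma subbox_trans: "subbox k a'' b'' a' b' \<Longrightarrow> subbox k a' b' a b \<Longrightarrow> subbox k a'' b'' a b"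
  unfolding subbox_def by force

lemma subbox_obox: "subbox k a' b' a b \<Longrightarrow> obox k a' b' \<subseteq> obox k a b"
  unfolding subbox_def obox_def by force

definition box_dense :: "nat \<Rightarrow> (nat \<Rightarrow> real) set \<Rightarrow> (nat \<Rightarrow> real) \<Rightarrow> (nat \<Rightarrow> real) \<Rightarrow> bool" where
  "box_dense k T a b \<longleftrightarrow> (\<forall>a' b'. subbox k a' b' a b \<longrightarrow> T \<inter> obox k a' b' \<noteq> {})"

text \<open>Baire's theorem for open boxes. If no \<open>T n\<close> is dense in a subbox, strictly
  nested boxes that avoid the sets one after another have a common point, which lies in no
  \<open>T n\<close>.\<close>

lemma box_baire:
  assumes ab: "subbox k a b a b" and cov: "\<And>x. x \<in> obox k a b \<Longrightarrow> \<exists>n::nat. x \<in> T n"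
  shows "\<exists>n a' b'. subbox k a' b' a b \<and> box_dense k (T n) a' b'"
proof (rule ccontr)
  assume no: "\<not> ?thesis"
  define R where "R n p q \<longleftrightarrow> (\<forall>i<k. fst p i < fst q i \<and> fst q i < snd q i \<and> snd q i < snd p i) \<and>
     T n \<inter> obox k (fst q) (snd q) = {}" for n and p q :: "(nat \<Rightarrow> real) \<times> (nat \<Rightarrow> real)"
  have step: "\<exists>q. subbox k (fst q) (snd q) a b \<and> R n p q" if p: "subbox k (fst p) (snd p) a b" for n p
  proof -
    have "\<not> box_dense k (T n) (fst p) (snd p)" using no p by blast
    then obtain a' b' where ab': "subbox k a' b' (fst p) (snd p)" "T n \<inter> obox k a' b' = {}"
      unfolding box_dense_def by blast
    \<comment> \<open>The middle third keeps the new box strictly inside at both ends, so that the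
      limit of the left ends lies in every open box of the sequence.\<close>
    define q where "q = (\<lambda>i. a' i + (b' i - a' i) / 3, \<lambda>i. b' i - (b' i - a' i) / 3)"
    have q: "fst p i < fst q i \<and> fst q i < snd q i \<and> snd q i < snd p i \<and> a' i \<le> fst q i \<and> snd q i \<le> b' i" if "i < k" for i
      using ab'(1) that unfolding subbox_def q_def fst_conv snd_conv by (auto simp: field_simps)
    have "obox k (fst q) (snd q) \<subseteq> obox k a' b'" by (rule subbox_obox) (use q in \<open>auto simp: subbox_def\<close>)
    then have "R n p q" using q ab'(2) unfolding R_def by blast
    moreover have "subbox k (fst q) (snd q) a b" using q p unfolding subbox_def by (smt (verit))
    ultimately show ?thesis by blast
  qed
  have "\<exists>f. \<forall>n. subbox k (fst (f n)) (snd (f n)) a b \<and> R n (f n) (f (Suc n))"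
    by (rule dependent_nat_choice) (use ab step in \<open>auto intro!: exI[of _ "(a,b)"]\<close>)
  then obtain f where f: "\<And>n. subbox k (fst (f n)) (snd (f n)) a b" "\<And>n. R n (f n) (f (Suc n))" by blast
  define A B where "A n = fst (f n)" and "B n = snd (f n)" for n
  have AB: "A n i < A (Suc n) i" "A n i < B n i" "B (Suc n) i < B n i" if "i < k" for n i
    using f(1)[of n] f(2)[of n] that unfolding subbox_def R_def A_def B_def by auto
  have T: "T n \<inter> obox k (A (Suc n)) (B (Suc n)) = {}" for n using f(2)[of n] unfolding R_def A_def B_def by blast
  have incA: "A m i \<le> A n i" if "i < k" "m \<le> n" for m n i
    using lift_Suc_mono_le[of "\<lambda>n. A n i" m n] AB(1)[OF that(1)] that(2) by (simp add: less_imp_le)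
  have decB: "B n i \<le> B m i" if "i < k" "m \<le> n" for m n i
    using lift_Suc_antimono_le[of "\<lambda>n. B n i" m n] AB(3)[OF that(1)] that(2) by (simp add: less_imp_le)
  have AmBn: "A m i < B n i" if "i < k" for m n i
  proof -
    have "A m i \<le> A (max m n) i" "B (max m n) i \<le> B n i" using incA[OF that] decB[OF that] by auto
    then show ?thesis using AB(2)[OF that, of "max m n"] by linarith
  qed
  define x where "x i = (if i < k then (SUP n. A n i) else 0)" for i
  have x: "A n i < x i \<and> x i < B n i" if i: "i < k" for n i
  proof
    have bdd: "bdd_above (range (\<lambda>n. A n i))" using AmBn[OF i, of _ 0] by (intro bdd_aboveI2[of _ _ "B 0 i"]) (simp add: less_imp_le)
    have "A (Suc n) i \<le> (SUP n. A n i)" by (rule cSUP_upper[OF UNIV_I bdd])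
    then show "A n i < x i" using AB(1)[OF i, of n] i by (simp add: x_def)
    have "(SUP n. A n i) \<le> B (Suc n) i" using AmBn[OF i, of _ "Suc n"] by (intro cSUP_least) (auto simp: less_imp_le)
    then show "x i < B n i" using AB(3)[OF i, of n] i by (simp add: x_def)
  qed
  have xn: "x \<in> obox k (A n) (B n)" for n using x by (auto simp: obox_def Rn_iff x_def)
  have "obox k (A 0) (B 0) \<subseteq> obox k a b" using f(1)[of 0] subbox_obox unfolding A_def B_def by blast
  then obtain n where "x \<in> T n" using cov xn[of 0] by blast
  then show False using T[of n] xn[of "Suc n"] by blast
qed

lemma positive_lower_bound: "(\<And>i. i < (k::nat) \<Longrightarrow> (0::real) < g i) \<Longrightarrow> \<exists>d>0. \<forall>i<k. d \<le> g i"
proof (induction k)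
  case 0
  then show ?case by (auto intro: zero_less_one)
next
  case (Suc k)
  obtain d where d: "d > 0" "\<forall>i<k. d \<le> g i" using Suc by auto
  have "min d (g k) > 0" using d(1) Suc.prems[of k] by simp
  moreover have "\<forall>i<Suc k. min d (g k) \<le> g i" using d(2) by (auto simp: less_Suc_eq min_le_iff_disj)
  ultimately show ?case by blast
qed

lemma obox_neighbourhood:
  assumes "x \<in> obox k a b"
  obtains d where "d > 0" "\<And>y. y \<in> Rn k \<Longrightarrow> (\<forall>i<k. x i - d < y i \<and> y i < x i + d) \<Longrightarrow> y \<in> obox k a b"
proof -
  have "0 < min (x i - a i) (b i - x i)" if "i < k" for i using assms that by (auto simp: obox_def)
  then obtain d where d: "d > 0" "\<forall>i<k. d \<le> min (x i - a i) (b i - x i)"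
    using positive_lower_bound[of k "\<lambda>i. min (x i - a i) (b i - x i)"] by blast
  show ?thesis
  proof (rule that[OF d(1)])
    fix y assume y: "y \<in> Rn k" "\<forall>i<k. x i - d < y i \<and> y i < x i + d"
    have "a i < y i \<and> y i < b i" if "i < k" for i
    proof -
      have "d \<le> x i - a i" "d \<le> b i - x i" using d(2) that by auto
      moreover have "x i - d < y i" "y i < x i + d" using y(2) that by auto
      ultimately show ?thesis by linarith
    qed
    then show "y \<in> obox k a b" using y(1) by (simp add: obox_def)
  qed
qed

lemma obox_nonempty: "subbox k a b a b \<Longrightarrow> obox k a b \<noteq> {}"
proof -
  assume "subbox k a b a b"
  then have "(\<lambda>i. if i < k then (a i + b i) / 2 else 0) \<in> obox k a b"
    by (auto simp: obox_def Rn_iff subbox_def field_simps)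
  then show ?thesis by blast
qed

context ominimal_expansion
begin

text \<open>The form of tameness from which everything below is derived: no definable set is dense
  in a box together with its complement.\<close>

definition box_property :: "nat \<Rightarrow> bool" where
  "box_property k \<longleftrightarrow> (\<forall>P a b. dfn k P \<longrightarrow> subbox k a b a b \<longrightarrow> box_dense k {x. P x} a b \<longrightarrow>
     (\<exists>a' b'. subbox k a' b' a b \<and> (\<forall>x\<in>obox k a' b'. P x)))"

text \<open>Baire's theorem makes one set of the cover dense in a subbox, and
  \<open>box_property\<close> turns density into containment. Countability of the index type lets
  rational data, chosen pointwise, become uniform on a box.\<close>

lemma countable_cover_contains_box:
  fixes P :: "'c::countable \<Rightarrow> (nat \<Rightarrow> real) \<Rightarrow> bool"
  assumes N: "box_property k" and ab: "subbox k a b a b" and P: "\<And>c. dfn k (P c)"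
    and cov: "\<And>x. x \<in> obox k a b \<Longrightarrow> \<exists>c. P c x"
  obtains c a' b' where "subbox k a' b' a b" "\<And>x. x \<in> obox k a' b' \<Longrightarrow> P c x"
proof -
  have "\<exists>n. x \<in> {x. P (from_nat n) x}" if "x \<in> obox k a b" for x
    using cov[OF that] by (metis from_nat_to_nat mem_Collect_eq)
  then have "\<exists>n a' b'. subbox k a' b' a b \<and> box_dense k {x. P (from_nat n) x} a' b'"
    by (rule box_baire[OF ab])
  then obtain n a' b' where 1: "subbox k a' b' a b" "box_dense k {x. P (from_nat n) x} a' b'" by blast
  have "subbox k a' b' a' b'" using 1(1) by (auto simp: subbox_def)
  then obtain a'' b'' where 2: "subbox k a'' b'' a' b'" "\<forall>x\<in>obox k a'' b''. P (from_nat n) x"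
    using N P[of "from_nat n"] 1(2) unfolding box_property_def by blast
  show ?thesis
    by (rule that[OF subbox_trans[OF 2(1) 1(1)]]) (use 2(2) in blast)
qed

text \<open>On each vertical line the predicate is constant on some interval with rational ends,
  since definable subsets of the line are finite unions of intervals. The induction hypothesis makes
  the ends and the truth value uniform over a smaller base box, and density excludes the value
  \<open>False\<close>.\<close>

lemma box_property: "box_property k"
proof (induction k)
  case 0
  show ?case unfolding box_property_def
  proof (intro allI impI)
    fix P and a b :: "nat \<Rightarrow> real"
    assume *: "subbox 0 a b a b" "box_dense 0 {x. P x} a b"
    then have "{x. P x} \<inter> obox 0 a b \<noteq> {}" unfolding box_dense_def by blast
    then obtain y where y: "P y" "y \<in> obox 0 a b" by blast
    have "x = y" if "x \<in> obox 0 a b" for x using that y(2) by (auto simp: obox_def Rn_iff fun_eq_iff)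
    then show "\<exists>a' b'. subbox 0 a' b' a b \<and> (\<forall>x\<in>obox 0 a' b'. P x)" using * y(1) by blast
  qed
next
  case (Suc k)
  show ?case unfolding box_property_def
  proof (intro allI impI)
    fix P a b
    assume P: "dfn (Suc k) P" and ab: "subbox (Suc k) a b a b" and dense: "box_dense (Suc k) {x. P x} a b"
    define Q where "Q c x \<longleftrightarrow> (case c of (p, q, s) \<Rightarrow> (a k \<le> of_rat p \<and> p < q \<and> of_rat q \<le> b k) \<and>
        (\<forall>t. of_rat p < t \<and> t < of_rat q \<longrightarrow> (P (x(k := t)) \<longleftrightarrow> s)))" for c :: "rat \<times> rat \<times> bool" and x
    have abk: "subbox k a b a b" "a k < b k" using ab by (auto simp: subbox_def)
    have Q: "dfn k (Q c)" for c
    proof -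
      obtain p q s where c: "c = (p, q, s)" by (cases c)
      have "dfn (Suc k) (\<lambda>y. of_rat p < y k \<and> y k < of_rat q \<longrightarrow> (P ((y(k := 0))(k := y k)) \<longleftrightarrow> s))"
        using P by (intro dfn_imp dfn_and dfn_less dfn_iff dterm_const dterm_coord dfn_const) simp_all
      then have "dfn k (\<lambda>x. \<forall>t. of_rat p < t \<and> t < of_rat q \<longrightarrow> (P (x(k := t)) \<longleftrightarrow> s))" by (rule dfn_all)
      from dfn_and[OF dfn_const this] show ?thesis unfolding Q_def c prod.case .
    qed
    have cov: "\<exists>c. Q c x" if x: "x \<in> obox k a b" for x
    proof -
      have "x \<in> Rn k" using x by (simp add: obox_def)
      obtain \<I> where I: "finite \<I>" "\<And>I. I \<in> \<I> \<Longrightarrow> is_interval I" "{t. P (x(k := t))} = \<Union>\<I>"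
        by (rule fibre_intervals[OF P \<open>x \<in> Rn k\<close>]) (rule that)
      obtain q0 where q0: "q0 > a k" "{a k<..<q0} \<subseteq> \<Union>\<I> \<or> {a k<..<q0} \<inter> \<Union>\<I> = {}"
        using intervals_right_germ[OF I(1,2), of "a k"] by blast
      have m: "a k < min q0 (b k)" using q0(1) abk(2) by simp
      obtain p where p: "a k < of_rat p" "of_rat p < min q0 (b k)" using of_rat_dense[OF m] by blast
      obtain q where q: "of_rat p < (of_rat q :: real)" "of_rat q < min q0 (b k)" using of_rat_dense[OF p(2)] by blast
      have sub: "{of_rat p<..<of_rat q} \<subseteq> {a k<..<q0}" using p q by auto
      have pq: "a k \<le> of_rat p \<and> p < q \<and> of_rat q \<le> b k" using p q by (simp add: of_rat_less)
      have mem: "t \<in> {a k<..<q0}" if "of_rat p < t \<and> t < of_rat q" for t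
        by (rule subsetD[OF sub]) (use that in simp)
      have memI: "P (x(k := t)) \<longleftrightarrow> t \<in> \<Union>\<I>" for t using I(3) by blast
      from q0(2) show ?thesis
      proof
        assume "{a k<..<q0} \<subseteq> \<Union>\<I>"
        then have "\<forall>t. of_rat p < t \<and> t < of_rat q \<longrightarrow> (P (x(k := t)) \<longleftrightarrow> True)" unfolding memI using mem by blast
        then have "Q (p, q, True) x" unfolding Q_def prod.case using pq by blast
        then show ?thesis by blast
      next
        assume "{a k<..<q0} \<inter> \<Union>\<I> = {}"
        then have "\<forall>t. of_rat p < t \<and> t < of_rat q \<longrightarrow> (P (x(k := t)) \<longleftrightarrow> False)" unfolding memI using mem by blast
        then have "Q (p, q, False) x" unfolding Q_def prod.case using pq by blast
        then show ?thesis by blast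
      qed
    qed
    obtain c a' b' where c: "subbox k a' b' a b" "\<And>x. x \<in> obox k a' b' \<Longrightarrow> Q c x"
      by (rule countable_cover_contains_box[OF Suc abk(1) Q cov]) (assumption, rule that)
    obtain p q s where pqs: "c = (p, q, s)" by (cases c)
    obtain x0 where "x0 \<in> obox k a' b'" using obox_nonempty c(1) by (fastforce simp: subbox_def)
    from c(2)[OF this] have pq: "a k \<le> of_rat p" "p < q" "of_rat q \<le> b k" unfolding Q_def pqs prod.case by blast+
    let ?a = "a'(k := of_rat p)" and ?b = "b'(k := of_rat q)"
    have sub: "subbox (Suc k) ?a ?b a b"
      using c(1) pq by (auto simp: subbox_def less_Suc_eq of_rat_less)
    have val: "P x \<longleftrightarrow> s" if x: "x \<in> obox (Suc k) ?a ?b" for x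
    proof -
      have "x(k := 0) \<in> obox k a' b'" "of_rat p < x k" "x k < of_rat q"
        using x by (auto simp: obox_def Rn_iff less_Suc_eq)
      then have "P ((x(k := 0))(k := x k)) \<longleftrightarrow> s" using c(2) unfolding Q_def pqs prod.case by blast
      then show ?thesis by simp
    qed
    have "{x. P x} \<inter> obox (Suc k) ?a ?b \<noteq> {}" using dense sub unfolding box_dense_def by blast
    then have s using val by blast
    then have "\<forall>x\<in>obox (Suc k) ?a ?b. P x" using val by blast
    then show "\<exists>a' b'. subbox (Suc k) a' b' a b \<and> (\<forall>x\<in>obox (Suc k) a' b'. P x)" using sub by blast
  qed
qed

lemmas cover_contains_box = countable_cover_contains_box[OF box_property]

subsection \<open>Definable functions are continuous on a subbox\<close>

text \<open>Failure of continuity at \<open>x\<close> with the fixed tolerance \<open>e\<close>.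
  Neighbourhoods are cubes given by coordinates, so that this is a first-order formula in
  \<open>x\<close> and \<open>e\<close>.\<close>

definition oscillates :: "nat \<Rightarrow> ((nat \<Rightarrow> real) \<Rightarrow> real) \<Rightarrow> (nat \<Rightarrow> real) \<Rightarrow> real \<Rightarrow> bool" where
  "oscillates k f x e \<longleftrightarrow> (\<forall>d. d > 0 \<longrightarrow> (\<exists>y\<in>Rn k. (\<forall>i<k. x i - d < y i \<and> y i < x i + d) \<and>
     \<not> (f x - e < f y \<and> f y < f x + e)))"

lemma dfn_oscillates:
  assumes f: "dterm k f" shows "dfn (Suc k) (\<lambda>z. oscillates k f (z(k := 0)) (z k))"
proof -
  let ?m = "Suc (Suc k)"
  \<comment> \<open>Layout of the variables: the first \<open>k\<close> entries are the point, entry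
    \<open>k\<close> the tolerance, entry \<open>Suc k\<close> the radius \<open>d\<close>, and the
    block behind them the competing point \<open>y\<close>.\<close>
  define Q where "Q z \<longleftrightarrow> (\<forall>i<k. z i - z (Suc k) < z (i + ?m) \<and> z (i + ?m) < z i + z (Suc k)) \<and>
     \<not> (f (\<lambda>i. if i < k then z i else 0) - z k < f (\<lambda>i. if i < k then z (i + ?m) else 0) \<and>
        f (\<lambda>i. if i < k then z (i + ?m) else 0) < f (\<lambda>i. if i < k then z i else 0) + z k)" for z
  have 1: "dterm (?m + k) (\<lambda>z. f (\<lambda>i. if i < k then z i else 0))"
    using dterm_reindex[OF f, of "\<lambda>i. i" "?m + k"] by simp
  have 2: "dterm (?m + k) (\<lambda>z. f (\<lambda>i. if i < k then z (i + ?m) else 0))"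
    using dterm_reindex[OF f, of "\<lambda>i. i + ?m" "?m + k"] by simp
  have "dfn (?m + k) Q"
    unfolding Q_def
    by (intro dfn_and dfn_not dfn_less dterm_diff dterm_add dfn_ball_lessThan 1 2 dterm_coord) simp_all
  then have "dfn ?m (\<lambda>x. \<exists>y\<in>Rn k. Q (cat ?m x y))" by (rule dfn_ex_block)
  then have "dfn ?m (\<lambda>x. x (Suc k) > 0 \<longrightarrow> (\<exists>y\<in>Rn k. Q (cat ?m x y)))"
    by (intro dfn_imp dfn_less dterm_const dterm_coord) simp_all
  then have "dfn ?m (\<lambda>z. z (Suc k) > 0 \<longrightarrow> (\<exists>y\<in>Rn k. (\<forall>i<k. z i - z (Suc k) < y i \<and> y i < z i + z (Suc k)) \<and>
     \<not> (f ((z(Suc k := 0))(k := 0)) - z k < f y \<and> f y < f ((z(Suc k := 0))(k := 0)) + z k)))"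
  proof (rule dfn_cong')
    fix z assume z: "z \<in> Rn ?m"
    have "Q (cat ?m z y) \<longleftrightarrow> (\<forall>i<k. z i - z (Suc k) < y i \<and> y i < z i + z (Suc k)) \<and>
     \<not> (f ((z(Suc k := 0))(k := 0)) - z k < f y \<and> f y < f ((z(Suc k := 0))(k := 0)) + z k)" if y: "y \<in> Rn k" for y
    proof -
      have e1: "(\<lambda>i. if i < k then cat ?m z y i else 0) = (z(Suc k := 0))(k := 0)"
        using z by (auto simp: cat_def Rn_iff fun_eq_iff)
      have e2: "(\<lambda>i. if i < k then cat ?m z y (i + ?m) else 0) = y"
        using y by (auto simp: cat_def Rn_iff fun_eq_iff)
      have e3: "cat ?m z y i = z i" if "i < ?m" for i using that by (simp add: cat_def)
      have e4: "cat ?m z y (i + ?m) = y i" for i by (simp add: cat_def)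
      show ?thesis unfolding Q_def e1 e2 using e3 e4 by simp
    qed
    then show "(z (Suc k) > 0 \<longrightarrow> (\<exists>y\<in>Rn k. Q (cat ?m z y))) \<longleftrightarrow> (z (Suc k) > 0 \<longrightarrow>
      (\<exists>y\<in>Rn k. (\<forall>i<k. z i - z (Suc k) < y i \<and> y i < z i + z (Suc k)) \<and>
     \<not> (f ((z(Suc k := 0))(k := 0)) - z k < f y \<and> f y < f ((z(Suc k := 0))(k := 0)) + z k)))" by simp
  qed
  then have "dfn (Suc k) (\<lambda>z. \<forall>d. d > 0 \<longrightarrow> (\<exists>y\<in>Rn k. (\<forall>i<k. z i - d < y i \<and> y i < z i + d) \<and>
     \<not> (f (z(k := 0)) - z k < f y \<and> f y < f (z(k := 0)) + z k)))"
    by (intro dfn_all) (erule dfn_cong', simp)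
  then show ?thesis
    by (rule dfn_cong') (simp add: oscillates_def)
qed

text \<open>If the points of continuity are not dense, some box consists of discontinuities. A fixed
  tolerance, and then a strip of that height containing the values, can be chosen uniformly on
  subboxes; these two contradict each other.\<close>

lemma generic_continuity:
  assumes f: "dterm k f" and ab: "subbox k a b a b"
  obtains a' b' where "subbox k a' b' a b" "\<And>x e. x \<in> obox k a' b' \<Longrightarrow> e > 0 \<Longrightarrow> \<not> oscillates k f x e"
proof -
  let ?C = "\<lambda>x. \<forall>e. e > 0 \<longrightarrow> \<not> oscillates k f x e"
  have "dfn (Suc k) (\<lambda>z. z k > 0 \<longrightarrow> \<not> oscillates k f (z(k := 0)) (z k))"
    by (intro dfn_imp dfn_not dfn_oscillates f dfn_less dterm_const dterm_coord) simp
  then have C: "dfn k ?C" by (rule dfn_all)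
  show ?thesis
  proof (cases "box_dense k {x. ?C x} a b")
    case True
    then obtain a' b' where "subbox k a' b' a b" "\<forall>x\<in>obox k a' b'. ?C x"
      using box_property C ab unfolding box_property_def by blast
    then show ?thesis using that by blast
  next
    case False
    then obtain a1 b1 where ab1: "subbox k a1 b1 a b" "{x. ?C x} \<inter> obox k a1 b1 = {}"
      unfolding box_dense_def by blast
    have ab1': "subbox k a1 b1 a1 b1" using ab1(1) by (auto simp: subbox_def)
    have d2: "dfn k (\<lambda>x. oscillates k f x (1 / of_nat (Suc n)))" for n
      by (rule dfn_cong'[OF dfn_coord_subst[OF dfn_oscillates[OF f]]]) (auto simp: Rn_iff fun_upd_idem)
    have c2: "\<exists>n. oscillates k f x (1 / of_nat (Suc n))" if x: "x \<in> obox k a1 b1" for x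
    proof -
      obtain e where e: "e > 0" "oscillates k f x e" using ab1(2) x by blast
      obtain n where n: "1 / of_nat (Suc n) < e" using nat_approx_posE[OF e(1)] by blast
      have "oscillates k f x (1 / of_nat (Suc n))" unfolding oscillates_def
      proof (intro allI impI)
        fix d :: real assume "d > 0"
        then obtain y where y: "y \<in> Rn k" "\<forall>i<k. x i - d < y i \<and> y i < x i + d" "\<not> (f x - e < f y \<and> f y < f x + e)"
          using e(2) unfolding oscillates_def by blast
        have "\<not> (f x - 1 / of_nat (Suc n) < f y \<and> f y < f x + 1 / of_nat (Suc n))" using y(3) n by linarith
        then show "\<exists>y\<in>Rn k. (\<forall>i<k. x i - d < y i \<and> y i < x i + d) \<and>
           \<not> (f x - 1 / of_nat (Suc n) < f y \<and> f y < f x + 1 / of_nat (Suc n))" using y(1,2) by blast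
      qed
      then show ?thesis by blast
    qed
    obtain n a2 b2 where ab2: "subbox k a2 b2 a1 b1" "\<And>x. x \<in> obox k a2 b2 \<Longrightarrow> oscillates k f x (1 / of_nat (Suc n))"
      by (rule cover_contains_box[OF ab1' d2 c2]) (assumption, rule that)
    have ab2': "subbox k a2 b2 a2 b2" using ab2(1) by (auto simp: subbox_def)
    \<comment> \<open>The strips get exactly the height of the tolerance: two values in one
      half-open strip differ by less than \<epsilon>.\<close>
    define \<epsilon> where "\<epsilon> = (1::real) / of_nat (Suc n)"
    have \<epsilon>: "\<epsilon> > 0" by (simp add: \<epsilon>_def)
    have d3: "dfn k (\<lambda>x. of_int j * \<epsilon> \<le> f x \<and> f x < (of_int j + 1) * \<epsilon>)" for j :: int
      by (intro dfn_and dfn_le dfn_less dterm_const f)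
    have c3: "\<exists>j::int. of_int j * \<epsilon> \<le> f x \<and> f x < (of_int j + 1) * \<epsilon>" for x
    proof (rule exI[of _ "\<lfloor>f x / \<epsilon>\<rfloor>"])
      have "of_int \<lfloor>f x / \<epsilon>\<rfloor> \<le> f x / \<epsilon>" "f x / \<epsilon> < of_int \<lfloor>f x / \<epsilon>\<rfloor> + 1" by linarith+
      then show "of_int \<lfloor>f x / \<epsilon>\<rfloor> * \<epsilon> \<le> f x \<and> f x < (of_int \<lfloor>f x / \<epsilon>\<rfloor> + 1) * \<epsilon>"
        unfolding pos_le_divide_eq[OF \<epsilon>] pos_divide_less_eq[OF \<epsilon>] by (rule conjI)
    qed
    obtain j a3 b3 where ab3: "subbox k a3 b3 a2 b2"
      "\<And>x. x \<in> obox k a3 b3 \<Longrightarrow> of_int j * \<epsilon> \<le> f x \<and> f x < (of_int (j::int) + 1) * \<epsilon>"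
      by (rule cover_contains_box[OF ab2' d3 c3]) (rule that)
    have "subbox k a3 b3 a3 b3" using ab3(1) by (auto simp: subbox_def)
    then obtain x where x: "x \<in> obox k a3 b3" using obox_nonempty by blast
    then have "x \<in> obox k a2 b2" using subbox_obox[OF ab3(1)] by blast
    then have osc: "oscillates k f x \<epsilon>" using ab2(2) by (simp add: \<epsilon>_def)
    obtain d where d: "d > 0" "\<And>y. y \<in> Rn k \<Longrightarrow> (\<forall>i<k. x i - d < y i \<and> y i < x i + d) \<Longrightarrow> y \<in> obox k a3 b3"
      by (rule obox_neighbourhood[OF x]) (rule that)
    obtain y where y: "y \<in> Rn k" "\<forall>i<k. x i - d < y i \<and> y i < x i + d" "\<not> (f x - \<epsilon> < f y \<and> f y < f x + \<epsilon>)"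
      using osc d(1) unfolding oscillates_def by blast
    have "y \<in> obox k a3 b3" by (rule d(2)[OF y(1,2)])
    then have "f x - \<epsilon> < f y \<and> f y < f x + \<epsilon>" using ab3(2)[OF x] ab3(2)[of y] by (auto simp: algebra_simps)
    then show ?thesis using y(3) by blast
  qed
qed

lemma continuous_on_obox:
  assumes "\<And>x e. x \<in> obox k a b \<Longrightarrow> e > 0 \<Longrightarrow> \<not> oscillates k f x e"
  shows "continuous_on (obox k a b) f"
  unfolding continuous_on_def
proof (intro ballI tendstoI)
  fix x and e :: real assume x: "x \<in> obox k a b" and e: "e > 0"
  obtain d where d: "d > 0" "\<forall>y\<in>Rn k. (\<forall>i<k. x i - d < y i \<and> y i < x i + d) \<longrightarrow> f x - e < f y \<and> f y < f x + e"
    using assms[OF x e] unfolding oscillates_def by blast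
  let ?U = "\<Inter>i\<in>{..<k}. {y :: nat \<Rightarrow> real. x i - d < y i} \<inter> {y. y i < x i + d}"
  have c: "continuous_on UNIV (\<lambda>y :: nat \<Rightarrow> real. y i)" for i by (rule continuous_on_product_coordinates)
  have "open ?U"
    by (intro open_INT open_Int ballI open_Collect_less c continuous_on_const) simp
  moreover have "x \<in> ?U" using d(1) by auto
  ultimately have "\<forall>\<^sub>F y in at x within obox k a b. y \<in> ?U"
    using eventually_at_topological by blast
  moreover have "\<forall>\<^sub>F y in at x within obox k a b. y \<in> obox k a b" by (simp add: eventually_at_filter)
  ultimately show "\<forall>\<^sub>F y in at x within obox k a b. dist (f y) (f x) < e"
  proof eventually_elim
    case (elim y)
    have "y \<in> Rn k" using elim(2) by (simp add: obox_def)
    moreover have "\<forall>i<k. x i - d < y i \<and> y i < x i + d" using elim(1) by blast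
    ultimately have "f x - e < f y \<and> f y < f x + e" using d(2) by blast
    then show ?case by (simp add: dist_real_def abs_less_iff)
  qed
qed

lemma continuous_subbox:
  assumes f: "\<And>j. j < (m::nat) \<Longrightarrow> dterm k (f j)" and ab: "subbox k a b a b"
  shows "\<exists>a' b'. subbox k a' b' a b \<and> (\<forall>j<m. \<forall>x\<in>obox k a' b'. \<forall>e>0. \<not> oscillates k (f j) x e)"
  using f
proof (induction m)
  case 0
  then show ?case using ab by blast
next
  case (Suc m)
  obtain a1 b1 where 1: "subbox k a1 b1 a b" "\<forall>j<m. \<forall>x\<in>obox k a1 b1. \<forall>e>0. \<not> oscillates k (f j) x e" using Suc by auto
  have "subbox k a1 b1 a1 b1" using 1(1) by (auto simp: subbox_def)
  then obtain a2 b2 where 2: "subbox k a2 b2 a1 b1" "\<And>x e. x \<in> obox k a2 b2 \<Longrightarrow> e > 0 \<Longrightarrow> \<not> oscillates k (f m) x e"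
    using generic_continuity[OF Suc.prems[of m]] by blast
  have "\<forall>j<m. \<forall>x\<in>obox k a2 b2. \<forall>e>0. \<not> oscillates k (f j) x e"
    using 1(2) subbox_obox[OF 2(1)] by blast
  then have "\<forall>j<Suc m. \<forall>x\<in>obox k a2 b2. \<forall>e>0. \<not> oscillates k (f j) x e" using 2(2) by (simp add: less_Suc_eq)
  then show ?case using subbox_trans[OF 2(1) 1(1)] by blast
qed

end

section \<open>Definably embedded boxes contain cells\<close>

definition closed_box :: "nat \<Rightarrow> (nat \<Rightarrow> real) \<Rightarrow> (nat \<Rightarrow> real) \<Rightarrow> (nat \<Rightarrow> real) set" where
  "closed_box k a b = {x \<in> Rn k. \<forall>i<k. a i \<le> x i \<and> x i \<le> b i}"

lemma compact_closed_box: "compact (closed_box k a b)"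
proof -
  let ?S = "\<lambda>i. if i < k then {a i..b i} else {0 :: real}"
  have "x \<in> closed_box k a b \<longleftrightarrow> (\<forall>i. x i \<in> ?S i)" for x
  proof
    assume "x \<in> closed_box k a b"
    then show "\<forall>i. x i \<in> ?S i" by (simp add: closed_box_def Rn_iff)
  next
    assume *: "\<forall>i. x i \<in> ?S i"
    have "a i \<le> x i \<and> x i \<le> b i" if "i < k" for i using spec[OF *, of i] that by simp
    moreover have "x i = 0" if "i \<ge> k" for i using spec[OF *, of i] that by simp
    ultimately show "x \<in> closed_box k a b" by (simp add: closed_box_def Rn_iff)
  qed
  then have "closed_box k a b = PiE UNIV ?S"
    by (intro set_eqI) (simp only: PiE_UNIV_domain Pi_iff UNIV_I simp_thms ball_UNIV)
  moreover have "compactin (product_topology (\<lambda>_. euclidean) UNIV) (PiE UNIV ?S)"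
    unfolding compactin_PiE by (intro disjI2 ballI) (simp only: compactin_euclidean_iff compact_Icc compact_sing split: if_split, simp)
  ultimately show ?thesis by (simp only: euclidean_product_topology compactin_euclidean_iff)
qed

context ominimal_expansion
begin

lemma dterm_subst:
  assumes F: "dterm (Suc m) F" and g: "dterm m g" shows "dterm m (\<lambda>x. F (x(m := g x)))"
proof -
  let ?F = "\<lambda>y. F (\<lambda>i. if i < Suc m then y (if i = m then Suc m else i) else 0)"
  have "dterm (Suc (Suc m)) ?F" by (rule dterm_reindex[OF F]) auto
  then have "dfn (Suc (Suc m)) (\<lambda>y. y m = ?F y)" by (intro dfn_eq dterm_coord) simp_all
  from dfn_subst[OF this dterm_weaken[OF g]] show ?thesis
    unfolding dterm_def
  proof (rule dfn_cong')
    fix x assume x: "x \<in> Rn (Suc m)"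
    have "(\<lambda>i. if i < Suc m then (x(Suc m := g (x(m := 0)))) (if i = m then Suc m else i) else 0) =
        (x(m := 0))(m := g (x(m := 0)))"
      using x by (auto simp: Rn_iff fun_eq_iff)
    then show "((x(Suc m := g (x(m := 0)))) m = ?F (x(Suc m := g (x(m := 0))))) \<longleftrightarrow>
       x m = F ((x(m := 0))(m := g (x(m := 0))))" by simp
  qed
qed

lemma dfn_box_image:
  assumes h: "\<And>j. j < n \<Longrightarrow> dterm k (h j)"
  shows "dfn n (\<lambda>z. \<exists>x\<in>obox k a b. \<forall>j<n. z j = h j x)"
proof -
  define Q where "Q w \<longleftrightarrow> (\<forall>i<k. a i < w (i + n) \<and> w (i + n) < b i) \<and>
      (\<forall>j<n. w j = h j (\<lambda>i. if i < k then w (i + n) else 0))" for w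
  have 1: "dterm (n + k) (\<lambda>w. h j (\<lambda>i. if i < k then w (i + n) else 0))" if "j < n" for j
    using dterm_reindex[OF h[OF that], of "\<lambda>i. i + n" "n + k"] by simp
  have "dfn (n + k) Q" unfolding Q_def
    by (intro dfn_and dfn_ball_lessThan dfn_less dfn_eq dterm_const dterm_coord 1) simp_all
  from dfn_ex_block[OF this] show ?thesis
  proof (rule dfn_cong')
    fix z assume "z \<in> Rn n"
    have "Q (cat n z y) \<longleftrightarrow> y \<in> obox k a b \<and> (\<forall>j<n. z j = h j y)" if y: "y \<in> Rn k" for y
    proof -
      have e: "(\<lambda>i. if i < k then cat n z y (i + n) else 0) = y" using y by (auto simp: cat_def Rn_iff fun_eq_iff)
      show ?thesis unfolding Q_def e using y by (auto simp: cat_def obox_def)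
    qed
    then show "(\<exists>y\<in>Rn k. Q (cat n z y)) \<longleftrightarrow> (\<exists>x\<in>obox k a b. \<forall>j<n. z j = h j x)"
      by (auto simp: obox_def)
  qed
qed

definition box_image :: "nat \<Rightarrow> nat \<Rightarrow> (nat \<Rightarrow> real) \<Rightarrow> (nat \<Rightarrow> real) \<Rightarrow> (nat \<Rightarrow> (nat \<Rightarrow> real) \<Rightarrow> real) \<Rightarrow> (nat \<Rightarrow> real) set" where
  "box_image m k a b h = {z \<in> Rn m. \<exists>x\<in>obox k a b. \<forall>j<m. z j = h j x}"

text \<open>Definability of the cell is carried along, because the next graph or band over it has to
  be shown definable.\<close>

definition contains_cell :: "nat \<Rightarrow> nat \<Rightarrow> (nat \<Rightarrow> real) set \<Rightarrow> bool" where
  "contains_cell m k S \<longleftrightarrow> (\<exists>C. cell D m k C \<and> C \<in> D m \<and> C \<subseteq> S)"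

text \<open>The induction runs over the ambient dimension \<open>m\<close>, for all box dimensions
  \<open>k\<close> at once: a graph keeps \<open>k\<close>, while a band lowers both dimensions by
  one.\<close>

definition embedding_property :: "nat \<Rightarrow> bool" where
  "embedding_property m \<longleftrightarrow> (\<forall>k a b h. subbox k a b a b \<longrightarrow> (\<forall>j<m. dterm k (h j)) \<longrightarrow>
     (\<forall>x\<in>obox k a b. \<forall>y\<in>obox k a b. (\<forall>j<m. h j x = h j y) \<longrightarrow> x = y) \<longrightarrow> contains_cell m k (box_image m k a b h))"

lemma contains_cell_mono: "contains_cell m k S \<Longrightarrow> S \<subseteq> T \<Longrightarrow> contains_cell m k T"
  unfolding contains_cell_def by blast

lemma box_image_mono: "obox k a' b' \<subseteq> obox k a b \<Longrightarrow> box_image m k a' b' h \<subseteq> box_image m k a b h"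
  unfolding box_image_def by blast

text \<open>The first \<open>m\<close> coordinates already determine the point, so the image is a
  graph over its projection. The last coordinate is a continuous function of the others, because a
  continuous injection of a compact box has a continuous inverse.\<close>

lemma graph_contains_cell:
  assumes IH: "embedding_property m" and ab: "subbox k a b a b"
    and h: "\<And>j. j < Suc m \<Longrightarrow> dterm k (h j)"
    and inj: "\<And>x y. x \<in> obox k a b \<Longrightarrow> y \<in> obox k a b \<Longrightarrow> (\<forall>j<m. h j x = h j y) \<Longrightarrow> x = y"
  shows "contains_cell (Suc m) k (box_image (Suc m) k a b h)"
proof -
  have "\<exists>a' b'. subbox k a' b' a b \<and> (\<forall>j<Suc m. \<forall>x\<in>obox k a' b'. \<forall>e>0. \<not> oscillates k (h j) x e)"
    by (rule continuous_subbox[OF h ab])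
  then obtain a2 b2 where 2: "subbox k a2 b2 a b" "\<forall>j<Suc m. \<forall>x\<in>obox k a2 b2. \<forall>e>0. \<not> oscillates k (h j) x e"
    by (elim exE conjE) (rule that)
  have cont: "continuous_on (obox k a2 b2) (h j)" if "j < Suc m" for j
    by (rule continuous_on_obox) (simp add: 2(2) that)
  \<comment> \<open>A smaller box whose closure stays in the box of continuity: the closed box gives
    the continuous inverse, the open one is passed to the induction hypothesis.\<close>
  define a3 b3 where "a3 i = a2 i + (b2 i - a2 i) / 3" and "b3 i = b2 i - (b2 i - a2 i) / 3" for i
  have ab3: "a2 i < a3 i \<and> a3 i < b3 i \<and> b3 i < b2 i" if "i < k" for i
    using 2(1) that by (auto simp: subbox_def a3_def b3_def field_simps)
  have sub3: "subbox k a3 b3 a3 b3" using ab3 by (simp add: subbox_def)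
  let ?K = "closed_box k a3 b3"
  have K2: "?K \<subseteq> obox k a2 b2"
  proof
    fix x assume x: "x \<in> ?K"
    have "a2 i < x i \<and> x i < b2 i" if "i < k" for i
      using x ab3[OF that] that unfolding closed_box_def by (auto intro: less_le_trans le_less_trans)
    then show "x \<in> obox k a2 b2" using x by (simp add: closed_box_def obox_def)
  qed
  have oK: "obox k a3 b3 \<subseteq> ?K" by (auto simp: closed_box_def obox_def less_imp_le)
  have K1: "?K \<subseteq> obox k a b" using K2 subbox_obox[OF 2(1)] by blast
  have "\<forall>x\<in>obox k a3 b3. \<forall>y\<in>obox k a3 b3. (\<forall>j<m. h j x = h j y) \<longrightarrow> x = y"
  proof (intro ballI impI)
    fix x y assume "x \<in> obox k a3 b3" "y \<in> obox k a3 b3" "\<forall>j<m. h j x = h j y"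
    then show "x = y" by (intro inj subsetD[OF K1] subsetD[OF oK]) simp_all
  qed
  moreover have "\<forall>j<m. dterm k (h j)" using h by simp
  ultimately have "contains_cell m k (box_image m k a3 b3 h)"
    by (intro IH[unfolded embedding_property_def, rule_format]) (use sub3 in \<open>simp_all\<close>)
  then obtain C where C: "cell D m k C" "C \<in> D m" "C \<subseteq> box_image m k a3 b3 h" unfolding contains_cell_def by blast
  define H where "H x = (\<lambda>j. if j < m then h j x else 0)" for x
  have contH: "continuous_on ?K H"
    unfolding H_def
  proof (rule continuous_on_coordinatewise_then_product)
    fix j show "continuous_on ?K (\<lambda>x. if j < m then h j x else 0)"
      using continuous_on_subset[OF cont K2] by (cases "j < m") auto
  qed
  have injH: "inj_on H ?K"
  proof (rule inj_onI)
    fix x y assume "x \<in> ?K" "y \<in> ?K" and eq: "H x = H y"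
    moreover have "h j x = h j y" if "j < m" for j using fun_cong[OF eq, of j] that by (simp add: H_def)
    ultimately show "x = y" by (intro inj subsetD[OF K1]) simp_all
  qed
  define g where "g = inv_into ?K H"
  have gH: "g (H x) = x" if "x \<in> ?K" for x unfolding g_def by (rule inv_into_f_f[OF injH that])
  have contg: "continuous_on (H ` ?K) g"
    by (rule continuous_on_inv[OF contH compact_closed_box]) (simp add: gH)
  define f where "f z = h m (g z)" for z
  have contf: "continuous_on (H ` ?K) f"
    unfolding f_def
    by (rule continuous_on_compose2[OF continuous_on_subset[OF cont K2] contg]) (auto simp: gH)
  have Cx: "\<exists>x\<in>obox k a3 b3. z = H x" if "z \<in> C" for z
  proof -
    have "z \<in> box_image m k a3 b3 h" using C(3) that by (rule subsetD)
    then obtain x where x: "x \<in> obox k a3 b3" "\<forall>j<m. z j = h j x" and z: "z \<in> Rn m"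
      unfolding box_image_def by (elim CollectE conjE bexE)
    have "z = H x" using x(2) z by (auto simp: H_def Rn_iff fun_eq_iff)
    then show ?thesis using x(1) by blast
  qed
  have CK: "C \<subseteq> H ` ?K" using Cx oK by blast
  let ?E = "{z \<in> Rn (Suc m). z(m := 0) \<in> C \<and> z m = f (z(m := 0))}"
  have Ex: "z m = f (z(m := 0)) \<longleftrightarrow> (\<exists>x\<in>obox k a3 b3. \<forall>j<Suc m. z j = h j x)" if z: "z \<in> Rn (Suc m)" "z(m := 0) \<in> C" for z
  proof -
    obtain x0 where x0: "x0 \<in> obox k a3 b3" "z(m := 0) = H x0" using Cx[OF z(2)] by blast
    have x0K: "x0 \<in> ?K" using x0(1) oK by blast
    have f0: "f (z(m := 0)) = h m x0" unfolding f_def x0(2) gH[OF x0K] ..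
    have zj: "z j = h j x0" if "j < m" for j using fun_cong[OF x0(2), of j] that by (simp add: H_def)
    show ?thesis
    proof
      assume "z m = f (z(m := 0))"
      then have "\<forall>j<Suc m. z j = h j x0" using f0 zj by (simp add: less_Suc_eq)
      then show "\<exists>x\<in>obox k a3 b3. \<forall>j<Suc m. z j = h j x" using x0(1) by blast
    next
      assume "\<exists>x\<in>obox k a3 b3. \<forall>j<Suc m. z j = h j x"
      then obtain x where x: "x \<in> obox k a3 b3" "\<forall>j<Suc m. z j = h j x" by blast
      have "\<forall>j<m. h j x = h j x0" using x(2) zj by simp
      then have "x = x0" using x(1) x0(1) by (intro inj subsetD[OF K1] subsetD[OF oK]) simp_all
      then show "z m = f (z(m := 0))" using x(2) f0 by simp
    qed
  qed
  have "dfn m (\<lambda>z. z \<in> C)"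
  proof -
    have "{z \<in> Rn m. z \<in> C} = C" using definable_subset[OF C(2)] by blast
    then show ?thesis using C(2) by (simp add: dfn_def)
  qed
  then have "dfn (Suc m) (\<lambda>z. z(m := 0) \<in> C \<and> (\<exists>x\<in>obox k a3 b3. \<forall>j<Suc m. z j = h j x))"
    by (intro dfn_and dfn_weaken[of m "\<lambda>z. z \<in> C"] dfn_box_image h)
  then have "dfn (Suc m) (\<lambda>z. z(m := 0) \<in> C \<and> z m = f (z(m := 0)))"
    by (rule dfn_cong') (simp add: Ex cong: conj_cong)
  then have ED: "?E \<in> D (Suc m)" by (simp add: dfn_def)
  have "definable_continuous D m C f"
    unfolding definable_continuous_def using ED continuous_on_subset[OF contf CK] by blast
  then have "cell D (Suc m) k ?E" by (rule cell_graph[OF C(1)])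
  moreover have "?E \<subseteq> box_image (Suc m) k a b h"
  proof
    fix z assume z: "z \<in> ?E"
    then have "\<exists>x\<in>obox k a3 b3. \<forall>j<Suc m. z j = h j x" using Ex[of z] by simp
    then obtain x where "x \<in> obox k a3 b3" "\<forall>j<Suc m. z j = h j x" by (elim bexE)
    moreover have "x \<in> obox k a b" using calculation oK K1 by blast
    ultimately show "z \<in> box_image (Suc m) k a b h" using z unfolding box_image_def by blast
  qed
  ultimately show ?thesis unfolding contains_cell_def using ED by blast
qed

end

section \<open>Slicing a box across one coordinate\<close>

definition ins :: "nat \<Rightarrow> (nat \<Rightarrow> real) \<Rightarrow> real \<Rightarrow> nat \<Rightarrow> real" where
  "ins l w s = (\<lambda>i. if i < l then w i else if i = l then s else w (i - 1))"

definition del :: "nat \<Rightarrow> (nat \<Rightarrow> real) \<Rightarrow> nat \<Rightarrow> real" where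
  "del l x = (\<lambda>i. if i < l then x i else x (Suc i))"

lemma ins_Rn: "w \<in> Rn k \<Longrightarrow> l \<le> k \<Longrightarrow> ins l w s \<in> Rn (Suc k)"
  by (auto simp: ins_def Rn_iff)

lemma ins_inj: "ins l w s = ins l w' s' \<Longrightarrow> w = w'"
proof
  fix i assume eq: "ins l w s = ins l w' s'"
  show "w i = w' i"
    using fun_cong[OF eq, of i] fun_cong[OF eq, of "Suc i"] by (cases "i < l") (auto simp: ins_def)
qed

lemma continuous_on_ins: "continuous_on S (\<lambda>s. ins l w s)"
  unfolding ins_def
proof (rule continuous_on_coordinatewise_then_product)
  fix i show "continuous_on S (\<lambda>s. if i < l then w i else if i = l then s else w (i - 1))"
    by (cases "i < l"; cases "i = l") (auto intro: continuous_intros)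
qed

text \<open>The intermediate value theorem gives a solution and compactness a least one. The least
  one is unique and described by a formula, which makes it a definable choice.\<close>

lemma level_set_least:
  fixes \<phi> :: "real \<Rightarrow> real"
  assumes cont: "continuous_on {lo..hi} \<phi>" and s: "s1 \<in> {lo..hi}" "s2 \<in> {lo..hi}" and c: "\<phi> s1 \<le> c" "c \<le> \<phi> s2"
  shows "\<exists>!s. s \<in> {lo..hi} \<and> \<phi> s = c \<and> (\<forall>s'. lo \<le> s' \<and> s' < s \<longrightarrow> \<phi> s' \<noteq> c)"
proof -
  have "connected (\<phi> ` {lo..hi})" by (rule connected_continuous_image[OF cont]) simp
  then have "c \<in> \<phi> ` {lo..hi}" using connectedD_interval[of "\<phi> ` {lo..hi}" "\<phi> s1" "\<phi> s2" c] s c by blast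
  then have ne: "{s \<in> {lo..hi}. \<phi> s = c} \<noteq> {}" by blast
  have "closed {s \<in> {lo..hi}. \<phi> s = c}" by (rule continuous_closed_preimage_constant[OF cont closed_atLeastAtMost])
  moreover have "bounded {s \<in> {lo..hi}. \<phi> s = c}" by (rule bounded_subset[of "{lo..hi}"]) auto
  ultimately have "compact {s \<in> {lo..hi}. \<phi> s = c}" using compact_eq_bounded_closed by blast
  then obtain s where s: "s \<in> {lo..hi}" "\<phi> s = c" "\<forall>t\<in>{s \<in> {lo..hi}. \<phi> s = c}. s \<le> t"
    using compact_attains_inf[OF _ ne] by blast
  show ?thesis
  proof (rule ex1I[of _ s])
    have "\<phi> s' \<noteq> c" if "lo \<le> s' \<and> s' < s" for s'
    proof
      assume "\<phi> s' = c"
      then have "s \<le> s'" using s that by auto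
      then show False using that by simp
    qed
    then show "s \<in> {lo..hi} \<and> \<phi> s = c \<and> (\<forall>s'. lo \<le> s' \<and> s' < s \<longrightarrow> \<phi> s' \<noteq> c)" using s by blast
    fix t assume t: "t \<in> {lo..hi} \<and> \<phi> t = c \<and> (\<forall>s'. lo \<le> s' \<and> s' < t \<longrightarrow> \<phi> s' \<noteq> c)"
    then have "s \<le> t" using s(3) by blast
    moreover have "\<not> s < t" using t s by auto
    ultimately show "t = s" by simp
  qed
qed

context ominimal_expansion
begin

lemma dfn_least_level:
  assumes F: "dterm (Suc k) F" and l: "l \<le> k"
  shows "dfn (Suc k) (\<lambda>z. z k \<in> {lo..hi} \<and> F (ins l (z(k := 0)) (z k)) = c \<and>
      (\<forall>s. lo \<le> s \<and> s < z k \<longrightarrow> F (ins l (z(k := 0)) s) \<noteq> c))"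
proof -
  have e: "(\<lambda>i. if i < Suc k then x (if i < l then i else if i = l then r else i - 1) else 0) = ins l w (x r)"
    if "\<And>i. i < k \<Longrightarrow> w i = x i" "\<And>i. i \<ge> k \<Longrightarrow> w i = 0" for x r and w :: "nat \<Rightarrow> real"
    using that l by (auto simp: ins_def fun_eq_iff less_Suc_eq)
  have 1: "dterm (Suc k) (\<lambda>z. F (ins l (z(k := 0)) (z k)))"
  proof (rule dterm_cong[OF dterm_reindex[OF F, of "\<lambda>i. if i < l then i else if i = l then k else i - 1" "Suc k"]])
    fix x assume x: "x \<in> Rn (Suc k)"
    show "F (\<lambda>i. if i < Suc k then x (if i < l then i else if i = l then k else i - 1) else 0) = F (ins l (x(k := 0)) (x k))"
      by (subst e[of "x(k := 0)"]) (use x in \<open>auto simp: Rn_iff\<close>)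
  qed (use l in auto)
  have 2: "dterm (Suc (Suc k)) (\<lambda>y. F (ins l ((y(Suc k := 0))(k := 0)) (y (Suc k))))"
  proof (rule dterm_cong[OF dterm_reindex[OF F, of "\<lambda>i. if i < l then i else if i = l then Suc k else i - 1" "Suc (Suc k)"]])
    fix x assume x: "x \<in> Rn (Suc (Suc k))"
    show "F (\<lambda>i. if i < Suc k then x (if i < l then i else if i = l then Suc k else i - 1) else 0) =
        F (ins l ((x(Suc k := 0))(k := 0)) (x (Suc k)))"
      by (subst e[of "(x(Suc k := 0))(k := 0)"]) (use x in \<open>auto simp: Rn_iff\<close>)
  qed (use l in auto)
  have "dfn (Suc (Suc k)) (\<lambda>y. lo \<le> y (Suc k) \<and> y (Suc k) < (y(Suc k := 0)) k \<longrightarrow> F (ins l ((y(Suc k := 0))(k := 0)) (y (Suc k))) \<noteq> c)"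
    by (intro dfn_imp dfn_and dfn_le dfn_less dfn_not dfn_eq dterm_const dterm_coord 2 dterm_weaken[of "Suc k" "\<lambda>x. x k"]) simp_all
  then have 3: "dfn (Suc k) (\<lambda>z. \<forall>s. lo \<le> s \<and> s < z k \<longrightarrow> F (ins l (z(k := 0)) s) \<noteq> c)" by (rule dfn_all)
  show ?thesis unfolding atLeastAtMost_iff
    by (intro dfn_and dfn_le dfn_eq dterm_const dterm_coord 1 3) simp_all
qed

text \<open>Over the subbox every projected point carries the whole interval from \<open>p\<close>
  to \<open>q\<close> of last coordinates. On a slice where \<open>h m\<close> is constant the first
  \<open>m\<close> coordinates are injective, so the induction hypothesis puts a cell of dimension
  \<open>k - 1\<close> below, and the band over it has dimension \<open>k\<close>.\<close>

lemma band_contains_cell: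
  assumes IH: "embedding_property m" and ab: "subbox k a b a b"
    and h: "\<And>j. j < Suc m \<Longrightarrow> dterm k (h j)"
    and inj: "\<And>x y. x \<in> obox k a b \<Longrightarrow> y \<in> obox k a b \<Longrightarrow> (\<forall>j<Suc m. h j x = h j y) \<Longrightarrow> x = y"
    and ab1: "subbox k a1 b1 a b" and pq: "p < q"
    and band: "\<And>x t. x \<in> obox k a1 b1 \<Longrightarrow> p < t \<Longrightarrow> t < q \<Longrightarrow> \<exists>y\<in>obox k a b. (\<forall>j<m. h j y = h j x) \<and> h m y = t"
  shows "contains_cell (Suc m) k (box_image (Suc m) k a b h)"
proof -
  have ab1': "subbox k a1 b1 a1 b1" using ab1 by (auto simp: subbox_def)
  have "\<exists>a' b'. subbox k a' b' a1 b1 \<and> (\<forall>j<Suc m. \<forall>x\<in>obox k a' b'. \<forall>e>0. \<not> oscillates k (h j) x e)"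
    by (rule continuous_subbox[OF h ab1'])
  then obtain a2 b2 where 2: "subbox k a2 b2 a1 b1" "\<forall>j<Suc m. \<forall>x\<in>obox k a2 b2. \<forall>e>0. \<not> oscillates k (h j) x e"
    by (elim exE conjE) (rule that)
  have o21: "obox k a2 b2 \<subseteq> obox k a1 b1" by (rule subbox_obox[OF 2(1)])
  have o2: "obox k a2 b2 \<subseteq> obox k a b" using o21 subbox_obox[OF ab1] by blast
  have ab2': "subbox k a2 b2 a2 b2" using 2(1) by (auto simp: subbox_def)
  have osc: "\<not> oscillates k (h m) x e" if "x \<in> obox k a2 b2" "e > 0" for x e using 2(2) that by simp
  have cont: "continuous_on (obox k a2 b2) (h m)" by (rule continuous_on_obox[OF osc])
  show ?thesis
  proof (cases "\<forall>x\<in>obox k a2 b2. \<forall>y\<in>obox k a2 b2. h m x = h m y")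
    \<comment> \<open>With \<open>h m\<close> constant, the first \<open>m\<close> coordinates are
      injective on the whole box, and the graph case applies.\<close>
    case True
    have "contains_cell (Suc m) k (box_image (Suc m) k a2 b2 h)"
    proof (rule graph_contains_cell[OF IH ab2' h])
      fix x y assume xy: "x \<in> obox k a2 b2" "y \<in> obox k a2 b2" "\<forall>j<m. h j x = h j y"
      have "h m x = h m y" using True xy(1,2) by blast
      then have "\<forall>j<Suc m. h j x = h j y" using xy(3) by (simp add: less_Suc_eq)
      then show "x = y" using xy(1,2) by (intro inj subsetD[OF o2]) simp_all
    qed
    then show ?thesis by (rule contains_cell_mono) (rule box_image_mono[OF o2])
  next
    case False
    then obtain x y where x: "x \<in> obox k a2 b2" and y: "y \<in> obox k a2 b2" and xy: "h m x \<noteq> h m y" by blast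
    \<comment> \<open>Passing from \<open>x\<close> to \<open>y\<close> one coordinate at a time
      finds a direction \<open>l\<close> along which \<open>h m\<close> has different values at the
      two ends.\<close>
    define w where "w l = (\<lambda>i. if i < l then y i else x i)" for l
    have wB: "w l \<in> obox k a2 b2" for l using x y by (auto simp: w_def obox_def Rn_iff)
    have wk: "w k = y" using x y by (auto simp: w_def obox_def Rn_iff fun_eq_iff)
    have "\<exists>l<k. h m (w l) \<noteq> h m (w (Suc l))"
    proof (rule ccontr)
      assume *: "\<not> ?thesis"
      have "l \<le> k \<Longrightarrow> h m (w l) = h m x" for l
      proof (induction l)
        case 0
        have "w 0 = x" by (simp add: w_def)
        then show ?case by simp
      next
        case (Suc l)
        then show ?case using * by simp
      qed
      from this[of k] show False using wk xy by simp
    qed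
    then obtain l where l: "l < k" "h m (w l) \<noteq> h m (w (Suc l))" by blast
    define u v where "u = w l" and "v = w (Suc l)"
    have uB: "u \<in> obox k a2 b2" and vB: "v \<in> obox k a2 b2" by (simp_all add: u_def v_def wB)
    have vu: "v = u(l := v l)" by (auto simp: u_def v_def w_def fun_eq_iff)
    obtain k' where k': "k = Suc k'" using l(1) by (cases k) auto
    have lk': "l \<le> k'" using l(1) k' by simp
    \<comment> \<open>The level \<open>c\<close> is the midpoint of the two end values and
      \<epsilon> half their distance. Near \<open>u\<close> and \<open>v\<close> the values of
      \<open>h m\<close> stay on opposite sides of \<open>c\<close>, so every nearby parallel
      segment meets the level.\<close>
    define c where "c = (h m u + h m v) / 2"
    define \<epsilon> where "\<epsilon> = \<bar>h m u - h m v\<bar> / 2"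
    have \<epsilon>: "\<epsilon> > 0" using l(2) by (simp add: \<epsilon>_def u_def v_def)
    obtain d1 where d1: "d1 > 0" "\<forall>y\<in>Rn k. (\<forall>i<k. u i - d1 < y i \<and> y i < u i + d1) \<longrightarrow> h m u - \<epsilon> < h m y \<and> h m y < h m u + \<epsilon>"
      using osc[OF uB \<epsilon>] unfolding oscillates_def by blast
    obtain d2 where d2: "d2 > 0" "\<forall>y\<in>Rn k. (\<forall>i<k. v i - d2 < y i \<and> y i < v i + d2) \<longrightarrow> h m v - \<epsilon> < h m y \<and> h m y < h m v + \<epsilon>"
      using osc[OF vB \<epsilon>] unfolding oscillates_def by blast
    obtain d3 where d3: "d3 > 0" "\<And>y. y \<in> Rn k \<Longrightarrow> (\<forall>i<k. u i - d3 < y i \<and> y i < u i + d3) \<Longrightarrow> y \<in> obox k a2 b2"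
      by (rule obox_neighbourhood[OF uB]) (rule that)
    define d where "d = min d1 (min d2 d3)"
    have d: "d > 0" "d \<le> d1" "d \<le> d2" "d \<le> d3" using d1(1) d2(1) d3(1) by (auto simp: d_def)
    define a4 b4 where "a4 i = del l u i - d" and "b4 i = del l u i + d" for i
    let ?W = "obox k' a4 b4"
    have ab4: "subbox k' a4 b4 a4 b4" using d(1) by (simp add: subbox_def a4_def b4_def)
    have near: "\<forall>i<k. i \<noteq> l \<longrightarrow> u i - d < ins l z s i \<and> ins l z s i < u i + d" if z: "z \<in> ?W" for z s
    proof (intro allI impI)
      fix i assume i: "i < k" "i \<noteq> l"
      define j where "j = (if i < l then i else i - 1)"
      have "j < k'" using i l(1) k' by (auto simp: j_def)
      then have "a4 j < z j \<and> z j < b4 j" using z by (simp add: obox_def)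
      moreover have "del l u j = u i" using i by (auto simp: del_def j_def)
      moreover have "ins l z s i = z j" using i by (auto simp: ins_def j_def)
      ultimately show "u i - d < ins l z s i \<and> ins l z s i < u i + d" by (simp add: a4_def b4_def)
    qed
    have insl: "ins l z s l = s" for z s by (simp add: ins_def)
    have insR: "ins l z s \<in> Rn k" if "z \<in> ?W" for z s unfolding k' by (rule ins_Rn) (use that lk' in \<open>auto simp: obox_def\<close>)
    have nu: "h m u - \<epsilon> < h m (ins l z (u l)) \<and> h m (ins l z (u l)) < h m u + \<epsilon>" if z: "z \<in> ?W" for z
    proof -
      have "\<forall>i<k. u i - d1 < ins l z (u l) i \<and> ins l z (u l) i < u i + d1"
      proof (intro allI impI)
        fix i assume "i < k"
        then show "u i - d1 < ins l z (u l) i \<and> ins l z (u l) i < u i + d1"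
          using near[OF z, of "u l"] insl d d1(1) by (cases "i = l") (simp, force)
      qed
      then show ?thesis using d1(2) insR[OF z] by blast
    qed
    have nv: "h m v - \<epsilon> < h m (ins l z (v l)) \<and> h m (ins l z (v l)) < h m v + \<epsilon>" if z: "z \<in> ?W" for z
    proof -
      have "\<forall>i<k. v i - d2 < ins l z (v l) i \<and> ins l z (v l) i < v i + d2"
      proof (intro allI impI)
        fix i assume i: "i < k"
        show "v i - d2 < ins l z (v l) i \<and> ins l z (v l) i < v i + d2"
        proof (cases "i = l")
          case True then show ?thesis using insl d2(1) by simp
        next
          case False
          then have "v i = u i" using fun_cong[OF vu, of i] by simp
          then show ?thesis using near[OF z, of "v l"] i False d by force
        qed
      qed
      then show ?thesis using d2(2) insR[OF z] by blast
    qed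
    define lo hi where "lo = min (u l) (v l)" and "hi = max (u l) (v l)"
    have inB: "ins l z s \<in> obox k a2 b2" if z: "z \<in> ?W" and s: "s \<in> {lo..hi}" for z s
    proof -
      have B: "ins l z (u l) \<in> obox k a2 b2"
      proof (rule d3(2)[OF insR[OF z]], intro allI impI)
        fix i assume "i < k"
        then show "u i - d3 < ins l z (u l) i \<and> ins l z (u l) i < u i + d3"
          using near[OF z, of "u l"] insl d d3(1) by (cases "i = l") (simp, force)
      qed
      have "a2 i < ins l z s i \<and> ins l z s i < b2 i" if i: "i < k" for i
      proof (cases "i = l")
        case True
        have "a2 l < u l" "u l < b2 l" "a2 l < v l" "v l < b2 l" using uB vB l(1) by (auto simp: obox_def)
        then show ?thesis using s True insl by (auto simp: lo_def hi_def)
      next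
        case False
        then have "ins l z s i = ins l z (u l) i" by (simp add: ins_def)
        then show ?thesis using B i by (simp add: obox_def)
      qed
      then show ?thesis using insR[OF z] by (simp add: obox_def)
    qed
    have cont\<phi>: "continuous_on {lo..hi} (\<lambda>s. h m (ins l z s))" if z: "z \<in> ?W" for z
      by (rule continuous_on_compose2[OF cont continuous_on_ins]) (use inB[OF z] in blast)
    define L where "L z s \<longleftrightarrow> s \<in> {lo..hi} \<and> h m (ins l z s) = c \<and> (\<forall>s'. lo \<le> s' \<and> s' < s \<longrightarrow> h m (ins l z s') \<noteq> c)" for z s
    have ul: "u l \<in> {lo..hi}" "v l \<in> {lo..hi}" by (auto simp: lo_def hi_def)
    have least: "\<exists>!s. L z s" if z: "z \<in> ?W" for z
    proof (cases "h m u < h m v")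
      case True
      then have "h m (ins l z (u l)) \<le> c" "c \<le> h m (ins l z (v l))"
        using nu[OF z] nv[OF z] by (auto simp: c_def \<epsilon>_def abs_if field_simps)
      then show ?thesis unfolding L_def by (rule level_set_least[OF cont\<phi>[OF z] ul])
    next
      case False
      then have "h m (ins l z (v l)) \<le> c" "c \<le> h m (ins l z (u l))"
        using nu[OF z] nv[OF z] by (auto simp: c_def \<epsilon>_def abs_if field_simps)
      then show ?thesis unfolding L_def by (rule level_set_least[OF cont\<phi>[OF z] ul(2,1)])
    qed
    \<comment> \<open>The default \<open>0\<close> outside \<open>?W\<close> makes \<open>g\<close>
      a definable function on all of \<open>Rn k'\<close>.\<close>
    define g where "g z = (if z \<in> ?W then (THE s. L z s) else 0)" for z
    have gL: "L z (g z)" if z: "z \<in> ?W" for z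
      unfolding g_def if_P[OF z] by (rule theI'[OF least[OF z]])
    have gu: "g z = s" if "z \<in> ?W" "L z s" for z s
      by (rule ex1E[OF least[OF that(1)]]) (metis gL[OF that(1)] that(2))
    have gi: "g z \<in> {lo..hi}" "h m (ins l z (g z)) = c" if "z \<in> ?W" for z
      using gL[OF that] unfolding L_def by blast+
    have g: "dterm k' g"
    proof -
      have hm: "dterm (Suc k') (h m)" using h[of m] k' by simp
      have W: "dfn k' (\<lambda>z. \<forall>i<k'. a4 i < z i \<and> z i < b4 i)"
        by (intro dfn_ball_lessThan dfn_and dfn_less dterm_const dterm_coord)
      note W' = dfn_weaken[OF W]
      have "dfn (Suc k') (\<lambda>y. ((\<forall>i<k'. a4 i < (y(k' := 0)) i \<and> (y(k' := 0)) i < b4 i) \<and> L (y(k' := 0)) (y k')) \<or>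
         (\<not> (\<forall>i<k'. a4 i < (y(k' := 0)) i \<and> (y(k' := 0)) i < b4 i) \<and> y k' = 0))"
        unfolding L_def
        by (intro dfn_or dfn_and[OF W' dfn_least_level[OF hm lk']] dfn_and dfn_not W' dfn_eq dterm_coord dterm_const) simp_all
      then show ?thesis unfolding dterm_def
      proof (rule dfn_cong')
        fix y assume y: "y \<in> Rn (Suc k')"
        have yW: "(\<forall>i<k'. a4 i < (y(k' := 0)) i \<and> (y(k' := 0)) i < b4 i) \<longleftrightarrow> y(k' := 0) \<in> ?W"
          using y by (auto simp: obox_def Rn_iff)
        show "(((\<forall>i<k'. a4 i < (y(k' := 0)) i \<and> (y(k' := 0)) i < b4 i) \<and> L (y(k' := 0)) (y k')) \<or>
         (\<not> (\<forall>i<k'. a4 i < (y(k' := 0)) i \<and> (y(k' := 0)) i < b4 i) \<and> y k' = 0)) \<longleftrightarrow> y k' = g (y(k' := 0))"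
          unfolding yW
        proof (cases "y(k' := 0) \<in> ?W")
          case True
          have "L (y(k' := 0)) (y k') \<longleftrightarrow> y k' = g (y(k' := 0))" using gu[OF True] gL[OF True] by metis
          then show "((y(k' := 0) \<in> ?W \<and> L (y(k' := 0)) (y k')) \<or> (y(k' := 0) \<notin> ?W \<and> y k' = 0)) \<longleftrightarrow> y k' = g (y(k' := 0))"
            using True by blast
        next
          case False
          then have "g (y(k' := 0)) = 0" by (simp only: g_def if_False)
          then show "((y(k' := 0) \<in> ?W \<and> L (y(k' := 0)) (y k')) \<or> (y(k' := 0) \<notin> ?W \<and> y k' = 0)) \<longleftrightarrow> y k' = g (y(k' := 0))"
            using False by simp
        qed
      qed
    qed
    define h' where "h' j z = h j (ins l z (g z))" for j z
    have h': "dterm k' (h' j)" if "j < m" for j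
    proof -
      have hj: "dterm (Suc k') (h j)" using h[of j] that k' by simp
      have "dterm (Suc k') (\<lambda>x. h j (\<lambda>i. if i < Suc k' then x (if i < l then i else if i = l then k' else i - 1) else 0))"
        by (rule dterm_reindex[OF hj, of "\<lambda>i. if i < l then i else if i = l then k' else i - 1" "Suc k'"]) (use lk' in auto)
      from dterm_subst[OF this g] show ?thesis
      proof (rule dterm_cong)
        fix x assume x: "x \<in> Rn k'"
        have "(\<lambda>i. if i < Suc k' then (x(k' := g x)) (if i < l then i else if i = l then k' else i - 1) else 0) = ins l x (g x)"
          using x lk' by (auto simp: ins_def Rn_iff fun_eq_iff less_Suc_eq)
        then show "h j (\<lambda>i. if i < Suc k' then (x(k' := g x)) (if i < l then i else if i = l then k' else i - 1) else 0) = h' j x"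
          by (simp add: h'_def)
      qed
    qed
    have inj': "\<forall>z\<in>?W. \<forall>z'\<in>?W. (\<forall>j<m. h' j z = h' j z') \<longrightarrow> z = z'"
    proof (intro ballI impI)
      fix z z' assume z: "z \<in> ?W" "z' \<in> ?W" "\<forall>j<m. h' j z = h' j z'"
      have "h m (ins l z (g z)) = h m (ins l z' (g z'))" using gi(2)[OF z(1)] gi(2)[OF z(2)] by simp
      then have eq: "\<forall>j<Suc m. h j (ins l z (g z)) = h j (ins l z' (g z'))"
        using z(3) by (simp add: h'_def less_Suc_eq)
      have "ins l z (g z) \<in> obox k a b" "ins l z' (g z') \<in> obox k a b"
        using inB[OF z(1) gi(1)[OF z(1)]] inB[OF z(2) gi(1)[OF z(2)]] o2 by blast+
      then have "ins l z (g z) = ins l z' (g z')" by (rule inj[OF _ _ eq])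
      then show "z = z'" by (rule ins_inj)
    qed
    have "contains_cell m k' (box_image m k' a4 b4 h')"
      by (intro IH[unfolded embedding_property_def, rule_format])
        (use ab4 h' in simp_all, use inj' in simp)
    then obtain C where C: "cell D m k' C" "C \<in> D m" "C \<subseteq> box_image m k' a4 b4 h'" unfolding contains_cell_def by blast
    have dC: "dfn m (\<lambda>z. z \<in> C)"
    proof -
      have "{z \<in> Rn m. z \<in> C} = C" using definable_subset[OF C(2)] by blast
      then show ?thesis using C(2) by (simp add: dfn_def)
    qed
    have dc: "definable_continuous D m C (\<lambda>_. r)" for r
    proof -
      have "dfn (Suc m) (\<lambda>z. z(m := 0) \<in> C \<and> z m = r)"
        by (intro dfn_and dfn_weaken[OF dC] dfn_eq dterm_coord dterm_const) simp
      then show ?thesis unfolding definable_continuous_def dfn_def by simp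
    qed
    have cb: "cell_bound D m C (\<lambda>_. ereal r)" for r unfolding cell_bound_def using dc[of r] by blast
    let ?E = "{z \<in> Rn (Suc m). z(m := 0) \<in> C \<and> ereal p < ereal (z m) \<and> ereal (z m) < ereal q}"
    have "cell D (Suc m) (Suc k') ?E"
      by (rule cell_band[OF C(1) cb[of p] cb[of q]]) (simp add: pq)
    moreover have "?E \<in> D (Suc m)"
    proof -
      have "dfn (Suc m) (\<lambda>z. z(m := 0) \<in> C \<and> ereal p < ereal (z m) \<and> ereal (z m) < ereal q)"
        unfolding less_ereal.simps by (intro dfn_and dfn_weaken[OF dC] dfn_less dterm_coord dterm_const) simp_all
      then show ?thesis by (simp add: dfn_def)
    qed
    moreover have "?E \<subseteq> box_image (Suc m) k a b h"
    proof
      fix z assume z: "z \<in> ?E"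
      then have "z(m := 0) \<in> box_image m k' a4 b4 h'" using C(3) by blast
      then obtain w where w: "w \<in> ?W" "\<forall>j<m. (z(m := 0)) j = h' j w" unfolding box_image_def by blast
      have "ins l w (g w) \<in> obox k a1 b1" using inB[OF w(1) gi(1)[OF w(1)]] o21 by blast
      moreover have "p < z m" "z m < q" using z by auto
      ultimately obtain y where y: "y \<in> obox k a b" "\<forall>j<m. h j y = h j (ins l w (g w))" "h m y = z m" using band[of "ins l w (g w)" "z m"] by blast
      have "\<forall>j<Suc m. z j = h j y" using y(2,3) w(2) by (simp add: less_Suc_eq h'_def)
      then show "z \<in> box_image (Suc m) k a b h" using z y(1) unfolding box_image_def by blast
    qed
    ultimately show ?thesis unfolding contains_cell_def k' by blast
  qed
qed

lemma dfn_all_between: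
  assumes lo: "dterm k lo" and hi: "dterm k hi" and R: "dfn (Suc k) (\<lambda>z. R (z(k := 0)) (z k))"
  shows "dfn k (\<lambda>x. \<forall>t. lo x < t \<and> t < hi x \<longrightarrow> R x t)"
proof -
  have "dfn (Suc k) (\<lambda>z. lo (z(k := 0)) < z k \<and> z k < hi (z(k := 0)) \<longrightarrow> R (z(k := 0)) (z k))"
    by (intro dfn_imp dfn_and dfn_less dterm_weaken lo hi dterm_coord R) simp_all
  then show ?thesis by (rule dfn_all)
qed

text \<open>With no coordinate to tell points apart, injectivity leaves a box with a single point,
  hence \<open>k = 0\<close>.\<close>

lemma embedding_property_0: "embedding_property 0"
  unfolding embedding_property_def
proof (intro allI impI)
  fix k a b and h :: "nat \<Rightarrow> (nat \<Rightarrow> real) \<Rightarrow> real"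
  assume ab: "subbox k a b a b" and inj: "\<forall>x\<in>obox k a b. \<forall>y\<in>obox k a b. (\<forall>j<0. h j x = h j y) \<longrightarrow> x = y"
  obtain x where x: "x \<in> obox k a b" using obox_nonempty[OF ab] by blast
  have k: "k = 0"
  proof (rule ccontr)
    assume "k \<noteq> 0"
    obtain d where d: "d > 0" "\<And>y. y \<in> Rn k \<Longrightarrow> (\<forall>i<k. x i - d < y i \<and> y i < x i + d) \<Longrightarrow> y \<in> obox k a b"
      by (rule obox_neighbourhood[OF x]) (rule that)
    have "x(0 := x 0 + d / 2) \<in> obox k a b"
      by (rule d(2)) (use x d(1) \<open>k \<noteq> 0\<close> in \<open>auto simp: obox_def Rn_iff\<close>)
    then have "x = x(0 := x 0 + d / 2)" using inj x by simp
    from fun_cong[OF this, of 0] show False using d(1) by simp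
  qed
  have "Rn 0 \<in> D 0" using definable_compl[OF definable_empty[of 0]] by simp
  moreover have "Rn 0 \<subseteq> box_image 0 k a b h" unfolding box_image_def using x by blast
  ultimately show "contains_cell 0 k (box_image 0 k a b h)"
    unfolding contains_cell_def k using cell_point by blast
qed

text \<open>\<open>S x t\<close> says that \<open>t\<close> occurs as last coordinate over the
  projection of \<open>x\<close>. On either side of \<open>h m x\<close>, nearby values
  \<open>t\<close> either all occur or all fail to occur, and rational bounds for this become
  uniform on a subbox. If a whole interval is filled, the band case applies; otherwise the
  projection is injective and the graph case applies.\<close>

lemma embedding_property_Suc:
  assumes IH: "embedding_property m" shows "embedding_property (Suc m)"
  unfolding embedding_property_def
proof (intro allI impI)
  fix k a b and h :: "nat \<Rightarrow> (nat \<Rightarrow> real) \<Rightarrow> real"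
  assume ab: "subbox k a b a b" and h0: "\<forall>j<Suc m. dterm k (h j)"
    and inj0: "\<forall>x\<in>obox k a b. \<forall>y\<in>obox k a b. (\<forall>j<Suc m. h j x = h j y) \<longrightarrow> x = y"
  have h: "dterm k (h j)" if "j < Suc m" for j using h0 that by blast
  have inj: "x = y" if "x \<in> obox k a b" "y \<in> obox k a b" "\<forall>j<Suc m. h j x = h j y" for x y
    using inj0 that by blast
  define S where "S x t \<longleftrightarrow> (\<exists>y\<in>obox k a b. (\<forall>j<m. h j y = h j x) \<and> h m y = t)" for x t
  have dS: "dfn (Suc k) (\<lambda>z. S (z(k := 0)) (z k))"
  proof -
    \<comment> \<open>Layout of the variables: the first \<open>k\<close> entries are
      \<open>x\<close>, entry \<open>k\<close> is \<open>t\<close>, and the block behind them is the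
      witness \<open>y\<close>.\<close>
    define Q where "Q w \<longleftrightarrow> (\<forall>i<k. a i < w (i + Suc k) \<and> w (i + Suc k) < b i) \<and>
        (\<forall>j<m. h j (\<lambda>i. if i < k then w (i + Suc k) else 0) = h j (\<lambda>i. if i < k then w i else 0)) \<and>
        h m (\<lambda>i. if i < k then w (i + Suc k) else 0) = w k" for w
    have 1: "dterm (Suc k + k) (\<lambda>w. h j (\<lambda>i. if i < k then w (i + Suc k) else 0))" if "j < Suc m" for j
      using dterm_reindex[OF h[OF that], of "\<lambda>i. i + Suc k" "Suc k + k"] by simp
    have 2: "dterm (Suc k + k) (\<lambda>w. h j (\<lambda>i. if i < k then w i else 0))" if "j < Suc m" for j
      using dterm_reindex[OF h[OF that], of "\<lambda>i. i" "Suc k + k"] by simp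
    have "dfn (Suc k + k) Q" unfolding Q_def
      by (intro dfn_and dfn_ball_lessThan dfn_less dfn_eq dterm_const dterm_coord 1 2) simp_all
    from dfn_ex_block[OF this] show ?thesis
    proof (rule dfn_cong')
      fix z assume z: "z \<in> Rn (Suc k)"
      have "Q (cat (Suc k) z y) \<longleftrightarrow> y \<in> obox k a b \<and> (\<forall>j<m. h j y = h j (z(k := 0))) \<and> h m y = z k" if y: "y \<in> Rn k" for y
      proof -
        have e1: "(\<lambda>i. if i < k then cat (Suc k) z y (i + Suc k) else 0) = y" using y by (auto simp: cat_def Rn_iff fun_eq_iff)
        have e2: "(\<lambda>i. if i < k then cat (Suc k) z y i else 0) = z(k := 0)" using z by (auto simp: cat_def Rn_iff fun_eq_iff)
        show ?thesis unfolding Q_def e1 e2 using y by (auto simp: cat_def obox_def)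
      qed
      then show "(\<exists>y\<in>Rn k. Q (cat (Suc k) z y)) \<longleftrightarrow> S (z(k := 0)) (z k)"
        unfolding S_def by (auto simp: obox_def)
    qed
  qed
  have Sself: "S x (h m y)" if "y \<in> obox k a b" "\<forall>j<m. h j y = h j x" for x y
    unfolding S_def using that by blast
  \<comment> \<open>The flag \<open>s\<close> records whether the interval from \<open>p\<close> to
    \<open>q\<close> is filled entirely. In the other case, the behaviour on each side of
    \<open>h m x\<close>, up to \<open>p\<close> and up to \<open>q\<close>, is constant.\<close>
  define Cv where "Cv c x \<longleftrightarrow> (case c of (p, q, s) \<Rightarrow> of_rat p < h m x \<and> h m x < of_rat q \<and>
     (if s then \<forall>t. of_rat p < t \<and> t < of_rat q \<longrightarrow> S x t else
       ((\<forall>t. of_rat p < t \<and> t < h m x \<longrightarrow> S x t) \<or> (\<forall>t. of_rat p < t \<and> t < h m x \<longrightarrow> \<not> S x t)) \<and>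
       ((\<forall>t. h m x < t \<and> t < of_rat q \<longrightarrow> S x t) \<or> (\<forall>t. h m x < t \<and> t < of_rat q \<longrightarrow> \<not> S x t)) \<and>
       \<not> (\<forall>t. of_rat p < t \<and> t < of_rat q \<longrightarrow> S x t)))" for c :: "rat \<times> rat \<times> bool" and x
  have dCv: "dfn k (Cv c)" for c
  proof -
    obtain p q s where c: "c = (p, q, s)" by (cases c)
    have hm: "dterm k (h m)" using h by simp
    have nS: "dfn (Suc k) (\<lambda>z. \<not> S (z(k := 0)) (z k))" by (rule dfn_not[OF dS])
    show ?thesis
    proof (cases s)
      case True
      show ?thesis unfolding Cv_def c prod.case if_P[OF True]
        by (intro dfn_and dfn_less hm dterm_const dfn_all_between dS)
    next
      case False
      show ?thesis unfolding Cv_def c prod.case if_not_P[OF False]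
        by (intro dfn_and dfn_or dfn_less hm dterm_const dfn_not dfn_all_between[OF _ _ nS] dfn_all_between[OF _ _ dS])
    qed
  qed
  have cov: "\<exists>c. Cv c x" if x: "x \<in> obox k a b" for x
  proof -
    have xR: "x \<in> Rn k" using x by (simp add: obox_def)
    have xk: "(x(k := t))(k := 0) = x" for t using xR by (auto simp: Rn_iff)
    obtain \<I> where \<I>: "finite \<I>" "\<And>I. I \<in> \<I> \<Longrightarrow> is_interval I" "{t. S ((x(k := t))(k := 0)) ((x(k := t)) k)} = \<Union>\<I>"
      by (rule fibre_intervals[OF dS xR]) (rule that)
    have SI: "{t. S x t} = \<Union>\<I>" using \<I>(3) unfolding xk by simp
    obtain q where q: "q > h m x" "{h m x<..<q} \<subseteq> {t. S x t} \<or> {h m x<..<q} \<inter> {t. S x t} = {}"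
      using intervals_right_germ[OF \<I>(1,2), of "h m x"] unfolding SI by blast
    obtain p where p: "p < h m x" "{p<..<h m x} \<subseteq> {t. S x t} \<or> {p<..<h m x} \<inter> {t. S x t} = {}"
      using intervals_left_germ[OF \<I>(1,2), of "h m x"] unfolding SI by blast
    obtain q' where q': "h m x < of_rat q'" "of_rat q' < q" using of_rat_dense[OF q(1)] by blast
    obtain p' where p': "p < of_rat p'" "of_rat p' < h m x" using of_rat_dense[OF p(1)] by blast
    have r: "(\<forall>t. h m x < t \<and> t < of_rat q' \<longrightarrow> S x t) \<or> (\<forall>t. h m x < t \<and> t < of_rat q' \<longrightarrow> \<not> S x t)"
      using q(2)
    proof
      assume *: "{h m x<..<q} \<subseteq> {t. S x t}"
      have "S x t" if "h m x < t \<and> t < of_rat q'" for t using subsetD[OF *, of t] that q'(2) by simp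
      then show ?thesis by blast
    next
      assume *: "{h m x<..<q} \<inter> {t. S x t} = {}"
      have "\<not> S x t" if "h m x < t \<and> t < of_rat q'" for t
        using * that q'(2) by (auto simp: disjoint_iff)
      then show ?thesis by blast
    qed
    have l: "(\<forall>t. of_rat p' < t \<and> t < h m x \<longrightarrow> S x t) \<or> (\<forall>t. of_rat p' < t \<and> t < h m x \<longrightarrow> \<not> S x t)"
      using p(2)
    proof
      assume *: "{p<..<h m x} \<subseteq> {t. S x t}"
      have "S x t" if "of_rat p' < t \<and> t < h m x" for t using subsetD[OF *, of t] that p'(1) by simp
      then show ?thesis by blast
    next
      assume *: "{p<..<h m x} \<inter> {t. S x t} = {}"
      have "\<not> S x t" if "of_rat p' < t \<and> t < h m x" for t
        using * that p'(1) by (auto simp: disjoint_iff)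
      then show ?thesis by blast
    qed
    show ?thesis
    proof (cases "\<forall>t. of_rat p' < t \<and> t < of_rat q' \<longrightarrow> S x t")
      case True
      then have "Cv (p', q', True) x" unfolding Cv_def prod.case if_True using q'(1) p'(2) by blast
      then show ?thesis by blast
    next
      case False
      then have "Cv (p', q', False) x" unfolding Cv_def prod.case if_False using q'(1) p'(2) l r by blast
      then show ?thesis by blast
    qed
  qed
  obtain c a1 b1 where c: "subbox k a1 b1 a b" "\<And>x. x \<in> obox k a1 b1 \<Longrightarrow> Cv c x"
    by (rule cover_contains_box[OF ab dCv cov]) (assumption, rule that)
  obtain p q s where pqs: "c = (p, q, s)" by (cases c)
  have sub1: "subbox k a1 b1 a1 b1" using c(1) by (auto simp: subbox_def)
  have o1: "obox k a1 b1 \<subseteq> obox k a b" by (rule subbox_obox[OF c(1)])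
  have pq: "of_rat p < h m x" "h m x < of_rat q" if "x \<in> obox k a1 b1" for x
    using c(2)[OF that] unfolding Cv_def pqs by simp_all
  show "contains_cell (Suc m) k (box_image (Suc m) k a b h)"
  proof (cases s)
    case True
    obtain x0 where x0: "x0 \<in> obox k a1 b1" using obox_nonempty[OF sub1] by blast
    have pq': "real_of_rat p < of_rat q" using pq[OF x0] by linarith
    show ?thesis
    proof (rule band_contains_cell[OF IH ab h inj c(1) pq'])
      fix x t assume x: "x \<in> obox k a1 b1" and t: "real_of_rat p < t" "t < of_rat q"
      have "S x t" using c(2)[OF x] t unfolding Cv_def pqs prod.case if_P[OF True] by blast
      then show "\<exists>y\<in>obox k a b. (\<forall>j<m. h j y = h j x) \<and> h m y = t" unfolding S_def .
    qed assumption+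
  next
    case False
    \<comment> \<open>Two points with the same projection share the set of occurring values. Since
      each value occurs for the other point, everything to the right of \<open>h m x\<close> and
      everything to the left of \<open>h m y\<close> is filled; together this is the whole interval,
      against the choice of \<open>s\<close>.\<close>
    have less: "\<not> h m x < h m y" if x: "x \<in> obox k a1 b1" and y: "y \<in> obox k a1 b1" and eq: "\<forall>j<m. h j x = h j y" for x y
    proof
      assume lt: "h m x < h m y"
      have SS: "S y = S x" unfolding S_def using eq by simp
      have cx: "(\<forall>t. h m x < t \<and> t < of_rat q \<longrightarrow> S x t) \<or> (\<forall>t. h m x < t \<and> t < of_rat q \<longrightarrow> \<not> S x t)"
        "\<not> (\<forall>t. of_rat p < t \<and> t < of_rat q \<longrightarrow> S x t)"
        using c(2)[OF x] unfolding Cv_def pqs prod.case if_not_P[OF False] by blast+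
      have cy: "(\<forall>t. of_rat p < t \<and> t < h m y \<longrightarrow> S x t) \<or> (\<forall>t. of_rat p < t \<and> t < h m y \<longrightarrow> \<not> S x t)"
        using c(2)[OF y] unfolding Cv_def pqs prod.case if_not_P[OF False] SS by blast
      have "S x (h m y)" by (rule Sself) (use y o1 eq in auto)
      then have 1: "\<forall>t. h m x < t \<and> t < of_rat q \<longrightarrow> S x t" using cx(1) lt pq(2)[OF y] by blast
      have "S x (h m x)" by (rule Sself) (use x o1 in auto)
      then have 2: "\<forall>t. of_rat p < t \<and> t < h m y \<longrightarrow> S x t" using cy lt pq(1)[OF x] by blast
      have "S x t" if "of_rat p < t \<and> t < of_rat q" for t
        using 1 2 that lt by (cases "t < h m y") simp_all
      then show False using cx(2) by blast
    qed
    have "contains_cell (Suc m) k (box_image (Suc m) k a1 b1 h)"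
    proof (rule graph_contains_cell[OF IH sub1 h])
      fix x y assume xy: "x \<in> obox k a1 b1" "y \<in> obox k a1 b1" "\<forall>j<m. h j x = h j y"
      have "\<forall>j<m. h j y = h j x" using xy(3) by simp
      then have "\<not> h m y < h m x" by (rule less[OF xy(2,1)])
      then have "h m x = h m y" using less[OF xy] by linarith
      then have "\<forall>j<Suc m. h j x = h j y" using xy(3) by (simp add: less_Suc_eq)
      then show "x = y" using xy(1,2) by (intro inj subsetD[OF o1]) simp_all
    qed
    then show ?thesis by (rule contains_cell_mono) (rule box_image_mono[OF o1])
  qed
qed

theorem embedding_property: "embedding_property m"
  by (induction m) (auto intro: embedding_property_0 embedding_property_Suc)

end

section \<open>Definable selection\<close>

lemma cat_Suc: "cat (Suc k) (b(k := t)) z = cat k b (case_nat t z)"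
  by (auto simp: cat_def fun_eq_iff split: nat.splits intro: arg_cong[of _ _ z])

lemma case_nat_Rn: "case_nat t z \<in> Rn (Suc m) \<longleftrightarrow> z \<in> Rn m"
  by (auto simp: Rn_iff split: nat.splits dest: Suc_le_D)

lemma case_nat_tail: "case_nat (z 0) (\<lambda>i. z (Suc i)) = z"
  by (auto simp: fun_eq_iff split: nat.splits)

context ominimal_expansion
begin

text \<open>The lexicographically least point of each fibre: by compactness the first coordinate
  attains its minimum, and fixing it there leaves a compact fibre in the remaining
  coordinates.\<close>

lemma compact_selection:
  assumes E: "dfn (k + m) E" and B: "dfn k (\<lambda>b. b \<in> B)" "B \<subseteq> Rn k"
    and cp: "\<And>b. b \<in> B \<Longrightarrow> compact {z \<in> Rn m. E (cat k b z)}"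
    and ne: "\<And>b. b \<in> B \<Longrightarrow> \<exists>z\<in>Rn m. E (cat k b z)"
  shows "\<exists>h. (\<forall>j<m. dterm k (h j)) \<and> (\<forall>b\<in>B. E (cat k b (\<lambda>j. if j < m then h j b else 0)))"
  using E cp ne
proof (induction m arbitrary: E)
  case 0
  have "E (cat k b (\<lambda>j. if j < 0 then undefined j b else 0))" if b: "b \<in> B" for b
  proof -
    obtain z where z: "z \<in> Rn 0" "E (cat k b z)" using 0(3)[OF b] by blast
    have "z = (\<lambda>j. if j < 0 then undefined j b else 0)" using z(1) by (auto simp: Rn_iff)
    then show ?thesis using z(2) by simp
  qed
  then show ?case by blast
next
  case (Suc m)
  define F where "F b = {z \<in> Rn (Suc m). E (cat k b z)}" for b
  have Fc: "compact (F b)" "F b \<noteq> {}" if "b \<in> B" for b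
    using Suc.prems(2)[OF that] Suc.prems(3)[OF that] by (auto simp: F_def)
  define E1 where "E1 y \<longleftrightarrow> (\<exists>z\<in>Rn m. E (cat (Suc k) y z))" for y
  have dE1: "dfn (Suc k) E1" unfolding E1_def using dfn_ex_block[of "Suc k" m E] Suc.prems(1) by simp
  have E1F: "E1 (b(k := t)) \<longleftrightarrow> t \<in> (\<lambda>z. z 0) ` F b" for b t
  proof
    assume "E1 (b(k := t))"
    then obtain z where "z \<in> Rn m" "E (cat k b (case_nat t z))" unfolding E1_def cat_Suc by blast
    then have "case_nat t z \<in> F b" by (simp add: F_def case_nat_Rn)
    then show "t \<in> (\<lambda>z. z 0) ` F b" by (rule rev_image_eqI) simp
  next
    assume "t \<in> (\<lambda>z. z 0) ` F b"
    then obtain z where z: "z \<in> F b" "t = z 0" by blast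
    have "case_nat t (\<lambda>i. z (Suc i)) = z" unfolding z(2) by (rule case_nat_tail)
    then have "E (cat (Suc k) (b(k := t)) (\<lambda>i. z (Suc i)))" "(\<lambda>i. z (Suc i)) \<in> Rn m"
      using z(1) by (simp_all add: F_def cat_Suc Rn_iff)
    then show "E1 (b(k := t))" unfolding E1_def by blast
  qed
  define M where "M b t \<longleftrightarrow> E1 (b(k := t)) \<and> (\<forall>s. s < t \<longrightarrow> \<not> E1 (b(k := s)))" for b t
  have ex1: "\<exists>!t. M b t" if b: "b \<in> B" for b
  proof -
    have "compact ((\<lambda>z. z 0) ` F b)"
      by (rule compact_continuous_image[OF _ Fc(1)[OF b]]) (rule continuous_on_subset[OF continuous_on_product_coordinates subset_UNIV])
    moreover have "(\<lambda>z. z 0) ` F b \<noteq> {}" using Fc(2)[OF b] by blast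
    ultimately obtain t where t: "t \<in> (\<lambda>z. z 0) ` F b" "\<forall>s\<in>(\<lambda>z. z 0) ` F b. t \<le> s"
      using compact_attains_inf by blast
    show ?thesis
    proof (rule ex1I[of _ t])
      show "M b t" unfolding M_def E1F using t by (meson not_le)
      fix s assume "M b s"
      then have "s \<in> (\<lambda>z. z 0) ` F b" "\<not> t < s" using t(1) unfolding M_def E1F by blast+
      then show "s = t" using t(2) by force
    qed
  qed
  \<comment> \<open>Outside \<open>B\<close> the default \<open>0\<close> is used, so that
    \<open>h0\<close> is definable on all of \<open>Rn k\<close>.\<close>
  define h0 where "h0 b = (if b \<in> B then (THE t. M b t) else 0)" for b
  have h0M: "M b (h0 b)" if "b \<in> B" for b
    unfolding h0_def if_P[OF that] by (rule theI'[OF ex1[OF that]])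
  have h0u: "t = h0 b" if "b \<in> B" "M b t" for b t
    by (rule ex1E[OF ex1[OF that(1)]]) (metis h0M[OF that(1)] that(2))
  have dh0: "dterm k h0"
  proof -
    have "dfn (Suc (Suc k)) (\<lambda>y. E1 (\<lambda>i. if i < Suc k then y (if i = k then Suc k else i) else 0))"
      by (rule dfn_reindex[OF dE1]) auto
    then have 1: "dfn (Suc (Suc k)) (\<lambda>y. E1 (((y(Suc k := 0))(k := 0))(k := y (Suc k))))"
    proof (rule dfn_cong')
      fix y assume "y \<in> Rn (Suc (Suc k))"
      then have "(\<lambda>i. if i < Suc k then y (if i = k then Suc k else i) else 0) = ((y(Suc k := 0))(k := 0))(k := y (Suc k))"
        by (auto simp: Rn_iff fun_eq_iff)
      then show "E1 (\<lambda>i. if i < Suc k then y (if i = k then Suc k else i) else 0) \<longleftrightarrow>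
          E1 (((y(Suc k := 0))(k := 0))(k := y (Suc k)))" by simp
    qed
    have "dfn (Suc (Suc k)) (\<lambda>y. y (Suc k) < (y(Suc k := 0)) k \<longrightarrow> \<not> E1 (((y(Suc k := 0))(k := 0))(k := y (Suc k))))"
      by (intro dfn_imp dfn_not 1 dfn_less dterm_coord dterm_weaken[of "Suc k" "\<lambda>x. x k"]) simp_all
    then have 2: "dfn (Suc k) (\<lambda>y. \<forall>s. s < y k \<longrightarrow> \<not> E1 ((y(k := 0))(k := s)))" by (rule dfn_all)
    have "dfn (Suc k) (\<lambda>y. E1 y)" by (rule dE1)
    then have "dfn (Suc k) (\<lambda>y. E1 ((y(k := 0))(k := y k)))" by simp
    then have 3: "dfn (Suc k) (\<lambda>y. M (y(k := 0)) (y k))" unfolding M_def by (rule dfn_and[OF _ 2])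
    note W = dfn_weaken[OF B(1)]
    have "dfn (Suc k) (\<lambda>y. (y(k := 0) \<in> B \<and> M (y(k := 0)) (y k)) \<or> (y(k := 0) \<notin> B \<and> y k = 0))"
      by (intro dfn_or dfn_and[OF W 3] dfn_and[OF dfn_not[OF W]] dfn_eq dterm_coord dterm_const) simp
    then show ?thesis unfolding dterm_def
    proof (rule dfn_cong')
      fix y
      show "((y(k := 0) \<in> B \<and> M (y(k := 0)) (y k)) \<or> (y(k := 0) \<notin> B \<and> y k = 0)) \<longleftrightarrow> y k = h0 (y(k := 0))"
      proof (cases "y(k := 0) \<in> B")
        case True
        then have "M (y(k := 0)) (y k) \<longleftrightarrow> y k = h0 (y(k := 0))" using h0M[OF True] h0u[OF True, of "y k"] by auto
        then show ?thesis using True by simp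
      next
        case False
        then have "h0 (y(k := 0)) = 0" by (simp only: h0_def if_False)
        then show ?thesis using False by simp
      qed
    qed
  qed
  \<comment> \<open>\<open>r w\<close> recovers the parameter from a point of
    \<open>Rn (k + m)\<close>; \<open>E'\<close> is the fibre condition with the first coordinate
    fixed at its least value.\<close>
  define r where "r w = (\<lambda>i. if i < k then w i else 0 :: real)" for w
  define E' where "E' w \<longleftrightarrow> E (cat k (r w) (case_nat (h0 (r w)) (\<lambda>i. w (i + k))))" for w
  have dE': "dfn (k + m) E'"
  proof -
    have "dfn (Suc (k + m)) (\<lambda>y. E (\<lambda>i. if i < k + Suc m then y (if i < k then i else if i = k then k + m else i - 1) else 0))"
      by (rule dfn_reindex[OF Suc.prems(1)]) auto
    moreover have "dterm (k + m) (\<lambda>w. h0 (r w))"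
      unfolding r_def using dterm_reindex[OF dh0, of "\<lambda>i. i" "k + m"] by simp
    ultimately have "dfn (k + m) (\<lambda>x. E (\<lambda>i. if i < k + Suc m then
        (x(k + m := h0 (r x))) (if i < k then i else if i = k then k + m else i - 1) else 0))"
      by (rule dfn_subst)
    then show ?thesis
    proof (rule dfn_cong')
      fix x assume x: "x \<in> Rn (k + m)"
      have "(if i < k + Suc m then (x(k + m := h0 (r x))) (if i < k then i else if i = k then k + m else i - 1) else 0) =
         cat k (r x) (case_nat (h0 (r x)) (\<lambda>i. x (i + k))) i" for i
      proof -
        consider "i < k" | "i = k" | j where "i = k + Suc j"
          by (metis add_Suc_right less_imp_Suc_add linorder_neqE_nat)
        then show ?thesis
          using x by cases (auto simp: cat_def r_def Rn_iff add.commute)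
      qed
      then have "(\<lambda>i. if i < k + Suc m then (x(k + m := h0 (r x))) (if i < k then i else if i = k then k + m else i - 1) else 0) =
         cat k (r x) (case_nat (h0 (r x)) (\<lambda>i. x (i + k)))" by (rule ext)
      then show "E (\<lambda>i. if i < k + Suc m then (x(k + m := h0 (r x))) (if i < k then i else if i = k then k + m else i - 1) else 0) \<longleftrightarrow> E' x"
        by (simp only: E'_def)
    qed
  qed
  have E'b: "E' (cat k b z) \<longleftrightarrow> E (cat k b (case_nat (h0 b) z))" if b: "b \<in> B" for b z
  proof -
    have "b \<in> Rn k" using b B(2) by blast
    then have 1: "r (cat k b z) = b" by (auto simp: r_def cat_def Rn_iff fun_eq_iff)
    have 2: "(\<lambda>i. cat k b z (i + k)) = z" by (simp add: cat_def)
    show ?thesis unfolding E'_def 1 2 ..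
  qed
  have fib: "{z \<in> Rn m. E' (cat k b z)} = (\<lambda>z i. z (Suc i)) ` (F b \<inter> {z. z 0 = h0 b})" if b: "b \<in> B" for b
  proof (intro equalityI subsetI)
    fix z assume "z \<in> {z \<in> Rn m. E' (cat k b z)}"
    then have "case_nat (h0 b) z \<in> F b \<inter> {z. z 0 = h0 b}" using E'b[OF b] by (simp add: F_def case_nat_Rn)
    then show "z \<in> (\<lambda>z i. z (Suc i)) ` (F b \<inter> {z. z 0 = h0 b})" by (rule rev_image_eqI) simp
  next
    fix z assume "z \<in> (\<lambda>z i. z (Suc i)) ` (F b \<inter> {z. z 0 = h0 b})"
    then obtain w where w: "w \<in> F b" "w 0 = h0 b" "z = (\<lambda>i. w (Suc i))" by blast
    have "case_nat (h0 b) z = w" unfolding w(3) w(2)[symmetric] by (rule case_nat_tail)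
    then show "z \<in> {z \<in> Rn m. E' (cat k b z)}" using w(1) E'b[OF b] case_nat_Rn[of "h0 b" z m] by (simp add: F_def)
  qed
  have cp': "compact {z \<in> Rn m. E' (cat k b z)}" if b: "b \<in> B" for b
  proof -
    have "closed {z :: nat \<Rightarrow> real. z 0 = h0 b}" by (intro closed_Collect_eq continuous_on_product_coordinates continuous_on_const)
    then have "compact (F b \<inter> {z. z 0 = h0 b})" by (rule compact_Int_closed[OF Fc(1)[OF b]])
    moreover have "continuous_on (F b \<inter> {z. z 0 = h0 b}) (\<lambda>z i. z (Suc i))"
      by (rule continuous_on_coordinatewise_then_product) (rule continuous_on_subset[OF continuous_on_product_coordinates subset_UNIV])
    ultimately show ?thesis unfolding fib[OF b] by (intro compact_continuous_image)
  qed
  have ne': "\<exists>z\<in>Rn m. E' (cat k b z)" if b: "b \<in> B" for b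
  proof -
    have "h0 b \<in> (\<lambda>z. z 0) ` F b" using h0M[OF b] unfolding M_def E1F by blast
    then obtain z where "z \<in> F b" "h0 b = z 0" by (elim imageE)
    then have "(\<lambda>i. z (Suc i)) \<in> {z \<in> Rn m. E' (cat k b z)}" unfolding fib[OF b] by (intro imageI) simp
    then show ?thesis by blast
  qed
  have "\<exists>h. (\<forall>j<m. dterm k (h j)) \<and> (\<forall>b\<in>B. E' (cat k b (\<lambda>j. if j < m then h j b else 0)))"
    by (rule Suc.IH[OF dE' cp' ne'])
  then obtain h' where h': "\<forall>j<m. dterm k (h' j)" "\<forall>b\<in>B. E' (cat k b (\<lambda>j. if j < m then h' j b else 0))"
    by (elim exE conjE) (rule that)
  define h where "h = (\<lambda>j. case j of 0 \<Rightarrow> h0 | Suc j \<Rightarrow> h' j)"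
  have "dterm k (h j)" if "j < Suc m" for j using that dh0 h'(1) by (cases j) (auto simp: h_def)
  moreover have "E (cat k b (\<lambda>j. if j < Suc m then h j b else 0))" if b: "b \<in> B" for b
  proof -
    have "case_nat (h0 b) (\<lambda>j. if j < m then h' j b else 0) = (\<lambda>j. if j < Suc m then h j b else 0)"
      by (auto simp: h_def fun_eq_iff split: nat.splits)
    then show ?thesis using bspec[OF h'(2) b] unfolding E'b[OF b] by (simp only:)
  qed
  ultimately show ?case by blast
qed

end

section \<open>The tangent cone at infinity\<close>

text \<open>A form without sequences, from which closedness and invariance under dilations follow
  easily. Conversely, tolerance \<open>1 / (j + 1)\<close> and bound \<open>j\<close> produce the
  sequences.\<close>

lemma tangent_cone_at_infinity_iff:
  fixes A :: "(complex ^ 'n) set"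
  shows "v \<in> tangent_cone_at_infinity A \<longleftrightarrow>
    (\<forall>e>0. \<forall>M. \<exists>x\<in>A. \<exists>t>0. norm x > M \<and> t > M \<and> norm (x /\<^sub>R t - v) < e)" (is "_ \<longleftrightarrow> ?R")
proof
  assume "v \<in> tangent_cone_at_infinity A"
  then obtain x t where xt: "\<forall>j. x j \<in> A \<and> t j > 0" "filterlim (\<lambda>j. norm (x j)) at_top sequentially"
      "filterlim t at_top sequentially" "(\<lambda>j. x j /\<^sub>R t j) \<longlonglongrightarrow> v"
    unfolding tangent_cone_at_infinity_def by blast
  show ?R
  proof (intro allI impI)
    fix e M :: real assume e: "e > 0"
    have "\<forall>\<^sub>F j in sequentially. norm (x j) > M \<and> t j > M \<and> dist (x j /\<^sub>R t j) v < e"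
      using xt(2,3) tendstoD[OF xt(4) e] by (simp add: filterlim_at_top_dense eventually_conj_iff)
    then obtain j where "norm (x j) > M \<and> t j > M \<and> dist (x j /\<^sub>R t j) v < e"
      using eventually_happens'[OF sequentially_bot] by blast
    then show "\<exists>x\<in>A. \<exists>t>0. norm x > M \<and> t > M \<and> norm (x /\<^sub>R t - v) < e"
      using xt(1) unfolding dist_norm by blast
  qed
next
  assume R: ?R
  have "\<exists>p. fst p \<in> A \<and> snd p > 0 \<and> norm (fst p) > real j \<and> snd p > real j \<and> norm (fst p /\<^sub>R snd p - v) < 1 / real (Suc j)" for j :: nat
    using R[rule_format, of "1 / real (Suc j)" "real j"] by force
  then obtain p where p: "\<And>j. fst (p j) \<in> A \<and> snd (p j) > 0 \<and> norm (fst (p j)) > real j \<and> snd (p j) > real j \<and>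
      norm (fst (p j) /\<^sub>R snd (p j) - v) < 1 / real (Suc j)" by metis
  have "filterlim (\<lambda>j. norm (fst (p j))) at_top sequentially"
    by (rule filterlim_at_top_mono[OF filterlim_real_sequentially]) (simp add: p less_imp_le)
  moreover have "filterlim (\<lambda>j. snd (p j)) at_top sequentially"
    by (rule filterlim_at_top_mono[OF filterlim_real_sequentially]) (simp add: p less_imp_le)
  moreover have "(\<lambda>j. fst (p j) /\<^sub>R snd (p j)) \<longlonglongrightarrow> v"
  proof (rule LIM_zero_cancel, rule Lim_null_comparison)
    show "\<forall>\<^sub>F j in sequentially. norm (fst (p j) /\<^sub>R snd (p j) - v) \<le> 1 / real (Suc j)"
      by (intro always_eventually allI less_imp_le) (simp only: p)
    show "(\<lambda>j. 1 / real (Suc j)) \<longlonglongrightarrow> 0" by (rule LIMSEQ_Suc[OF lim_1_over_n])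
  qed
  ultimately show "v \<in> tangent_cone_at_infinity A"
    unfolding tangent_cone_at_infinity_def using p
    by (intro CollectI exI[of _ "\<lambda>j. fst (p j)"] exI[of _ "\<lambda>j. snd (p j)"]) simp
qed

lemma closed_tangent_cone_at_infinity:
  fixes A :: "(complex ^ 'n) set"
  shows "closed (tangent_cone_at_infinity A)"
proof -
  have "v \<in> tangent_cone_at_infinity A" if v: "v \<in> closure (tangent_cone_at_infinity A)" for v :: "complex ^ 'n"
    unfolding tangent_cone_at_infinity_iff
  proof (intro allI impI)
    fix e M :: real assume e: "e > 0"
    then have "e / 2 > 0" by simp
    then obtain u where u: "u \<in> tangent_cone_at_infinity A" "dist u v < e / 2"
      using v unfolding closure_approachable by blast
    obtain x t where xt: "x \<in> A" "t > 0" "norm x > M" "t > M" "norm (x /\<^sub>R t - u) < e / 2"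
      using u(1) \<open>e / 2 > 0\<close> unfolding tangent_cone_at_infinity_iff by blast
    have "norm (x /\<^sub>R t - v) < e"
      using norm_triangle_lt[of "x /\<^sub>R t - u" "u - v" e] xt(5) u(2) by (simp add: dist_norm)
    then show "\<exists>x\<in>A. \<exists>t>0. norm x > M \<and> t > M \<and> norm (x /\<^sub>R t - v) < e" using xt by blast
  qed
  then show ?thesis by (metis closure_subset_eq subsetI)
qed

text \<open>The points of \<open>A\<close> are kept and the scales \<open>t\<close> are divided by
  \<open>r\<close>.\<close>

lemma tangent_cone_at_infinity_scaleR:
  fixes A :: "(complex ^ 'n) set"
  assumes v: "v \<in> tangent_cone_at_infinity A" and r: "r > 0"
  shows "r *\<^sub>R v \<in> tangent_cone_at_infinity A"
  unfolding tangent_cone_at_infinity_iff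
proof (intro allI impI)
  fix e M :: real assume e: "e > 0"
  have "e / r > 0" using e r by simp
  \<comment> \<open>The bound \<open>M * r\<close> is what \<open>t / r > M\<close>
    requires.\<close>
  then obtain x t where xt: "x \<in> A" "t > 0" "norm x > max M (M * r)" "t > max M (M * r)" "norm (x /\<^sub>R t - v) < e / r"
    using v unfolding tangent_cone_at_infinity_iff by blast
  have "norm (x /\<^sub>R (t / r) - r *\<^sub>R v) = r * norm (x /\<^sub>R t - v)"
  proof -
    have "x /\<^sub>R (t / r) - r *\<^sub>R v = r *\<^sub>R (x /\<^sub>R t - v)" by (simp add: scaleR_diff_right divide_inverse mult.commute)
    then show ?thesis using r by simp
  qed
  then have "norm (x /\<^sub>R (t / r) - r *\<^sub>R v) < e" using xt(5) r by (simp add: field_simps)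
  moreover have "t / r > 0" "t / r > M" using xt r by (simp_all add: field_simps)
  ultimately show "\<exists>x\<in>A. \<exists>t>0. norm x > M \<and> t > M \<and> norm (x /\<^sub>R t - r *\<^sub>R v) < e"
    using xt(1,3) by (intro bexI[of _ x] exI[of _ "t / r"]) simp_all
qed

section \<open>Norm estimates on cones\<close>

lemma clinear_iso_scaleR: "clinear_iso T \<Longrightarrow> T (r *\<^sub>R z) = r *\<^sub>R T z"
proof -
  assume T: "clinear_iso T"
  have e: "r *\<^sub>R y = of_real r *s y" for y :: "complex ^ 'a"
    unfolding vec_eq_iff vector_scaleR_component vector_smult_component by (simp add: scaleR_conv_of_real)
  show ?thesis unfolding e by (rule clinear_isoD(2)[OF T])
qed

lemma clinear_iso_bound: "clinear_iso T \<Longrightarrow> \<exists>B>0. \<forall>z. norm (T z) \<le> B * norm z"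
proof -
  assume T: "clinear_iso T"
  have "linear T" by (intro linearI clinear_isoD(1)[OF T] clinear_iso_scaleR[OF T])
  then show ?thesis using linear_conv_bounded_linear bounded_linear.pos_bounded by (metis mult.commute)
qed

lemma clinear_iso_continuous_nth: "clinear_iso T \<Longrightarrow> continuous_on S (\<lambda>z. T z $ i)"
  by (intro continuous_on_component clinear_iso_continuous)

text \<open>Homogeneity reduces the estimate to the compact set
  \<open>C \<inter> sphere 0 1\<close>, on which the sum of the coordinates is continuous and, by
  \<open>nz\<close>, positive.\<close>

lemma cone_norm_bound:
  fixes C :: "(complex ^ 'n) set"
  assumes C: "closed C" "\<And>z r. z \<in> C \<Longrightarrow> r > 0 \<Longrightarrow> r *\<^sub>R z \<in> C"
    and T: "clinear_iso T" and nz: "\<And>z. z \<in> C \<Longrightarrow> (\<forall>i\<in>A. T z $ i = 0) \<Longrightarrow> z = 0"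
  shows "\<exists>K\<ge>0. \<forall>z\<in>C. norm z \<le> K * (\<Sum>i\<in>A. norm (T z $ i))"
proof -
  define g where "g z = (\<Sum>i\<in>A. norm (T z $ i))" for z
  have g0: "g z \<ge> 0" for z unfolding g_def by (intro sum_nonneg) simp
  have gs: "g (r *\<^sub>R z) = r * g z" if "r > 0" for r z
    using that unfolding g_def clinear_iso_scaleR[OF T] by (simp add: sum_distrib_left)
  have gp: "g z > 0" if z: "z \<in> C" "z \<noteq> 0" for z
  proof -
    have "g z \<noteq> 0"
    proof
      assume "g z = 0"
      then have "\<forall>i\<in>A. norm (T z $ i) = 0" unfolding g_def by (subst (asm) sum_nonneg_eq_0_iff) auto
      then show False using nz[OF z(1)] z(2) by simp
    qed
    then show ?thesis using g0[of z] by simp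
  qed
  have cg: "continuous_on S g" for S unfolding g_def
    by (intro continuous_on_sum continuous_on_norm clinear_iso_continuous_nth[OF T])
  let ?S = "C \<inter> sphere 0 1"
  have S: "compact ?S" using closed_Int_compact[OF C(1) compact_sphere] .
  have toS: "(1 / norm z) *\<^sub>R z \<in> ?S" if "z \<in> C" "z \<noteq> 0" for z using C(2)[OF that(1), of "1 / norm z"] that(2) by simp
  show ?thesis
  proof (cases "?S = {}")
    case True
    have "norm z \<le> 0 * g z" if "z \<in> C" for z using toS[OF that] True by (cases "z = 0") auto
    then show ?thesis unfolding g_def by (intro exI[of _ 0]) simp
  next
    case False
    obtain u where u: "u \<in> ?S" "\<forall>z\<in>?S. g u \<le> g z" using continuous_attains_inf[OF S False cg] by blast
    have "u \<noteq> 0" using u(1) by auto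
    then have gu: "g u > 0" using gp u(1) by blast
    have "norm z \<le> (1 / g u) * g z" if z: "z \<in> C" for z
    proof (cases "z = 0")
      case True
      then show ?thesis using gu g0[of z] by simp
    next
      case False
      have "g u \<le> g ((1 / norm z) *\<^sub>R z)" using u(2) toS[OF z False] by blast
      also have "\<dots> = (1 / norm z) * g z" by (rule gs) (use False in simp)
      finally show ?thesis using gu False by (simp add: field_simps)
    qed
    then show ?thesis unfolding g_def[symmetric] using gu by (intro exI[of _ "1 / g u"]) simp
  qed
qed

text \<open>If no constant works, points of \<open>X\<close> violate the estimate with every factor
  \<open>j + 1\<close>. Their norms tend to infinity, and a limit of the normalised points is a unit
  vector of the tangent cone whose coordinates in \<open>I\<close> vanish.\<close>

lemma cone_over_of_tangent_cone:
  fixes X :: "(complex ^ 'n) set"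
  assumes T: "clinear_iso T"
    and nz: "\<And>z. z \<in> tangent_cone_at_infinity X \<Longrightarrow> (\<forall>i\<in>I. T z $ i = 0) \<Longrightarrow> z = 0"
  shows "\<exists>K. cone_over I K (T ` X)"
proof (rule ccontr)
  assume no: "\<not> ?thesis"
  obtain B where B: "B > 0" "\<And>z. norm (T z) \<le> B * norm z" using clinear_iso_bound[OF T] by blast
  have "\<exists>x\<in>X. \<exists>i. norm (T x $ i) > real (Suc j) * (1 + (\<Sum>l\<in>I. norm (T x $ l)))" for j
  proof -
    have "\<not> cone_over I (real (Suc j)) (T ` X)" using no by blast
    then show ?thesis unfolding cone_over_def by (auto simp: not_le)
  qed
  then obtain x i where x: "\<And>j. x j \<in> X" "\<And>j. norm (T (x j) $ i j) > real (Suc j) * (1 + (\<Sum>l\<in>I. norm (T (x j) $ l)))"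
    by metis
  have nT: "B * norm (x j) > real (Suc j) * (1 + (\<Sum>l\<in>I. norm (T (x j) $ l)))" for j
    using x(2)[of j] B(2)[of "x j"] Finite_Cartesian_Product.norm_nth_le[of "T (x j)" "i j"] by linarith
  have s0: "(\<Sum>l\<in>I. norm (T (x j) $ l)) \<ge> 0" for j by (intro sum_nonneg) simp
  have big: "norm (x j) > real (Suc j) / B" for j
  proof -
    have "real (Suc j) \<le> real (Suc j) * (1 + (\<Sum>l\<in>I. norm (T (x j) $ l)))" using s0[of j] by (simp add: mult_le_cancel_left1)
    then have "real (Suc j) < B * norm (x j)" using nT[of j] by linarith
    then show ?thesis using B(1) by (simp add: field_simps)
  qed
  have pos: "norm (x j) > 0" for j using big[of j] B(1) by (meson divide_nonneg_pos le_less_trans of_nat_0_le_iff)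
  have lim: "filterlim (\<lambda>j. norm (x j)) at_top sequentially"
  proof (rule filterlim_at_top_mono)
    show "filterlim (\<lambda>j. (1 / B) * real j) at_top sequentially"
      by (rule filterlim_tendsto_pos_mult_at_top[OF tendsto_const _ filterlim_real_sequentially]) (use B in simp)
    have "(1 / B) * real j \<le> norm (x j)" for j using big[of j] B(1) by (simp add: field_simps)
    then show "\<forall>\<^sub>F j in sequentially. (1 / B) * real j \<le> norm (x j)" by simp
  qed
  define u where "u j = x j /\<^sub>R norm (x j)" for j
  have "u j \<in> sphere 0 1" for j using pos[of j] by (simp add: u_def)
  then obtain v r where v: "v \<in> sphere 0 1" "strict_mono (r :: nat \<Rightarrow> nat)" "(u \<circ> r) \<longlonglongrightarrow> v"
    using compact_sphere[of "0 :: complex ^ 'n" 1] unfolding compact_def by meson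
  have lim': "filterlim (\<lambda>j. norm (x (r j))) at_top sequentially"
    by (rule filterlim_compose[OF lim filterlim_subseq[OF v(2)]])
  have "v \<in> tangent_cone_at_infinity X"
    unfolding tangent_cone_at_infinity_def
    using x(1) pos lim' v(3) by (intro CollectI exI[of _ "\<lambda>j. x (r j)"] exI[of _ "\<lambda>j. norm (x (r j))"]) (simp add: u_def o_def)
  moreover have "T v $ l = 0" if l: "l \<in> I" for l
  proof -
    have "(\<lambda>j. T ((u \<circ> r) j) $ l) \<longlonglongrightarrow> T v $ l"
      by (rule continuous_on_tendsto_compose[OF clinear_iso_continuous_nth[OF T, of UNIV] v(3)]) simp_all
    moreover have "(\<lambda>j. T ((u \<circ> r) j) $ l) \<longlonglongrightarrow> 0"
    proof (rule Lim_null_comparison)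
      have "norm (T (u j) $ l) \<le> B / real (Suc j)" for j
      proof -
        have "norm (T (x j) $ l) \<le> (\<Sum>l\<in>I. norm (T (x j) $ l))"
          by (rule member_le_sum[OF l]) auto
        then have "real (Suc j) * norm (T (x j) $ l) \<le> real (Suc j) * (1 + (\<Sum>l\<in>I. norm (T (x j) $ l)))"
          by (intro mult_left_mono) linarith+
        then have "real (Suc j) * norm (T (x j) $ l) \<le> B * norm (x j)" using nT[of j] by linarith
        moreover have "norm (T (u j) $ l) = norm (T (x j) $ l) / norm (x j)"
          unfolding u_def clinear_iso_scaleR[OF T] by (simp add: divide_inverse mult.commute)
        ultimately have "real (Suc j) * norm (T (u j) $ l) \<le> B" using pos[of j] by (simp add: divide_le_eq del: of_nat_Suc)
        then show ?thesis by (subst pos_le_divide_eq) (simp_all add: mult.commute del: of_nat_Suc)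
      qed
      then have "norm (T ((u \<circ> r) j) $ l) \<le> B / real (Suc (r j))" for j by simp
      then show "\<forall>\<^sub>F j in sequentially. norm (T ((u \<circ> r) j) $ l) \<le> B / real (Suc (r j))" by simp
      have "(\<lambda>j. B / real (Suc j)) \<longlonglongrightarrow> 0" by (rule LIMSEQ_Suc[OF lim_const_over_n])
      then show "(\<lambda>j. B / real (Suc (r j))) \<longlonglongrightarrow> 0" using LIMSEQ_subseq_LIMSEQ[OF _ v(2)] by (simp add: o_def)
    qed
    ultimately show ?thesis by (rule LIMSEQ_unique)
  qed
  ultimately have "v = 0" by (intro nz) blast+
  then show False using v(1) by simp
qed

section \<open>Cones of small dimension\<close>

lemma realify_nth:
  fixes i :: "'n::finite"
  obtains p where "p < CARD('n)" "\<And>z :: complex ^ 'n. realify z (2 * p) = Re (z $ i)"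
    "\<And>z :: complex ^ 'n. realify z (Suc (2 * p)) = Im (z $ i)"
proof -
  have "bij_betw (from_nat_into (UNIV :: 'n set)) {..<CARD('n)} UNIV"
    by (rule bij_betw_from_nat_into_finite) simp
  then obtain p where p: "p < CARD('n)" "from_nat_into (UNIV :: 'n set) p = i"
    by (metis UNIV_I bij_betw_def imageE lessThan_iff)
  show ?thesis by (rule that[OF p(1)]) (use p in \<open>simp_all add: realify_def\<close>)
qed

lemma realify_inv: "\<zeta> \<in> Rn (2 * CARD('n)) \<Longrightarrow> realify (inv realify \<zeta> :: complex ^ 'n) = \<zeta>"
  using bij_betw_realify[where 'n='n] by (metis bij_betw_def f_inv_into_f)

lemma inv_realify: "inv realify (realify (z :: complex ^ 'n)) = z"
  using bij_betw_realify[where 'n='n] by (metis bij_betw_def inv_f_f)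

lemma realify_image_iff:
  fixes C :: "(complex ^ 'n) set"
  assumes "\<zeta> \<in> Rn (2 * CARD('n))" shows "\<zeta> \<in> realify ` C \<longleftrightarrow> inv realify \<zeta> \<in> C"
proof
  assume "\<zeta> \<in> realify ` C"
  then show "inv realify \<zeta> \<in> C" by (auto simp: inv_realify)
next
  assume "inv realify \<zeta> \<in> C"
  then show "\<zeta> \<in> realify ` C" using realify_inv[OF assms] by (intro image_eqI[of _ _ "inv realify \<zeta>"]) simp_all
qed

lemma continuous_on_realify: "continuous_on S (realify :: complex ^ 'n \<Rightarrow> _)"
proof (rule continuous_on_coordinatewise_then_product)
  fix j
  show "continuous_on S (\<lambda>z :: complex ^ 'n. realify z j)"
    unfolding realify_def Let_def
    by (cases "j < 2 * CARD('n)"; cases "even j") (simp_all add: continuous_intros)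
qed

context ominimal_expansion
begin

definition cterm :: "nat \<Rightarrow> ((nat \<Rightarrow> real) \<Rightarrow> complex) \<Rightarrow> bool" where
  "cterm m f \<longleftrightarrow> dterm m (\<lambda>x. Re (f x)) \<and> dterm m (\<lambda>x. Im (f x))"

lemma cterm_const: "cterm m (\<lambda>_. c)"
  unfolding cterm_def by (simp add: dterm_const)

lemma cterm_mult: "cterm m f \<Longrightarrow> cterm m g \<Longrightarrow> cterm m (\<lambda>x. f x * g x)"
  unfolding cterm_def times_complex.sel by (auto intro!: dterm_add dterm_diff dterm_mult)

lemma cterm_sum: "finite I \<Longrightarrow> (\<And>i. i \<in> I \<Longrightarrow> cterm m (f i)) \<Longrightarrow> cterm m (\<lambda>x. \<Sum>i\<in>I. f i x)"
  unfolding cterm_def Re_sum Im_sum by (auto intro!: dterm_sum)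

lemma dfn_cterm_eq: "cterm m f \<Longrightarrow> cterm m g \<Longrightarrow> dfn m (\<lambda>x. f x = g x)"
  unfolding cterm_def complex_eq_iff by (auto intro!: dfn_and dfn_eq)

lemma cterm_inv_realify: "cterm (k + 2 * CARD('n)) (\<lambda>w. (inv realify (\<lambda>i. w (i + k)) :: complex ^ 'n) $ i)"
proof -
  obtain p where p: "p < CARD('n)" "\<And>z :: complex ^ 'n. realify z (2 * p) = Re (z $ i)"
      "\<And>z :: complex ^ 'n. realify z (Suc (2 * p)) = Im (z $ i)"
    using realify_nth[of i] by metis
  have sh: "realify (inv realify (\<lambda>i. w (i + k)) :: complex ^ 'n) = (\<lambda>i. w (i + k))"
    if "w \<in> Rn (k + 2 * CARD('n))" for w :: "nat \<Rightarrow> real"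
    by (rule realify_inv) (use that in \<open>simp add: Rn_iff\<close>)
  have "dterm (k + 2 * CARD('n)) (\<lambda>w. Re ((inv realify (\<lambda>i. w (i + k)) :: complex ^ 'n) $ i))"
    by (rule dterm_cong[OF dterm_coord[of "2 * p + k"]]) (use p(1) in \<open>simp_all add: p(2)[symmetric] sh\<close>)
  moreover have "dterm (k + 2 * CARD('n)) (\<lambda>w. Im ((inv realify (\<lambda>i. w (i + k)) :: complex ^ 'n) $ i))"
    by (rule dterm_cong[OF dterm_coord[of "Suc (2 * p) + k"]]) (use p(1) in \<open>simp_all add: p(3)[symmetric] sh\<close>)
  ultimately show ?thesis unfolding cterm_def ..
qed

lemma cterm_clinear:
  fixes T :: "complex ^ 'n \<Rightarrow> complex ^ 'n"
  assumes "clinear_iso T" shows "cterm (k + 2 * CARD('n)) (\<lambda>w. T (inv realify (\<lambda>i. w (i + k))) $ i)"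
proof -
  have "cterm (k + 2 * CARD('n)) (\<lambda>w. \<Sum>j\<in>UNIV. (inv realify (\<lambda>i. w (i + k)) :: complex ^ 'n) $ j * T (axis j 1) $ i)"
    by (intro cterm_sum cterm_mult cterm_inv_realify cterm_const) simp
  moreover have "(\<lambda>w. \<Sum>j\<in>UNIV. (inv realify (\<lambda>i. w (i + k)) :: complex ^ 'n) $ j * T (axis j 1) $ i) =
      (\<lambda>w. T (inv realify (\<lambda>i. w (i + k))) $ i)"
    by (rule ext) (rule clinear_iso_nth[OF assms, symmetric])
  ultimately show ?thesis by (rule back_subst)
qed

lemma dfn_ball_finite: "finite A \<Longrightarrow> (\<And>i. i \<in> A \<Longrightarrow> dfn m (P i)) \<Longrightarrow> dfn m (\<lambda>x. \<forall>i\<in>A. P i x)"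
proof (induction A rule: finite_induct)
  case empty
  then show ?case by (simp add: dfn_const)
next
  case (insert a A)
  then have "dfn m (\<lambda>x. P a x \<and> (\<forall>i\<in>A. P i x))" by (intro dfn_and) auto
  then show ?case by simp
qed

text \<open>The parameters can be recovered from a solution \<open>z\<close>: the radius is the
  modulus of \<open>T z $ i0\<close>, and the slopes are quotients by this nonzero number. Hence
  every choice of solutions is injective. The fibres are compact, as required for the selection: the
  parameters bound the coordinates outside \<open>R\<close>, and these bound \<open>z\<close> by
  \<open>nz\<close>.\<close>

lemma contains_cell_of_transversals:
  fixes C :: "(complex ^ 'n) set" and e :: "nat \<Rightarrow> 'n::finite"
  assumes C: "closed C" "\<And>z r. z \<in> C \<Longrightarrow> r > 0 \<Longrightarrow> r *\<^sub>R z \<in> C" "definable_Cn D C"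
    and T: "clinear_iso T" and nz: "\<And>z. z \<in> C \<Longrightarrow> (\<forall>i\<in>-R. T z $ i = 0) \<Longrightarrow> z = 0"
    and solv: "\<And>w \<rho>. \<rho> > 0 \<Longrightarrow> \<exists>z\<in>C. (\<forall>l<d. T z $ e l = w l * T z $ i0) \<and>
        (\<forall>i\<in>- (R \<union> e ` {..<d} \<union> {i0}). T z $ i = 0) \<and> norm (T z $ i0) = \<rho>"
  shows "contains_cell (2 * CARD('n)) (Suc (2 * d)) (realify ` C)"
proof -
  let ?k = "Suc (2 * d)" and ?N = "2 * CARD('n)"
  \<comment> \<open>The interval from \<open>1\<close> to \<open>2\<close> keeps the last parameter,
    the radius, positive.\<close>
  let ?a = "\<lambda>_ :: nat. 1 :: real" and ?b = "\<lambda>_ :: nat. 2 :: real"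
  let ?B = "obox ?k ?a ?b"
  define W where "W b l = Complex (b (2 * l)) (b (Suc (2 * l)))" for b :: "nat \<Rightarrow> real" and l
  \<comment> \<open>The condition on the modulus is squared, which makes it polynomial in the real
    coordinates and hence definable.\<close>
  define P where "P b z \<longleftrightarrow> z \<in> C \<and> (\<forall>l<d. T z $ e l = W b l * T z $ i0) \<and>
     (\<forall>i\<in>- (R \<union> e ` {..<d} \<union> {i0}). T z $ i = 0) \<and>
     Re (T z $ i0) * Re (T z $ i0) + Im (T z $ i0) * Im (T z $ i0) = b (2 * d) * b (2 * d)" for b z
  have nsq: "Re c * Re c + Im c * Im c = norm c * norm c" for c
    using cmod_power2[of c] by (simp add: power2_eq_square)
  have Pn: "norm (T z $ i0) = b (2 * d)" if "P b z" "b (2 * d) > 0" for b z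
  proof -
    have "norm (T z $ i0) * norm (T z $ i0) = b (2 * d) * b (2 * d)" using that(1) unfolding P_def nsq by blast
    then have "(norm (T z $ i0))\<^sup>2 = (b (2 * d))\<^sup>2" by (simp add: power2_eq_square)
    then show ?thesis by (rule power2_eq_imp_eq) (use that(2) in simp_all)
  qed
  have Bpos: "b (2 * d) > 0" if "b \<in> ?B" for b using that unfolding obox_def by force
  define E where "E w \<longleftrightarrow> P w (inv realify (\<lambda>i. w (i + ?k)))" for w
  have Ecat: "E (cat ?k b \<zeta>) \<longleftrightarrow> P b (inv realify \<zeta>)" for b \<zeta>
  proof -
    have 1: "(\<lambda>i. cat ?k b \<zeta> (i + ?k)) = \<zeta>" by (simp add: cat_def)
    have 2: "W (cat ?k b \<zeta>) l = W b l" if "l < d" for l using that by (simp add: W_def cat_def)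
    have 3: "cat ?k b \<zeta> (2 * d) = b (2 * d)" by (simp add: cat_def)
    show ?thesis unfolding E_def 1 P_def 3 using 2 by simp
  qed
  have dE: "dfn (?k + ?N) E"
  proof -
    have "dfn ?N (\<lambda>\<zeta>. \<zeta> \<in> realify ` C)"
    proof -
      have "{\<zeta> \<in> Rn ?N. \<zeta> \<in> realify ` C} = realify ` C"
        using definable_subset C(3) unfolding definable_Cn_def by blast
      then show ?thesis using C(3) by (simp add: dfn_def definable_Cn_def)
    qed
    from dfn_shift[OF this, of ?k] have 1: "dfn (?k + ?N) (\<lambda>w. (inv realify (\<lambda>i. w (i + ?k)) :: complex ^ 'n) \<in> C)"
    proof (rule dfn_cong')
      fix w :: "nat \<Rightarrow> real" assume "w \<in> Rn (?k + ?N)"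
      then have "(\<lambda>i. w (i + ?k)) \<in> Rn ?N" by (simp add: Rn_iff)
      then show "(\<lambda>i. w (i + ?k)) \<in> realify ` C \<longleftrightarrow> inv realify (\<lambda>i. w (i + ?k)) \<in> C" by (rule realify_image_iff)
    qed
    have 2: "cterm (?k + ?N) (\<lambda>w. W w l)" if "l < d" for l
      unfolding cterm_def W_def complex.sel by (intro conjI dterm_coord) (use that in auto)
    have 3: "dterm (?k + ?N) (\<lambda>w. Re (T (inv realify (\<lambda>i. w (i + ?k))) $ i))"
      "dterm (?k + ?N) (\<lambda>w. Im (T (inv realify (\<lambda>i. w (i + ?k))) $ i))" for i
      using cterm_clinear[OF T, of ?k i] unfolding cterm_def by blast+
    have 4: "dfn (?k + ?N) (\<lambda>w. \<forall>l<d. T (inv realify (\<lambda>i. w (i + ?k))) $ e l = W w l * T (inv realify (\<lambda>i. w (i + ?k))) $ i0)"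
      by (intro dfn_ball_lessThan dfn_cterm_eq cterm_mult 2 cterm_clinear[OF T])
    have 5: "dfn (?k + ?N) (\<lambda>w. \<forall>i\<in>- (R \<union> e ` {..<d} \<union> {i0}). T (inv realify (\<lambda>i. w (i + ?k))) $ i = 0)"
      by (intro dfn_ball_finite dfn_cterm_eq cterm_const cterm_clinear[OF T]) simp
    have 6: "dfn (?k + ?N) (\<lambda>w. Re (T (inv realify (\<lambda>i. w (i + ?k))) $ i0) * Re (T (inv realify (\<lambda>i. w (i + ?k))) $ i0) +
        Im (T (inv realify (\<lambda>i. w (i + ?k))) $ i0) * Im (T (inv realify (\<lambda>i. w (i + ?k))) $ i0) = w (2 * d) * w (2 * d))"
      by (intro dfn_eq dterm_add dterm_mult 3 dterm_coord) simp_all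
    show ?thesis unfolding E_def P_def by (intro dfn_and 1 4 5 6)
  qed
  have dB: "dfn ?k (\<lambda>b. b \<in> ?B)"
  proof -
    have "dfn ?k (\<lambda>b. \<forall>i<?k. ?a i < b i \<and> b i < ?b i)"
      by (intro dfn_ball_lessThan dfn_and dfn_less dterm_const dterm_coord)
    then show ?thesis by (rule dfn_cong') (simp add: obox_def)
  qed
  have fib: "{\<zeta> \<in> Rn ?N. E (cat ?k b \<zeta>)} = realify ` {z. P b z}" for b
  proof (intro equalityI subsetI)
    fix \<zeta> assume "\<zeta> \<in> {\<zeta> \<in> Rn ?N. E (cat ?k b \<zeta>)}"
    then have "P b (inv realify \<zeta>)" and \<zeta>: "\<zeta> \<in> Rn ?N" by (simp_all add: Ecat)
    then show "\<zeta> \<in> realify ` {z. P b z}" unfolding realify_image_iff[OF \<zeta>] by simp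
  next
    fix \<zeta> assume "\<zeta> \<in> realify ` {z. P b z}"
    then obtain z where z: "P b z" "\<zeta> = realify z" by blast
    have "realify z \<in> Rn ?N" using bij_betw_realify[where 'n='n] by (auto simp: bij_betw_def)
    then show "\<zeta> \<in> {\<zeta> \<in> Rn ?N. E (cat ?k b \<zeta>)}" using z by (simp add: Ecat inv_realify)
  qed
  obtain K where K: "K \<ge> 0" "\<And>z. z \<in> C \<Longrightarrow> norm z \<le> K * (\<Sum>i\<in>-R. norm (T z $ i))"
    using cone_norm_bound[OF C(1,2) T nz] by blast
  have cp: "compact {\<zeta> \<in> Rn ?N. E (cat ?k b \<zeta>)}" if b: "b \<in> ?B" for b
  proof -
    have "closed {z. P b z}"
    proof -
      have "closed {z. T z $ e l = W b l * T z $ i0}" for l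
        by (intro closed_Collect_eq continuous_intros clinear_iso_continuous_nth[OF T])
      moreover have "closed {z. T z $ i = 0}" for i
        by (intro closed_Collect_eq continuous_intros clinear_iso_continuous_nth[OF T])
      moreover have "closed {z. Re (T z $ i0) * Re (T z $ i0) + Im (T z $ i0) * Im (T z $ i0) = b (2 * d) * b (2 * d)}"
        by (intro closed_Collect_eq continuous_intros clinear_iso_continuous_nth[OF T])
      moreover have "{z. P b z} = C \<inter> (\<Inter>l\<in>{..<d}. {z. T z $ e l = W b l * T z $ i0}) \<inter>
          (\<Inter>i\<in>- (R \<union> e ` {..<d} \<union> {i0}). {z. T z $ i = 0}) \<inter>
          {z. Re (T z $ i0) * Re (T z $ i0) + Im (T z $ i0) * Im (T z $ i0) = b (2 * d) * b (2 * d)}"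
        unfolding P_def by auto
      ultimately show ?thesis using C(1) by (simp only:) (intro closed_Int closed_INT ballI; simp)
    qed
    moreover have "bounded {z. P b z}"
    proof -
      define m where "m = b (2 * d) * (1 + (\<Sum>l<d. norm (W b l)))"
      have s0: "(\<Sum>l<d. norm (W b l)) \<ge> 0" by (intro sum_nonneg) simp
      have "norm z \<le> K * (\<Sum>i\<in>-R. m)" if z: "P b z" for z
      proof -
        note n0 = Pn[OF z Bpos[OF b]]
        have "norm (T z $ i) \<le> m" if i: "i \<in> -R" for i
        proof -
          consider "i = i0" | l where "l < d" "i = e l" | "i \<in> - (R \<union> e ` {..<d} \<union> {i0})" using i by blast
          then show ?thesis
          proof cases
            case 1
            then show ?thesis using n0 Bpos[OF b] s0 by (simp add: m_def mult_le_cancel_left1)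
          next
            case 2
            have "norm (W b l) \<le> (\<Sum>l<d. norm (W b l))" by (rule member_le_sum) (use 2 in auto)
            then have "norm (W b l) * b (2 * d) \<le> (1 + (\<Sum>l<d. norm (W b l))) * b (2 * d)"
              by (intro mult_right_mono) (use Bpos[OF b] in linarith)+
            moreover have "T z $ i = W b l * T z $ i0" using z 2 unfolding P_def by blast
            ultimately show ?thesis using n0 by (simp add: m_def norm_mult mult.commute)
          next
            case 3
            then have "T z $ i = 0" using z unfolding P_def by blast
            then show ?thesis using Bpos[OF b] s0 by (simp add: m_def)
          qed
        qed
        then have "(\<Sum>i\<in>-R. norm (T z $ i)) \<le> (\<Sum>i\<in>-R. m)" by (rule sum_mono)
        then have "K * (\<Sum>i\<in>-R. norm (T z $ i)) \<le> K * (\<Sum>i\<in>-R. m)" by (rule mult_left_mono[OF _ K(1)])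
        moreover have "z \<in> C" using z unfolding P_def by blast
        ultimately show ?thesis using K(2)[of z] by linarith
      qed
      then show ?thesis unfolding bounded_iff by blast
    qed
    ultimately have "compact {z. P b z}" by (simp add: compact_eq_bounded_closed)
    then show ?thesis unfolding fib by (rule compact_continuous_image[OF continuous_on_realify])
  qed
  have ne: "\<exists>\<zeta>\<in>Rn ?N. E (cat ?k b \<zeta>)" if b: "b \<in> ?B" for b
  proof -
    obtain z where z: "z \<in> C" "\<forall>l<d. T z $ e l = W b l * T z $ i0"
        "\<forall>i\<in>- (R \<union> e ` {..<d} \<union> {i0}). T z $ i = 0" "norm (T z $ i0) = b (2 * d)"
      using solv[OF Bpos[OF b], of "W b"] by blast
    have "P b z" unfolding P_def nsq using z by simp
    then have "realify z \<in> {\<zeta> \<in> Rn ?N. E (cat ?k b \<zeta>)}" unfolding fib by blast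
    then show ?thesis by blast
  qed
  have BR: "?B \<subseteq> Rn ?k" unfolding obox_def by blast
  have "\<exists>h. (\<forall>j<?N. dterm ?k (h j)) \<and> (\<forall>b\<in>?B. E (cat ?k b (\<lambda>j. if j < ?N then h j b else 0)))"
    by (rule compact_selection[OF dE dB BR cp ne])
  then obtain h where h: "\<forall>j<?N. dterm ?k (h j)" "\<forall>b\<in>?B. E (cat ?k b (\<lambda>j. if j < ?N then h j b else 0))"
    by (elim exE conjE) (rule that)
  define H where "H b = (\<lambda>j. if j < ?N then h j b else 0)" for b
  have PH: "P b (inv realify (H b))" if "b \<in> ?B" for b
    using bspec[OF h(2) that] unfolding Ecat H_def .
  have inj: "b = b'" if b: "b \<in> ?B" "b' \<in> ?B" "\<forall>j<?N. h j b = h j b'" for b b'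
  proof -
    have HH: "H b = H b'" using b(3) by (auto simp: H_def fun_eq_iff)
    let ?z = "inv realify (H b) :: complex ^ 'n"
    have P: "P b ?z" "P b' ?z" using PH[OF b(1)] PH[OF b(2)] unfolding HH by simp_all
    have \<rho>: "b (2 * d) = b' (2 * d)" using Pn[OF P(1) Bpos[OF b(1)]] Pn[OF P(2) Bpos[OF b(2)]] by simp
    have "norm (T ?z $ i0) > 0" using Pn[OF P(1) Bpos[OF b(1)]] Bpos[OF b(1)] by simp
    then have t0: "T ?z $ i0 \<noteq> 0" by simp
    have w: "W b l = W b' l" if "l < d" for l
    proof -
      have "W b l * T ?z $ i0 = W b' l * T ?z $ i0" using P that unfolding P_def by metis
      then show ?thesis using t0 by simp
    qed
    have "b i = b' i" for i
    proof -
      consider "i \<ge> ?k" | "i = 2 * d" | l where "l < d" "i = 2 * l" | l where "l < d" "i = Suc (2 * l)"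
      proof -
        have "i \<ge> ?k \<or> i = 2 * d \<or> (i div 2 < d \<and> i = 2 * (i div 2)) \<or> (i div 2 < d \<and> i = Suc (2 * (i div 2)))" by presburger
        then show thesis using that by blast
      qed
      then show ?thesis
      proof cases
        case 1
        then show ?thesis using subsetD[OF BR b(1)] subsetD[OF BR b(2)] by (simp add: Rn_iff)
      next
        case 2
        then show ?thesis using \<rho> by simp
      next
        case 3
        then show ?thesis using w[OF 3(1)] by (simp add: W_def)
      next
        case 4
        then show ?thesis using w[OF 4(1)] by (simp add: W_def)
      qed
    qed
    then show ?thesis by (rule ext)
  qed
  have "subbox ?k ?a ?b ?a ?b" by (simp add: subbox_def)
  then have "contains_cell ?N ?k (box_image ?N ?k ?a ?b h)"
    by (rule embedding_property[unfolded embedding_property_def, rule_format]) (use h(1) inj in simp_all)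
  moreover have "box_image ?N ?k ?a ?b h \<subseteq> realify ` C"
  proof
    fix \<zeta> assume "\<zeta> \<in> box_image ?N ?k ?a ?b h"
    then obtain b where b: "b \<in> ?B" "\<forall>j<?N. \<zeta> j = h j b" and \<zeta>: "\<zeta> \<in> Rn ?N"
      unfolding box_image_def by (elim CollectE conjE bexE)
    have "\<zeta> = H b" using b(2) \<zeta> by (auto simp: H_def Rn_iff fun_eq_iff)
    then have "inv realify \<zeta> \<in> C" using PH[OF b(1)] unfolding P_def by blast
    then show "\<zeta> \<in> realify ` C" unfolding realify_image_iff[OF \<zeta>] .
  qed
  ultimately show ?thesis by (rule contains_cell_mono)
qed

end

section \<open>Choice of the transversal subspace\<close>

lemma clinear_iso_compose: "clinear_iso S \<Longrightarrow> clinear_iso T \<Longrightarrow> clinear_iso (S \<circ> T)"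
  unfolding clinear_iso_def by (auto intro: bij_comp)

lemma clinear_iso_shear:
  fixes J :: "'n::finite set"
  assumes "i0 \<notin> J"
  shows "clinear_iso (\<lambda>z :: complex ^ 'n. \<chi> i. if i \<in> J then z $ i - w i * z $ i0 else z $ i)" (is "clinear_iso ?f")
proof -
  let ?g = "\<lambda>z :: complex ^ 'n. \<chi> i. if i \<in> J then z $ i + w i * z $ i0 else z $ i"
  have "bij ?f" by (rule o_bij[of ?g]) (use assms in \<open>simp_all add: fun_eq_iff vec_eq_iff\<close>)
  then show ?thesis unfolding clinear_iso_def by (simp add: vec_eq_iff algebra_simps)
qed

context ominimal_expansion
begin

lemma transversal_of_small_dimension:
  fixes C :: "(complex ^ 'n) set"
  assumes C: "closed C" "\<And>z r. z \<in> C \<Longrightarrow> r > 0 \<Longrightarrow> r *\<^sub>R z \<in> C" "definable_Cn D C"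
    and dim: "real_dim_Cn D C \<le> ereal (2 * real d)" and d: "d \<le> CARD('n)"
  obtains T I where "clinear_iso T" "card I = d" "\<And>z. z \<in> C \<Longrightarrow> (\<forall>i\<in>I. T z $ i = 0) \<Longrightarrow> z = 0"
proof -
  define good where "good R \<longleftrightarrow> (\<exists>T. clinear_iso T \<and> (\<forall>z\<in>C. (\<forall>i\<in>-R. T z $ i = 0) \<longrightarrow> z = 0))" for R :: "'n set"
  have "clinear_iso (\<lambda>z :: complex ^ 'n. z)" unfolding clinear_iso_def by (simp add: bij_id[unfolded id_def])
  then have "good {}" unfolding good_def by (intro exI[of _ "\<lambda>z. z"]) (simp add: vec_eq_iff)
  moreover have "\<forall>R. good R \<longrightarrow> card R < Suc CARD('n)" by (simp add: card_mono less_Suc_eq_le)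
  ultimately have "\<exists>R. good R \<and> (\<forall>R'. good R' \<longrightarrow> card R' \<le> card R)" by (rule ex_has_greatest_nat)
  then obtain R where R: "good R" "\<And>R'. good R' \<Longrightarrow> card R' \<le> card R" by blast
  obtain T where T: "clinear_iso T" "\<And>z. z \<in> C \<Longrightarrow> (\<forall>i\<in>-R. T z $ i = 0) \<Longrightarrow> z = 0"
    using R(1) unfolding good_def by blast
  have big: "card R \<ge> CARD('n) - d"
  proof (rule ccontr)
    assume "\<not> ?thesis"
    then have "Suc d \<le> card (-R)" by (simp add: Compl_eq_Diff_UNIV card_Diff_subset)
    then obtain S where S: "S \<subseteq> -R" "card S = Suc d" by (rule obtain_subset_with_card_n) (rule that)
    then have "S \<noteq> {}" by auto
    then obtain i0 where i0: "i0 \<in> S" by blast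
    \<comment> \<open>There is room for \<open>d + 1\<close> coordinates outside \<open>R\<close>:
      \<open>i0\<close> carries the vector \<open>e\<close> of the overview, and \<open>J\<close>
      the coordinate space of the slopes.\<close>
    define J where "J = S - {i0}"
    have J: "card J = d" "i0 \<notin> J" "i0 \<notin> R" using S i0 by (auto simp: J_def)
    obtain e where e: "bij_betw e {..<d} J"
      using ex_bij_betw_nat_finite[OF finite[of J]] unfolding J(1) atLeast0LessThan by blast
    have eJ: "e ` {..<d} = J" using e by (simp add: bij_betw_def)
    have "contains_cell (2 * CARD('n)) (Suc (2 * d)) (realify ` C)"
    proof (rule contains_cell_of_transversals[OF C T, where e=e and ?i0.0=i0])
      fix w :: "nat \<Rightarrow> complex" and \<rho> :: real assume \<rho>: "\<rho> > 0"
      define w' where "w' i = w (inv_into {..<d} e i)" for i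
      have w': "w' (e l) = w l" if "l < d" for l
        unfolding w'_def using that e by (simp add: bij_betw_def)
      \<comment> \<open>This shear maps the vector with coordinate one at \<open>i0\<close> and
        slopes \<open>w'\<close> to the axis \<open>i0\<close>, so that maximality of
        \<open>R\<close> can be applied to \<open>insert i0 R\<close> in the new
        coordinates.\<close>
      define S' where "S' = (\<lambda>z :: complex ^ 'n. \<chi> i. if i \<in> J then z $ i - w' i * z $ i0 else z $ i)"
      have "clinear_iso (S' \<circ> T)"
        unfolding S'_def by (rule clinear_iso_compose[OF clinear_iso_shear[OF J(2)] T(1)])
      moreover have "\<not> good (insert i0 R)" using R(2)[of "insert i0 R"] J(3) by auto
      ultimately have "\<not> (\<forall>z\<in>C. (\<forall>i\<in>- insert i0 R. (S' \<circ> T) z $ i = 0) \<longrightarrow> z = 0)" unfolding good_def by blast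
      then obtain z where z: "z \<in> C" "\<forall>i\<in>- insert i0 R. S' (T z) $ i = 0" "z \<noteq> 0" unfolding comp_apply by blast
      have zJ: "T z $ i = w' i * T z $ i0" if "i \<in> J" for i
      proof -
        have "i \<in> - insert i0 R" using that S(1) by (auto simp: J_def)
        then show ?thesis using bspec[OF z(2), of i] that by (simp add: S'_def)
      qed
      have z0: "T z $ i = 0" if "i \<notin> R" "i \<notin> J" "i \<noteq> i0" for i
        using bspec[OF z(2), of i] that by (simp add: S'_def)
      \<comment> \<open>If this coordinate vanished, \<open>z\<close> would lie in the subspace
        belonging to \<open>R\<close> and would be zero.\<close>
      have nz: "T z $ i0 \<noteq> 0"
      proof
        assume *: "T z $ i0 = 0"
        have "T z $ i = 0" if "i \<in> -R" for i
          using zJ[of i] z0[of i] * that by (cases "i \<in> J"; cases "i = i0") simp_all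
        then show False using T(2)[OF z(1)] z(3) by blast
      qed
      \<comment> \<open>A positive dilation adjusts the modulus and leaves the homogeneous linear
        conditions intact.\<close>
      define r where "r = \<rho> / norm (T z $ i0)"
      have r: "r > 0" using \<rho> nz by (simp add: r_def)
      have Tr: "T (r *\<^sub>R z) $ i = r *\<^sub>R (T z $ i)" for i by (simp add: clinear_iso_scaleR[OF T(1)])
      show "\<exists>z\<in>C. (\<forall>l<d. T z $ e l = w l * T z $ i0) \<and>
        (\<forall>i\<in>- (R \<union> e ` {..<d} \<union> {i0}). T z $ i = 0) \<and> norm (T z $ i0) = \<rho>"
      proof (intro bexI[of _ "r *\<^sub>R z"] conjI allI impI ballI)
        fix l assume l: "l < d"
        then have "e l \<in> J" using eJ by blast
        then show "T (r *\<^sub>R z) $ e l = w l * T (r *\<^sub>R z) $ i0" unfolding Tr zJ[OF \<open>e l \<in> J\<close>] w'[OF l] by simp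
      next
        fix i assume "i \<in> - (R \<union> e ` {..<d} \<union> {i0})"
        then show "T (r *\<^sub>R z) $ i = 0" unfolding Tr eJ using z0[of i] by simp
      next
        show "norm (T (r *\<^sub>R z) $ i0) = \<rho>" unfolding Tr using \<rho> nz by (simp add: r_def)
        show "r *\<^sub>R z \<in> C" by (rule C(2)[OF z(1) r])
      qed
    qed
    then obtain Q where Q: "cell D (2 * CARD('n)) (Suc (2 * d)) Q" "Q \<subseteq> realify ` C"
      unfolding contains_cell_def by blast
    have "Suc (2 * d) \<in> {k. \<exists>Q. cell D (2 * CARD('n)) k Q \<and> Q \<subseteq> realify ` C}"
      by (intro CollectI exI[of _ Q] conjI Q)
    then have "ereal (real (Suc (2 * d))) \<le> real_dim_Cn D C"
      unfolding real_dim_Cn_def odim_def by (rule SUP_upper)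
    then have "ereal (real (Suc (2 * d))) \<le> ereal (2 * real d)" using dim by (rule order_trans)
    then show False by simp
  qed
  \<comment> \<open>A smaller coordinate subspace meets \<open>C\<close> in zero all the more;
    cutting \<open>R\<close> down makes its complement have exactly \<open>d\<close>
    elements.\<close>
  obtain R' where R': "R' \<subseteq> R" "card R' = CARD('n) - d" by (rule obtain_subset_with_card_n[OF big]) (rule that)
  show ?thesis
  proof (rule that[OF T(1)])
    show "card (-R') = d" using R'(2) d by (simp add: Compl_eq_Diff_UNIV card_Diff_subset)
    fix z assume "z \<in> C" "\<forall>i\<in>-R'. T z $ i = 0"
    then show "z = 0" using R'(1) by (intro T(2)) auto
  qed
qed

end

theorem theorem3p6:
  fixes D :: "nat \<Rightarrow> (nat \<Rightarrow> real) set set"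
    and X :: "(complex ^ 'n) set"
    and d :: nat
  assumes "ominimal_expansion D"
    and "d \<le> CARD('n)"
    and "closed_pure_dim_analytic d X"
    and "definable_Cn D (tangent_cone_at_infinity X)"
    and "real_dim_Cn D (tangent_cone_at_infinity X) \<le> ereal (2 * real d)"
  shows "algebraic_set X"
proof -
  interpret ominimal_expansion D by (rule assms(1))
  obtain T I where T: "clinear_iso T" "card I = d"
      "\<And>z. z \<in> tangent_cone_at_infinity X \<Longrightarrow> (\<forall>i\<in>I. T z $ i = 0) \<Longrightarrow> z = 0"
    by (rule transversal_of_small_dimension[OF closed_tangent_cone_at_infinity
          tangent_cone_at_infinity_scaleR assms(4,5,2)]) (assumption, assumption, rule that)
  obtain K where "cone_over I K (T ` X)" using cone_over_of_tangent_cone[OF T(1,3)] by blast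
  then show ?thesis by (rule algebraic_of_cone[OF assms(3) T(1,2)])
qed

end
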